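(* Let $(S,\psi)$ be an embedded Poisson submanifold of a Poisson manifold $(M,\pi)$, with infinitesimal Poisson algebra $\mathcal P$, and let $\mathcal G$, $\mathfrak M(\mathcal P)$, $\mathfrak M_0(\mathcal P)$, $\mathcal C(\mathcal P)$, $\mathcal C_0(\mathcal P)$, $\mathrm H^1_{\partial_{\mathcal D}}$, $\mathrm J$ and $\sigma$ be as defined in the context. Then the first cohomology $\mathrm H^1(\mathcal P)$ fits in the following diagram of short exact sequences, consisting of a horizontal sequence $$0\to \frac{\mathrm H^1_{\partial_{\mathcal D}}}{\ker \mathrm J}\hookrightarrow \mathrm H^1(\mathcal P)\twoheadrightarrow \frac{\mathfrak M(\mathcal P)}{\mathcal C(\mathcal P)+\operatorname{Inn}\mathcal G}\to 0$$ and a vertical sequence through its last nonzero term $$0\to \frac{\mathfrak M_0(\mathcal P)}{\mathcal C_0(\mathcal P)+\operatorname{Inn}\mathcal G}\hookrightarrow \frac{\mathfrak M(\mathcal P)}{\mathcal C(\mathcal P)+\operatorname{Inn}\mathcal G}\twoheadrightarrow \frac{\operatorname{Im}\sigma|_{\mathfrak M(\mathcal P)}}{\mathrm{Ham}(S,\psi)}\to 0.$$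
   Context: Infinitesimal Poisson algebra. Everything is smooth; $C^\infty_S$ is the algebra of smooth functions on $S$. On a Poisson manifold $(M,\pi)$ put $\pi^\sharp\alpha=\pi(\alpha,\cdot)$, $\{f,g\}_\pi=\pi(df,dg)$, $[\alpha,\beta]_\pi=L_{\pi^\sharp\alpha}\beta-L_{\pi^\sharp\beta}\alpha-d(\pi(\alpha,\beta))$. Let $(S,\psi)\hookrightarrow(M,\pi)$ be an embedded Poisson submanifold, $E=T_SM/TS$ its normal bundle, $E^*\simeq TS^\circ\subset T^*_SM$ the conormal bundle. The cotangent Lie algebroid of $M$ restricts to a Lie algebroid $T^*_SM$ over $S$ with anchor $\pi^\sharp|_S$ and bracket $[\alpha|_S,\beta|_S]_S=[\alpha,\beta]_\pi|_S$; the restriction map $r:T^*_SM\to T^*S$ has kernel $E^*$. The induced bracket $[\cdot,\cdot]_1$ on $\Gamma E^*$ is $C^\infty_S$-bilinear, giving a $C^\infty_S$-Lie algebra $\mathcal G=(\Gamma E^*,[\cdot,\cdot]_1)$. Fix an exponential map (tubular neighborhood map) $\mathbf e:E\to M$ of $S$; it induces a splitting $T_SM=TS\oplus E$ and hence a vector bundle map $h:T^*S\to T^*_SM$ with $r\circ h=\mathrm{Id}$. Put $\mathcal D_\alpha\xi=[h(\alpha),\xi]_S$ (a contravariant derivative on $E^*$: $C^\infty_S$-linear in $\alpha\in\Gamma T^*S$ and $\mathcal D_\alpha(f\xi)=f\mathcal D_\alpha\xi+(L_{\psi^\sharp\alpha}f)\xi$) and $\mathcal K(\alpha,\beta)=[h(\alpha),h(\beta)]_S-h[\alpha,\beta]_\psi$,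 so $\mathcal K\in\Gamma(\wedge^2TS\otimes E^* )$. The commutative algebra of fiberwise affine functions on $E$ is $C^\infty_{\mathrm{aff}}(E)=C^\infty_S\oplus\Gamma E^*$ with product $(f\oplus\eta)(g\oplus\xi)=fg\oplus(f\xi+g\eta)$. The infinitesimal Poisson algebra of $S$ is $\mathcal P=(C^\infty_{\mathrm{aff}}(E),\{\cdot,\cdot\}^{\mathrm{aff}})$ with $$\{f\oplus\eta,g\oplus\xi\}^{\mathrm{aff}}=\psi(df,dg)\oplus\big(\mathcal D_{df}\xi-\mathcal D_{dg}\eta+[\eta,\xi]_1+\mathcal K(df,dg)\big).$$ It is a Poisson algebra; different choices of $\mathbf e$ give isomorphic Poisson algebras. First cohomology. $\mathrm H^1(\mathcal P)=\mathrm{Poiss}(\mathcal P)/\mathrm{Ham}(\mathcal P)$: $\mathbb R$-linear derivations of the commutative algebra that are also derivations of the bracket, modulo the derivations $\{p,\cdot\}^{\mathrm{aff}}$. $\mathrm{Ham}(S,\psi)=\{\psi^\sharp dh\mid h\in C^\infty_S\}$. Derivative endomorphisms. $\mathbb D(\Gamma E^* )$ is the set of $\mathbb R$-linear $\delta:\Gamma E^*\to\Gamma E^*$ for which there is a (unique) vector field $\sigma_\delta$ on $S$, the symbol, with $\delta(f\eta)=f\delta(\eta)+(L_{\sigma_\delta}f)\eta$; $\sigma:\delta\mapsto\sigma_\delta$. Every derivation of $C^\infty_{\mathrm{aff}}(E)$ is uniquely $X_Q+X_\delta$ with $Q\in\Gamma(TS\otimes E^* )$, $\delta\in\mathbb D(\Gamma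 E^* )$, $X_Q(f\oplus\eta)=0\oplus Q(f)$ where $Q(f):=Q(df)$, and $X_\delta(f\oplus\eta)=L_{\sigma_\delta}f\oplus\delta(\eta)$. Contravariant differential. For $Q\in\Gamma(\wedge^kTS\otimes E^* )$, $$(d_{\mathcal D}Q)(df_0,\dots,df_k)=\sum_i(-1)^i\mathcal D_{df_i}\big(Q(df_0,\dots,\widehat{df_i},\dots,df_k)\big)+\sum_{i<j}(-1)^{i+j}Q\big(d\psi(df_i,df_j),df_0,\dots,\widehat{df_i},\dots,\widehat{df_j},\dots,df_k\big).$$ Let $Z_{\mathcal G}$ be the center of $\mathcal G$ and $\mathfrak Z^k=\Gamma(\wedge^kTS\otimes Z_{\mathcal G})$ the $k$-vector fields on $S$ with values in $Z_{\mathcal G}$. $d_{\mathcal D}$ restricts to $\partial_{\mathcal D}$ on $\mathfrak Z^\bullet$ with $\partial_{\mathcal D}^2=0$; $\mathrm H^1_{\partial_{\mathcal D}}$ is its first cohomology, and $\mathrm J:\mathrm H^1_{\partial_{\mathcal D}}\to\mathrm H^1(\mathcal P)$, $\mathrm J[Q]=[X_Q]$. Subspaces. $\mathfrak M(\mathcal P)$ is the set of $\delta\in\mathbb D(\Gamma E^* )$ that are derivations of the Lie bracket $[\cdot,\cdot]_1$ and for which there is $\widetilde Q\in\Gamma(TS\otimes E^* )$ such that, with $u=\sigma_\delta$ and for all $f,g\in C^\infty_S$, $$[\delta,\mathcal D_{df}]-\mathcal D_{d(L_uf)}=[\widetilde Q(f),\cdot]_1,\qquad (d_{\mathcal D}\widetilde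 Q)(df,dg)=\delta(\mathcal K(df,dg))-\mathcal K(d(L_uf),dg)-\mathcal K(df,d(L_ug)).$$ $\mathfrak M_0(\mathcal P)=\ker(\sigma|_{\mathfrak M(\mathcal P)})$; $\mathcal C(\mathcal P)=\{\mathcal D_{dh}\mid h\in C^\infty_S\}$; $\mathcal C_0(\mathcal P)=\mathfrak M_0(\mathcal P)\cap\mathcal C(\mathcal P)$; $\operatorname{Inn}\mathcal G=\{[\xi,\cdot]_1\mid\xi\in\Gamma E^*\}$. The arrows of the diagram are the natural $\mathbb R$-linear maps: in the horizontal sequence the map induced by $\mathrm J$ and $[X_Q+X_\delta]\mapsto[\delta]$; in the vertical sequence the map induced by the inclusion $\mathfrak M_0(\mathcal P)\subseteq\mathfrak M(\mathcal P)$ and $[\delta]\mapsto[\sigma_\delta]$. *)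

theory Defs
  imports
    "HOL-Analysis.Analysis"
    "HOL-Library.Function_Algebras"
    "HOL-Library.Set_Algebras"
    "HOL-Algebra.Module"
    "HOL-Algebra.AbelCoset"
begin

text \<open>
  Conventions. Functions, tensors and linear operators that are mathematically defined on a
  subset of a type are extended by 0 outside of it, so that they are determined by their values on
  that subset and the pointwise vector space operations of function types are the intended ones.
\<close>

section \<open>Linear algebra on carrier sets\<close>

instantiation "fun" :: (type, real_vector) real_vector
begin

definition scaleR_fun :: "real \<Rightarrow> ('a \<Rightarrow> 'b) \<Rightarrow> 'a \<Rightarrow> 'b"
  where "scaleR_fun c f = (\<lambda>x. c *\<^sub>R f x)"

instance
  by standard (simp_all add: scaleR_fun_def fun_eq_iff scaleR_add_right scaleR_add_left)

end

definition linear_from :: "'v::real_vector set \<Rightarrow> ('v \<Rightarrow> 'w::real_vector) \<Rightarrow> bool"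
  where "linear_from U f \<longleftrightarrow>
    (\<forall>x\<in>U. \<forall>y\<in>U. f (x + y) = f x + f y) \<and> (\<forall>c. \<forall>x\<in>U. f (c *\<^sub>R x) = c *\<^sub>R f x)"

definition linear_maps :: "'v::real_vector set \<Rightarrow> 'w::real_vector set \<Rightarrow> ('v \<Rightarrow> 'w) set"
  where "linear_maps U V = {f. linear_from U f \<and> f ` U \<subseteq> V \<and> (\<forall>x. x \<notin> U \<longrightarrow> f x = 0)}"

definition alt_multilinear :: "'v::real_vector set \<Rightarrow> nat \<Rightarrow> 'w::real_vector set \<Rightarrow> ('v list \<Rightarrow> 'w) set"
  where "alt_multilinear V k B = {F.
    (\<forall>xs. length xs = k \<and> set xs \<subseteq> V \<longrightarrow> F xs \<in> B) \<and>
    (\<forall>xs. \<not> (length xs = k \<and> set xs \<subseteq> V) \<longrightarrow> F xs = 0) \<and>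
    (\<forall>xs i. length xs = k \<and> set xs \<subseteq> V \<and> i < k \<longrightarrow> linear_from V (\<lambda>a. F (xs[i := a]))) \<and>
    (\<forall>xs i j. length xs = k \<and> set xs \<subseteq> V \<and> i < j \<and> j < k \<and> xs ! i = xs ! j \<longrightarrow> F xs = 0)}"

definition real_ring :: "real ring"
  where "real_ring = \<lparr>carrier = UNIV, mult = (*), one = 1, zero = 0, add = (+)\<rparr>"

text \<open>The fields \<open>mult\<close> and \<open>one\<close> of a module record carry no information for a vector space.\<close>

definition vspace :: "'v::real_vector set \<Rightarrow> (real, 'v) module"
  where "vspace U =
    \<lparr>carrier = U, mult = undefined, one = undefined, zero = 0, add = (+), smult = (*\<^sub>R)\<rparr>"

definition quot_module :: "(real, 'v) module \<Rightarrow> 'v set \<Rightarrow> (real, 'v set) module"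
  where "quot_module A N =
    \<lparr>carrier = a_rcosets\<^bsub>A\<^esub> N, mult = undefined, one = undefined, zero = N, add = set_add A,
     smult = (\<lambda>r C. \<Union>x\<in>C. N +>\<^bsub>A\<^esub> (r \<odot>\<^bsub>A\<^esub> x))\<rparr>"

definition module_homs :: "(real, 'v) module \<Rightarrow> (real, 'w) module \<Rightarrow> ('v \<Rightarrow> 'w) set"
  where "module_homs A B = {f. f \<in> carrier A \<rightarrow> carrier B \<and>
    (\<forall>x\<in>carrier A. \<forall>y\<in>carrier A. f (x \<oplus>\<^bsub>A\<^esub> y) = f x \<oplus>\<^bsub>B\<^esub> f y) \<and>
    (\<forall>r. \<forall>x\<in>carrier A. f (r \<odot>\<^bsub>A\<^esub> x) = r \<odot>\<^bsub>B\<^esub> f x)}"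

definition short_exact ::
    "(real, 'u) module \<Rightarrow> (real, 'v) module \<Rightarrow> (real, 'w) module \<Rightarrow> ('u \<Rightarrow> 'v) \<Rightarrow> ('v \<Rightarrow> 'w) \<Rightarrow> bool"
  where "short_exact A B C f g \<longleftrightarrow>
    Module.module real_ring A \<and> Module.module real_ring B \<and> Module.module real_ring C \<and>
    f \<in> module_homs A B \<and> g \<in> module_homs B C \<and>
    inj_on f (carrier A) \<and> f ` carrier A = a_kernel B C g \<and> g ` carrier B = carrier C"


section \<open>Smooth manifolds\<close>

primrec ck_on :: "nat \<Rightarrow> 'e::euclidean_space set \<Rightarrow> ('e \<Rightarrow> 'f::real_normed_vector) \<Rightarrow> bool"
  where
    "ck_on 0 W f \<longleftrightarrow> continuous_on W f"
  | "ck_on (Suc k) W f \<longleftrightarrow> (\<forall>x\<in>W. f differentiable (at x)) \<and>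
       (\<forall>v. ck_on k W (\<lambda>x. frechet_derivative f (at x) v))"

text \<open>Smoothness on an arbitrary set: local existence of smooth extensions to open sets of the
  ambient Euclidean space. It is used for relatively open subsets of linear subspaces.\<close>

definition smooth_on :: "'e::euclidean_space set \<Rightarrow> ('e \<Rightarrow> 'f::real_normed_vector) \<Rightarrow> bool"
  where "smooth_on A f \<longleftrightarrow> (\<forall>a\<in>A. \<exists>W g. open W \<and> a \<in> W \<and> (\<forall>k. ck_on k W g) \<and>
    (\<forall>x\<in>A \<inter> W. g x = f x))"

text \<open>A manifold is modelled on a linear subspace \<open>model\<close> of a Euclidean space, so that its
  dimension \<open>dim model\<close> is an arbitrary natural number.\<close>

record ('p, 'e) mfd =
  pts :: "'p set"
  model :: "'e set"
  charts :: "('p set \<times> ('p \<Rightarrow> 'e)) set"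

definition mfd_topology :: "('p, 'e::euclidean_space) mfd \<Rightarrow> 'p topology"
  where "mfd_topology N = topology (\<lambda>A. A \<subseteq> pts N \<and>
    (\<forall>(U, \<phi>)\<in>charts N. openin (top_of_set (model N)) (\<phi> ` (A \<inter> U))))"

definition admissible_chart :: "('p, 'e::euclidean_space) mfd \<Rightarrow> 'p set \<times> ('p \<Rightarrow> 'e) \<Rightarrow> bool"
  where "admissible_chart N = (\<lambda>(U, \<phi>).
    U \<subseteq> pts N \<and> inj_on \<phi> U \<and> openin (top_of_set (model N)) (\<phi> ` U) \<and>
    (\<forall>(U', \<phi>')\<in>charts N.
      openin (top_of_set (model N)) (\<phi> ` (U \<inter> U')) \<and>
      openin (top_of_set (model N)) (\<phi>' ` (U \<inter> U')) \<and>
      smooth_on (\<phi> ` (U \<inter> U')) (\<phi>' \<circ> inv_into U \<phi>) \<and>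
      smooth_on (\<phi>' ` (U \<inter> U')) (\<phi> \<circ> inv_into U' \<phi>')))"

definition smooth_manifold :: "('p, 'e::euclidean_space) mfd \<Rightarrow> bool"
  where "smooth_manifold N \<longleftrightarrow> subspace (model N) \<and> (\<Union>(U, \<phi>)\<in>charts N. U) = pts N \<and>
    (\<forall>c\<in>charts N. admissible_chart N c) \<and>
    Hausdorff_space (mfd_topology N) \<and> second_countable (mfd_topology N)"

definition open_submanifold :: "('p, 'e) mfd \<Rightarrow> 'p set \<Rightarrow> ('p, 'e) mfd"
  where "open_submanifold N A =
    \<lparr>pts = A, model = model N, charts = {(U \<inter> A, \<phi>) | U \<phi>. (U, \<phi>) \<in> charts N}\<rparr>"

definition smooth_map ::
    "('p, 'e::euclidean_space) mfd \<Rightarrow> ('q, 'f::euclidean_space) mfd \<Rightarrow> ('p \<Rightarrow> 'q) \<Rightarrow> bool"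
  where "smooth_map N N' F \<longleftrightarrow> F ` pts N \<subseteq> pts N' \<and>
    continuous_map (mfd_topology N) (mfd_topology N') F \<and>
    (\<forall>(U, \<phi>)\<in>charts N. \<forall>(U', \<phi>')\<in>charts N'.
      smooth_on (\<phi> ` (U \<inter> F -` U')) (\<phi>' \<circ> F \<circ> inv_into U \<phi>))"

definition diffeomorphism ::
    "('p, 'e::euclidean_space) mfd \<Rightarrow> ('q, 'f::euclidean_space) mfd \<Rightarrow> ('p \<Rightarrow> 'q) \<Rightarrow> bool"
  where "diffeomorphism N N' F \<longleftrightarrow> bij_betw F (pts N) (pts N') \<and>
    smooth_map N N' F \<and> smooth_map N' N (inv_into (pts N) F)"

type_synonym 'a fn = "'a \<Rightarrow> real"
type_synonym 'a tvec = "'a fn \<Rightarrow> real"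
type_synonym 'a covec = "'a tvec \<Rightarrow> real"
type_synonym 'a vfield = "'a \<Rightarrow> 'a tvec"
type_synonym 'a form = "'a \<Rightarrow> 'a covec"
type_synonym ('a, 'w) mvfield = "'a \<Rightarrow> 'a covec list \<Rightarrow> 'w"

definition smooth_functions :: "('a, 'e::euclidean_space) mfd \<Rightarrow> 'a fn set"
  where "smooth_functions N = {f. (\<forall>p. p \<notin> pts N \<longrightarrow> f p = 0) \<and>
    (\<forall>(U, \<phi>)\<in>charts N. smooth_on (\<phi> ` U) (f \<circ> inv_into U \<phi>))}"

text \<open>Tangent vectors are the point derivations of the algebra of smooth functions.\<close>

definition tangent :: "('a, 'e::euclidean_space) mfd \<Rightarrow> 'a \<Rightarrow> 'a tvec set"
  where "tangent N p = {v \<in> linear_maps (smooth_functions N) UNIV.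
    \<forall>f\<in>smooth_functions N. \<forall>g\<in>smooth_functions N. v (f * g) = f p * v g + g p * v f}"

definition cotangent :: "('a, 'e::euclidean_space) mfd \<Rightarrow> 'a \<Rightarrow> 'a covec set"
  where "cotangent N p = linear_maps (tangent N p) UNIV"

definition differential :: "('a, 'e::euclidean_space) mfd \<Rightarrow> 'a fn \<Rightarrow> 'a form"
  where "differential N f = (\<lambda>p v. if p \<in> pts N \<and> v \<in> tangent N p then v f else 0)"

definition lie_fn :: "'a vfield \<Rightarrow> 'a fn \<Rightarrow> 'a fn"
  where "lie_fn X f = (\<lambda>p. X p f)"

definition vector_fields :: "('a, 'e::euclidean_space) mfd \<Rightarrow> 'a vfield set"
  where "vector_fields N = {X. (\<forall>p\<in>pts N. X p \<in> tangent N p) \<and> (\<forall>p. p \<notin> pts N \<longrightarrow> X p = 0) \<and>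
    (\<forall>f\<in>smooth_functions N. lie_fn X f \<in> smooth_functions N)}"

definition pairing :: "'a form \<Rightarrow> 'a vfield \<Rightarrow> 'a fn"
  where "pairing \<alpha> X = (\<lambda>p. \<alpha> p (X p))"

definition one_forms :: "('a, 'e::euclidean_space) mfd \<Rightarrow> 'a form set"
  where "one_forms N = {\<alpha>. (\<forall>p\<in>pts N. \<alpha> p \<in> cotangent N p) \<and> (\<forall>p. p \<notin> pts N \<longrightarrow> \<alpha> p = 0) \<and>
    (\<forall>X\<in>vector_fields N. pairing \<alpha> X \<in> smooth_functions N)}"

definition lie_bracket :: "('a, 'e::euclidean_space) mfd \<Rightarrow> 'a vfield \<Rightarrow> 'a vfield \<Rightarrow> 'a vfield"
  where "lie_bracket N X Y = (\<lambda>p f. if f \<in> smooth_functions N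
    then X p (lie_fn Y f) - Y p (lie_fn X f) else 0)"

definition lie_form :: "('a, 'e::euclidean_space) mfd \<Rightarrow> 'a vfield \<Rightarrow> 'a form \<Rightarrow> 'a form"
  where "lie_form N X \<beta> = (THE \<omega>. \<omega> \<in> one_forms N \<and> (\<forall>Y\<in>vector_fields N.
    pairing \<omega> Y = lie_fn X (pairing \<beta> Y) - pairing \<beta> (lie_bracket N X Y)))"

definition eval_mv :: "('a, 'w) mvfield \<Rightarrow> 'a form list \<Rightarrow> 'a \<Rightarrow> 'w"
  where "eval_mv Q \<alpha>s = (\<lambda>p. Q p (map (\<lambda>\<alpha>. \<alpha> p) \<alpha>s))"

text \<open>Smooth \<open>k\<close>-vector fields on \<open>N\<close> with values in a vector bundle with fibres \<open>B p\<close> and space of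
  smooth sections \<open>Sec\<close>; at each point they are alternating \<open>k\<close>-linear maps on the cotangent space.\<close>

definition multivector_fields ::
    "('a, 'e::euclidean_space) mfd \<Rightarrow> nat \<Rightarrow> ('a \<Rightarrow> 'w::real_vector set) \<Rightarrow> ('a \<Rightarrow> 'w) set \<Rightarrow>
      ('a, 'w) mvfield set"
  where "multivector_fields N k B Sec = {Q.
    (\<forall>p\<in>pts N. Q p \<in> alt_multilinear (cotangent N p) k (B p)) \<and>
    (\<forall>p. p \<notin> pts N \<longrightarrow> Q p = 0) \<and>
    (\<forall>\<alpha>s. length \<alpha>s = k \<and> set \<alpha>s \<subseteq> one_forms N \<longrightarrow> eval_mv Q \<alpha>s \<in> Sec)}"


section \<open>Poisson manifolds\<close>

definition poisson_bracket ::
    "('a, 'e::euclidean_space) mfd \<Rightarrow> ('a, real) mvfield \<Rightarrow> 'a fn \<Rightarrow> 'a fn \<Rightarrow> 'a fn"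
  where "poisson_bracket N \<pi> f g = eval_mv \<pi> [differential N f, differential N g]"

definition poisson_structure :: "('a, 'e::euclidean_space) mfd \<Rightarrow> ('a, real) mvfield \<Rightarrow> bool"
  where "poisson_structure N \<pi> \<longleftrightarrow>
    \<pi> \<in> multivector_fields N 2 (\<lambda>_. UNIV) (smooth_functions N) \<and>
    (\<forall>f\<in>smooth_functions N. \<forall>g\<in>smooth_functions N. \<forall>h\<in>smooth_functions N.
      poisson_bracket N \<pi> f (poisson_bracket N \<pi> g h) +
      poisson_bracket N \<pi> g (poisson_bracket N \<pi> h f) +
      poisson_bracket N \<pi> h (poisson_bracket N \<pi> f g) = 0)"

definition sharp ::
    "('a, 'e::euclidean_space) mfd \<Rightarrow> ('a, real) mvfield \<Rightarrow> 'a form \<Rightarrow> 'a vfield"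
  where "sharp N \<pi> \<alpha> = (\<lambda>p f. \<pi> p [\<alpha> p, differential N f p])"

definition koszul ::
    "('a, 'e::euclidean_space) mfd \<Rightarrow> ('a, real) mvfield \<Rightarrow> 'a form \<Rightarrow> 'a form \<Rightarrow> 'a form"
  where "koszul N \<pi> \<alpha> \<beta> = lie_form N (sharp N \<pi> \<alpha>) \<beta> - lie_form N (sharp N \<pi> \<beta>) \<alpha>
    - differential N (eval_mv \<pi> [\<alpha>, \<beta>])"

text \<open>Charts of \<open>M\<close> in which the subset \<open>S\<close> is the slice cut out by the linear subspace \<open>W\<close> of the
  model space.\<close>

definition slice_charts ::
    "('a, 'e::euclidean_space) mfd \<Rightarrow> 'e set \<Rightarrow> 'a set \<Rightarrow> ('a set \<times> ('a \<Rightarrow> 'e)) set"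
  where "slice_charts M W S =
    {(U, \<phi>). admissible_chart M (U, \<phi>) \<and> \<phi> ` (U \<inter> S) = \<phi> ` U \<inter> W}"

definition embedded_submanifold ::
    "('a, 'e::euclidean_space) mfd \<Rightarrow> 'e set \<Rightarrow> 'a set \<Rightarrow> bool"
  where "embedded_submanifold M W S \<longleftrightarrow> subspace W \<and> W \<subseteq> model M \<and> S \<subseteq> pts M \<and>
    (\<forall>p\<in>S. \<exists>(U, \<phi>)\<in>slice_charts M W S. p \<in> U)"

definition submanifold ::
    "('a, 'e::euclidean_space) mfd \<Rightarrow> 'e set \<Rightarrow> 'a set \<Rightarrow> ('a, 'e) mfd"
  where "submanifold M W S =
    \<lparr>pts = S, model = W, charts = {(U \<inter> S, \<phi>) | U \<phi>. (U, \<phi>) \<in> slice_charts M W S}\<rparr>"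

text \<open>The data of an embedded submanifold \<open>(S, \<psi>)\<close> of \<open>(M, \<pi>)\<close> with an exponential map
  \<open>e : E \<rightarrow> M\<close>. A point of the normal bundle \<open>E\<close> is a pair of a point \<open>p\<close> of \<open>S\<close> and a coset of the
  tangent space of \<open>S\<close> in that of \<open>M\<close>.\<close>

record ('a, 'e) setting =
  amb :: "('a, 'e) mfd"
  amb_poisson :: "('a, real) mvfield"
  sub_pts :: "'a set"
  sub_model :: "'e set"
  sub_poisson :: "('a, real) mvfield"
  expmap :: "'a \<times> 'a tvec set \<Rightarrow> 'a"

definition sub_mfd :: "('a, 'e::euclidean_space) setting \<Rightarrow> ('a, 'e) mfd"
  where "sub_mfd D = submanifold (amb D) (sub_model D) (sub_pts D)"

abbreviation smooth_S :: "('a, 'e::euclidean_space) setting \<Rightarrow> 'a fn set"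
  where "smooth_S D \<equiv> smooth_functions (sub_mfd D)"

abbreviation d_S :: "('a, 'e::euclidean_space) setting \<Rightarrow> 'a fn \<Rightarrow> 'a form"
  where "d_S D \<equiv> differential (sub_mfd D)"

abbreviation bracket_S :: "('a, 'e::euclidean_space) setting \<Rightarrow> 'a fn \<Rightarrow> 'a fn \<Rightarrow> 'a fn"
  where "bracket_S D \<equiv> poisson_bracket (sub_mfd D) (sub_poisson D)"

definition restrict_S :: "('a, 'e) setting \<Rightarrow> 'a fn \<Rightarrow> 'a fn"
  where "restrict_S D f = (\<lambda>p. if p \<in> sub_pts D then f p else 0)"

text \<open>The last condition says that the inclusion of \<open>S\<close> in \<open>M\<close> is a Poisson map.\<close>

definition embedded_poisson_submanifold :: "('a, 'e::euclidean_space) setting \<Rightarrow> bool"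
  where "embedded_poisson_submanifold D \<longleftrightarrow>
    embedded_submanifold (amb D) (sub_model D) (sub_pts D) \<and>
    poisson_structure (sub_mfd D) (sub_poisson D) \<and>
    (\<forall>f\<in>smooth_functions (amb D). \<forall>g\<in>smooth_functions (amb D).
      bracket_S D (restrict_S D f) (restrict_S D g) =
      restrict_S D (poisson_bracket (amb D) (amb_poisson D) f g))"


section \<open>Normal bundle and exponential maps\<close>

definition push :: "('a, 'e::euclidean_space) setting \<Rightarrow> 'a tvec \<Rightarrow> 'a tvec"
  where "push D v = (\<lambda>f. if f \<in> smooth_functions (amb D) then v (restrict_S D f) else 0)"

definition tangent_S_in_M :: "('a, 'e::euclidean_space) setting \<Rightarrow> 'a \<Rightarrow> 'a tvec set"
  where "tangent_S_in_M D p = push D ` tangent (sub_mfd D) p"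

definition normal_space :: "('a, 'e::euclidean_space) setting \<Rightarrow> 'a \<Rightarrow> 'a tvec set set"
  where "normal_space D p = {v +o tangent_S_in_M D p | v. v \<in> tangent (amb D) p}"

text \<open>A tangent vector applied to a function that is only defined and smooth near \<open>p\<close>.\<close>

definition apply_local :: "('a, 'e::euclidean_space) mfd \<Rightarrow> 'a \<Rightarrow> 'a tvec \<Rightarrow> 'a fn \<Rightarrow> real"
  where "apply_local N p v g = (THE r. \<exists>f\<in>smooth_functions N. \<exists>A. openin (mfd_topology N) A \<and>
    p \<in> A \<and> (\<forall>q\<in>A. f q = g q) \<and> r = v f)"

definition chart_differential ::
    "('a, 'e::euclidean_space) mfd \<Rightarrow> ('a \<Rightarrow> 'e) \<Rightarrow> 'a \<Rightarrow> 'a tvec \<Rightarrow> 'e"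
  where "chart_differential N \<phi> p v = (\<Sum>b\<in>Basis. apply_local N p v (\<lambda>q. \<phi> q \<bullet> b) *\<^sub>R b)"

text \<open>A slice chart \<open>\<phi>\<close> of \<open>M\<close> gives a chart of the total space of \<open>E\<close>: the base point contributes
  \<open>\<phi> p \<in> W\<close>, the class of \<open>v\<close> contributes the component of \<open>d\<phi>(v)\<close> orthogonal to \<open>W\<close>, where
  \<open>closest_point W\<close> is the orthogonal projection onto \<open>W\<close>.\<close>

definition normal_chart ::
    "('a, 'e::euclidean_space) setting \<Rightarrow> ('a \<Rightarrow> 'e) \<Rightarrow> 'a \<times> 'a tvec set \<Rightarrow> 'e"
  where "normal_chart D \<phi> = (\<lambda>(p, c). \<phi> p + (THE y. \<forall>v\<in>c.
    y = chart_differential (amb D) \<phi> p v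
      - closest_point (sub_model D) (chart_differential (amb D) \<phi> p v)))"

definition normal_bundle ::
    "('a, 'e::euclidean_space) setting \<Rightarrow> ('a \<times> 'a tvec set, 'e) mfd"
  where "normal_bundle D =
    \<lparr>pts = Sigma (sub_pts D) (normal_space D), model = model (amb D),
     charts = {(Sigma (U \<inter> sub_pts D) (normal_space D), normal_chart D \<phi>) | U \<phi>.
       (U, \<phi>) \<in> slice_charts (amb D) (sub_model D) (sub_pts D)}\<rparr>"

definition velocity :: "('a, 'e::euclidean_space) mfd \<Rightarrow> (real \<Rightarrow> 'a) \<Rightarrow> 'a tvec"
  where "velocity N \<gamma> = (\<lambda>f. if f \<in> smooth_functions N then deriv (\<lambda>t. f (\<gamma> t)) 0 else 0)"

text \<open>The splitting \<open>E \<rightarrow> T\<^sub>SM\<close> induced by \<open>e\<close>: the image of the class of \<open>v \<in> T\<^sub>pM\<close> under the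
  differential of \<open>e\<close> at the zero vector of \<open>E\<^sub>p\<close>.\<close>

definition normal_velocity :: "('a, 'e::euclidean_space) setting \<Rightarrow> 'a \<Rightarrow> 'a tvec \<Rightarrow> 'a tvec"
  where "normal_velocity D p v =
    velocity (amb D) (\<lambda>t. expmap D (p, (t *\<^sub>R v) +o tangent_S_in_M D p))"

definition exponential_map :: "('a, 'e::euclidean_space) setting \<Rightarrow> bool"
  where "exponential_map D \<longleftrightarrow> (let A = expmap D ` pts (normal_bundle D) in
    openin (mfd_topology (amb D)) A \<and>
    diffeomorphism (normal_bundle D) (open_submanifold (amb D) A) (expmap D) \<and>
    (\<forall>p\<in>sub_pts D. expmap D (p, tangent_S_in_M D p) = p) \<and>
    (\<forall>p\<in>sub_pts D. \<forall>v\<in>tangent (amb D) p. normal_velocity D p v \<in> v +o tangent_S_in_M D p))"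


section \<open>The restricted Lie algebroid and the infinitesimal Poisson algebra\<close>

definition smult_section :: "'a fn \<Rightarrow> ('a \<Rightarrow> 'w::real_vector) \<Rightarrow> 'a \<Rightarrow> 'w"
  where "smult_section f \<eta> = (\<lambda>p. f p *\<^sub>R \<eta> p)"

definition restricted_forms :: "('a, 'e::euclidean_space) setting \<Rightarrow> 'a form set"
  where "restricted_forms D = {a. (\<forall>p\<in>sub_pts D. a p \<in> cotangent (amb D) p) \<and>
    (\<forall>p. p \<notin> sub_pts D \<longrightarrow> a p = 0) \<and>
    (\<forall>X\<in>vector_fields (amb D). pairing a X \<in> smooth_S D)}"

text \<open>Since \<open>S\<close> need not be closed, a section along \<open>S\<close> is the restriction of a one-form on \<open>M\<close> only
  locally; the bracket is defined through such local extensions.\<close>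

definition restricted_bracket ::
    "('a, 'e::euclidean_space) setting \<Rightarrow> 'a form \<Rightarrow> 'a form \<Rightarrow> 'a form"
  where "restricted_bracket D a b = (THE c. c \<in> restricted_forms D \<and>
    (\<forall>\<alpha>\<in>one_forms (amb D). \<forall>\<beta>\<in>one_forms (amb D). \<forall>U. openin (mfd_topology (amb D)) U \<longrightarrow>
      (\<forall>p\<in>U \<inter> sub_pts D. \<alpha> p = a p \<and> \<beta> p = b p) \<longrightarrow>
      (\<forall>p\<in>U \<inter> sub_pts D. c p = koszul (amb D) (amb_poisson D) \<alpha> \<beta> p)))"

definition conormal :: "('a, 'e::euclidean_space) setting \<Rightarrow> 'a \<Rightarrow> 'a covec set"
  where "conormal D p = {a \<in> cotangent (amb D) p. \<forall>v\<in>tangent_S_in_M D p. a v = 0}"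

definition conormal_sections :: "('a, 'e::euclidean_space) setting \<Rightarrow> 'a form set"
  where "conormal_sections D = {\<eta> \<in> restricted_forms D. \<forall>p\<in>sub_pts D. \<eta> p \<in> conormal D p}"

definition bracket_1 :: "('a, 'e::euclidean_space) setting \<Rightarrow> 'a form \<Rightarrow> 'a form \<Rightarrow> 'a form"
  where "bracket_1 D \<eta> \<xi> = restricted_bracket D \<eta> \<xi>"

text \<open>\<open>h\<close> is dual to the projection \<open>T\<^sub>SM = TS \<oplus> E \<rightarrow> TS\<close>.\<close>

definition lift_covec :: "('a, 'e::euclidean_space) setting \<Rightarrow> 'a \<Rightarrow> 'a covec \<Rightarrow> 'a covec"
  where "lift_covec D p \<alpha> = (THE a. a \<in> cotangent (amb D) p \<and>
    (\<forall>v\<in>tangent (sub_mfd D) p. a (push D v) = \<alpha> v) \<and>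
    (\<forall>v\<in>tangent (amb D) p. a (normal_velocity D p v) = 0))"

definition lift_form :: "('a, 'e::euclidean_space) setting \<Rightarrow> 'a form \<Rightarrow> 'a form"
  where "lift_form D \<alpha> = (\<lambda>p. if p \<in> sub_pts D then lift_covec D p (\<alpha> p) else 0)"

definition cder :: "('a, 'e::euclidean_space) setting \<Rightarrow> 'a form \<Rightarrow> 'a form \<Rightarrow> 'a form"
  where "cder D \<alpha> \<xi> = restricted_bracket D (lift_form D \<alpha>) \<xi>"

definition curv :: "('a, 'e::euclidean_space) setting \<Rightarrow> 'a form \<Rightarrow> 'a form \<Rightarrow> 'a form"
  where "curv D \<alpha> \<beta> = restricted_bracket D (lift_form D \<alpha>) (lift_form D \<beta>)
    - lift_form D (koszul (sub_mfd D) (sub_poisson D) \<alpha> \<beta>)"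

type_synonym 'a aff = "'a fn \<times> 'a form"

definition aff_carrier :: "('a, 'e::euclidean_space) setting \<Rightarrow> 'a aff set"
  where "aff_carrier D = smooth_S D \<times> conormal_sections D"

definition aff_mult :: "'a aff \<Rightarrow> 'a aff \<Rightarrow> 'a aff"
  where "aff_mult = (\<lambda>(f, \<eta>) (g, \<xi>). (f * g, smult_section f \<xi> + smult_section g \<eta>))"

definition aff_bracket :: "('a, 'e::euclidean_space) setting \<Rightarrow> 'a aff \<Rightarrow> 'a aff \<Rightarrow> 'a aff"
  where "aff_bracket D = (\<lambda>(f, \<eta>) (g, \<xi>).
    (bracket_S D f g,
     cder D (d_S D f) \<xi> - cder D (d_S D g) \<eta> + bracket_1 D \<eta> \<xi> + curv D (d_S D f) (d_S D g)))"


section \<open>Cohomology and derivative endomorphisms\<close>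

definition poiss_P :: "('a, 'e::euclidean_space) setting \<Rightarrow> ('a aff \<Rightarrow> 'a aff) set"
  where "poiss_P D = {X \<in> linear_maps (aff_carrier D) (aff_carrier D).
    \<forall>p\<in>aff_carrier D. \<forall>q\<in>aff_carrier D.
      X (aff_mult p q) = aff_mult (X p) q + aff_mult p (X q) \<and>
      X (aff_bracket D p q) = aff_bracket D (X p) q + aff_bracket D p (X q)}"

definition ham_P :: "('a, 'e::euclidean_space) setting \<Rightarrow> ('a aff \<Rightarrow> 'a aff) set"
  where "ham_P D = {(\<lambda>q. if q \<in> aff_carrier D then aff_bracket D p q else 0) | p.
    p \<in> aff_carrier D}"

definition H1_P :: "('a, 'e::euclidean_space) setting \<Rightarrow> (real, ('a aff \<Rightarrow> 'a aff) set) module"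
  where "H1_P D = quot_module (vspace (poiss_P D)) (ham_P D)"

definition ham_S :: "('a, 'e::euclidean_space) setting \<Rightarrow> 'a vfield set"
  where "ham_S D = {sharp (sub_mfd D) (sub_poisson D) (d_S D h) | h. h \<in> smooth_S D}"

definition is_symbol ::
    "('a, 'e::euclidean_space) setting \<Rightarrow> ('a form \<Rightarrow> 'a form) \<Rightarrow> 'a vfield \<Rightarrow> bool"
  where "is_symbol D \<delta> u \<longleftrightarrow> u \<in> vector_fields (sub_mfd D) \<and>
    (\<forall>f\<in>smooth_S D. \<forall>\<eta>\<in>conormal_sections D.
      \<delta> (smult_section f \<eta>) = smult_section f (\<delta> \<eta>) + smult_section (lie_fn u f) \<eta>)"

definition derivative_endos :: "('a, 'e::euclidean_space) setting \<Rightarrow> ('a form \<Rightarrow> 'a form) set"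
  where "derivative_endos D =
    {\<delta> \<in> linear_maps (conormal_sections D) (conormal_sections D). \<exists>u. is_symbol D \<delta> u}"

text \<open>The symbol is unique if \<open>E\<close> has positive rank. In rank 0 every vector field is a symbol of the
  only element 0 of \<open>derivative_endos D\<close>.\<close>

definition symbol :: "('a, 'e::euclidean_space) setting \<Rightarrow> ('a form \<Rightarrow> 'a form) \<Rightarrow> 'a vfield"
  where "symbol D \<delta> = (THE u. is_symbol D \<delta> u)"

text \<open>\<open>conormal_mv D k\<close> is the space of \<open>k\<close>-vector fields on \<open>S\<close> with values in the conormal
  bundle.\<close>

definition conormal_mv :: "('a, 'e::euclidean_space) setting \<Rightarrow> nat \<Rightarrow> ('a, 'a covec) mvfield set"
  where "conormal_mv D k = multivector_fields (sub_mfd D) k (conormal D) (conormal_sections D)"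

definition X_Q ::
    "('a, 'e::euclidean_space) setting \<Rightarrow> ('a, 'a covec) mvfield \<Rightarrow> 'a aff \<Rightarrow> 'a aff"
  where "X_Q D Q = (\<lambda>q. if q \<in> aff_carrier D then (0, eval_mv Q [d_S D (fst q)]) else 0)"

definition X_delta ::
    "('a, 'e::euclidean_space) setting \<Rightarrow> ('a form \<Rightarrow> 'a form) \<Rightarrow> 'a aff \<Rightarrow> 'a aff"
  where "X_delta D \<delta> =
    (\<lambda>q. if q \<in> aff_carrier D then (lie_fn (symbol D \<delta>) (fst q), \<delta> (snd q)) else 0)"

text \<open>The contravariant differential of a \<open>k\<close>-vector field, evaluated on \<open>df\<^sub>0, \<dots>, df\<^sub>k\<close>; these
  values determine it.\<close>

definition dD_exact ::
    "('a, 'e::euclidean_space) setting \<Rightarrow> nat \<Rightarrow> ('a, 'a covec) mvfield \<Rightarrow> (nat \<Rightarrow> 'a fn) \<Rightarrow> 'a form"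
  where "dD_exact D k Q f =
    (\<Sum>i\<le>k. (-1) ^ i *\<^sub>R cder D (d_S D (f i))
      (eval_mv Q (map (\<lambda>m. d_S D (f m)) (filter (\<lambda>m. m \<noteq> i) [0..<Suc k])))) +
    (\<Sum>(i, j)\<in>{(i, j). i < j \<and> j \<le> k}. (-1) ^ (i + j) *\<^sub>R
      eval_mv Q (d_S D (bracket_S D (f i) (f j)) #
        map (\<lambda>m. d_S D (f m)) (filter (\<lambda>m. m \<noteq> i \<and> m \<noteq> j) [0..<Suc k])))"

definition dD ::
    "('a, 'e::euclidean_space) setting \<Rightarrow> nat \<Rightarrow> ('a, 'a covec) mvfield \<Rightarrow> ('a, 'a covec) mvfield"
  where "dD D k Q = (THE R. R \<in> conormal_mv D (Suc k) \<and>
    (\<forall>f. (\<forall>i\<le>k. f i \<in> smooth_S D) \<longrightarrow>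
      eval_mv R (map (\<lambda>m. d_S D (f m)) [0..<Suc k]) = dD_exact D k Q f))"

definition center_G :: "('a, 'e::euclidean_space) setting \<Rightarrow> 'a form set"
  where "center_G D =
    {\<xi> \<in> conormal_sections D. \<forall>\<eta>\<in>conormal_sections D. bracket_1 D \<xi> \<eta> = 0}"

definition central_mv :: "('a, 'e::euclidean_space) setting \<Rightarrow> nat \<Rightarrow> ('a, 'a covec) mvfield set"
  where "central_mv D k = {Q \<in> conormal_mv D k.
    \<forall>\<alpha>s. length \<alpha>s = k \<and> set \<alpha>s \<subseteq> one_forms (sub_mfd D) \<longrightarrow> eval_mv Q \<alpha>s \<in> center_G D}"

definition H1_dD :: "('a, 'e::euclidean_space) setting \<Rightarrow> (real, ('a, 'a covec) mvfield set) module"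
  where "H1_dD D =
    quot_module (vspace {Q \<in> central_mv D 1. dD D 1 Q = 0}) (dD D 0 ` central_mv D 0)"

text \<open>Maps out of a quotient are given by the union of the images of all representatives; the image
  of each representative is a coset, which for a well-defined map does not depend on it.\<close>

definition J_map ::
    "('a, 'e::euclidean_space) setting \<Rightarrow> ('a, 'a covec) mvfield set \<Rightarrow> ('a aff \<Rightarrow> 'a aff) set"
  where "J_map D C = (\<Union>Q\<in>C. ham_P D +>\<^bsub>vspace (poiss_P D)\<^esub> X_Q D Q)"


section \<open>The spaces in the vertical sequence\<close>

definition MP :: "('a, 'e::euclidean_space) setting \<Rightarrow> ('a form \<Rightarrow> 'a form) set"
  where "MP D = {\<delta> \<in> derivative_endos D.
    (\<forall>\<eta>\<in>conormal_sections D. \<forall>\<xi>\<in>conormal_sections D.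
      \<delta> (bracket_1 D \<eta> \<xi>) = bracket_1 D (\<delta> \<eta>) \<xi> + bracket_1 D \<eta> (\<delta> \<xi>)) \<and>
    (\<exists>Q\<in>conormal_mv D 1. let u = symbol D \<delta> in
      (\<forall>f\<in>smooth_S D. \<forall>\<eta>\<in>conormal_sections D.
        \<delta> (cder D (d_S D f) \<eta>) - cder D (d_S D f) (\<delta> \<eta>) - cder D (d_S D (lie_fn u f)) \<eta>
          = bracket_1 D (eval_mv Q [d_S D f]) \<eta>) \<and>
      (\<forall>f\<in>smooth_S D. \<forall>g\<in>smooth_S D.
        eval_mv (dD D 1 Q) [d_S D f, d_S D g] =
          \<delta> (curv D (d_S D f) (d_S D g)) - curv D (d_S D (lie_fn u f)) (d_S D g)
          - curv D (d_S D f) (d_S D (lie_fn u g))))}"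

definition MP0 :: "('a, 'e::euclidean_space) setting \<Rightarrow> ('a form \<Rightarrow> 'a form) set"
  where "MP0 D = {\<delta> \<in> MP D. symbol D \<delta> = 0}"

definition CP :: "('a, 'e::euclidean_space) setting \<Rightarrow> ('a form \<Rightarrow> 'a form) set"
  where "CP D =
    {(\<lambda>\<eta>. if \<eta> \<in> conormal_sections D then cder D (d_S D h) \<eta> else 0) | h. h \<in> smooth_S D}"

definition CP0 :: "('a, 'e::euclidean_space) setting \<Rightarrow> ('a form \<Rightarrow> 'a form) set"
  where "CP0 D = MP0 D \<inter> CP D"

definition InnG :: "('a, 'e::euclidean_space) setting \<Rightarrow> ('a form \<Rightarrow> 'a form) set"
  where "InnG D =
    {(\<lambda>\<eta>. if \<eta> \<in> conormal_sections D then bracket_1 D \<xi> \<eta> else 0) | \<xi>. \<xi> \<in> conormal_sections D}"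

definition arrow_J ::
    "('a, 'e::euclidean_space) setting \<Rightarrow> ('a, 'a covec) mvfield set set \<Rightarrow> ('a aff \<Rightarrow> 'a aff) set"
  where "arrow_J D K = (\<Union>C\<in>K. J_map D C)"

definition arrow_delta ::
    "('a, 'e::euclidean_space) setting \<Rightarrow> ('a aff \<Rightarrow> 'a aff) set \<Rightarrow> ('a form \<Rightarrow> 'a form) set"
  where "arrow_delta D C =
    (\<Union>\<delta>\<in>{\<delta> \<in> derivative_endos D. \<exists>Q\<in>conormal_mv D 1. X_Q D Q + X_delta D \<delta> \<in> C}.
      (CP D + InnG D) +>\<^bsub>vspace (MP D)\<^esub> \<delta>)"

definition arrow_incl ::
    "('a, 'e::euclidean_space) setting \<Rightarrow> ('a form \<Rightarrow> 'a form) set \<Rightarrow> ('a form \<Rightarrow> 'a form) set"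
  where "arrow_incl D C = (\<Union>\<delta>\<in>C. (CP D + InnG D) +>\<^bsub>vspace (MP D)\<^esub> \<delta>)"

definition arrow_symbol ::
    "('a, 'e::euclidean_space) setting \<Rightarrow> ('a form \<Rightarrow> 'a form) set \<Rightarrow> 'a vfield set"
  where "arrow_symbol D C =
    (\<Union>\<delta>\<in>C. ham_S D +>\<^bsub>vspace (symbol D ` MP D)\<^esub> symbol D \<delta>)"

end

theory Submission
  imports Defs "HOL-Computational_Algebra.Polynomial"
begin

text \<open>Affine functions on \<open>E\<close> are the first-order jets along \<open>S\<close> of functions on \<open>M\<close>: near each point
  of \<open>S\<close>, \<open>f \<oplus> \<eta>\<close> is represented by a function \<open>F\<close> with \<open>F = f\<close> and \<open>dF = h(df) + \<eta>\<close> on \<open>S\<close>. Under this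
  correspondence the product and the affine bracket are those of \<open>M\<close>, so that the Leibniz rule and
  the Jacobi identity are inherited from \<open>M\<close>.

  Every Poisson derivation is uniquely \<open>X\<^sub>Q + X\<^sub>\<delta>\<close>, and comparing both sides of the derivation
  identity on the generators \<open>f \<oplus> 0\<close> and \<open>0 \<oplus> \<eta>\<close> shows that \<open>X\<^sub>Q + X\<^sub>\<delta>\<close> is Poisson iff \<open>\<delta>\<close> satisfies
  the conditions defining \<open>MP\<close> with \<open>Q\<close> as witness. Thus \<open>X\<^sub>Q + X\<^sub>\<delta> \<mapsto> \<delta>\<close> maps the Poisson derivations
  onto \<open>MP\<close>, with kernel the \<open>X\<^sub>Q\<close> for central cocycles \<open>Q\<close>, and the Hamiltonian ones onto
  \<open>CP + InnG\<close>; the symbol in turn maps \<open>CP + InnG\<close> onto the Hamiltonian vector fields of \<open>S\<close>.\<close>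

section \<open>Quotients of real vector spaces\<close>

text \<open>Two obstacles shape the development. Tangent vectors are point derivations of globally
  defined smooth functions, so everything local has to be recovered with bump functions and
  Hadamard's lemma. And S need not be closed, so functions and sections along S extend to M only
  near each point; identities along S are therefore checked on local potentials
  (\<open>exact_on\<close>, \<open>lifts\<close>), and each \<open>THE\<close> in the definitions
  has to be shown independent of the extension. What makes the jet correspondence work is that S is
  Poisson: a function vanishing on S has brackets vanishing on S, so Hamiltonian directions of M are
  tangent to S, and the 1-jet of a bracket along S depends only on the 1-jets of its arguments. The
  exponential map supplies the splitting through its derivative along the fibres at the zero
  section, and its smoothness is what gives h(df) smooth potentials. Positive codimension provides
  at each point of S a conormal section that does not vanish there; this makes symbols unique and
  forces a derivation to send conormal sections to conormal sections.\<close>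

definition submod :: "(real, 'v) module \<Rightarrow> 'v set \<Rightarrow> bool"
  where "submod A N \<longleftrightarrow> N \<subseteq> carrier A \<and> \<zero>\<^bsub>A\<^esub> \<in> N \<and> (\<forall>x\<in>N. \<forall>y\<in>N. x \<oplus>\<^bsub>A\<^esub> y \<in> N) \<and>
    (\<forall>r. \<forall>x\<in>N. r \<odot>\<^bsub>A\<^esub> x \<in> N)"

lemma cring_real_ring: "cring real_ring"
proof (rule cringI)
  show "abelian_group real_ring"
    by (rule abelian_groupI) (auto simp: real_ring_def intro: exI[of _ "- x" for x])
  show "Group.comm_monoid real_ring"
    by (rule comm_monoidI) (auto simp: real_ring_def)
qed (auto simp: real_ring_def algebra_simps)

lemma real_ring_simps [simp]:
  "carrier real_ring = UNIV" "a \<otimes>\<^bsub>real_ring\<^esub> b = a * b" "\<one>\<^bsub>real_ring\<^esub> = 1"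
  "\<zero>\<^bsub>real_ring\<^esub> = 0" "a \<oplus>\<^bsub>real_ring\<^esub> b = a + b"
  by (auto simp: real_ring_def)

lemma real_ring_minus [simp]: "\<ominus>\<^bsub>real_ring\<^esub> a = - a"
  using abelian_group.minus_equality[OF cring.axioms(1)[OF cring_real_ring, THEN ring.is_abelian_group], of "-a" a]
  by auto

lemma vspace_simps [simp]:
  "carrier (vspace U) = U" "x \<oplus>\<^bsub>vspace U\<^esub> y = x + y" "\<zero>\<^bsub>vspace U\<^esub> = 0" "r \<odot>\<^bsub>vspace U\<^esub> x = r *\<^sub>R x"
  by (auto simp: vspace_def)

lemma module_homsD:
  assumes "f \<in> module_homs A B" "x \<in> carrier A"
  shows "f x \<in> carrier B" "y \<in> carrier A ==> f (x \<oplus>\<^bsub>A\<^esub> y) = f x \<oplus>\<^bsub>B\<^esub> f y"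
    "f (r \<odot>\<^bsub>A\<^esub> x) = r \<odot>\<^bsub>B\<^esub> f x"
  using assms by (simp_all add: module_homs_def Pi_iff)

lemma module_vspace: assumes "subspace U" shows "Module.module real_ring (vspace U)"
proof (rule moduleI)
  show "abelian_group (vspace U)"
  proof (rule abelian_groupI)
    fix x assume "x \<in> carrier (vspace U)"
    then show "\<exists>y\<in>carrier (vspace U). y \<oplus>\<^bsub>vspace U\<^esub> x = \<zero>\<^bsub>vspace U\<^esub>"
      using assms by (intro bexI[of _ "-x"]) (auto simp: subspace_neg)
  qed (use assms in \<open>auto simp: subspace_add subspace_0 algebra_simps\<close>)
qed (use assms cring_real_ring in \<open>auto simp: subspace_scale algebra_simps\<close>)

lemma submod_vspace: "subspace U ==> subspace N ==> N \<subseteq> U ==> submod (vspace U) N"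
  by (auto simp: submod_def subspace_0 subspace_add subspace_scale)

lemma coset_vspace: "N +>\<^bsub>vspace U\<^esub> x = (\<lambda>n. n + x) ` N"
  by (auto simp: a_r_coset_def r_coset_def)

lemma coset_vspace_eq:
  assumes "subspace N" "x - y \<in> N" shows "N +>\<^bsub>vspace U\<^esub> x = N +>\<^bsub>vspace U\<^esub> y"
  unfolding coset_vspace
proof (intro equalityI subsetI)
  fix z assume "z \<in> (\<lambda>n. n + x) ` N"
  then obtain n where n: "n \<in> N" "z = n + x" by auto
  then show "z \<in> (\<lambda>n. n + y) ` N" using assms by (intro image_eqI[of _ _ "n + (x - y)"]) (auto simp: subspace_add)
next
  fix z assume "z \<in> (\<lambda>n. n + y) ` N"
  then obtain n where n: "n \<in> N" "z = n + y" by auto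
  then show "z \<in> (\<lambda>n. n + x) ` N" using assms by (intro image_eqI[of _ _ "n - (x - y)"]) (auto simp: subspace_diff)
qed

lemma a_kernel_conv: "a_kernel A B f = {x \<in> carrier A. f x = \<zero>\<^bsub>B\<^esub>}"
  by (simp add: a_kernel_def kernel_def)

context
  fixes A :: "(real, 'v) module" and N
  assumes mod: "Module.module real_ring A" and sub: "submod A N"
begin

interpretation A: Module.module real_ring A by (rule mod)

text \<open>Negation is scaling by \<open>-1\<close>, which is why \<open>submod\<close> does not
  list it.\<close>

lemma submod_minus: assumes "x \<in> N" shows "\<ominus>\<^bsub>A\<^esub> x \<in> N"
proof -
  have "x \<in> carrier A" using sub assms by (auto simp: submod_def)
  then have "(\<ominus>\<^bsub>real_ring\<^esub> 1) \<odot>\<^bsub>A\<^esub> x = \<ominus>\<^bsub>A\<^esub> (1 \<odot>\<^bsub>A\<^esub> x)" by (intro A.smult_l_minus) auto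
  then have "\<ominus>\<^bsub>A\<^esub> x = (-1) \<odot>\<^bsub>A\<^esub> x" using A.smult_one \<open>x \<in> carrier A\<close> by auto
  then show ?thesis using sub assms by (simp add: submod_def)
qed

lemma submod_subgroup: "abelian_subgroup N A"
proof (rule abelian_subgroupI3)
  show "additive_subgroup N A"
    unfolding additive_subgroup_def
    by (rule subgroup.intro) (use sub submod_minus in \<open>auto simp: submod_def a_inv_def\<close>)
qed (rule A.abelian_group_axioms)

interpretation S: abelian_subgroup N A by (rule submod_subgroup)

lemma quot_simps [simp]:
  "carrier (quot_module A N) = a_rcosets\<^bsub>A\<^esub> N" "x \<oplus>\<^bsub>quot_module A N\<^esub> y = x <+>\<^bsub>A\<^esub> y"
  "\<zero>\<^bsub>quot_module A N\<^esub> = N"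
  by (auto simp: quot_module_def)

lemma coset_carrier: "C \<in> a_rcosets\<^bsub>A\<^esub> N \<longleftrightarrow> (\<exists>x\<in>carrier A. C = N +>\<^bsub>A\<^esub> x)"
  by (auto simp: A_RCOSETS_def')

lemma coset_self: "x \<in> carrier A ==> x \<in> N +>\<^bsub>A\<^esub> x"
  by (rule S.a_rcos_self)

lemma mem_coset: assumes "x \<in> carrier A" shows "y \<in> N +>\<^bsub>A\<^esub> x \<longleftrightarrow> (\<exists>n\<in>N. y = n \<oplus>\<^bsub>A\<^esub> x)"
  by (auto simp: a_r_coset_def')

text \<open>\<open>quot_module\<close> scales a coset by a union over all its elements; since
  scaling preserves N, the members of this union are one and the same coset.\<close>

lemma coset_smult:
  assumes x: "x \<in> carrier A" shows "r \<odot>\<^bsub>quot_module A N\<^esub> (N +>\<^bsub>A\<^esub> x) = N +>\<^bsub>A\<^esub> (r \<odot>\<^bsub>A\<^esub> x)"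
proof -
  have *: "N +>\<^bsub>A\<^esub> (r \<odot>\<^bsub>A\<^esub> y) = N +>\<^bsub>A\<^esub> (r \<odot>\<^bsub>A\<^esub> x)" if y: "y \<in> N +>\<^bsub>A\<^esub> x" for y
  proof -
    obtain n where n: "n \<in> N" "y = n \<oplus>\<^bsub>A\<^esub> x" using y unfolding mem_coset[OF x] by (elim bexE) (rule that)
    have nc: "n \<in> carrier A" using n sub by (auto simp: submod_def)
    have "r \<odot>\<^bsub>A\<^esub> y = r \<odot>\<^bsub>A\<^esub> n \<oplus>\<^bsub>A\<^esub> r \<odot>\<^bsub>A\<^esub> x" using n nc x by (simp add: A.smult_r_distr)
    moreover have "r \<odot>\<^bsub>A\<^esub> n \<in> N" using n sub by (auto simp: submod_def)
    ultimately have "r \<odot>\<^bsub>A\<^esub> y \<in> N +>\<^bsub>A\<^esub> (r \<odot>\<^bsub>A\<^esub> x)" using mem_coset[of "r \<odot>\<^bsub>A\<^esub> x"] x by auto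
    then show ?thesis using S.a_repr_independence'[of "r \<odot>\<^bsub>A\<^esub> y" "r \<odot>\<^bsub>A\<^esub> x"] x by simp
  qed
  have "x \<in> N +>\<^bsub>A\<^esub> x" using x by (rule coset_self)
  then have "(\<Union>y\<in>N +>\<^bsub>A\<^esub> x. N +>\<^bsub>A\<^esub> (r \<odot>\<^bsub>A\<^esub> y)) = N +>\<^bsub>A\<^esub> (r \<odot>\<^bsub>A\<^esub> x)" 
  proof (intro equalityI UN_least)
    show "N +>\<^bsub>A\<^esub> (r \<odot>\<^bsub>A\<^esub> x) \<subseteq> (\<Union>y\<in>N +>\<^bsub>A\<^esub> x. N +>\<^bsub>A\<^esub> (r \<odot>\<^bsub>A\<^esub> y))"
      by (rule UN_upper) fact
  qed (rule equalityD1, rule *)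
  then show ?thesis by (simp add: quot_module_def)
qed

lemma coset_add:
  "x \<in> carrier A ==> y \<in> carrier A ==> (N +>\<^bsub>A\<^esub> x) <+>\<^bsub>A\<^esub> (N +>\<^bsub>A\<^esub> y) = N +>\<^bsub>A\<^esub> (x \<oplus>\<^bsub>A\<^esub> y)"
  by (rule S.a_rcos_sum)

lemma coset_eq_zero: assumes "x \<in> carrier A" shows "N +>\<^bsub>A\<^esub> x = N \<longleftrightarrow> x \<in> N"
  using S.a_rcos_const[of x] coset_self[OF assms] by auto

lemma module_quot: "Module.module real_ring (quot_module A N)"
proof (rule moduleI)
  show "abelian_group (quot_module A N)"
  proof (rule abelian_groupI)
    fix C assume "C \<in> carrier (quot_module A N)"
    then obtain x where x: "x \<in> carrier A" "C = N +>\<^bsub>A\<^esub> x" by (auto simp: coset_carrier)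
    have "N +>\<^bsub>A\<^esub> \<zero>\<^bsub>A\<^esub> = N" using coset_eq_zero sub by (auto simp: submod_def)
    then show "\<exists>y\<in>carrier (quot_module A N). y \<oplus>\<^bsub>quot_module A N\<^esub> C = \<zero>\<^bsub>quot_module A N\<^esub>"
      using x by (intro bexI[of _ "N +>\<^bsub>A\<^esub> (\<ominus>\<^bsub>A\<^esub> x)"]) (auto simp: coset_carrier coset_add A.M.l_neg)
    show "\<zero>\<^bsub>quot_module A N\<^esub> \<oplus>\<^bsub>quot_module A N\<^esub> C = C"
      using x coset_add[of "\<zero>\<^bsub>A\<^esub>" x] \<open>N +>\<^bsub>A\<^esub> \<zero>\<^bsub>A\<^esub> = N\<close> by auto
  next
    have "N +>\<^bsub>A\<^esub> \<zero>\<^bsub>A\<^esub> = N" using coset_eq_zero sub by (auto simp: submod_def)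
    then show "\<zero>\<^bsub>quot_module A N\<^esub> \<in> carrier (quot_module A N)"
      using A.M.zero_closed by (fastforce simp: coset_carrier)
  qed (auto simp: coset_carrier coset_add A.M.a_assoc A.M.a_comm A.M.a_lcomm)
  show "cring real_ring" by (rule cring_real_ring)
qed (auto simp: coset_carrier coset_smult coset_add A.smult_l_distr[simplified] A.smult_r_distr
    A.smult_assoc1[simplified] A.smult_one[simplified])

lemma proj_hom: "(\<lambda>x. N +>\<^bsub>A\<^esub> x) \<in> module_homs A (quot_module A N)"
  by (auto simp: module_homs_def coset_carrier coset_add coset_smult)

lemma induced_hom:
  assumes \<phi>: "\<phi> \<in> module_homs A B" and F: "\<And>a. a \<in> carrier A ==> F (N +>\<^bsub>A\<^esub> a) = \<phi> a"
  shows "F \<in> module_homs (quot_module A N) B"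
  using \<phi> by (auto simp: module_homs_def coset_carrier coset_add coset_smult F Pi_iff)

end

section \<open>Maps out of quotients and short exact sequences\<close>

lemma module_homs_zero:
  assumes "Module.module real_ring A" "Module.module real_ring B" "f \<in> module_homs A B"
  shows "f \<zero>\<^bsub>A\<^esub> = \<zero>\<^bsub>B\<^esub>"
proof -
  interpret A: Module.module real_ring A by (rule assms(1))
  interpret B: Module.module real_ring B by (rule assms(2))
  have "f \<zero>\<^bsub>A\<^esub> = f (0 \<odot>\<^bsub>A\<^esub> \<zero>\<^bsub>A\<^esub>)"
    using A.smult_l_null[OF A.M.zero_closed] by simp
  also have "\<dots> = 0 \<odot>\<^bsub>B\<^esub> f \<zero>\<^bsub>A\<^esub>" by (rule module_homsD(3)[OF assms(3) A.M.zero_closed])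
  also have "\<dots> = \<zero>\<^bsub>B\<^esub>"
    using B.smult_l_null[OF module_homsD(1)[OF assms(3) A.M.zero_closed]] by simp
  finally show ?thesis .
qed

lemma module_homs_comp:
  "f \<in> module_homs A B ==> g \<in> module_homs B C ==> (\<lambda>x. g (f x)) \<in> module_homs A C"
  by (auto simp: module_homs_def Pi_def)

lemma submod_kernel:
  assumes "Module.module real_ring A" "Module.module real_ring B" "f \<in> module_homs A B"
  shows "submod A (a_kernel A B f)"
proof -
  interpret A: Module.module real_ring A by (rule assms(1))
  interpret B: Module.module real_ring B by (rule assms(2))
  show ?thesis using module_homs_zero[OF assms]
    by (simp add: submod_def a_kernel_conv module_homsD[OF assms(3)])
qed

text \<open>The left term is the quotient by the kernel of \<open>\<phi>\<close>, so injectivity is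
  the first isomorphism theorem. The map \<open>F\<close> enters only through its values on cosets,
  which is all that the union encoding of the arrows provides directly; exactness is then tested on
  representatives.\<close>

lemma short_exact_quotI:
  assumes A: "Module.module real_ring A" and N: "submod A N"
    and B: "Module.module real_ring B" and C: "Module.module real_ring C"
    and \<phi>: "\<phi> \<in> module_homs A B" and F: "\<And>a. a \<in> carrier A ==> F (N +>\<^bsub>A\<^esub> a) = \<phi> a"
    and ker: "\<And>a. a \<in> carrier A ==> \<phi> a = \<zero>\<^bsub>B\<^esub> ==> a \<in> N"
    and g: "g \<in> module_homs B C" and surj: "carrier C \<subseteq> g ` carrier B"
    and ex: "\<And>b. b \<in> carrier B ==> g b = \<zero>\<^bsub>C\<^esub> \<longleftrightarrow> b \<in> \<phi> ` carrier A"
  shows "short_exact (quot_module A N) B C F g"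
  unfolding short_exact_def
proof (intro conjI)
  interpret A: Module.module real_ring A by (rule A)
  interpret B: Module.module real_ring B by (rule B)
  note q = coset_carrier[OF A N]
  show "Module.module real_ring (quot_module A N)" by (rule module_quot[OF A N])
  show "F \<in> module_homs (quot_module A N) B" by (rule induced_hom[OF A N \<phi> F])
  have \<phi>c: "\<phi> a \<in> carrier B" if "a \<in> carrier A" for a using module_homsD(1)[OF \<phi> that] .
  show "F ` carrier (quot_module A N) = a_kernel B C g"
  proof -
    have "carrier (quot_module A N) = (\<lambda>a. N +>\<^bsub>A\<^esub> a) ` carrier A"
      unfolding quot_simps(1)[OF A N] by (rule Set.set_eqI) (simp only: q image_iff Bex_def conj_commute)
    then have "F ` carrier (quot_module A N) = F ` (\<lambda>a. N +>\<^bsub>A\<^esub> a) ` carrier A"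
      by (rule arg_cong)
    also have "\<dots> = \<phi> ` carrier A" using F by (auto simp: image_image)
    also have "\<dots> = a_kernel B C g" unfolding a_kernel_conv using ex \<phi>c by blast
    finally show ?thesis .
  qed
  show "inj_on F (carrier (quot_module A N))"
  proof (rule inj_onI)
    fix x y assume "x \<in> carrier (quot_module A N)" "y \<in> carrier (quot_module A N)" and e: "F x = F y"
    then obtain a b where ab: "a \<in> carrier A" "b \<in> carrier A" "x = N +>\<^bsub>A\<^esub> a" "y = N +>\<^bsub>A\<^esub> b"
      unfolding quot_simps[OF A N] q by blast
    have e': "\<phi> a = \<phi> b" using e ab F by auto
    have "\<phi> ((-1) \<odot>\<^bsub>A\<^esub> b) = (-1) \<odot>\<^bsub>B\<^esub> \<phi> b" "\<phi> (a \<oplus>\<^bsub>A\<^esub> (-1) \<odot>\<^bsub>A\<^esub> b) = \<phi> a \<oplus>\<^bsub>B\<^esub> \<phi> ((-1) \<odot>\<^bsub>A\<^esub> b)"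
      using module_homsD[OF \<phi>] ab by simp_all
    moreover have m: "(-1) \<odot>\<^bsub>A\<^esub> b = \<ominus>\<^bsub>A\<^esub> b"
      using A.smult_l_minus[of 1 b] ab A.smult_one[of b] by simp
    moreover have "(-1) \<odot>\<^bsub>B\<^esub> \<phi> b = \<ominus>\<^bsub>B\<^esub> \<phi> b"
      using B.smult_l_minus[of 1 "\<phi> b"] \<phi>c[of b] ab B.smult_one[of "\<phi> b"] by simp
    ultimately have "\<phi> (a \<oplus>\<^bsub>A\<^esub> \<ominus>\<^bsub>A\<^esub> b) = \<zero>\<^bsub>B\<^esub>" using e' \<phi>c ab by (simp add: B.M.r_neg)
    then have n: "a \<oplus>\<^bsub>A\<^esub> \<ominus>\<^bsub>A\<^esub> b \<in> N" using ker ab by simp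
    have "a = (a \<oplus>\<^bsub>A\<^esub> \<ominus>\<^bsub>A\<^esub> b) \<oplus>\<^bsub>A\<^esub> b" using ab by (simp add: A.M.a_assoc A.M.l_neg)
    then have "a \<in> N +>\<^bsub>A\<^esub> b" using n mem_coset[OF A N, of b a] ab by blast
    then show "x = y" using ab abelian_subgroup.a_repr_independence'[OF submod_subgroup[OF A N], of a b] by simp
  qed
  show "g ` carrier B = carrier C" using surj module_homsD(1)[OF g] by blast
qed (use B C g in auto)

text \<open>A union of cosets whose representatives differ by elements of N collapses to a single
  coset.\<close>

lemma union_coset_vspace:
  assumes "subspace N" "x \<in> X" "\<And>y. y \<in> X ==> f y - f x \<in> N"
  shows "(\<Union>y\<in>X. N +>\<^bsub>vspace U\<^esub> f y) = N +>\<^bsub>vspace U\<^esub> f x"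
  using assms coset_vspace_eq[OF assms(1) assms(3), where U=U] by blast

text \<open>Evaluates the union encoding of a map out of a quotient at a coset. Additivity is asked
  on \<open>U\<close> only, since \<open>symbol\<close> is known to be additive only on derivative
  endomorphisms.\<close>

lemma union_coset_induced:
  assumes U: "subspace U" and N: "subspace N" "N \<subseteq> U" and L: "subspace L" and x: "x \<in> U"
    and f: "\<And>x y. x \<in> U ==> y \<in> U ==> f (x + y) = f x + f y" "\<And>n. n \<in> N ==> f n \<in> L"
  shows "(\<Union>y\<in>N +>\<^bsub>vspace U\<^esub> x. L +>\<^bsub>vspace V\<^esub> f y) = L +>\<^bsub>vspace V\<^esub> f x"
proof (rule union_coset_vspace[OF L])
  show "x \<in> N +>\<^bsub>vspace U\<^esub> x" unfolding coset_vspace using N(1) by (intro image_eqI[of _ _ 0]) (auto simp: subspace_0)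
  fix y assume "y \<in> N +>\<^bsub>vspace U\<^esub> x"
  then obtain n where "n \<in> N" "y = n + x" by (auto simp: coset_vspace)
  then show "f y - f x \<in> L" using f N x by auto
qed

lemma linear_vspace_hom:
  assumes "\<And>x. x \<in> U ==> f x \<in> V" "\<And>x y. x \<in> U ==> y \<in> U ==> f (x + y) = f x + f y"
    "\<And>c x. x \<in> U ==> f (c *\<^sub>R x) = c *\<^sub>R f x"
  shows "f \<in> module_homs (vspace U) (vspace V)"
  using assms by (auto simp: module_homs_def)

section \<open>Smooth functions on subsets of Euclidean spaces\<close>

lemma frechet_derivativeD:
  "f differentiable (at x) ==> (f has_derivative frechet_derivative f (at x)) (at x)"
  by (simp add: frechet_derivative_works)

text \<open>\<open>frechet_derivative\<close> is a choice among all derivatives, and functions that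
  agree near x have the same derivatives there; so the choices agree even where there is no
  derivative.\<close>

lemma frechet_derivative_cong_open:
  assumes "open W" "x \<in> W" "\<And>y. y \<in> W ==> f y = g y"
  shows "frechet_derivative f (at x) = frechet_derivative g (at x)"
proof -
  have "(f has_derivative d) (at x) \<longleftrightarrow> (g has_derivative d) (at x)" for d
    using has_derivative_transform_within_open[OF _ assms(1,2), of f d UNIV g]
      has_derivative_transform_within_open[OF _ assms(1,2), of g d UNIV f] assms(3) by auto
  then show ?thesis by (simp add: frechet_derivative_def)
qed

lemma ck_on_cong_imp:
  assumes "open W" "\<And>x. x \<in> W ==> f x = g x" "ck_on k W f" shows "ck_on k W g"
  using assms(2,3)
proof (induction k arbitrary: f g)
  case 0
  then show ?case using continuous_on_cong[of W W f g] by auto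
next
  case (Suc k)
  show ?case unfolding ck_on.simps
  proof (intro conjI ballI allI)
    fix x assume x: "x \<in> W"
    then have "(f has_derivative frechet_derivative f (at x)) (at x)"
      using Suc.prems by (auto intro: frechet_derivativeD)
    then show "g differentiable at x"
      using has_derivative_transform_within_open[OF _ assms(1) x, of f _ UNIV g] Suc.prems
      by (auto simp: differentiable_def)
  next
    fix v
    show "ck_on k W (\<lambda>x. frechet_derivative g (at x) v)"
      by (rule Suc.IH[of "\<lambda>x. frechet_derivative f (at x) v"])
        (use Suc.prems frechet_derivative_cong_open[OF assms(1), of _ f g] in auto)
  qed
qed

text \<open>Lets an explicit derivative replace the choice operator
  \<open>frechet_derivative\<close>; the closure properties below all go through it.\<close>

lemma ck_on_SucI:
  assumes "open W" "\<And>x. x \<in> W ==> (f has_derivative f' x) (at x)" "\<And>v. ck_on k W (\<lambda>x. f' x v)"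
  shows "ck_on (Suc k) W f"
  unfolding ck_on.simps
proof (intro conjI ballI allI)
  fix v
  have *: "frechet_derivative f (at x) = f' x" if "x \<in> W" for x
    using frechet_derivative_at[OF assms(2)[OF that]] by simp
  show "ck_on k W (\<lambda>x. frechet_derivative f (at x) v)"
    by (rule ck_on_cong_imp[OF assms(1) _ assms(3)[of v]]) (simp add: *)
qed (use assms(2) in \<open>auto simp: differentiable_def\<close>)

lemma ck_on_subset: "ck_on k W f ==> V \<subseteq> W ==> ck_on k V f"
  by (induction k arbitrary: f) (auto intro: continuous_on_subset)

lemma ck_on_SucD: "ck_on (Suc k) W f ==> ck_on k W f"
proof (induction k arbitrary: f)
  case 0
  then show ?case
    by (auto intro!: continuous_at_imp_continuous_on differentiable_imp_continuous_within)
next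
  case (Suc k)
  then show ?case unfolding ck_on.simps(2)[of "Suc k"] by (auto simp del: ck_on.simps simp: ck_on.simps(2)[of k])
qed

lemma ck_on_const: "open W ==> ck_on k W (\<lambda>x. c)"
  by (induction k arbitrary: c) (auto intro!: continuous_on_const)

lemma ck_on_bounded_linear:
  assumes "open W" "bounded_linear f" shows "ck_on k W f"
proof (cases k)
  case 0
  then show ?thesis using assms(2) by (simp add: linear_continuous_on)
next
  case (Suc j)
  have "ck_on (Suc j) W f"
    by (rule ck_on_SucI[OF assms(1) bounded_linear_imp_has_derivative[OF assms(2)] ck_on_const[OF assms(1)]])
  then show ?thesis using Suc by simp
qed

lemma ck_on_linear_comp:
  assumes "open W" "bounded_linear h" "ck_on k W f" shows "ck_on k W (\<lambda>x. h (f x))"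
  using assms(3)
proof (induction k arbitrary: f)
  case 0
  then show ?case using assms(2) by (simp add: bounded_linear.continuous_on)
next
  case (Suc k)
  show ?case
    by (rule ck_on_SucI[OF assms(1), of _ "\<lambda>x v. h (frechet_derivative f (at x) v)"])
      (use Suc assms(2) in \<open>auto intro!: bounded_linear.has_derivative[OF assms(2)] frechet_derivativeD\<close>)
qed

lemma ck_on_add:
  assumes "open W" "ck_on k W f" "ck_on k W g" shows "ck_on k W (\<lambda>x. f x + g x)"
  using assms(2,3)
proof (induction k arbitrary: f g)
  case (Suc k)
  show ?case
    by (rule ck_on_SucI[OF assms(1), of _ "\<lambda>x v. frechet_derivative f (at x) v + frechet_derivative g (at x) v"])
      (use Suc in \<open>auto intro!: has_derivative_add frechet_derivativeD\<close>)
qed (auto intro: continuous_on_add)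

lemma ck_on_sum:
  assumes "open W" "\<And>i. i \<in> I ==> ck_on k W (f i)" shows "ck_on k W (\<lambda>x. \<Sum>i\<in>I. f i x)"
  using assms(2) by (induction I rule: infinite_finite_induct) (auto intro: ck_on_const ck_on_add assms(1))

lemma ck_on_bilinear:
  assumes "open W" "bounded_bilinear bp" "ck_on k W f" "ck_on k W g"
  shows "ck_on k W (\<lambda>x. bp (f x) (g x))"
  using assms(3,4)
proof (induction k arbitrary: f g)
  case 0
  then show ?case by (auto intro: bounded_bilinear.continuous_on[OF assms(2)])
next
  case (Suc k)
  show ?case
  proof (rule ck_on_SucI[OF assms(1), of _ "\<lambda>x v. bp (f x) (frechet_derivative g (at x) v)
      + bp (frechet_derivative f (at x) v) (g x)"])
    fix x assume "x \<in> W"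
    then show "((\<lambda>x. bp (f x) (g x)) has_derivative (\<lambda>v. bp (f x) (frechet_derivative g (at x) v)
        + bp (frechet_derivative f (at x) v) (g x))) (at x)"
      using Suc.prems by (auto intro!: bounded_bilinear.FDERIV[OF assms(2)] frechet_derivativeD)
  next
    fix v show "ck_on k W (\<lambda>x. bp (f x) (frechet_derivative g (at x) v)
        + bp (frechet_derivative f (at x) v) (g x))"
      using Suc.prems ck_on_SucD[OF Suc.prems(1)] ck_on_SucD[OF Suc.prems(2)]
      by (intro ck_on_add Suc.IH assms(1)) auto
  qed
qed

lemma ck_on_comp:
  fixes f :: "'e::euclidean_space \<Rightarrow> 'f::euclidean_space" and g :: "'f \<Rightarrow> 'g::real_normed_vector"
  assumes "open W" "f ` W \<subseteq> V" "ck_on k W f" "ck_on k V g"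
  shows "ck_on k W (\<lambda>x. g (f x))"
  using assms(3,4)
proof (induction k arbitrary: g)
  case 0
  then show ?case using assms(2) by (auto intro: continuous_on_compose2)
next
  case (Suc k)
  have fW: "f x \<in> V" if "x \<in> W" for x using assms(2) that by auto
  have D: "((\<lambda>x. g (f x)) has_derivative (\<lambda>v. frechet_derivative g (at (f x)) (frechet_derivative f (at x) v))) (at x)"
    if "x \<in> W" for x
    using Suc.prems fW[OF that] that
    by (intro has_derivative_compose[of f _ _ _ g]) (auto intro!: frechet_derivativeD)
  \<comment> \<open>In the chain rule the point and the direction both vary with x. Expanding the
    direction in \<open>Basis\<close> leaves only derivatives of g in fixed directions, to which the
    induction hypothesis applies.\<close>
  have eq: "(\<Sum>b\<in>Basis. (frechet_derivative f (at x) v \<bullet> b) *\<^sub>R frechet_derivative g (at (f x)) b)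
      = frechet_derivative g (at (f x)) (frechet_derivative f (at x) v)" if "x \<in> W" for x v
  proof -
    have "linear (frechet_derivative g (at (f x)))"
      using Suc.prems(2) fW[OF that] by (auto intro: linear_frechet_derivative)
    then show ?thesis
      by (subst (3) euclidean_representation[symmetric]) (simp add: linear_sum linear_scale)
  qed
  show ?case
  proof (rule ck_on_SucI[OF assms(1) D])
    fix v
    have f: "ck_on k W f" by (rule ck_on_SucD[OF Suc.prems(1)])
    show "ck_on k W (\<lambda>x. frechet_derivative g (at (f x)) (frechet_derivative f (at x) v))"
    proof (rule ck_on_cong_imp[OF assms(1) eq])
      show "ck_on k W (\<lambda>x. \<Sum>b\<in>Basis. (frechet_derivative f (at x) v \<bullet> b) *\<^sub>R frechet_derivative g (at (f x)) b)"
        using Suc.prems f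
        by (intro ck_on_sum ck_on_bilinear[OF _ bounded_bilinear_scaleR] assms(1) Suc.IH
            ck_on_linear_comp[OF _ bounded_linear_inner_left]) auto
    qed
  qed
qed

definition cinf_on :: "'e::euclidean_space set \<Rightarrow> ('e \<Rightarrow> 'f::real_normed_vector) \<Rightarrow> bool"
  where "cinf_on W f \<longleftrightarrow> (\<forall>k. ck_on k W f)"

lemma cinf_on_imp_differentiable: "cinf_on W f ==> x \<in> W ==> f differentiable (at x)"
  unfolding cinf_on_def using ck_on.simps(2) by blast

lemma cinf_on_imp_continuous_on: "cinf_on W f ==> continuous_on W f"
  unfolding cinf_on_def using ck_on.simps(1) by blast

lemma cinf_on_derivative: "cinf_on W f ==> cinf_on W (\<lambda>x. frechet_derivative f (at x) v)"
  unfolding cinf_on_def using ck_on.simps(2) by blast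

lemma cinf_on_subset: "cinf_on W f ==> V \<subseteq> W ==> cinf_on V f"
  using ck_on_subset unfolding cinf_on_def by blast

lemma cinf_on_const: "open W ==> cinf_on W (\<lambda>x. c)"
  by (simp add: cinf_on_def ck_on_const)

lemma cinf_on_linear: "open W ==> bounded_linear f ==> cinf_on W f"
  by (simp add: cinf_on_def ck_on_bounded_linear)

lemma cinf_on_bilinear:
  "open W ==> bounded_bilinear bp ==> cinf_on W f ==> cinf_on W g ==> cinf_on W (\<lambda>x. bp (f x) (g x))"
  by (simp add: cinf_on_def ck_on_bilinear)

lemma cinf_on_add: "open W ==> cinf_on W f ==> cinf_on W g ==> cinf_on W (\<lambda>x. f x + g x)"
  by (simp add: cinf_on_def ck_on_add)

lemma cinf_on_diff:
  assumes "open W" "cinf_on W f" "cinf_on W g" shows "cinf_on W (\<lambda>x. f x - g x)"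
  using cinf_on_add[OF assms(1,2), of "\<lambda>x. - g x"] assms
  by (simp add: cinf_on_def ck_on_linear_comp[OF _ bounded_linear_minus[OF bounded_linear_ident]])

lemma cinf_on_mult:
  fixes f g :: "'e::euclidean_space \<Rightarrow> real"
  shows "open W ==> cinf_on W f ==> cinf_on W g ==> cinf_on W (\<lambda>x. f x * g x)"
  by (rule cinf_on_bilinear[OF _ bounded_bilinear_mult])

lemma cinf_on_comp:
  fixes f :: "'e::euclidean_space \<Rightarrow> 'f::euclidean_space"
  shows "open W ==> f ` W \<subseteq> V ==> cinf_on W f ==> cinf_on V g ==> cinf_on W (\<lambda>x. g (f x))"
  by (simp add: cinf_on_def ck_on_comp)

text \<open>The derivative is a polynomial in \<open>inverse x\<close>, so the induction stays
  inside the algebra generated by \<open>inverse\<close>.\<close>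

lemma cinf_on_inverse: "cinf_on (- {0::real}) inverse"
  unfolding cinf_on_def
proof
  fix k show "ck_on k (- {0::real}) inverse"
  proof (induction k)
    case 0
    show ?case by (auto intro!: continuous_intros)
  next
    case (Suc k)
    show ?case
    proof (rule ck_on_SucI[of _ _ "\<lambda>x v. - (inverse x * v * inverse x)"])
      fix v :: real
      have "ck_on k (- {0::real}) (\<lambda>x. (- v) * (inverse x * inverse x))"
        by (intro ck_on_bilinear[OF _ bounded_bilinear_mult] Suc.IH ck_on_const) auto
      then show "ck_on k (- {0::real}) (\<lambda>x. - (inverse x * v * inverse x))"
        by (simp add: mult_ac)
    qed (auto intro!: derivative_eq_intros)
  qed
qed

lemma cinf_on_divide:
  fixes f g :: "'e::euclidean_space \<Rightarrow> real"
  assumes "open W" "cinf_on W f" "cinf_on W g" "\<And>x. x \<in> W ==> g x \<noteq> 0"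
  shows "cinf_on W (\<lambda>x. f x / g x)"
  unfolding divide_inverse
  by (intro cinf_on_mult assms cinf_on_comp[OF _ _ _ cinf_on_inverse]) (use assms in auto)

section \<open>Flat functions, smooth steps and bumps\<close>

definition flat :: "real poly \<Rightarrow> real \<Rightarrow> real"
  where "flat p t = (if t > 0 then poly p (inverse t) * exp (- inverse t) else 0)"

lemma poly_exp_tendsto_0: "((\<lambda>x. poly p x * exp (- x)) \<longlongrightarrow> 0) (at_top::real filter)"
proof -
  have "((\<lambda>x. \<Sum>i\<le>degree p. coeff p i * (x ^ i / exp x)) \<longlongrightarrow> (\<Sum>i\<le>degree p. coeff p i * 0)) (at_top::real filter)"
    by (intro tendsto_sum tendsto_mult tendsto_const tendsto_power_div_exp_0)
  then show ?thesis
    by (simp add: poly_altdef exp_minus divide_inverse sum_distrib_left mult_ac)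
qed

text \<open>With s = 1/t one has ds/dt = -s^2, so p(s) exp(-s) has derivative s^2 (p(s) - p'(s))
  exp(-s): the family \<open>flat\<close> is closed under differentiation, which turns smoothness
  into an induction over all p at once.\<close>

lemma flat_has_derivative: "(flat p has_real_derivative flat ([:0,0,1:] * (p - pderiv p)) t) (at t)"
proof -
  consider "t > 0" | "t < 0" | "t = 0" by linarith
  then show ?thesis
  proof cases
    case 1
    have "((\<lambda>t. poly p (inverse t) * exp (- inverse t)) has_real_derivative flat ([:0,0,1:] * (p - pderiv p)) t) (at t)"
      using 1 unfolding flat_def
      by (auto intro!: derivative_eq_intros poly_DERIV simp: algebra_simps power2_eq_square)
    then show ?thesis
      by (rule has_field_derivative_transform_within_open[of _ _ _ "{0<..}"]) (use 1 in \<open>auto simp: flat_def\<close>)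
  next
    case 2
    have "((\<lambda>t. 0) has_real_derivative flat ([:0,0,1:] * (p - pderiv p)) t) (at t)"
      using 2 by (simp add: flat_def)
    then show ?thesis
      by (rule has_field_derivative_transform_within_open[of _ _ _ "{..<0}"]) (use 2 in \<open>auto simp: flat_def\<close>)
  next
    case 3
    \<comment> \<open>Dividing by y multiplies by s = 1/y, so the difference quotient at 0 is again
      of the form polynomial times exponential, with p shifted by one degree.\<close>
    have "((\<lambda>y. poly (pCons 0 p) (inverse y) * exp (- inverse y)) \<longlongrightarrow> 0) (at_right 0)"
      by (rule filterlim_compose[OF poly_exp_tendsto_0 filterlim_inverse_at_top_right])
    then have "((\<lambda>y. flat p y / y) \<longlongrightarrow> 0) (at_right 0)"
      by (rule Lim_transform_eventually)
        (auto simp: flat_def eventually_at_right_field divide_inverse mult_ac intro!: exI[of _ 1])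
    moreover have "((\<lambda>y. flat p y / y) \<longlongrightarrow> 0) (at_left 0)"
      by (rule Lim_transform_eventually[OF tendsto_const])
        (auto simp: flat_def eventually_at_left_field intro!: exI[of _ "-1"])
    ultimately have "((\<lambda>y. flat p y / y) \<longlongrightarrow> 0) (at 0)"
      by (simp add: filterlim_at_split)
    then show ?thesis using 3 by (simp add: has_field_derivative_iff flat_def)
  qed
qed

lemma cinf_on_flat: "cinf_on UNIV (flat p)"
  unfolding cinf_on_def
proof
  fix k show "ck_on k UNIV (flat p)"
  proof (induction k arbitrary: p)
    case 0
    show ?case using flat_has_derivative by (auto intro!: continuous_at_imp_continuous_on DERIV_isCont)
  next
    case (Suc k)
    show ?case
    proof (rule ck_on_SucI[of _ _ "\<lambda>x v. flat ([:0,0,1:] * (p - pderiv p)) x * v"])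
      fix v :: real
      show "ck_on k UNIV (\<lambda>x. flat ([:0,0,1:] * (p - pderiv p)) x * v)"
        by (intro ck_on_bilinear[OF _ bounded_bilinear_mult] Suc.IH ck_on_const) auto
    qed (use flat_has_derivative[of p] in \<open>auto simp: has_field_derivative_def\<close>)
  qed
qed

text \<open>The denominator is positive because t and 1 - t are never both nonpositive.\<close>

lemma smooth_step: "\<exists>s::real \<Rightarrow> real. cinf_on UNIV s \<and> (\<forall>t\<le>0. s t = 0) \<and> (\<forall>t\<ge>1. s t = 1)"
proof (intro exI[of _ "\<lambda>t. flat 1 t / (flat 1 t + flat 1 (1 - t))"] conjI)
  have pos: "flat 1 t + flat 1 (1 - t) > 0" for t by (auto simp: flat_def add_pos_pos)
  show "cinf_on UNIV (\<lambda>t. flat 1 t / (flat 1 t + flat 1 (1 - t)))"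
    using pos by (intro cinf_on_divide cinf_on_add cinf_on_comp[OF _ _ _ cinf_on_flat] cinf_on_diff cinf_on_const
        cinf_on_linear[OF _ bounded_linear_ident] open_UNIV subset_UNIV) (metis less_irrefl)
qed (auto simp: flat_def)

lemma smooth_bump:
  fixes a :: "'e::euclidean_space"
  assumes r: "r > 0"
  obtains B :: "'e \<Rightarrow> real" where "cinf_on UNIV B" "\<And>y. dist y a \<le> r ==> B y = 1" "\<And>y. dist y a \<ge> 2 * r ==> B y = 0"
proof -
  obtain s :: "real \<Rightarrow> real" where s: "cinf_on UNIV s" "\<And>t. t \<le> 0 ==> s t = 0" "\<And>t. t \<ge> 1 ==> s t = 1"
    using smooth_step by blast
  \<comment> \<open>The squared norm keeps the argument smooth at a. The argument is at least 1
    within distance r and at most 0 once the squared distance reaches \<open>2 * r\<^sup>2\<close>,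
    in particular at distance 2r.\<close>
  show thesis
  proof (rule that[of "\<lambda>y. s (2 - ((y - a) \<bullet> (y - a)) * (1 / r\<^sup>2))"])
    show "cinf_on UNIV (\<lambda>y. s (2 - ((y - a) \<bullet> (y - a)) * (1 / r\<^sup>2)))"
      by (intro cinf_on_comp[OF _ _ _ s(1)] cinf_on_diff cinf_on_const cinf_on_mult
          cinf_on_bilinear[OF _ bounded_bilinear_inner]
          cinf_on_linear[OF _ bounded_linear_ident] open_UNIV subset_UNIV)
  next
    fix y assume "dist y a \<le> r"
    then have "(dist y a)\<^sup>2 \<le> r\<^sup>2" by (simp add: power_mono)
    then show "s (2 - ((y - a) \<bullet> (y - a)) * (1 / r\<^sup>2)) = 1"
      using r by (intro s(3)) (simp add: dist_norm power2_norm_eq_inner field_simps)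
  next
    fix y assume "dist y a \<ge> 2 * r"
    then have "(dist y a)\<^sup>2 \<ge> (2*r)\<^sup>2" using r by (intro power_mono) auto
    then have "(dist y a)\<^sup>2 \<ge> 2 * r\<^sup>2" by (simp add: power_mult_distrib) (smt (verit) zero_le_power2)
    then show "s (2 - ((y - a) \<bullet> (y - a)) * (1 / r\<^sup>2)) = 0"
      using r by (intro s(2)) (simp add: dist_norm power2_norm_eq_inner field_simps)
  qed
qed

section \<open>Hadamard's lemma\<close>

lemma ck_on_segment_integral:
  fixes G :: "'e::euclidean_space \<Rightarrow> real"
  assumes "cinf_on (ball a r) G"
  shows "ck_on k (ball a r) (\<lambda>y. integral {0..1} (\<lambda>t. t ^ j * G (a + t *\<^sub>R (y - a))))"
  using assms
proof (induction k arbitrary: j G)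
  have seg: "a + t *\<^sub>R (y - a) \<in> ball a r" if "y \<in> ball a r" "t \<in> {0..1}" for y t
  proof -
    have "norm (t *\<^sub>R (y - a)) \<le> norm (y - a)" using that by (simp add: mult_left_le_one_le)
    then show ?thesis using that by (simp add: dist_norm norm_minus_commute)
  qed
  have cont: "continuous_on (ball a r \<times> cbox 0 1) (\<lambda>(y, t). t ^ j * G (a + t *\<^sub>R (y - a)))"
    if "cinf_on (ball a r) G" for G :: "'e \<Rightarrow> real" and j
    unfolding split_beta
    using seg by (intro continuous_intros continuous_on_compose2[OF cinf_on_imp_continuous_on[OF that]]) auto
  {
    case 0
    then show ?case using integral_continuous_on_param[OF cont[OF 0]] by (simp add: box_real)
  next
    case (Suc k)
    \<comment> \<open>The weight \<open>t ^ j\<close> closes the induction: differentiation under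
      the integral sign raises j by one and replaces G by one of its directional derivatives.
      \<open>leibniz_rule\<close> expects the derivative as a bounded linear function, hence
      \<open>Blinfun\<close>.\<close>
    define fx where "fx y t = Blinfun (\<lambda>v. t ^ Suc j * frechet_derivative G (at (a + t *\<^sub>R (y - a))) v)" for y t
    have fx: "blinfun_apply (fx y t) = (\<lambda>v. t ^ Suc j * frechet_derivative G (at (a + t *\<^sub>R (y - a))) v)"
      if "y \<in> ball a r" "t \<in> {0..1}" for y t
      unfolding fx_def
      by (rule bounded_linear_Blinfun_apply)
        (intro bounded_linear_const_mult has_derivative_bounded_linear[OF frechet_derivativeD]
          cinf_on_imp_differentiable[OF Suc.prems] seg that)
    have cfx: "continuous_on (ball a r \<times> cbox 0 1) (\<lambda>(y, t). fx y t)"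
    proof (rule continuous_on_blinfun_componentwise)
      fix b :: 'e assume "b \<in> Basis"
      have "continuous_on (ball a r \<times> cbox 0 1) (\<lambda>(y, t). t ^ Suc j * frechet_derivative G (at (a + t *\<^sub>R (y - a))) b)"
        by (rule cont[OF cinf_on_derivative[OF Suc.prems]])
      then show "continuous_on (ball a r \<times> cbox 0 1) (\<lambda>x. blinfun_apply (case x of (y, t) \<Rightarrow> fx y t) b)"
        by (rule continuous_on_eq) (auto simp: fx)
    qed
    have int: "(\<lambda>t. t ^ j * G (a + t *\<^sub>R (y - a))) integrable_on cbox 0 1" if "y \<in> ball a r" for y
      unfolding box_real using seg[OF that]
      by (intro integrable_continuous_real continuous_intros
          continuous_on_compose2[OF cinf_on_imp_continuous_on[OF Suc.prems]]) auto
    show ?case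
    proof (rule ck_on_SucI)
      fix y assume y: "y \<in> ball a r"
      have "((\<lambda>y. integral (cbox 0 1) (\<lambda>t. t ^ j * G (a + t *\<^sub>R (y - a))))
          has_derivative blinfun_apply (integral (cbox 0 1) (fx y))) (at y within ball a r)"
      proof (rule leibniz_rule[OF _ int cfx y convex_ball])
        fix x t assume xt: "x \<in> ball a r" "t \<in> cbox (0::real) 1"
        have "((\<lambda>y. G (a + t *\<^sub>R (y - a))) has_derivative
          (\<lambda>v. frechet_derivative G (at (a + t *\<^sub>R (x - a))) (t *\<^sub>R v))) (at x)"
          by (rule has_derivative_compose[of "\<lambda>y. a + t *\<^sub>R (y - a)" "\<lambda>v. t *\<^sub>R v" x UNIV G,
                OF _ frechet_derivativeD[OF cinf_on_imp_differentiable[OF Suc.prems seg]]])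
            (use xt in \<open>auto intro!: derivative_eq_intros\<close>)
        moreover have "frechet_derivative G (at (a + t *\<^sub>R (x - a))) (t *\<^sub>R v) =
            t * frechet_derivative G (at (a + t *\<^sub>R (x - a))) v" for v
          using xt seg cinf_on_imp_differentiable[OF Suc.prems]
          by (simp add: linear_scale[OF linear_frechet_derivative])
        ultimately have "((\<lambda>y. t ^ j * G (a + t *\<^sub>R (y - a))) has_derivative blinfun_apply (fx x t)) (at x)"
          using xt by (auto simp: fx intro!: derivative_eq_intros)
        then show "((\<lambda>y. t ^ j * G (a + t *\<^sub>R (y - a))) has_derivative blinfun_apply (fx x t)) (at x within ball a r)"
          by (rule has_derivative_at_withinI)
      qed
      then have "((\<lambda>y. integral {0..1} (\<lambda>t. t ^ j * G (a + t *\<^sub>R (y - a))))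
          has_derivative blinfun_apply (integral (cbox 0 1) (fx y))) (at y)"
        using y by (simp add: at_within_open[OF _ open_ball] box_real)
      moreover have "blinfun_apply (integral (cbox 0 1) (fx y)) =
        (\<lambda>v. integral {0..1} (\<lambda>t. t ^ Suc j * frechet_derivative G (at (a + t *\<^sub>R (y - a))) v))"
      proof
        fix v
        have "fx y integrable_on cbox 0 1"
        proof -
          have c: "continuous_on (cbox 0 1) (\<lambda>t. (y, t))" by (intro continuous_intros)
          have "continuous_on (cbox 0 1) (\<lambda>t. case (y, t) of (y, t) \<Rightarrow> fx y t)"
            by (rule continuous_on_compose2[OF cfx c]) (use y in auto)
          then show ?thesis by (intro integrable_continuous) simp
        qed
        then have "blinfun_apply (integral (cbox 0 1) (fx y)) v = integral (cbox 0 1) (\<lambda>t. fx y t v)"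
          by (rule blinfun_apply_integral)
        also have "\<dots> = integral {0..1} (\<lambda>t. t ^ Suc j * frechet_derivative G (at (a + t *\<^sub>R (y - a))) v)"
          unfolding box_real by (rule integral_cong) (simp add: fx[OF y])
        finally show "blinfun_apply (integral (cbox 0 1) (fx y)) v = \<dots>" .
      qed
      ultimately show "((\<lambda>y. integral {0..1} (\<lambda>t. t ^ j * G (a + t *\<^sub>R (y - a))))
          has_derivative (\<lambda>v. integral {0..1} (\<lambda>t. t ^ Suc j * frechet_derivative G (at (a + t *\<^sub>R (y - a))) v))) (at y)"
        by simp
    next
      fix v show "ck_on k (ball a r) (\<lambda>y. integral {0..1} (\<lambda>t. t ^ Suc j * frechet_derivative G (at (a + t *\<^sub>R (y - a))) v))"
        by (rule Suc.IH[OF cinf_on_derivative[OF Suc.prems]])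
    qed simp
  }
qed

text \<open>Integrate the derivative of g along the segment from a to y. The expansion of y - a is
  left open because it is later taken in an orthonormal basis of the model space, which may be a
  proper subspace of the ambient Euclidean space.\<close>

lemma hadamard:
  fixes g :: "'e::euclidean_space \<Rightarrow> real"
  assumes g: "cinf_on (ball a r) g" and r: "r > 0"
  obtains H where "\<And>b. cinf_on (ball a r) (H b)" "\<And>b. H b a = frechet_derivative g (at a) b"
    "\<And>B c y. finite B ==> y \<in> ball a r ==> y - a = (\<Sum>b\<in>B. c b *\<^sub>R b) ==> g y = g a + (\<Sum>b\<in>B. c b * H b y)"
proof -
  define H where "H b y = integral {0..1} (\<lambda>t. frechet_derivative g (at (a + t *\<^sub>R (y - a))) b)" for b y
  show thesis
  proof (rule that[of H])
    fix b
    show "cinf_on (ball a r) (H b)"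
      unfolding cinf_on_def H_def[abs_def]
      using ck_on_segment_integral[OF cinf_on_derivative[OF g, of b], of _ 0] by simp
    show "H b a = frechet_derivative g (at a) b" by (simp add: H_def)
  next
    fix B c y assume B: "finite B" and y: "y \<in> ball a r" and ya: "y - a = (\<Sum>b\<in>B. c b *\<^sub>R b)"
    have seg: "a + t *\<^sub>R (y - a) \<in> ball a r" if "t \<in> {0..1}" for t
    proof -
      have "norm (t *\<^sub>R (y - a)) \<le> norm (y - a)" using that by (simp add: mult_left_le_one_le)
      then show ?thesis using y by (simp add: dist_norm norm_minus_commute)
    qed
    have lin: "frechet_derivative g (at (a + t *\<^sub>R (y - a))) (y - a) =
        (\<Sum>b\<in>B. c b * frechet_derivative g (at (a + t *\<^sub>R (y - a))) b)" if "t \<in> {0..1}" for t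
    proof -
      have "linear (frechet_derivative g (at (a + t *\<^sub>R (y - a))))"
        by (intro linear_frechet_derivative cinf_on_imp_differentiable[OF g] seg that)
      then show ?thesis unfolding ya by (simp add: linear_sum linear_scale)
    qed
    have int: "(\<lambda>t. frechet_derivative g (at (a + t *\<^sub>R (y - a))) b) integrable_on {0..1}" for b
      using seg
      by (intro integrable_continuous_real continuous_on_compose2[OF cinf_on_imp_continuous_on[OF cinf_on_derivative[OF g]]]
          continuous_intros) auto
    have "((\<lambda>t. frechet_derivative g (at (a + t *\<^sub>R (y - a))) (y - a)) has_integral
        g (a + 1 *\<^sub>R (y - a)) - g (a + 0 *\<^sub>R (y - a))) {0..1}"
    proof (rule fundamental_theorem_of_calculus)
      fix t :: real assume t: "t \<in> {0..1}"
      have "((\<lambda>t. g (a + t *\<^sub>R (y - a))) has_derivative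
          (\<lambda>s. frechet_derivative g (at (a + t *\<^sub>R (y - a))) (s *\<^sub>R (y - a)))) (at t within {0..1})"
        by (rule has_derivative_compose[of "\<lambda>t. a + t *\<^sub>R (y - a)" "\<lambda>s. s *\<^sub>R (y - a)" t "{0..1}" g,
                OF _ frechet_derivativeD[OF cinf_on_imp_differentiable[OF g seg[OF t]]]])
          (auto intro!: derivative_eq_intros)
      moreover have "frechet_derivative g (at (a + t *\<^sub>R (y - a))) (s *\<^sub>R (y - a)) =
          s *\<^sub>R frechet_derivative g (at (a + t *\<^sub>R (y - a))) (y - a)" for s
        by (intro linear_scale linear_frechet_derivative cinf_on_imp_differentiable[OF g] seg t)
      ultimately show "((\<lambda>t. g (a + t *\<^sub>R (y - a))) has_vector_derivative
          frechet_derivative g (at (a + t *\<^sub>R (y - a))) (y - a)) (at t within {0..1})"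
        by (simp add: has_vector_derivative_def)
    qed simp
    then have "g y - g a = integral {0..1} (\<lambda>t. frechet_derivative g (at (a + t *\<^sub>R (y - a))) (y - a))"
      by (simp add: integral_unique)
    also have "\<dots> = integral {0..1} (\<lambda>t. \<Sum>b\<in>B. c b * frechet_derivative g (at (a + t *\<^sub>R (y - a))) b)"
      by (rule integral_cong) (rule lin)
    also have "\<dots> = (\<Sum>b\<in>B. c b * H b y)"
      unfolding H_def using B int by (subst integral_sum) (auto intro: integrable_on_mult_right)
    finally show "g y = g a + (\<Sum>b\<in>B. c b * H b y)" by simp
  qed
qed

section \<open>Smooth functions on arbitrary subsets through local extensions\<close>

lemma smooth_onI_cinf: "open W ==> cinf_on W f ==> A \<subseteq> W ==> smooth_on A f"
  unfolding smooth_on_def cinf_on_def by blast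

lemma smooth_onE:
  assumes "smooth_on A f" "a \<in> A"
  obtains W g where "open W" "a \<in> W" "cinf_on W g" "\<And>x. x \<in> A ==> x \<in> W ==> g x = f x"
proof -
  have "\<exists>W g. open W \<and> a \<in> W \<and> (\<forall>k. ck_on k W g) \<and> (\<forall>x\<in>A \<inter> W. g x = f x)"
    using assms by (simp only: smooth_on_def)
  then obtain W g where "open W" "a \<in> W" "\<forall>k. ck_on k W g" "\<forall>x\<in>A \<inter> W. g x = f x" by (elim exE conjE)
  then show thesis by (intro that[of W g]) (simp_all add: cinf_on_def)
qed

lemma smooth_on_iff:
  "smooth_on A f \<longleftrightarrow> (\<forall>a\<in>A. \<exists>W g. open W \<and> a \<in> W \<and> cinf_on W g \<and> (\<forall>x\<in>A \<inter> W. g x = f x))"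
  by (simp add: smooth_on_def cinf_on_def)

lemma smooth_on_transfer:
  assumes "smooth_on A f" "B \<subseteq> A" "\<And>x. x \<in> B ==> f x = g x"
  shows "smooth_on B g"
  unfolding smooth_on_iff
proof
  fix b assume "b \<in> B"
  then have "b \<in> A" using assms(2) by blast
  obtain W h where W: "open W" "b \<in> W" "cinf_on W h" "\<And>x. x \<in> A ==> x \<in> W ==> h x = f x"
    by (rule smooth_onE[OF assms(1) \<open>b \<in> A\<close>]) (rule that)
  show "\<exists>W h. open W \<and> b \<in> W \<and> cinf_on W h \<and> (\<forall>x\<in>B \<inter> W. h x = g x)"
    using W assms(2,3) by (intro exI[of _ W] exI[of _ h]) auto
qed

lemma smooth_on_subset: "smooth_on A f ==> B \<subseteq> A ==> smooth_on B f"
  by (rule smooth_on_transfer) auto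

lemma smooth_on_cong: "smooth_on A f ==> (\<And>x. x \<in> A ==> f x = g x) ==> smooth_on A g"
  by (rule smooth_on_transfer[OF _ subset_refl])

lemma smooth_on_local:
  assumes "\<And>a. a \<in> A ==> \<exists>W. open W \<and> a \<in> W \<and> smooth_on (A \<inter> W) f"
  shows "smooth_on A f"
  unfolding smooth_on_iff
proof
  fix a assume a: "a \<in> A"
  then obtain W where W: "open W" "a \<in> W" "smooth_on (A \<inter> W) f" using assms by blast
  have aW: "a \<in> A \<inter> W" using a W by simp
  obtain V g where V: "open V" "a \<in> V" "cinf_on V g" "\<And>x. x \<in> A \<inter> W ==> x \<in> V ==> g x = f x"
    by (rule smooth_onE[OF W(3) aW]) (rule that)
  show "\<exists>W g. open W \<and> a \<in> W \<and> cinf_on W g \<and> (\<forall>x\<in>A \<inter> W. g x = f x)"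
    using W V cinf_on_subset[OF V(3), of "V \<inter> W"] by (intro exI[of _ "V \<inter> W"] exI[of _ g]) auto
qed

lemma smooth_on_bilinear:
  assumes "bounded_bilinear bp" "smooth_on A f" "smooth_on A g"
  shows "smooth_on A (\<lambda>x. bp (f x) (g x))"
  unfolding smooth_on_iff
proof
  fix a assume a: "a \<in> A"
  obtain V f' where V: "open V" "a \<in> V" "cinf_on V f'" "\<And>x. x \<in> A ==> x \<in> V ==> f' x = f x"
    by (rule smooth_onE[OF assms(2) a]) (rule that)
  obtain W g' where W: "open W" "a \<in> W" "cinf_on W g'" "\<And>x. x \<in> A ==> x \<in> W ==> g' x = g x"
    by (rule smooth_onE[OF assms(3) a]) (rule that)
  have "cinf_on (V \<inter> W) (\<lambda>x. bp (f' x) (g' x))"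
    by (intro cinf_on_bilinear[OF _ assms(1)] open_Int V W cinf_on_subset[OF V(3)] cinf_on_subset[OF W(3)]) auto
  then show "\<exists>W h. open W \<and> a \<in> W \<and> cinf_on W h \<and> (\<forall>x\<in>A \<inter> W. h x = bp (f x) (g x))"
    using V W by (intro exI[of _ "V \<inter> W"] exI[of _ "\<lambda>x. bp (f' x) (g' x)"]) auto
qed

lemma smooth_on_mult: "smooth_on A f ==> smooth_on A g ==> smooth_on A (\<lambda>x. f x * (g x::real))"
  by (rule smooth_on_bilinear[OF bounded_bilinear_mult])

lemma smooth_on_add:
  assumes "smooth_on A f" "smooth_on A g"
  shows "smooth_on A (\<lambda>x. f x + g x)"
  unfolding smooth_on_iff
proof
  fix a assume a: "a \<in> A"
  obtain V f' where V: "open V" "a \<in> V" "cinf_on V f'" "\<And>x. x \<in> A ==> x \<in> V ==> f' x = f x"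
    by (rule smooth_onE[OF assms(1) a]) (rule that)
  obtain W g' where W: "open W" "a \<in> W" "cinf_on W g'" "\<And>x. x \<in> A ==> x \<in> W ==> g' x = g x"
    by (rule smooth_onE[OF assms(2) a]) (rule that)
  have "cinf_on (V \<inter> W) (\<lambda>x. f' x + g' x)"
    by (intro cinf_on_add open_Int V W cinf_on_subset[OF V(3)] cinf_on_subset[OF W(3)]) auto
  then show "\<exists>W h. open W \<and> a \<in> W \<and> cinf_on W h \<and> (\<forall>x\<in>A \<inter> W. h x = f x + g x)"
    using V W by (intro exI[of _ "V \<inter> W"] exI[of _ "\<lambda>x. f' x + g' x"]) auto
qed

lemma smooth_on_const: "smooth_on A (\<lambda>x. c)"
  by (rule smooth_onI_cinf[OF open_UNIV cinf_on_const]) auto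

lemma smooth_on_linear: "bounded_linear f ==> smooth_on A f"
  by (rule smooth_onI_cinf[OF open_UNIV cinf_on_linear]) auto

lemma smooth_on_comp:
  fixes f :: "'e::euclidean_space \<Rightarrow> 'f::euclidean_space"
  assumes "smooth_on A f" "f ` A \<subseteq> B" "smooth_on B g"
  shows "smooth_on A (\<lambda>x. g (f x))"
  unfolding smooth_on_iff
proof
  fix a assume a: "a \<in> A"
  obtain V f' where V: "open V" "a \<in> V" "cinf_on V f'" "\<And>x. x \<in> A ==> x \<in> V ==> f' x = f x"
    by (rule smooth_onE[OF assms(1) a]) (rule that)
  obtain W g' where W: "open W" "f a \<in> W" "cinf_on W g'" "\<And>x. x \<in> B ==> x \<in> W ==> g' x = g x"
    using smooth_onE[OF assms(3), of "f a"] a assms(2) by blast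
  define U where "U = V \<inter> f' -` W"
  have U: "open U" unfolding U_def
    by (rule continuous_open_preimage[OF cinf_on_imp_continuous_on[OF V(3)] V(1) W(1)])
  have "cinf_on U (\<lambda>x. g' (f' x))"
    by (rule cinf_on_comp[OF U _ _ W(3)]) (auto simp: U_def intro: cinf_on_subset[OF V(3)])
  moreover have "g' (f' x) = g (f x)" if "x \<in> A \<inter> U" for x
    using that V(4)[of x] W(4)[of "f x"] assms(2) by (auto simp: U_def)
  ultimately show "\<exists>W h. open W \<and> a \<in> W \<and> cinf_on W h \<and> (\<forall>x\<in>A \<inter> W. h x = g (f x))"
    using U V a W(2) by (intro exI[of _ U] exI[of _ "\<lambda>x. g' (f' x)"]) (auto simp: U_def)
qed

lemma smooth_on_imp_continuous_on:
  assumes "smooth_on A f" shows "continuous_on A f"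
  unfolding continuous_on_eq_continuous_within
proof
  fix a assume a: "a \<in> A"
  obtain W g where W: "open W" "a \<in> W" "cinf_on W g" "\<And>y. y \<in> A ==> y \<in> W ==> g y = f y"
    by (rule smooth_onE[OF assms a]) (rule that)
  have "continuous (at a) g"
    using continuous_on_eq_continuous_at[OF W(1)] cinf_on_imp_continuous_on[OF W(3)] W(2) by blast
  then have "continuous (at a within A) g" by (rule continuous_at_imp_continuous_within)
  then have "(g \<longlongrightarrow> f a) (at a within A)" using W(4)[OF a W(2)] by (simp add: continuous_within)
  then show "continuous (at a within A) f"
    unfolding continuous_within
    by (rule Lim_transform_eventually) (use W in \<open>auto simp: eventually_at_topological intro!: exI[of _ W]\<close>)
qed

section \<open>Directional derivatives on relatively open subsets of a linear subspace\<close>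

definition dird :: "('e::euclidean_space \<Rightarrow> real) \<Rightarrow> 'e \<Rightarrow> 'e \<Rightarrow> real"
  where "dird f x v = deriv (\<lambda>t. f (x + t *\<^sub>R v)) 0"

lemma line_in_open_eventually:
  fixes x v :: "'e::euclidean_space"
  assumes "subspace V" "openin (top_of_set V) A" "x \<in> A" "v \<in> V" "open W" "x \<in> W"
  shows "\<forall>\<^sub>F t in nhds (0::real). x + t *\<^sub>R v \<in> A \<inter> W"
proof -
  obtain T where T: "open T" "A = V \<inter> T" using assms(2) by (auto simp: openin_open)
  have "open ((\<lambda>t. x + t *\<^sub>R v) -` (T \<inter> W))"
    by (rule open_vimage[OF open_Int[OF T(1) assms(5)]]) (intro continuous_intros)
  then have "\<forall>\<^sub>F t in nhds (0::real). x + t *\<^sub>R v \<in> T \<inter> W"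
    using T assms(3,6) by (auto simp: eventually_nhds intro!: exI[of _ "(\<lambda>t. x + t *\<^sub>R v) -` (T \<inter> W)"])
  then show ?thesis
    by (rule eventually_mono) (use assms T in \<open>auto simp: subspace_add subspace_scale\<close>)
qed

text \<open>A line in a direction of V stays inside the relatively open set A for small parameters,
  so every local extension g of f yields the same derivative. This makes \<open>dird\<close>
  meaningful although f is only given on A.\<close>

lemma has_dird:
  assumes V: "subspace V" "openin (top_of_set V) A" "x \<in> A" "v \<in> V"
    and W: "open W" "x \<in> W" "g differentiable (at x)" "\<And>y. y \<in> A ==> y \<in> W ==> g y = f y"
  shows "((\<lambda>t. f (x + t *\<^sub>R v)) has_real_derivative frechet_derivative g (at x) v) (at 0)"
    and "dird f x v = frechet_derivative g (at x) v"
proof -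
  have "((\<lambda>t. g (x + t *\<^sub>R v)) has_derivative (\<lambda>s. frechet_derivative g (at (x + 0 *\<^sub>R v)) (s *\<^sub>R v))) (at 0)"
    by (rule has_derivative_compose[of "\<lambda>t. x + t *\<^sub>R v" "\<lambda>s. s *\<^sub>R v" 0 UNIV g, OF _ frechet_derivativeD])
      (use W(3) in \<open>auto intro!: derivative_eq_intros\<close>)
  then have "((\<lambda>t. g (x + t *\<^sub>R v)) has_real_derivative frechet_derivative g (at x) v) (at 0)"
    using W(3) by (simp add: has_field_derivative_def linear_scale[OF linear_frechet_derivative] mult_commute_abs)
  moreover have "\<forall>\<^sub>F t in nhds 0. g (x + t *\<^sub>R v) = f (x + t *\<^sub>R v)"
    using line_in_open_eventually[OF V W(1,2)] by (rule eventually_mono) (use W(4) in auto)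
  ultimately show 1: "((\<lambda>t. f (x + t *\<^sub>R v)) has_real_derivative frechet_derivative g (at x) v) (at 0)"
    using DERIV_cong_ev[of 0 0 "\<lambda>t. g (x + t *\<^sub>R v)" "\<lambda>t. f (x + t *\<^sub>R v)"] by blast
  then show "dird f x v = frechet_derivative g (at x) v"
    unfolding dird_def by (rule DERIV_imp_deriv)
qed

lemma smooth_on_dird:
  assumes "subspace V" "openin (top_of_set V) A" "v \<in> V" "smooth_on A f"
  shows "smooth_on A (\<lambda>x. dird f x v)"
  unfolding smooth_on_iff
proof
  fix a assume a: "a \<in> A"
  obtain W g where W: "open W" "a \<in> W" "cinf_on W g" "\<And>x. x \<in> A ==> x \<in> W ==> g x = f x"
    by (rule smooth_onE[OF assms(4) a]) (rule that)
  have "dird f x v = frechet_derivative g (at x) v" if "x \<in> A \<inter> W" for x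
    by (rule has_dird(2)[OF assms(1,2) _ assms(3) W(1)])
      (use that W(4) cinf_on_imp_differentiable[OF W(3)] in auto)
  then show "\<exists>W g. open W \<and> a \<in> W \<and> cinf_on W g \<and> (\<forall>x\<in>A \<inter> W. g x = dird f x v)"
    using W cinf_on_derivative[OF W(3), of v] by (intro exI[of _ W] exI[of _ "\<lambda>x. frechet_derivative g (at x) v"]) auto
qed

lemma dird_has_derivative:
  assumes "subspace V" "openin (top_of_set V) A" "v \<in> V" "smooth_on A f" "x \<in> A"
  shows "((\<lambda>t. f (x + t *\<^sub>R v)) has_real_derivative dird f x v) (at 0)"
proof -
  obtain W g where W: "open W" "x \<in> W" "cinf_on W g" "\<And>y. y \<in> A ==> y \<in> W ==> g y = f y"
    by (rule smooth_onE[OF assms(4,5)]) (rule that)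
  show ?thesis
    using has_dird[OF assms(1,2,5,3) W(1,2) cinf_on_imp_differentiable[OF W(3,2)] W(4)] by simp
qed

lemma dird_linear:
  assumes "subspace V" "openin (top_of_set V) A" "smooth_on A f" "x \<in> A" "finite B" "B \<subseteq> V"
  shows "dird f x (\<Sum>b\<in>B. c b *\<^sub>R b) = (\<Sum>b\<in>B. c b * dird f x b)"
proof -
  obtain W g where W: "open W" "x \<in> W" "cinf_on W g" "\<And>y. y \<in> A ==> y \<in> W ==> g y = f y"
    by (rule smooth_onE[OF assms(3,4)]) (rule that)
  have d: "dird f x v = frechet_derivative g (at x) v" if "v \<in> V" for v
    using has_dird(2)[OF assms(1,2,4) that W(1,2) cinf_on_imp_differentiable[OF W(3,2)] W(4)] .
  have "linear (frechet_derivative g (at x))"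
    by (rule linear_frechet_derivative[OF cinf_on_imp_differentiable[OF W(3,2)]])
  moreover have "(\<Sum>b\<in>B. c b *\<^sub>R b) \<in> V"
    using assms by (intro subspace_sum subspace_scale) auto
  ultimately show ?thesis using d assms(6) by (auto simp: linear_sum linear_scale intro!: sum.cong)
qed

section \<open>Smooth manifolds\<close>

lemma istopology_charts:
  assumes "\<And>U \<phi>. (U, \<phi>) \<in> C ==> inj_on \<phi> U"
  shows "istopology (\<lambda>A. A \<subseteq> P \<and> (\<forall>(U, \<phi>)\<in>C. openin (top_of_set V) (\<phi> ` (A \<inter> U))))"
  unfolding istopology_def
proof (intro conjI allI impI)
  fix A B
  assume A: "A \<subseteq> P \<and> (\<forall>(U, \<phi>)\<in>C. openin (top_of_set V) (\<phi> ` (A \<inter> U)))"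
    and B: "B \<subseteq> P \<and> (\<forall>(U, \<phi>)\<in>C. openin (top_of_set V) (\<phi> ` (B \<inter> U)))"
  show "A \<inter> B \<subseteq> P" using A by blast
  show "\<forall>(U, \<phi>)\<in>C. openin (top_of_set V) (\<phi> ` (A \<inter> B \<inter> U))"
  proof (clarify)
    fix U \<phi> assume c: "(U, \<phi>) \<in> C"
    have "\<phi> ` (A \<inter> B \<inter> U) = \<phi> ` ((A \<inter> U) \<inter> (B \<inter> U))" by (rule arg_cong) blast
    also have "\<dots> = \<phi> ` (A \<inter> U) \<inter> \<phi> ` (B \<inter> U)"
      by (rule inj_on_image_Int[OF assms[OF c]]) auto
    finally have *: "\<phi> ` (A \<inter> B \<inter> U) = \<phi> ` (A \<inter> U) \<inter> \<phi> ` (B \<inter> U)" .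
    show "openin (top_of_set V) (\<phi> ` (A \<inter> B \<inter> U))"
      unfolding * by (rule openin_Int) (use A B c in auto)
  qed
next
  fix K assume K: "\<forall>A\<in>K. A \<subseteq> P \<and> (\<forall>(U, \<phi>)\<in>C. openin (top_of_set V) (\<phi> ` (A \<inter> U)))"
  show "\<Union> K \<subseteq> P" using K by blast
  show "\<forall>(U, \<phi>)\<in>C. openin (top_of_set V) (\<phi> ` (\<Union> K \<inter> U))"
  proof (clarify)
    fix U \<phi> assume c: "(U, \<phi>) \<in> C"
    have *: "\<phi> ` (\<Union> K \<inter> U) = (\<Union>A\<in>K. \<phi> ` (A \<inter> U))" by blast
    show "openin (top_of_set V) (\<phi> ` (\<Union> K \<inter> U))"
      unfolding * by (rule openin_Union) (use K c in auto)
  qed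
qed

text \<open>Stated for injective charts instead of manifolds, so that it also covers S before it is
  known to be a manifold, and the normal bundle. Injectivity lets images of charts commute with
  intersections.\<close>

lemma openin_mfd:
  assumes "\<And>U \<phi>. (U, \<phi>) \<in> charts N ==> inj_on \<phi> U"
  shows "openin (mfd_topology N) A \<longleftrightarrow>
    A \<subseteq> pts N \<and> (\<forall>(U, \<phi>)\<in>charts N. openin (top_of_set (model N)) (\<phi> ` (A \<inter> U)))"
proof -
  have "openin (mfd_topology N) = (\<lambda>A. A \<subseteq> pts N \<and>
      (\<forall>(U, \<phi>)\<in>charts N. openin (top_of_set (model N)) (\<phi> ` (A \<inter> U))))"
    unfolding mfd_topology_def
    by (rule topology_inverse'[OF istopology_charts]) (rule assms)
  then show ?thesis by simp
qed

lemma admissibleD: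
  assumes "admissible_chart N (U, \<phi>)"
  shows "U \<subseteq> pts N" "inj_on \<phi> U" "openin (top_of_set (model N)) (\<phi> ` U)"
    "(U', \<phi>') \<in> charts N ==> openin (top_of_set (model N)) (\<phi> ` (U \<inter> U'))"
    "(U', \<phi>') \<in> charts N ==> openin (top_of_set (model N)) (\<phi>' ` (U \<inter> U'))"
    "(U', \<phi>') \<in> charts N ==> smooth_on (\<phi> ` (U \<inter> U')) (\<phi>' \<circ> inv_into U \<phi>)"
    "(U', \<phi>') \<in> charts N ==> smooth_on (\<phi>' ` (U \<inter> U')) (\<phi> \<circ> inv_into U' \<phi>')"
proof -
  have *: "U \<subseteq> pts N \<and> inj_on \<phi> U \<and> openin (top_of_set (model N)) (\<phi> ` U) \<and>
    (\<forall>c\<in>charts N.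
      openin (top_of_set (model N)) (\<phi> ` (U \<inter> fst c)) \<and>
      openin (top_of_set (model N)) (snd c ` (U \<inter> fst c)) \<and>
      smooth_on (\<phi> ` (U \<inter> fst c)) (snd c \<circ> inv_into U \<phi>) \<and>
      smooth_on (snd c ` (U \<inter> fst c)) (\<phi> \<circ> inv_into (fst c) (snd c)))"
    using assms unfolding admissible_chart_def by (simp add: case_prod_beta)
  show "U \<subseteq> pts N" "inj_on \<phi> U" "openin (top_of_set (model N)) (\<phi> ` U)"
    using * by simp_all
  assume c: "(U', \<phi>') \<in> charts N"
  note ** = bspec[OF conjunct2[OF conjunct2[OF conjunct2[OF *]]] c, simplified]
  show "openin (top_of_set (model N)) (\<phi> ` (U \<inter> U'))" "openin (top_of_set (model N)) (\<phi>' ` (U \<inter> U'))"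
    "smooth_on (\<phi> ` (U \<inter> U')) (\<phi>' \<circ> inv_into U \<phi>)"
    "smooth_on (\<phi>' ` (U \<inter> U')) (\<phi> \<circ> inv_into U' \<phi>')"
    using ** by blast+
qed

locale manifold =
  fixes N :: "('p, 'e::euclidean_space) mfd"
  assumes smooth: "smooth_manifold N"
begin

abbreviation "Sm \<equiv> smooth_functions N"
abbreviation "VF \<equiv> vector_fields N"
abbreviation "Om \<equiv> one_forms N"
abbreviation "dN \<equiv> differential N"

abbreviation "mopen \<equiv> openin (mfd_topology N)"
abbreviation "adm U \<phi> \<equiv> admissible_chart N (U, \<phi>)"

lemma subspace_model: "subspace (model N)"
  using smooth by (simp add: smooth_manifold_def)

lemma charts_adm: "(U, \<phi>) \<in> charts N ==> adm U \<phi>"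
  using smooth by (simp add: smooth_manifold_def)

lemma charts_cover: assumes "p \<in> pts N" obtains U \<phi> where "(U, \<phi>) \<in> charts N" "p \<in> U"
proof -
  have "p \<in> (\<Union>c\<in>charts N. fst c)" using assms smooth by (simp add: smooth_manifold_def case_prod_beta)
  then obtain c where "c \<in> charts N" "p \<in> fst c" by blast
  then show thesis by (intro that[of "fst c" "snd c"]) simp_all
qed

lemma adm_model: "adm U \<phi> ==> q \<in> U ==> \<phi> q \<in> model N"
  using openin_imp_subset[OF admissibleD(3)[of N U \<phi>]] by blast

lemma inj_charts: "(U, \<phi>) \<in> charts N ==> inj_on \<phi> U"
  using admissibleD(2)[OF charts_adm] .

lemma mopen_iff: "mopen A \<longleftrightarrow>
    A \<subseteq> pts N \<and> (\<forall>(U, \<phi>)\<in>charts N. openin (top_of_set (model N)) (\<phi> ` (A \<inter> U)))"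
  by (rule openin_mfd) (rule inj_charts)

lemma mopen_subset: "mopen A ==> A \<subseteq> pts N"
  by (simp add: mopen_iff)

lemma adm_open: assumes "adm U \<phi>" shows "mopen U"
  unfolding mopen_iff using admissibleD(1,5)[OF assms] by auto

lemma mopen_pts: "mopen (pts N)"
  unfolding mopen_iff using admissibleD(1,3)[OF charts_adm] by (auto simp: Int_absorb1)

lemma topspace_mfd [simp]: "topspace (mfd_topology N) = pts N"
  using mopen_pts openin_subset[of "mfd_topology N" "pts N"] mopen_subset[OF openin_topspace] by blast

lemma chart_transition:
  assumes "(U', \<phi>') \<in> charts N" "adm U \<phi>" "q \<in> U" "q \<in> U'"
  shows "(\<phi>' \<circ> inv_into U \<phi>) (\<phi> q) = \<phi>' q" "(\<phi> \<circ> inv_into U' \<phi>') (\<phi>' q) = \<phi> q"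
  using assms inj_charts[OF assms(1)] admissibleD(2)[OF assms(2)] by (simp_all add: inv_into_f_f)

text \<open>For atlas charts this is the definition of the topology. An admissible chart is compared
  near each point with an atlas chart, through the continuous transition map.\<close>

lemma adm_image_open:
  assumes "adm U \<phi>" "mopen A" shows "openin (top_of_set (model N)) (\<phi> ` (A \<inter> U))"
proof (subst openin_subopen, intro ballI)
  fix x assume "x \<in> \<phi> ` (A \<inter> U)"
  then obtain q where q: "q \<in> A" "q \<in> U" "x = \<phi> q" by blast
  obtain U' \<phi>' where c: "(U', \<phi>') \<in> charts N" "q \<in> U'"
    using charts_cover q(1) mopen_subset[OF assms(2)] by blast
  let ?\<tau> = "\<phi>' \<circ> inv_into U \<phi>" and ?S = "\<phi> ` (U \<inter> U')"
  have \<tau>: "?\<tau> (\<phi> p) = \<phi>' p" if "p \<in> U" "p \<in> U'" for p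
    using chart_transition[OF c(1) assms(1) that] by simp
  have cont: "continuous_on ?S ?\<tau>"
    by (rule smooth_on_imp_continuous_on[OF admissibleD(6)[OF assms(1) c(1)]])
  have "?\<tau> \<in> ?S \<rightarrow> model N"
    using \<tau> adm_model[OF charts_adm[OF c(1)]] by auto
  moreover have "openin (top_of_set (model N)) (\<phi>' ` (A \<inter> U'))"
    using assms(2) c(1) by (auto simp: mopen_iff)
  ultimately have "openin (top_of_set ?S) (?S \<inter> ?\<tau> -` (\<phi>' ` (A \<inter> U')))"
    by (rule continuous_openin_preimage[OF cont])
  then have "openin (top_of_set (model N)) (?S \<inter> ?\<tau> -` (\<phi>' ` (A \<inter> U')))"
    by (rule openin_trans) (rule admissibleD(4)[OF assms(1) c(1)])
  moreover have "?S \<inter> ?\<tau> -` (\<phi>' ` (A \<inter> U')) \<subseteq> \<phi> ` (A \<inter> U)"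
  proof
    fix y assume "y \<in> ?S \<inter> ?\<tau> -` (\<phi>' ` (A \<inter> U'))"
    then obtain p r where p: "p \<in> U" "p \<in> U'" "y = \<phi> p" "?\<tau> y = \<phi>' r" "r \<in> A" "r \<in> U'" by blast
    then have "\<phi>' p = \<phi>' r" using \<tau> by metis
    then have "p = r" using inj_charts[OF c(1)] p by (meson inj_onD)
    then show "y \<in> \<phi> ` (A \<inter> U)" using p by blast
  qed
  moreover have "x \<in> ?S \<inter> ?\<tau> -` (\<phi>' ` (A \<inter> U'))"
    using q c \<tau> by auto
  ultimately show "\<exists>T. openin (top_of_set (model N)) T \<and> x \<in> T \<and> T \<subseteq> \<phi> ` (A \<inter> U)"
    by blast
qed

lemma adm_preimage_open:
  assumes "adm U \<phi>" "openin (top_of_set (model N)) O'" shows "mopen {q \<in> U. \<phi> q \<in> O'}"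
  unfolding mopen_iff
proof (intro conjI)
  show "{q \<in> U. \<phi> q \<in> O'} \<subseteq> pts N" using admissibleD(1)[OF assms(1)] by auto
  show "\<forall>(U', \<phi>')\<in>charts N. openin (top_of_set (model N)) (\<phi>' ` ({q \<in> U. \<phi> q \<in> O'} \<inter> U'))"
  proof clarify
    fix U' \<phi>' assume c: "(U', \<phi>') \<in> charts N"
    let ?\<tau> = "\<phi> \<circ> inv_into U' \<phi>'" and ?S = "\<phi>' ` (U \<inter> U')"
    have \<tau>: "?\<tau> (\<phi>' p) = \<phi> p" if "p \<in> U" "p \<in> U'" for p
      using chart_transition[OF c assms(1) that] by simp
    have cont: "continuous_on ?S ?\<tau>"
      by (rule smooth_on_imp_continuous_on[OF admissibleD(7)[OF assms(1) c]])
    have "?\<tau> \<in> ?S \<rightarrow> model N"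
      using \<tau> adm_model[OF assms(1)] by auto
    then have "openin (top_of_set ?S) (?S \<inter> ?\<tau> -` O')"
      by (rule continuous_openin_preimage[OF cont _ assms(2)])
    then have "openin (top_of_set (model N)) (?S \<inter> ?\<tau> -` O')"
      by (rule openin_trans) (rule admissibleD(5)[OF assms(1) c])
    moreover have "?S \<inter> ?\<tau> -` O' = \<phi>' ` ({q \<in> U. \<phi> q \<in> O'} \<inter> U')"
    proof (intro equalityI subsetI)
      fix y assume "y \<in> ?S \<inter> ?\<tau> -` O'"
      then obtain p where p: "p \<in> U" "p \<in> U'" "y = \<phi>' p" "?\<tau> y \<in> O'" by blast
      then have "\<phi> p \<in> O'" using \<tau>[OF p(1,2)] by simp
      then show "y \<in> \<phi>' ` ({q \<in> U. \<phi> q \<in> O'} \<inter> U')" using p by blast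
    next
      fix y assume "y \<in> \<phi>' ` ({q \<in> U. \<phi> q \<in> O'} \<inter> U')"
      then obtain p where p: "p \<in> U" "p \<in> U'" "y = \<phi>' p" "\<phi> p \<in> O'" by blast
      then show "y \<in> ?S \<inter> ?\<tau> -` O'" using \<tau>[OF p(1,2)] by auto
    qed
    ultimately show "openin (top_of_set (model N)) (\<phi>' ` ({q \<in> U. \<phi> q \<in> O'} \<inter> U'))" by simp
  qed
qed

text \<open>Admissible charts are compatible with the atlas by definition, but with each other only
  by passing through an atlas chart around each point.\<close>

lemma adm_transition_smooth:
  assumes a: "adm U \<phi>" and b: "adm U' \<phi>'"
  shows "smooth_on (\<phi>' ` (U \<inter> U')) (\<phi> \<circ> inv_into U' \<phi>')"
proof (rule smooth_on_local)
  fix y assume "y \<in> \<phi>' ` (U \<inter> U')"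
  then obtain p where p: "p \<in> U" "p \<in> U'" "y = \<phi>' p" by blast
  obtain U0 \<phi>0 where c: "(U0, \<phi>0) \<in> charts N" "p \<in> U0"
    using charts_cover p(1) admissibleD(1)[OF a] by blast
  have "openin (top_of_set (model N)) (\<phi>' ` (U0 \<inter> U \<inter> U'))"
    by (rule adm_image_open[OF b openin_Int[OF adm_open[OF charts_adm[OF c(1)]] adm_open[OF a]]])
  then obtain T where T: "open T" "\<phi>' ` (U0 \<inter> U \<inter> U') = model N \<inter> T" by (auto simp: openin_open)
  have "smooth_on (\<phi>' ` (U0 \<inter> U \<inter> U')) (\<lambda>x. (\<phi> \<circ> inv_into U0 \<phi>0) ((\<phi>0 \<circ> inv_into U' \<phi>') x))"
  proof (rule smooth_on_comp[OF smooth_on_subset[OF admissibleD(6)[OF b c(1)]] _ admissibleD(7)[OF a c(1)]])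
    show "(\<phi>0 \<circ> inv_into U' \<phi>') ` \<phi>' ` (U0 \<inter> U \<inter> U') \<subseteq> \<phi>0 ` (U \<inter> U0)"
      using chart_transition(1)[OF c(1) b] by auto
  qed auto
  then have "smooth_on (\<phi>' ` (U0 \<inter> U \<inter> U')) (\<phi> \<circ> inv_into U' \<phi>')"
    by (rule smooth_on_cong)
      (use inj_charts[OF c(1)] admissibleD(2)[OF b] in \<open>auto simp: inv_into_f_f\<close>)
  moreover have "\<phi>' ` (U \<inter> U') \<inter> T \<subseteq> \<phi>' ` (U0 \<inter> U \<inter> U')"
    unfolding T using admissibleD(3)[OF b] by (auto dest: openin_imp_subset)
  ultimately have "smooth_on (\<phi>' ` (U \<inter> U') \<inter> T) (\<phi> \<circ> inv_into U' \<phi>')"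
    by (rule smooth_on_subset)
  moreover have "y \<in> T" using T(2) p c by auto
  ultimately show "\<exists>W. open W \<and> y \<in> W \<and> smooth_on (\<phi>' ` (U \<inter> U') \<inter> W) (\<phi> \<circ> inv_into U' \<phi>')"
    using T(1) by (intro exI[of _ T]) simp
qed

lemma smooth_on_change_chart:
  assumes a: "adm U \<phi>" and b: "adm U' \<phi>'" and A: "A \<subseteq> U"
    and s: "smooth_on (\<phi> ` A) (f \<circ> inv_into U \<phi>)"
  shows "smooth_on (\<phi>' ` (A \<inter> U')) (f \<circ> inv_into U' \<phi>')"
proof -
  have eq: "inv_into U' \<phi>' (\<phi>' q) = q" if "q \<in> U'" for q
    using that admissibleD(2)[OF b] by (simp add: inv_into_f_f)
  have eq': "inv_into U \<phi> (\<phi> q) = q" if "q \<in> U" for q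
    using that admissibleD(2)[OF a] by (simp add: inv_into_f_f)
  have "smooth_on (\<phi>' ` (A \<inter> U')) (\<lambda>x. (f \<circ> inv_into U \<phi>) ((\<phi> \<circ> inv_into U' \<phi>') x))"
  proof (rule smooth_on_comp[OF smooth_on_subset[OF adm_transition_smooth[OF a b]] _ s])
    show "(\<phi> \<circ> inv_into U' \<phi>') ` \<phi>' ` (A \<inter> U') \<subseteq> \<phi> ` A" using eq by auto
    show "\<phi>' ` (A \<inter> U') \<subseteq> \<phi>' ` (U \<inter> U')" using A by auto
  qed
  then show ?thesis by (rule smooth_on_cong) (use eq eq' A in auto)
qed

section \<open>Smoothness near a point, bump functions and cutoffs\<close>

definition smooth_near :: "('p \<Rightarrow> real) \<Rightarrow> 'p \<Rightarrow> bool"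
  where "smooth_near f p \<longleftrightarrow> (\<exists>U \<phi> A. adm U \<phi> \<and> mopen A \<and> p \<in> A \<and> A \<subseteq> U \<and>
    smooth_on (\<phi> ` A) (f \<circ> inv_into U \<phi>))"

lemma smooth_nearI: "adm U \<phi> ==> mopen A ==> p \<in> A ==> A \<subseteq> U ==>
    smooth_on (\<phi> ` A) (f \<circ> inv_into U \<phi>) ==> smooth_near f p"
  unfolding smooth_near_def by (intro exI conjI)

text \<open>Smoothness near p may be tested in any admissible chart, in particular in slice charts,
  which need not belong to the atlas.\<close>

lemma smooth_near_chart:
  assumes "smooth_near f p" "adm U \<phi>" "p \<in> U"
  obtains A where "mopen A" "p \<in> A" "A \<subseteq> U" "smooth_on (\<phi> ` A) (f \<circ> inv_into U \<phi>)"
proof -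
  obtain U' \<phi>' A where A: "adm U' \<phi>'" "mopen A" "p \<in> A" "A \<subseteq> U'" "smooth_on (\<phi>' ` A) (f \<circ> inv_into U' \<phi>')"
    using assms(1) unfolding smooth_near_def by (elim exE conjE)
  show thesis
    by (rule that[of "A \<inter> U"])
      (use A assms(3) smooth_on_change_chart[OF A(1) assms(2) A(4,5)] openin_Int[OF A(2) adm_open[OF assms(2)]] in auto)
qed

lemma smooth_near_cong:
  assumes "smooth_near f p" "mopen A" "p \<in> A" "\<And>q. q \<in> A ==> f q = g q"
  shows "smooth_near g p"
proof -
  obtain U \<phi> B where B: "adm U \<phi>" "mopen B" "p \<in> B" "B \<subseteq> U" "smooth_on (\<phi> ` B) (f \<circ> inv_into U \<phi>)"
    using assms(1) unfolding smooth_near_def by (elim exE conjE)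
  have "smooth_on (\<phi> ` (A \<inter> B)) (g \<circ> inv_into U \<phi>)"
    by (rule smooth_on_transfer[OF B(5)])
      (use assms(4) B(4) admissibleD(2)[OF B(1)] in \<open>auto simp: inv_into_f_f subset_iff\<close>)
  then show ?thesis
    by (intro smooth_nearI[OF B(1) openin_Int[OF assms(2) B(2)]]) (use B assms(3) in auto)
qed

lemma smooth_functionsD: "f \<in> Sm ==> p \<in> pts N ==> smooth_near f p"
proof -
  assume f: "f \<in> Sm" and p: "p \<in> pts N"
  obtain U \<phi> where c: "(U, \<phi>) \<in> charts N" "p \<in> U" using charts_cover[OF p] .
  show ?thesis
    by (rule smooth_nearI[OF charts_adm[OF c(1)] adm_open[OF charts_adm[OF c(1)]] c(2)])
      (use f c in \<open>auto simp: smooth_functions_def\<close>)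
qed

lemma smooth_functions_outside: "f \<in> Sm ==> p \<notin> pts N ==> f p = 0"
  by (simp add: smooth_functions_def)

lemma smooth_on_chartI:
  assumes a: "adm U \<phi>" and f: "\<And>p. p \<in> U ==> smooth_near f p"
  shows "smooth_on (\<phi> ` U) (f \<circ> inv_into U \<phi>)"
proof (rule smooth_on_local)
  fix x assume "x \<in> \<phi> ` U"
  then obtain p where p: "p \<in> U" "x = \<phi> p" by blast
  obtain A where A: "mopen A" "p \<in> A" "A \<subseteq> U" "smooth_on (\<phi> ` A) (f \<circ> inv_into U \<phi>)"
    by (rule smooth_near_chart[OF f[OF p(1)] a p(1)]) (rule that)
  have "openin (top_of_set (model N)) (\<phi> ` A)"
    using adm_image_open[OF a A(1)] A(3) by (simp add: Int_absorb2)
  then obtain T where T: "open T" "\<phi> ` A = model N \<inter> T" by (auto simp: openin_open)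
  have "\<phi> ` U \<inter> T \<subseteq> \<phi> ` A"
    unfolding T using adm_model[OF a] by auto
  then have "smooth_on (\<phi> ` U \<inter> T) (f \<circ> inv_into U \<phi>)" by (rule smooth_on_subset[OF A(4)])
  moreover have "x \<in> T" using T(2) p A by auto
  ultimately show "\<exists>W. open W \<and> x \<in> W \<and> smooth_on (\<phi> ` U \<inter> W) (f \<circ> inv_into U \<phi>)"
    using T(1) by (intro exI[of _ T]) simp
qed

lemma smooth_functionsI:
  assumes "\<And>p. p \<notin> pts N ==> f p = 0" "\<And>p. p \<in> pts N ==> smooth_near f p"
  shows "f \<in> Sm"
  unfolding smooth_functions_def
proof (intro CollectI conjI allI impI, rule assms(1), assumption, clarify)
  fix U \<phi> assume c: "(U, \<phi>) \<in> charts N"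
  show "smooth_on (\<phi> ` U) (f \<circ> inv_into U \<phi>)"
    by (rule smooth_on_chartI[OF charts_adm[OF c] assms(2)]) (use admissibleD(1)[OF charts_adm[OF c]] in blast)
qed

lemma smooth_in_adm:
  "adm U \<phi> ==> f \<in> Sm ==> smooth_on (\<phi> ` U) (f \<circ> inv_into U \<phi>)"
  by (rule smooth_on_chartI) (use admissibleD(1) smooth_functionsD in blast)+

lemma smooth_near_const: "p \<in> pts N ==> smooth_near (\<lambda>q. c) p"
proof -
  assume p: "p \<in> pts N"
  obtain U \<phi> where c: "(U, \<phi>) \<in> charts N" "p \<in> U" using charts_cover[OF p] .
  show ?thesis
    by (rule smooth_nearI[OF charts_adm[OF c(1)] adm_open[OF charts_adm[OF c(1)]] c(2) subset_refl])
      (simp add: o_def smooth_on_const)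
qed

lemma smooth_near_bin:
  assumes "smooth_near f p" "smooth_near g p"
    and op: "\<And>A (f'::'e \<Rightarrow> real) g'. smooth_on A f' ==> smooth_on A g' ==> smooth_on A (\<lambda>x. bp (f' x) (g' x))"
  shows "smooth_near (\<lambda>q. bp (f q) (g q)) p"
proof -
  obtain U \<phi> A where A: "adm U \<phi>" "mopen A" "p \<in> A" "A \<subseteq> U" "smooth_on (\<phi> ` A) (f \<circ> inv_into U \<phi>)"
    using assms(1) unfolding smooth_near_def by (elim exE conjE)
  have pU: "p \<in> U" using A by blast
  obtain B where B: "mopen B" "p \<in> B" "B \<subseteq> U" "smooth_on (\<phi> ` B) (g \<circ> inv_into U \<phi>)"
    by (rule smooth_near_chart[OF assms(2) A(1) pU]) (rule that)
  have "smooth_on (\<phi> ` (A \<inter> B)) (\<lambda>x. bp ((f \<circ> inv_into U \<phi>) x) ((g \<circ> inv_into U \<phi>) x))"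
    by (rule op[OF smooth_on_subset[OF A(5)] smooth_on_subset[OF B(4)]]) auto
  then show ?thesis
    by (intro smooth_nearI[OF A(1) openin_Int[OF A(2) B(1)]]) (use A B in \<open>auto simp: o_def\<close>)
qed

lemma smooth_near_add: "smooth_near f p ==> smooth_near g p ==> smooth_near (\<lambda>q. f q + g q) p"
  by (rule smooth_near_bin[OF _ _ smooth_on_add])

lemma smooth_near_mult: "smooth_near f p ==> smooth_near g p ==> smooth_near (\<lambda>q. f q * g q) p"
  by (rule smooth_near_bin[OF _ _ smooth_on_mult])

lemma smooth_near_chart_fun:
  assumes "adm U \<phi>" "p \<in> U" "openin (top_of_set (model N)) O'" "\<phi> p \<in> O'" "smooth_on O' g"
  shows "smooth_near (\<lambda>q. g (\<phi> q)) p"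
proof (rule smooth_nearI[OF assms(1) adm_preimage_open[OF assms(1,3)]])
  show "smooth_on (\<phi> ` {q \<in> U. \<phi> q \<in> O'}) ((\<lambda>q. g (\<phi> q)) \<circ> inv_into U \<phi>)"
    by (rule smooth_on_transfer[OF assms(5)]) (use admissibleD(2)[OF assms(1)] in \<open>auto simp: inv_into_f_f\<close>)
qed (use assms in auto)

text \<open>A Euclidean bump is read in a chart and extended by 0. The set C containing its support
  is compact, being the image of a closed ball of the model space; Hausdorffness makes C closed, and
  therefore the extension is smooth across the edge of the chart.\<close>

lemma bump:
  assumes U0: "mopen U0" "p \<in> U0"
  obtains \<rho> A C where "\<rho> \<in> Sm" "mopen A" "p \<in> A" "A \<subseteq> U0" "\<And>q. q \<in> A ==> \<rho> q = 1"
    "mopen (pts N - C)" "C \<subseteq> U0" "\<And>q. q \<notin> C ==> \<rho> q = 0"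
proof -
  have p: "p \<in> pts N" using mopen_subset[OF U0(1)] U0(2) by blast
  obtain U \<phi> where c: "(U, \<phi>) \<in> charts N" "p \<in> U" using charts_cover[OF p] .
  note a = charts_adm[OF c(1)]
  have inv: "inv_into U \<phi> (\<phi> q) = q" if "q \<in> U" for q
    using that admissibleD(2)[OF a] by (simp add: inv_into_f_f)
  obtain T where T: "open T" "\<phi> ` (U0 \<inter> U) = model N \<inter> T"
    using adm_image_open[OF a U0(1)] by (auto simp: openin_open)
  have "\<phi> p \<in> T" using T(2) U0 c by auto
  then obtain r' where r': "r' > 0" "cball (\<phi> p) r' \<subseteq> T" using T(1) open_contains_cball by blast
  \<comment> \<open>Halved because \<open>smooth_bump\<close> vanishes only from distance
    \<open>2 * r\<close> on.\<close>
  define r where "r = r' / 2"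
  have r: "r > 0" "cball (\<phi> p) (2 * r) \<subseteq> T" using r' by (auto simp: r_def)
  obtain B :: "'e \<Rightarrow> real" where B: "cinf_on UNIV B" "\<And>y. dist y (\<phi> p) \<le> r ==> B y = 1"
      "\<And>y. dist y (\<phi> p) \<ge> 2 * r ==> B y = 0"
    by (rule smooth_bump[OF r(1), of "\<phi> p"]) (rule that)
  define \<rho> where "\<rho> q = (if q \<in> U then B (\<phi> q) else 0)" for q
  define K where "K = model N \<inter> cball (\<phi> p) (2 * r)"
  define C where "C = inv_into U \<phi> ` K"
  define A where "A = {q \<in> U. \<phi> q \<in> model N \<inter> ball (\<phi> p) r}"
  have KU: "K \<subseteq> \<phi> ` (U0 \<inter> U)" using r T by (auto simp: K_def)
  have CU: "C \<subseteq> U0 \<inter> U" using KU inv by (auto simp: C_def)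
  have modelU: "\<phi> q \<in> model N" if "q \<in> U" for q
    using admissibleD(3)[OF a] that by (auto dest: openin_imp_subset)
  have notC: "\<rho> q = 0" if "q \<notin> C" for q
  proof (cases "q \<in> U")
    case True
    have "\<phi> q \<notin> K" using that inv[OF True] unfolding C_def by (metis image_eqI)
    then have "dist (\<phi> q) (\<phi> p) \<ge> 2 * r" using modelU[OF True] by (auto simp: K_def dist_commute)
    then show ?thesis using B(3) by (simp add: \<rho>_def)
  qed (simp add: \<rho>_def)
  have "compactin (mfd_topology N) C"
    unfolding C_def
  proof (rule image_compactin)
    show "compactin (top_of_set (\<phi> ` U)) K"
      using KU compact_Int_closed[OF compact_cball closed_subspace[OF subspace_model]]
      by (auto simp: compactin_subtopology K_def Int_commute)
    show "continuous_map (top_of_set (\<phi> ` U)) (mfd_topology N) (inv_into U \<phi>)"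
      unfolding continuous_map_def
    proof (intro conjI allI impI)
      show "inv_into U \<phi> \<in> topspace (top_of_set (\<phi> ` U)) \<rightarrow> topspace (mfd_topology N)"
        using inv admissibleD(1)[OF a] by auto
      fix O' assume O': "mopen O'"
      have "{x \<in> topspace (top_of_set (\<phi> ` U)). inv_into U \<phi> x \<in> O'} = \<phi> ` U \<inter> \<phi> ` (O' \<inter> U)"
        using inv by auto
      moreover have "openin (top_of_set (\<phi> ` U)) (\<phi> ` U \<inter> \<phi> ` (O' \<inter> U))"
        by (rule openin_subset_trans[OF openin_Int[OF admissibleD(3)[OF a] adm_image_open[OF a O']]])
          (use openin_imp_subset[OF admissibleD(3)[OF a]] in auto)
      ultimately show "openin (top_of_set (\<phi> ` U)) {x \<in> topspace (top_of_set (\<phi> ` U)). inv_into U \<phi> x \<in> O'}" by simp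
    qed
  qed
  then have "closedin (mfd_topology N) C"
    using smooth by (intro compactin_imp_closedin) (auto simp: smooth_manifold_def)
  then have Cop: "mopen (pts N - C)" using openin_diff[OF mopen_pts] by blast
  have "\<rho> \<in> Sm"
  proof (rule smooth_functionsI)
    fix q assume "q \<notin> pts N"
    then show "\<rho> q = 0" using admissibleD(1)[OF a] by (auto simp: \<rho>_def)
  next
    fix q assume q: "q \<in> pts N"
    show "smooth_near \<rho> q"
    proof (cases "q \<in> U")
      case True
      have "smooth_near (\<lambda>q. B (\<phi> q)) q"
        by (rule smooth_near_chart_fun[OF a True openin_subtopology_self modelU[OF True]])
          (rule smooth_onI_cinf[OF open_UNIV B(1) subset_UNIV])
      then show ?thesis by (rule smooth_near_cong[OF _ adm_open[OF a] True]) (simp add: \<rho>_def)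
    next
      case False
      then have "q \<in> pts N - C" using CU q by blast
      then show ?thesis
        by (rule smooth_near_cong[OF smooth_near_const[OF q, of 0] Cop]) (use notC in auto)
    qed
  qed
  moreover have "mopen A" unfolding A_def
    by (rule adm_preimage_open[OF a]) (auto simp: openin_open)
  moreover have "p \<in> A" using c modelU r by (auto simp: A_def)
  moreover have "A \<subseteq> U0"
  proof
    fix q assume q: "q \<in> A"
    then have "\<phi> q \<in> K" using r(1) by (auto simp: A_def K_def)
    then have "q \<in> C" using inv[of q] q unfolding C_def A_def by (metis (mono_tags, lifting) image_eqI mem_Collect_eq)
    then show "q \<in> U0" using CU by blast
  qed
  moreover have "\<rho> q = 1" if "q \<in> A" for q
    using that B(2)[of "\<phi> q"] by (auto simp: A_def \<rho>_def dist_commute)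
  ultimately show thesis using Cop CU notC by (intro that[of \<rho> A C]) auto
qed

text \<open>The complement of C is open and the product vanishes there, so g may behave arbitrarily
  away from U0.\<close>

lemma smooth_cutoff:
  assumes "\<rho> \<in> Sm" "mopen (pts N - C)" "C \<subseteq> U0" "\<And>q. q \<notin> C ==> \<rho> q = 0"
    "\<And>q. q \<in> U0 ==> smooth_near g q"
  shows "(\<lambda>q. \<rho> q * g q) \<in> Sm"
proof (rule smooth_functionsI)
  fix q assume "q \<notin> pts N"
  then show "\<rho> q * g q = 0" using smooth_functions_outside[OF assms(1)] by simp
next
  fix q assume q: "q \<in> pts N"
  show "smooth_near (\<lambda>q. \<rho> q * g q) q"
  proof (cases "q \<in> U0")
    case True
    show ?thesis
      by (rule smooth_near_mult[OF smooth_functionsD[OF assms(1) q] assms(5)[OF True]])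
  next
    case False
    then have "q \<in> pts N - C" using assms(3) q by blast
    then show ?thesis
      by (rule smooth_near_cong[OF smooth_near_const[OF q, of 0] assms(2)]) (use assms(4) in auto)
  qed
qed

lemma smooth_extension:
  assumes "mopen U0" "p \<in> U0" "\<And>q. q \<in> U0 ==> smooth_near g q"
  obtains f A where "f \<in> Sm" "mopen A" "p \<in> A" "A \<subseteq> U0" "\<And>q. q \<in> A ==> f q = g q"
proof -
  obtain \<rho> A C where \<rho>: "\<rho> \<in> Sm" "mopen A" "p \<in> A" "A \<subseteq> U0" "\<And>q. q \<in> A ==> \<rho> q = 1"
    "mopen (pts N - C)" "C \<subseteq> U0" "\<And>q. q \<notin> C ==> \<rho> q = 0"
    by (rule bump[OF assms(1,2)]) (rule that)
  show thesis
    by (rule that[OF smooth_cutoff[OF \<rho>(1,6,7,8) assms(3)] \<rho>(2-4)]) (use \<rho>(5) in simp_all)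
qed

lemma smooth_mult:
  "f \<in> Sm ==> g \<in> Sm ==> f * g \<in> Sm"
  by (rule smooth_functionsI) (auto simp: smooth_functions_outside times_fun_def intro: smooth_near_mult smooth_functionsD)

lemma subspace_smooth_functions: "subspace (Sm)"
proof (rule subspaceI)
  show "0 \<in> Sm"
    by (rule smooth_functionsI) (auto simp: zero_fun_def intro: smooth_near_const)
  show "f + g \<in> Sm" if "f \<in> Sm" "g \<in> Sm" for f g
    using that by (intro smooth_functionsI)
      (auto simp: smooth_functions_outside plus_fun_def intro: smooth_near_add smooth_functionsD)
  show "c *\<^sub>R f \<in> Sm" if "f \<in> Sm" for c f
    using that by (intro smooth_functionsI)
      (auto simp: smooth_functions_outside scaleR_fun_def intro: smooth_near_mult smooth_near_const smooth_functionsD)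
qed

lemmas smooth_intros =
  subspace_0[OF subspace_smooth_functions] subspace_add[OF subspace_smooth_functions]
  subspace_diff[OF subspace_smooth_functions] subspace_neg[OF subspace_smooth_functions]
  subspace_scale[OF subspace_smooth_functions] subspace_sum[OF subspace_smooth_functions]
  smooth_mult

text \<open>The constant 1, adjusted to the convention that functions vanish off
  \<open>pts N\<close>.\<close>

definition unit_fn :: "'p \<Rightarrow> real"
  where "unit_fn = (\<lambda>p. if p \<in> pts N then 1 else 0)"

lemma unit_fn_smooth: "unit_fn \<in> Sm"
proof (rule smooth_functionsI)
  fix p assume p: "p \<in> pts N"
  show "smooth_near unit_fn p"
    by (rule smooth_near_cong[OF smooth_near_const[OF p, of 1] mopen_pts p]) (simp add: unit_fn_def)
qed (simp add: unit_fn_def)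

end

section \<open>Tangent and cotangent vectors\<close>

lemma tangentD:
  assumes "v \<in> tangent N p"
  shows "f \<in> smooth_functions N ==> g \<in> smooth_functions N ==> v (f + g) = v f + v g"
    "f \<in> smooth_functions N ==> v (c *\<^sub>R f) = c * v f"
    "f \<in> smooth_functions N ==> g \<in> smooth_functions N ==> v (f * g) = f p * v g + g p * v f"
    "f \<notin> smooth_functions N ==> v f = 0"
  using assms by (simp_all add: tangent_def linear_maps_def linear_from_def)

lemma tangentI:
  assumes "\<And>f g. f \<in> smooth_functions N ==> g \<in> smooth_functions N ==> v (f + g) = v f + v g"
    "\<And>c f. f \<in> smooth_functions N ==> v (c *\<^sub>R f) = c * v f"
    "\<And>f g. f \<in> smooth_functions N ==> g \<in> smooth_functions N ==> v (f * g) = f p * v g + g p * v f"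
    "\<And>f. f \<notin> smooth_functions N ==> v f = 0"
  shows "v \<in> tangent N p"
  using assms by (simp add: tangent_def linear_maps_def linear_from_def)

lemma scaleR_fun_apply [simp]: "(c *\<^sub>R f) x = c *\<^sub>R f x"
  by (simp add: scaleR_fun_def)

lemma subspace_tangent: "subspace (tangent N p)"
  by (rule subspaceI; rule tangentI) (simp_all add: tangentD algebra_simps)

lemma subspace_linear_maps:
  assumes "subspace V" shows "subspace (linear_maps U V)"
proof (rule subspaceI)
  show "0 \<in> linear_maps U V" using subspace_0[OF assms] by (auto simp: linear_maps_def linear_from_def)
  show "f + g \<in> linear_maps U V" if "f \<in> linear_maps U V" "g \<in> linear_maps U V" for f g
    using that subspace_add[OF assms] by (auto simp: linear_maps_def linear_from_def image_subset_iff algebra_simps)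
  show "c *\<^sub>R f \<in> linear_maps U V" if "f \<in> linear_maps U V" for c f
    using that subspace_scale[OF assms]
    by (auto simp: linear_maps_def linear_from_def image_subset_iff algebra_simps scaleR_fun_def)
qed

lemma subspace_cotangent: "subspace (cotangent N p)"
  unfolding cotangent_def by (rule subspace_linear_maps[OF subspace_UNIV])

lemma cotangentD:
  assumes "a \<in> cotangent N p"
  shows "v \<in> tangent N p ==> w \<in> tangent N p ==> a (v + w) = a v + a w"
    "v \<in> tangent N p ==> a (c *\<^sub>R v) = c * a v"
    "v \<notin> tangent N p ==> a v = 0"
  using assms by (simp_all add: cotangent_def linear_maps_def linear_from_def)

lemma cotangentI:
  assumes "\<And>v w. v \<in> tangent N p ==> w \<in> tangent N p ==> a (v + w) = a v + a w"
    "\<And>c v. v \<in> tangent N p ==> a (c *\<^sub>R v) = c * a v"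
    "\<And>v. v \<notin> tangent N p ==> a v = 0"
  shows "a \<in> cotangent N p"
  using assms by (simp add: cotangent_def linear_maps_def linear_from_def)

lemma cotangent_zero: assumes "a \<in> cotangent N p" shows "a 0 = 0"
  using cotangentD(2)[OF assms subspace_0[OF subspace_tangent], of 0] by simp

lemma cotangent_sum:
  assumes "a \<in> cotangent N p" "\<And>b. b \<in> B ==> v b \<in> tangent N p"
  shows "a (\<Sum>b\<in>B. c b *\<^sub>R v b) = (\<Sum>b\<in>B. c b * a (v b))"
  using assms(2)
proof (induction B rule: infinite_finite_induct)
  case (insert x F)
  have "(\<Sum>b\<in>F. c b *\<^sub>R v b) \<in> tangent N p" "c x *\<^sub>R v x \<in> tangent N p"
    using insert by (auto intro!: subspace_sum subspace_scale subspace_tangent)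
  moreover have "a (\<Sum>b\<in>F. c b *\<^sub>R v b) = (\<Sum>b\<in>F. c b * a (v b))"
    by (rule insert(3)) (rule insert(4), simp)
  ultimately show ?case unfolding sum.insert[OF insert(1,2)]
    using insert(4)[of x] by (subst cotangentD(1)[OF assms(1)]) (simp_all only: cotangentD(2)[OF assms(1)] insertI1)
qed (simp_all add: cotangent_zero[OF assms(1)])

lemma sum_fun_apply: "(\<Sum>b\<in>B. f b) x = (\<Sum>b\<in>B. f b x)" for f :: "'b \<Rightarrow> 'c \<Rightarrow> 'd::comm_monoid_add"
  by (induction B rule: infinite_finite_induct) auto

context manifold
begin

lemma tangent_zero: "v \<in> tangent N p ==> v 0 = 0"
  using tangentD(2)[of v N p 0 0] smooth_intros(1) by simp

lemma tangent_diff: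
  "v \<in> tangent N p ==> f \<in> Sm ==> g \<in> Sm ==> v (f - g) = v f - v g"
  using tangentD(1)[of v N p "f - g" g] smooth_intros(3)[of f g] by simp

lemma tangent_sum:
  assumes "v \<in> tangent N p" "\<And>b. b \<in> B ==> f b \<in> Sm"
  shows "v (\<Sum>b\<in>B. f b) = (\<Sum>b\<in>B. v (f b))"
  using assms(2)
proof (induction B rule: infinite_finite_induct)
  case (insert x F)
  have "(\<Sum>b\<in>F. f b) \<in> Sm" "f x \<in> Sm"
    using insert(4) by (auto intro!: smooth_intros(6))
  then show ?case unfolding sum.insert[OF insert(1,2)]
    using insert(3)[OF insert(4)] by (subst tangentD(1)[OF assms(1)]) simp_all
qed (simp_all add: tangent_zero[OF assms(1)])

lemma tangent_unit: assumes "v \<in> tangent N p" "p \<in> pts N" shows "v unit_fn = 0"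
proof -
  have "unit_fn * unit_fn = unit_fn" by (auto simp: unit_fn_def)
  then show ?thesis
    using tangentD(3)[OF assms(1) unit_fn_smooth unit_fn_smooth] assms(2) by (simp add: unit_fn_def)
qed

text \<open>Take a bump \<rho> supported in A with value 1 at p and apply v to \<rho> (f - g) =
  0.\<close>

lemma tangent_local:
  assumes v: "v \<in> tangent N p" and fg: "f \<in> Sm" "g \<in> Sm"
    and A: "mopen A" "p \<in> A" "\<And>q. q \<in> A ==> f q = g q"
  shows "v f = v g"
proof -
  obtain \<rho> A' C where \<rho>: "\<rho> \<in> Sm" "mopen A'" "p \<in> A'" "A' \<subseteq> A" "\<And>q. q \<in> A' ==> \<rho> q = 1"
    "mopen (pts N - C)" "C \<subseteq> A" "\<And>q. q \<notin> C ==> \<rho> q = 0"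
    by (rule bump[OF A(1,2)]) (rule that)
  have s: "f - g \<in> Sm" by (rule smooth_intros(3)[OF fg])
  have "\<rho> q * (f q - g q) = 0" for q
    using \<rho>(7) \<rho>(8)[of q] A(3)[of q] by (cases "q \<in> C") auto
  then have "\<rho> * (f - g) = 0" by (auto simp: fun_eq_iff)
  then have "\<rho> p * v (f - g) + (f p - g p) * v \<rho> = 0"
    using tangentD(3)[OF v \<rho>(1) s] tangent_zero[OF v] by simp
  then show ?thesis using A(3)[OF A(2)] \<rho>(5)[OF \<rho>(3)] tangent_diff[OF v fg] by simp
qed

section \<open>Coordinate vectors and frames\<close>

definition chart_der :: "'p set \<Rightarrow> ('p \<Rightarrow> 'e) \<Rightarrow> 'p \<Rightarrow> 'e \<Rightarrow> 'p tvec"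
  where "chart_der U \<phi> q b f = (if f \<in> Sm then dird (f \<circ> inv_into U \<phi>) (\<phi> q) b else 0)"

context
  fixes U \<phi> assumes a: "adm U \<phi>"
begin

lemma inv_chart: "q \<in> U ==> inv_into U \<phi> (\<phi> q) = q"
  using admissibleD(2)[OF a] by (simp add: inv_into_f_f)

lemma chart_der_DERIV:
  assumes "q \<in> U" "b \<in> model N" "f \<in> Sm"
  shows "((\<lambda>t. (f \<circ> inv_into U \<phi>) (\<phi> q + t *\<^sub>R b)) has_real_derivative chart_der U \<phi> q b f) (at 0)"
  using dird_has_derivative[OF subspace_model admissibleD(3)[OF a] assms(2) smooth_in_adm[OF a assms(3)], of "\<phi> q"]
    assms(1,3) by (simp add: chart_der_def)

lemma chart_der_tangent:
  assumes "q \<in> U" "b \<in> model N" shows "chart_der U \<phi> q b \<in> tangent N q"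
proof (rule tangentI)
  fix f g assume fg: "f \<in> Sm" "g \<in> Sm"
  note D = chart_der_DERIV[OF assms fg(1)] chart_der_DERIV[OF assms fg(2)]
  have "((\<lambda>t. ((f + g) \<circ> inv_into U \<phi>) (\<phi> q + t *\<^sub>R b)) has_real_derivative
      chart_der U \<phi> q b f + chart_der U \<phi> q b g) (at 0)"
    using DERIV_add[OF D] by simp
  then show "chart_der U \<phi> q b (f + g) = chart_der U \<phi> q b f + chart_der U \<phi> q b g"
    using chart_der_DERIV[OF assms smooth_intros(2)[OF fg]] DERIV_unique by blast
  have "((\<lambda>t. ((f * g) \<circ> inv_into U \<phi>) (\<phi> q + t *\<^sub>R b)) has_real_derivative
      f q * chart_der U \<phi> q b g + g q * chart_der U \<phi> q b f) (at 0)"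
    using DERIV_mult[OF D] inv_chart[OF assms(1)] by (simp add: algebra_simps)
  then show "chart_der U \<phi> q b (f * g) = f q * chart_der U \<phi> q b g + g q * chart_der U \<phi> q b f"
    using chart_der_DERIV[OF assms smooth_mult[OF fg]] DERIV_unique by blast
next
  fix c f assume f: "f \<in> Sm"
  have "((\<lambda>t. ((c *\<^sub>R f) \<circ> inv_into U \<phi>) (\<phi> q + t *\<^sub>R b)) has_real_derivative c * chart_der U \<phi> q b f) (at 0)"
    using DERIV_cmult[OF chart_der_DERIV[OF assms f]] by simp
  then show "chart_der U \<phi> q b (c *\<^sub>R f) = c * chart_der U \<phi> q b f"
    using chart_der_DERIV[OF assms smooth_intros(5)[OF f]] DERIV_unique by blast
qed (simp add: chart_der_def)

lemma smooth_near_chart_der: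
  assumes "f \<in> Sm" "q \<in> U" "b \<in> model N"
  shows "smooth_near (\<lambda>q. chart_der U \<phi> q b f) q"
proof -
  have "smooth_near (\<lambda>q. dird (f \<circ> inv_into U \<phi>) (\<phi> q) b) q"
    by (rule smooth_near_chart_fun[OF a assms(2) admissibleD(3)[OF a]])
      (use assms smooth_on_dird[OF subspace_model admissibleD(3)[OF a] assms(3) smooth_in_adm[OF a assms(1)]] in \<open>auto simp: o_def\<close>)
  then show ?thesis using assms(1) by (simp add: chart_der_def)
qed

text \<open>By Hadamard's lemma f is near p equal to f(p) plus a sum of products (x_b - x_b(p)) G_b,
  and a derivation at p sees of G_b only the value G_b(p), a coordinate derivative of f. This is
  where point derivations turn out to be spanned by the coordinate vectors.\<close>

lemma tangent_chart_expand:
  assumes B: "finite B" "pairwise orthogonal B" "\<And>b. b \<in> B ==> norm b = 1" "span B = model N"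
    and A: "mopen A" "p \<in> A" "A \<subseteq> U"
    and x: "\<And>b. b \<in> B ==> x b \<in> Sm" "\<And>b q. b \<in> B ==> q \<in> A ==> x b q = \<phi> q \<bullet> b"
    and v: "v \<in> tangent N p" and f: "f \<in> Sm"
  shows "v f = (\<Sum>b\<in>B. v (x b) * chart_der U \<phi> p b f)"
proof -
  have p: "p \<in> U" using A by blast
  have pN: "p \<in> pts N" using A(2) mopen_subset[OF A(1)] by blast
  have pU: "\<phi> p \<in> \<phi> ` U" using p by blast
  obtain W g where W: "open W" "\<phi> p \<in> W" "cinf_on W g"
      "\<And>y. y \<in> \<phi> ` U ==> y \<in> W ==> g y = (f \<circ> inv_into U \<phi>) y"
    by (rule smooth_onE[OF smooth_in_adm[OF a f] pU]) (rule that)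
  obtain r where r: "r > 0" "ball (\<phi> p) r \<subseteq> W" using W(1,2) open_contains_ball by blast
  obtain H where H: "\<And>b. cinf_on (ball (\<phi> p) r) (H b)" "\<And>b. H b (\<phi> p) = frechet_derivative g (at (\<phi> p)) b"
    "\<And>B c y. finite B ==> y \<in> ball (\<phi> p) r ==> y - \<phi> p = (\<Sum>b\<in>B. c b *\<^sub>R b) ==>
      g y = g (\<phi> p) + (\<Sum>b\<in>B. c b * H b y)"
    by (rule hadamard[OF cinf_on_subset[OF W(3) r(2)] r(1)]) (rule that)
  have Hd: "H b (\<phi> p) = chart_der U \<phi> p b f" if "b \<in> B" for b
  proof -
    have "b \<in> model N" using that B(4) span_base by blast
    then show ?thesis
      using has_dird(2)[OF subspace_model admissibleD(3)[OF a] pU _ W(1,2) cinf_on_imp_differentiable[OF W(3,2)] W(4)] f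
      by (simp add: H(2) chart_der_def o_def)
  qed
  define A1 where "A1 = {q \<in> U. \<phi> q \<in> model N \<inter> ball (\<phi> p) r}"
  have A1: "mopen A1" "p \<in> A1"
    unfolding A1_def by (rule adm_preimage_open[OF a]) (use p r adm_model[OF a p] in \<open>auto simp: openin_open\<close>)
  have sH: "smooth_near (\<lambda>q. H b (\<phi> q)) q" if "q \<in> A1" for b q
    by (rule smooth_near_chart_fun[OF a, of _ "model N \<inter> ball (\<phi> p) r"])
      (use that smooth_onI_cinf[OF open_ball H(1)] in \<open>auto simp: A1_def openin_open\<close>)
  \<comment> \<open>The Hadamard factors exist only near p, whereas v acts on functions on all of N;
    hence global representatives of their germs.\<close>
  have "\<exists>G D. G \<in> Sm \<and> mopen D \<and> p \<in> D \<and> (\<forall>q\<in>D. G q = H b (\<phi> q))" for b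
  proof -
    obtain G D where "G \<in> Sm" "mopen D" "p \<in> D" "D \<subseteq> A1" "\<And>q. q \<in> D ==> G q = H b (\<phi> q)"
      by (rule smooth_extension[OF A1 sH[of _ b]]) (assumption, rule that)
    then show ?thesis by (intro exI[of _ G] exI[of _ D]) simp
  qed
  then obtain G D where G: "\<And>b. G b \<in> Sm" "\<And>b. mopen (D b)" "\<And>b. p \<in> D b"
      "\<And>b q. q \<in> D b ==> G b q = H b (\<phi> q)" by metis
  \<comment> \<open>One neighbourhood on which all representatives are valid; it is open because B
    is finite.\<close>
  define E where "E = A1 \<inter> A \<inter> (\<Inter>b\<in>B. D b)"
  have E: "mopen E" "p \<in> E"
  proof -
    have "mopen (\<Inter>(insert (A1 \<inter> A) (D ` B)))"
      by (rule openin_Inter) (use A A1 B(1) G(2) in auto)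
    moreover have "\<Inter>(insert (A1 \<inter> A) (D ` B)) = E" by (auto simp: E_def)
    ultimately show "mopen E" by simp
  qed (use A A1 G in \<open>auto simp: E_def\<close>)
  define f' where "f' = f p *\<^sub>R unit_fn + (\<Sum>b\<in>B. (x b - x b p *\<^sub>R unit_fn) * G b)"
  have sb: "x b - x b p *\<^sub>R unit_fn \<in> Sm" if "b \<in> B" for b
    by (intro smooth_intros x(1) that unit_fn_smooth)
  have sbG: "(x b - x b p *\<^sub>R unit_fn) * G b \<in> Sm" if "b \<in> B" for b
    by (intro smooth_intros(7) sb that G(1))
  have f': "f' \<in> Sm" unfolding f'_def
    by (intro smooth_intros(2) smooth_intros(5,6) unit_fn_smooth sbG)
  have "f q = f' q" if q: "q \<in> E" for q
  proof -
    have qU: "q \<in> U" "\<phi> q \<in> ball (\<phi> p) r" "q \<in> A" using q by (auto simp: E_def A1_def)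
    have qN: "q \<in> pts N" using qU(1) admissibleD(1)[OF a] by blast
    have "\<phi> q - \<phi> p \<in> span B"
      unfolding B(4) by (intro subspace_diff subspace_model adm_model[OF a] qU p)
    then have e: "\<phi> q - \<phi> p = (\<Sum>b\<in>B. ((\<phi> q - \<phi> p) \<bullet> b) *\<^sub>R b)"
      using orthonormal_basis_expand[OF B(2,3) _ B(1)] by simp
    have "f q = g (\<phi> q)" using W(4)[of "\<phi> q"] qU r(2) inv_chart by auto
    also have "\<dots> = g (\<phi> p) + (\<Sum>b\<in>B. ((\<phi> q - \<phi> p) \<bullet> b) * H b (\<phi> q))"
      by (rule H(3)[OF B(1) qU(2) e])
    also have "g (\<phi> p) = f p" using W(4)[OF pU W(2)] inv_chart[OF p] by simp
    also have "(\<Sum>b\<in>B. ((\<phi> q - \<phi> p) \<bullet> b) * H b (\<phi> q)) = (\<Sum>b\<in>B. ((x b - x b p *\<^sub>R unit_fn) * G b) q)"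
    proof (rule sum.cong[OF refl])
      fix b assume b: "b \<in> B"
      then have "G b q = H b (\<phi> q)" using q G(4) by (auto simp: E_def)
      then show "((\<phi> q - \<phi> p) \<bullet> b) * H b (\<phi> q) = ((x b - x b p *\<^sub>R unit_fn) * G b) q"
        using x(2)[OF b qU(3)] x(2)[OF b A(2)] qN
        by (simp add: scaleR_fun_def unit_fn_def inner_diff_left)
    qed
    finally show "f q = f' q"
      using qN by (simp add: f'_def sum_fun_apply scaleR_fun_def unit_fn_def)
  qed
  then have "v f = v f'" by (rule tangent_local[OF v f f' E])
  also have "\<dots> = (\<Sum>b\<in>B. v ((x b - x b p *\<^sub>R unit_fn) * G b))"
    unfolding f'_def
    by (simp add: tangentD(1,2)[OF v] tangent_sum[OF v] tangent_unit[OF v pN] smooth_intros(5,6) unit_fn_smooth sbG)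
  also have "\<dots> = (\<Sum>b\<in>B. v (x b) * chart_der U \<phi> p b f)"
  proof (rule sum.cong[OF refl])
    fix b assume b: "b \<in> B"
    have "(x b - x b p *\<^sub>R unit_fn) p = 0" using pN by (simp add: scaleR_fun_def unit_fn_def)
    then have "v ((x b - x b p *\<^sub>R unit_fn) * G b) = G b p * v (x b - x b p *\<^sub>R unit_fn)"
      using tangentD(3)[OF v sb[OF b] G(1)] by simp
    also have "v (x b - x b p *\<^sub>R unit_fn) = v (x b)"
      using tangent_diff[OF v x(1)[OF b] smooth_intros(5)[OF unit_fn_smooth]]
        tangentD(2)[OF v unit_fn_smooth] tangent_unit[OF v pN] by simp
    also have "G b p = chart_der U \<phi> p b f" using G(3,4) Hd[OF b] by simp
    finally show "v ((x b - x b p *\<^sub>R unit_fn) * G b) = v (x b) * chart_der U \<phi> p b f"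
      by (rule trans[OF _ mult.commute])
  qed
  finally show ?thesis .
qed

text \<open>The coordinates and coordinate fields of a chart are made global by one bump that is 1
  on A and supported in U0. The orthonormal basis stays a parameter so that it can later be adapted
  to a submanifold.\<close>

lemma frame:
  assumes B: "finite B" "pairwise orthogonal B" "\<And>b. b \<in> B ==> norm b = 1" "span B = model N"
    and U0: "mopen U0" "p \<in> U0" "U0 \<subseteq> U"
  obtains A x X where "mopen A" "p \<in> A" "A \<subseteq> U0"
    "\<And>b. b \<in> B ==> x b \<in> Sm" "\<And>b. b \<in> B ==> X b \<in> VF"
    "\<And>b q. b \<in> B ==> q \<in> A ==> x b q = \<phi> q \<bullet> b"
    "\<And>b q. b \<in> B ==> q \<in> A ==> X b q = chart_der U \<phi> q b"
    "\<And>v q f. q \<in> A ==> v \<in> tangent N q ==> f \<in> Sm ==> v f = (\<Sum>b\<in>B. v (x b) * X b q f)"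
    "\<And>b c q. b \<in> B ==> c \<in> B ==> q \<in> A ==> X b q (x c) = (if b = c then 1 else 0)"
proof -
  obtain \<rho> A C where \<rho>: "\<rho> \<in> Sm" "mopen A" "p \<in> A" "A \<subseteq> U0" "\<And>q. q \<in> A ==> \<rho> q = 1"
    "mopen (pts N - C)" "C \<subseteq> U0" "\<And>q. q \<notin> C ==> \<rho> q = 0"
    by (rule bump[OF U0(1,2)]) (rule that)
  have BV: "b \<in> model N" if "b \<in> B" for b using that B(4) span_base by blast
  define x where "x b = (\<lambda>q. \<rho> q * (\<phi> q \<bullet> b))" for b
  define X where "X b = (\<lambda>q f. \<rho> q * chart_der U \<phi> q b f)" for b
  have xs: "x b \<in> Sm" for b
    unfolding x_def
  proof (rule smooth_cutoff[OF \<rho>(1,6,7,8)])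
    fix q assume "q \<in> U0"
    then have q: "q \<in> U" using U0 by blast
    show "smooth_near (\<lambda>q. \<phi> q \<bullet> b) q"
      by (rule smooth_near_chart_fun[OF a q admissibleD(3)[OF a], of "\<lambda>y. y \<bullet> b"])
        (use q in \<open>auto intro: smooth_on_linear bounded_linear_inner_left\<close>)
  qed auto
  have XS: "X b \<in> VF" if b: "b \<in> B" for b
    unfolding vector_fields_def
  proof (intro CollectI conjI ballI allI impI)
    fix q assume q: "q \<in> pts N"
    show "X b q \<in> tangent N q"
    proof (cases "q \<in> U")
      case True
      have "X b q = \<rho> q *\<^sub>R chart_der U \<phi> q b" by (auto simp: X_def scaleR_fun_def)
      then show ?thesis
        using subspace_scale[OF subspace_tangent chart_der_tangent[OF True BV[OF b]]] by simp
    next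
      case False
      then have "X b q = 0" using \<rho>(7) \<rho>(8)[of q] U0 by (auto simp: X_def fun_eq_iff)
      then show ?thesis by (simp add: subspace_0[OF subspace_tangent])
    qed
  next
    fix q assume "q \<notin> pts N"
    then show "X b q = 0" using smooth_functions_outside[OF \<rho>(1)] by (auto simp: X_def fun_eq_iff)
  next
    fix f assume f: "f \<in> Sm"
    show "lie_fn (X b) f \<in> Sm"
      unfolding lie_fn_def X_def
      by (rule smooth_cutoff[OF \<rho>(1,6,7,8)]) (use smooth_near_chart_der[OF f _ BV[OF b]] U0 in auto)
  qed
  have xA: "x b q = \<phi> q \<bullet> b" if "q \<in> A" for b q using \<rho>(5)[OF that] by (simp add: x_def)
  have XA: "X b q = chart_der U \<phi> q b" if "q \<in> A" for b q using \<rho>(5)[OF that] by (simp add: X_def)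
  have AU: "A \<subseteq> U" using \<rho>(4) U0 by blast
  show thesis
  proof (rule that[OF \<rho>(2-4) xs XS xA XA])
    fix v q f assume q: "q \<in> A" and v: "v \<in> tangent N q" and f: "f \<in> Sm"
    show "v f = (\<Sum>b\<in>B. v (x b) * X b q f)"
      using tangent_chart_expand[OF B \<rho>(2) q AU xs xA v f] by (simp add: XA[OF q])
  next
    fix b c q assume b: "b \<in> B" and c: "c \<in> B" and q: "q \<in> A"
    have qU: "q \<in> U" using q AU by blast
    have "openin (top_of_set (model N)) (\<phi> ` A)"
      using adm_image_open[OF a \<rho>(2)] AU by (simp add: Int_absorb2)
    moreover have "(\<lambda>y. y \<bullet> c) differentiable (at (\<phi> q))"
      by (simp add: bounded_linear_imp_differentiable bounded_linear_inner_left)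
    moreover have "y \<bullet> c = (x c \<circ> inv_into U \<phi>) y" if "y \<in> \<phi> ` A" for y
      using that inv_chart AU xA by auto
    ultimately have "dird (x c \<circ> inv_into U \<phi>) (\<phi> q) b = frechet_derivative (\<lambda>y. y \<bullet> c) (at (\<phi> q)) b"
      by (intro has_dird(2)[OF subspace_model, of "\<phi> ` A" _ _ UNIV]) (use q BV[OF b] in auto)
    also have "frechet_derivative (\<lambda>y. y \<bullet> c) (at (\<phi> q)) = (\<lambda>y. y \<bullet> c)"
      using frechet_derivative_at[OF bounded_linear_imp_has_derivative[OF bounded_linear_inner_left]] by metis
    finally have "X b q (x c) = b \<bullet> c" by (simp add: XA[OF q] chart_der_def xs o_def)
    also have "\<dots> = (if b = c then 1 else 0)"
      using B(2,3) b c by (auto simp: pairwise_def orthogonal_def norm_eq_1)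
    finally show "X b q (x c) = (if b = c then 1 else 0)" .
  qed
qed

end

end

section \<open>Forms and Poisson structures\<close>

lemma eval_mv_Nil [simp]: "eval_mv Q [] p = Q p []"
  and eval_mv_1 [simp]: "eval_mv Q [\<alpha>] p = Q p [\<alpha> p]"
  and eval_mv_2 [simp]: "eval_mv Q [\<alpha>, \<beta>] p = Q p [\<alpha> p, \<beta> p]"
  by (simp_all add: eval_mv_def)

lemma alt_multilinear_2:
  assumes "F \<in> alt_multilinear V 2 B"
  shows "a \<in> V ==> b \<in> V ==> F [a, b] \<in> B"
    "a \<notin> V \<or> b \<notin> V ==> F [a, b] = 0"
    "a \<in> V ==> b \<in> V ==> c \<in> V ==> F [a + c, b] = F [a, b] + F [c, b]"
    "a \<in> V ==> b \<in> V ==> F [r *\<^sub>R a, b] = r *\<^sub>R F [a, b]"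
    "a \<in> V ==> b \<in> V ==> c \<in> V ==> F [a, b + c] = F [a, b] + F [a, c]"
    "a \<in> V ==> b \<in> V ==> F [a, r *\<^sub>R b] = r *\<^sub>R F [a, b]"
    "a \<in> V ==> F [a, a] = 0"
proof -
  have 1: "F xs \<in> B" if "length xs = 2" "set xs \<subseteq> V" for xs
    using assms that unfolding alt_multilinear_def by blast
  have 2: "F xs = 0" if "\<not> (length xs = 2 \<and> set xs \<subseteq> V)" for xs
    using assms that unfolding alt_multilinear_def by blast
  have 3: "linear_from V (\<lambda>a. F (xs[i := a]))" if "length xs = 2" "set xs \<subseteq> V" "i < 2" for xs i
    using assms that unfolding alt_multilinear_def by blast
  have 4: "F xs = 0" if "length xs = 2" "set xs \<subseteq> V" "xs ! 0 = xs ! 1" for xs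
  proof -
    have "\<forall>xs i j. length xs = 2 \<and> set xs \<subseteq> V \<and> i < j \<and> j < 2 \<and> xs ! i = xs ! j \<longrightarrow> F xs = 0"
      using assms unfolding alt_multilinear_def by blast
    from this[rule_format, of xs 0 1] that show ?thesis by simp
  qed
  show "a \<in> V ==> b \<in> V ==> F [a, b] \<in> B" by (rule 1) auto
  show "a \<notin> V \<or> b \<notin> V ==> F [a, b] = 0" by (rule 2) auto
  have l: "linear_from V (\<lambda>a. F [a, b])" if "b \<in> V" for b
  proof (cases "V = {}")
    case True then show ?thesis by (simp add: linear_from_def)
  next
    case False
    then obtain a where "a \<in> V" by blast
    then show ?thesis using 3[of "[a, b]" 0] that by simp
  qed
  have r: "linear_from V (\<lambda>b. F [a, b])" if "a \<in> V" for a
    using 3[of "[a, a]" 1] that by simp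
  show "a \<in> V ==> b \<in> V ==> c \<in> V ==> F [a + c, b] = F [a, b] + F [c, b]"
    "a \<in> V ==> b \<in> V ==> F [r *\<^sub>R a, b] = r *\<^sub>R F [a, b]"
    using l[of b] by (simp_all add: linear_from_def)
  show "a \<in> V ==> b \<in> V ==> c \<in> V ==> F [a, b + c] = F [a, b] + F [a, c]"
    "a \<in> V ==> b \<in> V ==> F [a, r *\<^sub>R b] = r *\<^sub>R F [a, b]"
    using r[of a] by (simp_all add: linear_from_def)
  show "a \<in> V ==> F [a, a] = 0" by (rule 4) auto
qed

lemma alt_multilinear_1:
  assumes "F \<in> alt_multilinear V 1 B"
  shows "a \<in> V ==> F [a] \<in> B" "a \<in> V ==> b \<in> V ==> F [a + b] = F [a] + F [b]"
    "a \<in> V ==> F [r *\<^sub>R a] = r *\<^sub>R F [a]"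
    "\<not> (length xs = 1 \<and> set xs \<subseteq> V) ==> F xs = 0"
proof -
  have 1: "F xs \<in> B" if "length xs = 1" "set xs \<subseteq> V" for xs
    using assms that unfolding alt_multilinear_def by blast
  have 3: "linear_from V (\<lambda>a. F (xs[i := a]))" if "length xs = 1" "set xs \<subseteq> V" "i < 1" for xs i
    using assms that unfolding alt_multilinear_def by blast
  show "a \<in> V ==> F [a] \<in> B" by (rule 1) auto
  show "\<not> (length xs = 1 \<and> set xs \<subseteq> V) ==> F xs = 0"
    using assms unfolding alt_multilinear_def by blast
  show "a \<in> V ==> b \<in> V ==> F [a + b] = F [a] + F [b]" "a \<in> V ==> F [r *\<^sub>R a] = r *\<^sub>R F [a]"
    using 3[of "[a]" 0] by (simp_all add: linear_from_def)
qed

lemma vector_fieldsD: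
  assumes "X \<in> vector_fields N"
  shows "p \<in> pts N ==> X p \<in> tangent N p" "p \<notin> pts N ==> X p = 0"
    "f \<in> smooth_functions N ==> (\<lambda>p. X p f) \<in> smooth_functions N"
  using assms by (auto simp: vector_fields_def lie_fn_def)

lemma one_formsD:
  assumes "\<alpha> \<in> one_forms N"
  shows "p \<in> pts N ==> \<alpha> p \<in> cotangent N p" "p \<notin> pts N ==> \<alpha> p = 0"
    "X \<in> vector_fields N ==> (\<lambda>p. \<alpha> p (X p)) \<in> smooth_functions N"
  using assms by (auto simp: one_forms_def pairing_def)

lemma vector_fieldsI:
  assumes "\<And>p. p \<in> pts N ==> X p \<in> tangent N p" "\<And>p. p \<notin> pts N ==> X p = 0"
    "\<And>f. f \<in> smooth_functions N ==> (\<lambda>p. X p f) \<in> smooth_functions N"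
  shows "X \<in> vector_fields N"
  using assms by (auto simp: vector_fields_def lie_fn_def)

lemma one_formsI:
  assumes "\<And>p. p \<in> pts N ==> \<alpha> p \<in> cotangent N p" "\<And>p. p \<notin> pts N ==> \<alpha> p = 0"
    "\<And>X. X \<in> vector_fields N ==> (\<lambda>p. \<alpha> p (X p)) \<in> smooth_functions N"
  shows "\<alpha> \<in> one_forms N"
  using assms by (auto simp: one_forms_def pairing_def)

lemma differential_apply [simp]: "p \<in> pts N ==> v \<in> tangent N p ==> differential N f p v = v f"
  by (simp add: differential_def)

context manifold
begin

lemma frame_at:
  assumes "mopen U0" "p \<in> U0"
  obtains B :: "'e set" and A x X where "finite B" "mopen A" "p \<in> A" "A \<subseteq> U0"
    "\<And>b. b \<in> B ==> x b \<in> Sm" "\<And>b. b \<in> B ==> X b \<in> VF"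
    "\<And>v q f. q \<in> A ==> v \<in> tangent N q ==> f \<in> Sm ==> v f = (\<Sum>b\<in>B. v (x b) * X b q f)"
    "\<And>b c q. b \<in> B ==> c \<in> B ==> q \<in> A ==> X b q (x c) = (if b = c then 1 else 0)"
proof -
  have "p \<in> pts N" using assms mopen_subset by blast
  then obtain U \<phi> where c: "(U, \<phi>) \<in> charts N" "p \<in> U" by (rule charts_cover)
  note a = charts_adm[OF c(1)]
  obtain B where B: "B \<subseteq> model N" "pairwise orthogonal B" "\<And>b. b \<in> B ==> norm b = 1"
      "independent B" "span B = model N"
    by (rule orthonormal_basis_subspace[OF subspace_model]) (rule that)
  have fB: "finite B" by (rule independent_imp_finite[OF B(4)])
  have U: "mopen (U0 \<inter> U)" "p \<in> U0 \<inter> U" "U0 \<inter> U \<subseteq> U"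
    using assms c adm_open[OF a] by auto
  obtain A x X where A: "mopen A" "p \<in> A" "A \<subseteq> U0 \<inter> U"
    "\<And>b. b \<in> B ==> x b \<in> Sm" "\<And>b. b \<in> B ==> X b \<in> VF"
    "\<And>b q. b \<in> B ==> q \<in> A ==> x b q = \<phi> q \<bullet> b"
    "\<And>b q. b \<in> B ==> q \<in> A ==> X b q = chart_der U \<phi> q b"
    "\<And>v q f. q \<in> A ==> v \<in> tangent N q ==> f \<in> Sm ==> v f = (\<Sum>b\<in>B. v (x b) * X b q f)"
    "\<And>b c q. b \<in> B ==> c \<in> B ==> q \<in> A ==> X b q (x c) = (if b = c then 1 else 0)"
    by (rule frame[OF a fB B(2,3,5) U]) (assumption, rule that)
  show thesis by (rule that[OF fB A(1,2) _ A(4,5,8,9)]) (use A(3) in auto)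
qed

lemma frame_tangent_expand:
  assumes "v \<in> tangent N q" "\<And>b. b \<in> B ==> w b \<in> tangent N q"
    "\<And>f. f \<in> Sm ==> v f = (\<Sum>b\<in>B. c b * w b f)"
  shows "v = (\<Sum>b\<in>B. c b *\<^sub>R w b)"
proof
  fix f show "v f = (\<Sum>b\<in>B. c b *\<^sub>R w b) f"
  proof (cases "f \<in> Sm")
    case True then show ?thesis using assms(3) by (simp add: sum_fun_apply)
  next
    case False
    then show ?thesis using tangentD(4)[OF assms(1)] tangentD(4)[OF assms(2)] by (simp add: sum_fun_apply)
  qed
qed

lemma subspace_vector_fields: "subspace (VF)"
proof (rule subspaceI)
  show "0 \<in> VF"
    using subspace_0[OF subspace_tangent] smooth_intros(1)
    by (intro vector_fieldsI) (simp_all add: zero_fun_def)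
next
  fix X Y assume XY: "X \<in> VF" "Y \<in> VF"
  have e: "(\<lambda>p. (X + Y) p f) = (\<lambda>p. X p f) + (\<lambda>p. Y p f)" for f by auto
  show "X + Y \<in> VF"
  proof (rule vector_fieldsI)
    fix f assume f: "f \<in> Sm"
    show "(\<lambda>p. (X + Y) p f) \<in> Sm"
      unfolding e by (rule smooth_intros(2)[OF vector_fieldsD(3)[OF XY(1) f] vector_fieldsD(3)[OF XY(2) f]])
  next
    fix p assume p: "p \<notin> pts N"
    show "(X + Y) p = 0" using vector_fieldsD(2)[OF XY(1) p] vector_fieldsD(2)[OF XY(2) p] by (auto simp: fun_eq_iff)
  qed (simp_all only: plus_fun_apply subspace_add[OF subspace_tangent] vector_fieldsD(1)[OF XY(1)] vector_fieldsD(1)[OF XY(2)])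
next
  fix c X assume X: "X \<in> VF"
  have e: "(\<lambda>p. (c *\<^sub>R X) p f) = c *\<^sub>R (\<lambda>p. X p f)" for f by auto
  show "c *\<^sub>R X \<in> VF"
  proof (rule vector_fieldsI)
    fix f assume f: "f \<in> Sm"
    show "(\<lambda>p. (c *\<^sub>R X) p f) \<in> Sm"
      unfolding e by (rule smooth_intros(5)[OF vector_fieldsD(3)[OF X f]])
  next
    fix p assume p: "p \<notin> pts N"
    show "(c *\<^sub>R X) p = 0" using vector_fieldsD(2)[OF X p] by (auto simp: fun_eq_iff)
  qed (simp_all only: scaleR_fun_apply subspace_scale[OF subspace_tangent] vector_fieldsD(1)[OF X])
qed

text \<open>Extend with constant coefficients in a local frame.\<close>

lemma tangent_extend:
  assumes "v \<in> tangent N p" "p \<in> pts N"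
  obtains Y where "Y \<in> VF" "Y p = v"
proof -
  obtain B :: "'e set" and A x X where F: "finite B" "mopen A" "p \<in> A" "A \<subseteq> pts N"
    "\<And>b. b \<in> B ==> x b \<in> Sm" "\<And>b. b \<in> B ==> X b \<in> VF"
    "\<And>v q f. q \<in> A ==> v \<in> tangent N q ==> f \<in> Sm ==> v f = (\<Sum>b\<in>B. v (x b) * X b q f)"
    "\<And>b c q. b \<in> B ==> c \<in> B ==> q \<in> A ==> X b q (x c) = (if b = c then 1 else 0)"
    by (rule frame_at[OF mopen_pts assms(2)]) (rule that)
  have "v = (\<Sum>b\<in>B. v (x b) *\<^sub>R X b p)"
    by (rule frame_tangent_expand[OF assms(1)])
      (use F(7)[OF F(3) assms(1)] vector_fieldsD(1)[OF F(6) assms(2)] in auto)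
  then have "(\<Sum>b\<in>B. v (x b) *\<^sub>R X b) p = v" by (simp add: sum_fun_apply)
  moreover have "(\<Sum>b\<in>B. v (x b) *\<^sub>R X b) \<in> VF"
    by (intro subspace_sum subspace_scale subspace_vector_fields F(6))
  ultimately show thesis by (rule that[rotated])
qed

lemma differential_cotangent: "p \<in> pts N ==> dN f p \<in> cotangent N p"
  by (rule cotangentI) (auto simp: differential_def subspace_add[OF subspace_tangent] subspace_scale[OF subspace_tangent])

lemma differential_one_form:
  assumes "f \<in> Sm" shows "dN f \<in> Om"
  unfolding one_forms_def
proof (intro CollectI conjI ballI allI impI differential_cotangent)
  fix X assume X: "X \<in> VF"
  have "pairing (dN f) X = (\<lambda>p. X p f)"
    using vector_fieldsD(1,2)[OF X] by (auto simp: pairing_def differential_def)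
  then show "pairing (dN f) X \<in> Sm" using vector_fieldsD(3)[OF X assms] by simp
qed (auto simp: differential_def)

lemma differential_outside:
  assumes "f \<notin> Sm" shows "dN f = 0"
  by (auto simp: differential_def tangentD(4)[OF _ assms] fun_eq_iff)

lemma differential_add:
  "f \<in> Sm ==> g \<in> Sm ==> dN (f + g) p = dN f p + dN g p"
  by (auto simp: differential_def tangentD fun_eq_iff)

lemma differential_scaleR:
  "f \<in> Sm ==> dN (c *\<^sub>R f) p = c *\<^sub>R dN f p"
  by (auto simp: differential_def tangentD fun_eq_iff)

lemma differential_mult:
  "f \<in> Sm ==> g \<in> Sm ==>
    dN (f * g) p = f p *\<^sub>R dN g p + g p *\<^sub>R dN f p"
  by (auto simp: differential_def tangentD fun_eq_iff)

lemma differential_local: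
  assumes "f \<in> Sm" "g \<in> Sm" "mopen A" "p \<in> A" "\<And>q. q \<in> A ==> f q = g q"
  shows "dN f p = dN g p"
  using tangent_local[OF _ assms] by (auto simp: differential_def fun_eq_iff)

lemma subspace_one_forms: "subspace (Om)"
proof (rule subspaceI)
  show "0 \<in> Om"
    using subspace_0[OF subspace_cotangent] smooth_intros(1)
    by (intro one_formsI) (simp_all add: zero_fun_def)
next
  fix X Y assume XY: "X \<in> Om" "Y \<in> Om"
  have e: "(\<lambda>p. (X + Y) p (Z p)) = (\<lambda>p. X p (Z p)) + (\<lambda>p. Y p (Z p))" for Z :: "'p vfield" by auto
  show "X + Y \<in> Om"
  proof (rule one_formsI)
    fix Z assume f: "Z \<in> VF"
    show "(\<lambda>p. (X + Y) p (Z p)) \<in> Sm"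
      unfolding e by (rule smooth_intros(2)[OF one_formsD(3)[OF XY(1) f] one_formsD(3)[OF XY(2) f]])
  next
    fix p assume p: "p \<notin> pts N"
    show "(X + Y) p = 0" using one_formsD(2)[OF XY(1) p] one_formsD(2)[OF XY(2) p] by (auto simp: fun_eq_iff)
  qed (simp_all only: plus_fun_apply subspace_add[OF subspace_cotangent] one_formsD(1)[OF XY(1)] one_formsD(1)[OF XY(2)])
next
  fix c X assume X: "X \<in> Om"
  have e: "(\<lambda>p. (c *\<^sub>R X) p (Z p)) = c *\<^sub>R (\<lambda>p. X p (Z p))" for Z :: "'p vfield" by auto
  show "c *\<^sub>R X \<in> Om"
  proof (rule one_formsI)
    fix Z assume f: "Z \<in> VF"
    show "(\<lambda>p. (c *\<^sub>R X) p (Z p)) \<in> Sm"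
      unfolding e by (rule smooth_intros(5)[OF one_formsD(3)[OF X f]])
  next
    fix p assume p: "p \<notin> pts N"
    show "(c *\<^sub>R X) p = 0" using one_formsD(2)[OF X p] by (auto simp: fun_eq_iff)
  qed (simp_all only: scaleR_fun_apply subspace_scale[OF subspace_cotangent] one_formsD(1)[OF X])
qed

text \<open>Tangent vectors extend to global fields, so covectors may be compared on values of
  fields, the form in which Lie derivatives and Koszul brackets are given.\<close>

lemma cotangent_eqI:
  assumes "a \<in> cotangent N p" "b \<in> cotangent N p" "p \<in> pts N"
    "\<And>Y. Y \<in> VF ==> a (Y p) = b (Y p)"
  shows "a = b"
proof
  fix v show "a v = b v"
  proof (cases "v \<in> tangent N p")
    case True
    obtain Y where "Y \<in> VF" "Y p = v" by (rule tangent_extend[OF True assms(3)])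
    then show ?thesis using assms(4) by blast
  qed (simp add: cotangentD(3)[OF assms(1)] cotangentD(3)[OF assms(2)])
qed

lemma one_forms_eqI:
  assumes "\<alpha> \<in> Om" "\<beta> \<in> Om"
    "\<And>Y p. Y \<in> VF ==> p \<in> pts N ==> \<alpha> p (Y p) = \<beta> p (Y p)"
  shows "\<alpha> = \<beta>"
proof
  fix p show "\<alpha> p = \<beta> p"
  proof (cases "p \<in> pts N")
    case True
    then show ?thesis
      by (intro cotangent_eqI[OF one_formsD(1)[OF assms(1)] one_formsD(1)[OF assms(2)]] assms(3))
  qed (simp add: one_formsD(2)[OF assms(1)] one_formsD(2)[OF assms(2)])
qed

section \<open>Lie brackets and Lie derivatives of one-forms\<close>

lemma lie_bracket_apply:
  "f \<in> Sm ==> lie_bracket N X Y p f = X p (\<lambda>q. Y q f) - Y p (\<lambda>q. X q f)"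
  by (simp add: lie_bracket_def lie_fn_def)

lemma lie_bracket_vector_field:
  assumes X: "X \<in> VF" and Y: "Y \<in> VF"
  shows "lie_bracket N X Y \<in> VF"
  unfolding vector_fields_def
proof (intro CollectI conjI ballI allI impI)
  fix p assume p: "p \<in> pts N"
  note Xp = vector_fieldsD(1)[OF X] and Yp = vector_fieldsD(1)[OF Y]
  note sX = vector_fieldsD(3)[OF X] and sY = vector_fieldsD(3)[OF Y]
  have add: "(\<lambda>q. Z q (f + g)) = (\<lambda>q. Z q f) + (\<lambda>q. Z q g)"
    if "Z \<in> VF" "f \<in> Sm" "g \<in> Sm" for Z f g
  proof
    fix q show "Z q (f + g) = ((\<lambda>q. Z q f) + (\<lambda>q. Z q g)) q"
      using that tangentD(1)[OF vector_fieldsD(1)[OF that(1)], of q f g] vector_fieldsD(2)[OF that(1), of q]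
      by (cases "q \<in> pts N") auto
  qed
  have scale: "(\<lambda>q. Z q (c *\<^sub>R f)) = c *\<^sub>R (\<lambda>q. Z q f)"
    if "Z \<in> VF" "f \<in> Sm" for Z f c
  proof
    fix q show "Z q (c *\<^sub>R f) = (c *\<^sub>R (\<lambda>q. Z q f)) q"
      using that tangentD(2)[OF vector_fieldsD(1)[OF that(1)], of q f c] vector_fieldsD(2)[OF that(1), of q]
      by (cases "q \<in> pts N") auto
  qed
  have mult: "(\<lambda>q. Z q (f * g)) = f * (\<lambda>q. Z q g) + g * (\<lambda>q. Z q f)"
    if "Z \<in> VF" "f \<in> Sm" "g \<in> Sm" for Z f g
  proof
    fix q show "Z q (f * g) = (f * (\<lambda>q. Z q g) + g * (\<lambda>q. Z q f)) q"
      using that tangentD(3)[OF vector_fieldsD(1)[OF that(1)], of q f g] vector_fieldsD(2)[OF that(1), of q]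
      by (cases "q \<in> pts N") auto
  qed
  show "lie_bracket N X Y p \<in> tangent N p"
  proof (rule tangentI)
    fix f g assume fg: "f \<in> Sm" "g \<in> Sm"
    show "lie_bracket N X Y p (f + g) = lie_bracket N X Y p f + lie_bracket N X Y p g"
      using fg by (simp only: lie_bracket_apply smooth_intros(2) add[OF X fg] add[OF Y fg]
        tangentD(1)[OF Xp[OF p] sY sY] tangentD(1)[OF Yp[OF p] sX sX])
    show "lie_bracket N X Y p (f * g) = f p * lie_bracket N X Y p g + g p * lie_bracket N X Y p f"
      using fg
      by (simp add: lie_bracket_apply smooth_mult mult[OF X fg] mult[OF Y fg]
        tangentD(1,3)[OF Xp[OF p]] tangentD(1,3)[OF Yp[OF p]] smooth_mult sX sY algebra_simps)
  next
    fix c f assume f: "f \<in> Sm"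
    show "lie_bracket N X Y p (c *\<^sub>R f) = c * lie_bracket N X Y p f"
      using f by (simp only: lie_bracket_apply smooth_intros(5) scale[OF X f] scale[OF Y f]
        tangentD(2)[OF Xp[OF p] sY] tangentD(2)[OF Yp[OF p] sX] right_diff_distrib)
  qed (simp add: lie_bracket_def)
next
  fix p assume "p \<notin> pts N"
  then show "lie_bracket N X Y p = 0"
    using vector_fieldsD(2)[OF X, of p] vector_fieldsD(2)[OF Y, of p] by (auto simp: lie_bracket_def fun_eq_iff)
next
  fix f assume f: "f \<in> Sm"
  have "lie_fn (lie_bracket N X Y) f = (\<lambda>p. X p (\<lambda>q. Y q f)) - (\<lambda>p. Y p (\<lambda>q. X q f))"
    using f by (auto simp: lie_fn_def lie_bracket_apply)
  then show "lie_fn (lie_bracket N X Y) f \<in> Sm"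
    using smooth_intros(3)[OF vector_fieldsD(3)[OF X vector_fieldsD(3)[OF Y f]]
      vector_fieldsD(3)[OF Y vector_fieldsD(3)[OF X f]]] by simp
qed

text \<open>The pairing of the Lie derivative of \<beta> along X with Y. As written it involves Y
  near p and not only Y p; \<open>lie_form_value_zero\<close> removes this dependence.\<close>

definition lie_form_value :: "'p vfield \<Rightarrow> 'p form \<Rightarrow> 'p vfield \<Rightarrow> 'p \<Rightarrow> real"
  where "lie_form_value X \<beta> Y p = X p (\<lambda>q. \<beta> q (Y q)) - \<beta> p (lie_bracket N X Y p)"

lemma lie_form_value_add:
  assumes X: "X \<in> VF" and \<beta>: "\<beta> \<in> Om" and Y: "Y \<in> VF" "Z \<in> VF"
    and p: "p \<in> pts N"
  shows "lie_form_value X \<beta> (Y + Z) p = lie_form_value X \<beta> Y p + lie_form_value X \<beta> Z p"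
    "lie_form_value X \<beta> (c *\<^sub>R Y) p = c * lie_form_value X \<beta> Y p"
proof -
  note Xp = vector_fieldsD(1)[OF X p]
  note lb = vector_fieldsD(1)[OF lie_bracket_vector_field[OF X] p]
  have "(\<lambda>q. \<beta> q ((Y + Z) q)) = (\<lambda>q. \<beta> q (Y q)) + (\<lambda>q. \<beta> q (Z q))"
  proof
    fix q show "\<beta> q ((Y + Z) q) = ((\<lambda>q. \<beta> q (Y q)) + (\<lambda>q. \<beta> q (Z q))) q"
      using cotangentD(1)[OF one_formsD(1)[OF \<beta>] vector_fieldsD(1)[OF Y(1)] vector_fieldsD(1)[OF Y(2)], of q]
        one_formsD(2)[OF \<beta>, of q] by (cases "q \<in> pts N") auto
  qed
  moreover have "lie_bracket N X (Y + Z) p = lie_bracket N X Y p + lie_bracket N X Z p"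
  proof
    fix f
    have "(\<lambda>q. (Y + Z) q f) = (\<lambda>q. Y q f) + (\<lambda>q. Z q f)" by auto
    then show "lie_bracket N X (Y + Z) p f = (lie_bracket N X Y p + lie_bracket N X Z p) f"
      using tangentD(1)[OF Xp vector_fieldsD(3)[OF Y(1)] vector_fieldsD(3)[OF Y(2)], of f f]
      by (auto simp: lie_bracket_def lie_fn_def)
  qed
  ultimately show "lie_form_value X \<beta> (Y + Z) p = lie_form_value X \<beta> Y p + lie_form_value X \<beta> Z p"
    using tangentD(1)[OF Xp one_formsD(3)[OF \<beta> Y(1)] one_formsD(3)[OF \<beta> Y(2)]]
      cotangentD(1)[OF one_formsD(1)[OF \<beta> p] lb[OF Y(1)] lb[OF Y(2)]]
    by (simp add: lie_form_value_def)
  have "(\<lambda>q. \<beta> q ((c *\<^sub>R Y) q)) = c *\<^sub>R (\<lambda>q. \<beta> q (Y q))"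
  proof
    fix q show "\<beta> q ((c *\<^sub>R Y) q) = (c *\<^sub>R (\<lambda>q. \<beta> q (Y q))) q"
      using cotangentD(2)[OF one_formsD(1)[OF \<beta>] vector_fieldsD(1)[OF Y(1)], of q c]
        one_formsD(2)[OF \<beta>, of q] by (cases "q \<in> pts N") auto
  qed
  moreover have "lie_bracket N X (c *\<^sub>R Y) p = c *\<^sub>R lie_bracket N X Y p"
  proof
    fix f
    have "(\<lambda>q. (c *\<^sub>R Y) q f) = c *\<^sub>R (\<lambda>q. Y q f)" by auto
    then show "lie_bracket N X (c *\<^sub>R Y) p f = (c *\<^sub>R lie_bracket N X Y p) f"
      using tangentD(2)[OF Xp vector_fieldsD(3)[OF Y(1)], of f c]
      by (auto simp: lie_bracket_def lie_fn_def right_diff_distrib)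
  qed
  ultimately show "lie_form_value X \<beta> (c *\<^sub>R Y) p = c * lie_form_value X \<beta> Y p"
    using tangentD(2)[OF Xp one_formsD(3)[OF \<beta> Y(1)], of c]
      cotangentD(2)[OF one_formsD(1)[OF \<beta> p] lb[OF Y(1)], of c]
    by (simp add: lie_form_value_def right_diff_distrib)
qed

text \<open>The Leibniz rule at a common zero of the first factors, where only the terms
  differentiating these factors survive.\<close>

lemma tangent_of_product_sum:
  assumes v: "v \<in> tangent N p" and A: "mopen A" "p \<in> A" and h: "h \<in> Sm"
    and s: "\<And>b. b \<in> B ==> f b \<in> Sm" "\<And>b. b \<in> B ==> g b \<in> Sm"
    and e: "\<And>q. q \<in> A ==> h q = (\<Sum>b\<in>B. f b q * g b q)" and z: "\<And>b. b \<in> B ==> f b p = 0"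
  shows "v h = (\<Sum>b\<in>B. v (f b) * g b p)"
proof -
  have fg: "f b * g b \<in> Sm" if "b \<in> B" for b
    by (intro smooth_mult s that)
  have "v h = v (\<Sum>b\<in>B. f b * g b)"
    by (rule tangent_local[OF v h smooth_intros(6)[OF fg] A]) (simp_all add: sum_fun_apply e)
  also have "\<dots> = (\<Sum>b\<in>B. v (f b * g b))" by (rule tangent_sum[OF v fg])
  also have "\<dots> = (\<Sum>b\<in>B. v (f b) * g b p)"
    by (rule sum.cong[OF refl]) (simp add: tangentD(3)[OF v s(1) s(2)] z)
  finally show ?thesis .
qed

text \<open>Expand Y near p in a frame; its coefficients vanish at p. Then X of \<beta>(Y) and
  \<beta> of the commutator reduce to the same sum, of derivatives of the coefficients times \<beta>
  on the frame, and cancel.\<close>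

lemma lie_form_value_zero:
  assumes X: "X \<in> VF" and \<beta>: "\<beta> \<in> Om" and Y: "Y \<in> VF"
    and p: "p \<in> pts N" and Yp: "Y p = 0"
  shows "lie_form_value X \<beta> Y p = 0"
proof -
  obtain B :: "'e set" and A x E where F: "finite B" "mopen A" "p \<in> A" "A \<subseteq> pts N"
    "\<And>b. b \<in> B ==> x b \<in> Sm" "\<And>b. b \<in> B ==> E b \<in> VF"
    "\<And>v q f. q \<in> A ==> v \<in> tangent N q ==> f \<in> Sm ==> v f = (\<Sum>b\<in>B. v (x b) * E b q f)"
    "\<And>b c q. b \<in> B ==> c \<in> B ==> q \<in> A ==> E b q (x c) = (if b = c then 1 else 0)"
    by (rule frame_at[OF mopen_pts p]) (rule that)
  note Xp = vector_fieldsD(1)[OF X p]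
  have EB: "E b q \<in> tangent N q" if "b \<in> B" "q \<in> A" for b q
    using vector_fieldsD(1)[OF F(6)[OF that(1)]] that(2) F(4) by blast
  have YE: "Y q = (\<Sum>b\<in>B. Y q (x b) *\<^sub>R E b q)" if "q \<in> A" for q
  proof -
    have Yt: "Y q \<in> tangent N q" using vector_fieldsD(1)[OF Y] that F(4) by blast
    show ?thesis by (rule frame_tangent_expand[OF Yt EB[OF _ that] F(7)[OF that Yt]])
  qed
  have "X p (\<lambda>q. \<beta> q (Y q)) = (\<Sum>b\<in>B. X p (\<lambda>q. Y q (x b)) * \<beta> p (E b p))"
  proof (rule tangent_of_product_sum[OF Xp F(2,3) one_formsD(3)[OF \<beta> Y] vector_fieldsD(3)[OF Y F(5)] one_formsD(3)[OF \<beta> F(6)]])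
    fix q assume q: "q \<in> A"
    then have "\<beta> q (Y q) = \<beta> q (\<Sum>b\<in>B. Y q (x b) *\<^sub>R E b q)" using YE by simp
    also have "\<dots> = (\<Sum>b\<in>B. Y q (x b) * \<beta> q (E b q))"
      by (rule cotangent_sum[OF one_formsD(1)[OF \<beta>]]) (use q F(4) EB in auto)
    finally show "\<beta> q (Y q) = (\<Sum>b\<in>B. Y q (x b) * \<beta> q (E b q))" .
  qed (simp_all add: Yp)
  moreover have "lie_bracket N X Y p = (\<Sum>b\<in>B. X p (\<lambda>q. Y q (x b)) *\<^sub>R E b p)"
  proof (rule frame_tangent_expand[OF vector_fieldsD(1)[OF lie_bracket_vector_field[OF X Y] p] EB[OF _ F(3)]])
    fix f assume f: "f \<in> Sm"
    have "X p (\<lambda>q. Y q f) = (\<Sum>b\<in>B. X p (\<lambda>q. Y q (x b)) * E b p f)"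
      by (rule tangent_of_product_sum[OF Xp F(2,3) vector_fieldsD(3)[OF Y f] vector_fieldsD(3)[OF Y F(5)] vector_fieldsD(3)[OF F(6) f]])
        (use F(4,7) f vector_fieldsD(1)[OF Y] in \<open>auto simp: Yp\<close>)
    then show "lie_bracket N X Y p f = (\<Sum>b\<in>B. X p (\<lambda>q. Y q (x b)) * E b p f)"
      using f by (simp add: lie_bracket_apply Yp)
  qed
  moreover have "\<beta> p (\<Sum>b\<in>B. X p (\<lambda>q. Y q (x b)) *\<^sub>R E b p) = (\<Sum>b\<in>B. X p (\<lambda>q. Y q (x b)) * \<beta> p (E b p))"
    by (rule cotangent_sum[OF one_formsD(1)[OF \<beta> p]]) (rule EB[OF _ F(3)])
  ultimately show ?thesis by (simp only: lie_form_value_def diff_self)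
qed

text \<open>The value on a tangent vector is computed with an arbitrary extending field. Two
  extensions differ by a field that vanishes at p, so linearity in Y and
  \<open>lie_form_value_zero\<close> make the value well defined, and the result is the object
  picked by \<open>THE\<close>.\<close>

lemma lie_form:
  assumes X: "X \<in> VF" and \<beta>: "\<beta> \<in> Om"
  shows "lie_form N X \<beta> \<in> Om"
    "Y \<in> VF ==> p \<in> pts N ==> lie_form N X \<beta> p (Y p) = lie_form_value X \<beta> Y p"
proof -
  have pairing_eq: "lie_fn X (pairing \<beta> Y) - pairing \<beta> (lie_bracket N X Y) = lie_form_value X \<beta> Y" for Y
    by (auto simp: lie_fn_def pairing_def lie_form_value_def)
  have well: "lie_form_value X \<beta> Y p = lie_form_value X \<beta> Z p"
    if "Y \<in> VF" "Z \<in> VF" "p \<in> pts N" "Y p = Z p" for Y Z p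
  proof -
    have m: "(-1) *\<^sub>R Z \<in> VF" by (intro subspace_scale subspace_vector_fields that(2))
    have "lie_form_value X \<beta> (Y + (-1) *\<^sub>R Z) p = 0"
      by (rule lie_form_value_zero[OF X \<beta> subspace_add[OF subspace_vector_fields that(1) m] that(3)]) (use that in simp)
    then show ?thesis
      using lie_form_value_add[OF X \<beta> that(1) m that(3)] lie_form_value_add(2)[OF X \<beta> that(2,2,3), of "-1"] by simp
  qed
  define \<omega> where "\<omega> p v = (if p \<in> pts N \<and> v \<in> tangent N p
    then lie_form_value X \<beta> (SOME Y. Y \<in> VF \<and> Y p = v) p else 0)" for p v
  have \<omega>: "\<omega> p (Y p) = lie_form_value X \<beta> Y p" if "Y \<in> VF" "p \<in> pts N" for Y p
  proof -
    let ?Z = "SOME Z. Z \<in> VF \<and> Z p = Y p"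
    have Z: "?Z \<in> VF \<and> ?Z p = Y p"
      by (rule someI[of _ Y]) (use that in simp)
    have "\<omega> p (Y p) = lie_form_value X \<beta> ?Z p"
      using that vector_fieldsD(1)[OF that] by (simp add: \<omega>_def)
    also have "\<dots> = lie_form_value X \<beta> Y p"
      by (rule well[OF conjunct1[OF Z] that conjunct2[OF Z]])
    finally show ?thesis .
  qed
  have \<omega>1: "\<omega> \<in> Om"
    unfolding one_forms_def
  proof (intro CollectI conjI ballI allI impI)
    fix p assume p: "p \<in> pts N"
    show "\<omega> p \<in> cotangent N p"
    proof (rule cotangentI)
      fix v w assume v: "v \<in> tangent N p" and w: "w \<in> tangent N p"
      obtain Y where Y: "Y \<in> VF" "Y p = v" by (rule tangent_extend[OF v p])
      obtain Z where Z: "Z \<in> VF" "Z p = w" by (rule tangent_extend[OF w p])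
      show "\<omega> p (v + w) = \<omega> p v + \<omega> p w"
        using \<omega>[OF subspace_add[OF subspace_vector_fields Y(1) Z(1)] p] \<omega>[OF Y(1) p] \<omega>[OF Z(1) p]
          lie_form_value_add(1)[OF X \<beta> Y(1) Z(1) p] Y(2) Z(2) by simp
    next
      fix c v assume v: "v \<in> tangent N p"
      obtain Y where Y: "Y \<in> VF" "Y p = v" by (rule tangent_extend[OF v p])
      show "\<omega> p (c *\<^sub>R v) = c * \<omega> p v"
        using \<omega>[OF subspace_scale[OF subspace_vector_fields Y(1)] p] \<omega>[OF Y(1) p]
          lie_form_value_add(2)[OF X \<beta> Y(1) Y(1) p] Y(2) by simp
    qed (simp add: \<omega>_def)
  next
    fix p assume "p \<notin> pts N" then show "\<omega> p = 0" by (auto simp: \<omega>_def)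
  next
    fix Y assume Y: "Y \<in> VF"
    have "pairing \<omega> Y = (\<lambda>p. X p (\<lambda>q. \<beta> q (Y q))) - (\<lambda>p. \<beta> p (lie_bracket N X Y p))"
    proof
      fix p show "pairing \<omega> Y p = ((\<lambda>p. X p (\<lambda>q. \<beta> q (Y q))) - (\<lambda>p. \<beta> p (lie_bracket N X Y p))) p"
        using \<omega>[OF Y, of p] vector_fieldsD(2)[OF X, of p] one_formsD(2)[OF \<beta>, of p]
        by (cases "p \<in> pts N") (auto simp: pairing_def lie_form_value_def \<omega>_def)
    qed
    then show "pairing \<omega> Y \<in> Sm"
      using smooth_intros(3)[OF vector_fieldsD(3)[OF X one_formsD(3)[OF \<beta> Y]]
        one_formsD(3)[OF \<beta> lie_bracket_vector_field[OF X Y]]] by simp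
  qed
  have val: "lie_form_value X \<beta> Y p = 0" if "p \<notin> pts N" for Y p
    using vector_fieldsD(2)[OF X that] one_formsD(2)[OF \<beta> that] by (simp add: lie_form_value_def)
  have "lie_form N X \<beta> = \<omega>"
    unfolding lie_form_def pairing_eq
  proof (rule the_equality)
    have "pairing \<omega> Y = lie_form_value X \<beta> Y" if "Y \<in> VF" for Y
    proof
      fix p show "pairing \<omega> Y p = lie_form_value X \<beta> Y p"
        using \<omega>[OF that, of p] val[of p Y] by (cases "p \<in> pts N") (auto simp: pairing_def \<omega>_def)
    qed
    then show "\<omega> \<in> Om \<and> (\<forall>Y\<in>VF. pairing \<omega> Y = lie_form_value X \<beta> Y)"
      using \<omega>1 by simp
  next
    fix \<omega>' assume h: "\<omega>' \<in> Om \<and> (\<forall>Y\<in>VF. pairing \<omega>' Y = lie_form_value X \<beta> Y)"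
    show "\<omega>' = \<omega>"
    proof (rule one_forms_eqI[OF conjunct1[OF h] \<omega>1])
      fix Y p assume Y: "Y \<in> VF" and p: "p \<in> pts N"
      have "pairing \<omega>' Y p = lie_form_value X \<beta> Y p" using h Y by simp
      then show "\<omega>' p (Y p) = \<omega> p (Y p)" using \<omega>[OF Y p] by (simp add: pairing_def)
    qed
  qed
  then show "lie_form N X \<beta> \<in> Om"
    "Y \<in> VF ==> p \<in> pts N ==> lie_form N X \<beta> p (Y p) = lie_form_value X \<beta> Y p"
    using \<omega>1 \<omega> by simp_all
qed

lemma tangent_uminus: "v \<in> tangent N p ==> f \<in> Sm ==> v (- f) = - v f"
  using tangentD(2)[of v N p f "-1"] by simp

lemma vector_field_pairing_add:
  assumes "\<alpha> \<in> Om" "\<beta> \<in> Om" "v \<in> tangent N p" "Y \<in> VF"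
  shows "v (\<lambda>q. (\<alpha> + \<beta>) q (Y q)) = v (\<lambda>q. \<alpha> q (Y q)) + v (\<lambda>q. \<beta> q (Y q))"
proof -
  have "(\<lambda>q. (\<alpha> + \<beta>) q (Y q)) = (\<lambda>q. \<alpha> q (Y q)) + (\<lambda>q. \<beta> q (Y q))" by auto
  then show ?thesis
    using tangentD(1)[OF assms(3) one_formsD(3)[OF assms(1,4)] one_formsD(3)[OF assms(2,4)]] by simp
qed

lemma lie_form_value_add_form:
  assumes X: "X \<in> VF" and "\<alpha> \<in> Om" "\<beta> \<in> Om" and Y: "Y \<in> VF" and p: "p \<in> pts N"
  shows "lie_form_value X (\<alpha> + \<beta>) Y p = lie_form_value X \<alpha> Y p + lie_form_value X \<beta> Y p"
  unfolding lie_form_value_def vector_field_pairing_add[OF assms(2,3) vector_fieldsD(1)[OF X p] Y] by simp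

lemma lie_form_value_add_field:
  assumes X: "X \<in> VF" "Z \<in> VF" and \<alpha>: "\<alpha> \<in> Om"
    and Y: "Y \<in> VF" and p: "p \<in> pts N"
  shows "lie_form_value (X + Z) \<alpha> Y p = lie_form_value X \<alpha> Y p + lie_form_value Z \<alpha> Y p"
proof -
  have "lie_bracket N (X + Z) Y p = lie_bracket N X Y p + lie_bracket N Z Y p"
  proof
    fix f
    have "(\<lambda>q. (X + Z) q f) = (\<lambda>q. X q f) + (\<lambda>q. Z q f)" by auto
    then show "lie_bracket N (X + Z) Y p f = (lie_bracket N X Y p + lie_bracket N Z Y p) f"
      using tangentD(1)[OF vector_fieldsD(1)[OF Y p] vector_fieldsD(3)[OF X(1)] vector_fieldsD(3)[OF X(2)], of f f]
      by (auto simp: lie_bracket_def lie_fn_def)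
  qed
  then show ?thesis
    using cotangentD(1)[OF one_formsD(1)[OF \<alpha> p] vector_fieldsD(1)[OF lie_bracket_vector_field[OF X(1) Y] p]
      vector_fieldsD(1)[OF lie_bracket_vector_field[OF X(2) Y] p]]
    by (simp add: lie_form_value_def)
qed

end

section \<open>Poisson brackets and the Koszul bracket of one-forms\<close>

locale poisson = manifold N for N :: "('p, 'e::euclidean_space) mfd" +
  fixes \<pi> :: "('p, real) mvfield"
  assumes poisson: "poisson_structure N \<pi>"
begin

lemma pi_alt: "p \<in> pts N ==> \<pi> p \<in> alt_multilinear (cotangent N p) 2 UNIV"
  using poisson by (simp add: poisson_structure_def multivector_fields_def)

lemma pi_outside: "p \<notin> pts N ==> \<pi> p = 0"
  using poisson by (simp add: poisson_structure_def multivector_fields_def)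

lemma pi_smooth:
  assumes "\<alpha> \<in> Om" "\<beta> \<in> Om" shows "eval_mv \<pi> [\<alpha>, \<beta>] \<in> Sm"
proof -
  have "\<forall>\<alpha>s. length \<alpha>s = 2 \<and> set \<alpha>s \<subseteq> Om \<longrightarrow> eval_mv \<pi> \<alpha>s \<in> Sm"
    using poisson by (simp add: poisson_structure_def multivector_fields_def)
  from this[rule_format, of "[\<alpha>, \<beta>]"] show ?thesis using assms by simp
qed

lemmas pi_simps = alt_multilinear_2[OF pi_alt]

lemma pi_skew:
  assumes "p \<in> pts N" "a \<in> cotangent N p" "b \<in> cotangent N p" shows "\<pi> p [a, b] = - \<pi> p [b, a]"
proof -
  have "a + b \<in> cotangent N p" by (rule subspace_add[OF subspace_cotangent assms(2,3)])
  then have "\<pi> p [a + b, a + b] = 0" by (rule pi_simps(7)[OF assms(1)])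
  moreover have "\<pi> p [a + b, a + b] = \<pi> p [a, a + b] + \<pi> p [b, a + b]"
    by (rule pi_simps(3)[OF assms(1,2) _ assms(3)]) fact
  moreover have "\<pi> p [a, a + b] = \<pi> p [a, a] + \<pi> p [a, b]" "\<pi> p [b, a + b] = \<pi> p [b, a] + \<pi> p [b, b]"
    by (rule pi_simps(5)[OF assms(1)]; rule assms)+
  moreover have "\<pi> p [a, a] = 0" "\<pi> p [b, b] = 0" by (rule pi_simps(7)[OF assms(1)]; rule assms)+
  ultimately show ?thesis by simp
qed

abbreviation br :: "'p fn \<Rightarrow> 'p fn \<Rightarrow> 'p fn"
  where "br \<equiv> poisson_bracket N \<pi>"

lemma br_apply: "br f g p = \<pi> p [dN f p, dN g p]"
  by (simp add: poisson_bracket_def)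

lemma br_smooth: "f \<in> Sm ==> g \<in> Sm ==> br f g \<in> Sm"
  unfolding poisson_bracket_def by (intro pi_smooth differential_one_form)

lemma br_skew: "br f g = - br g f"
proof
  fix p show "br f g p = (- br g f) p"
    using pi_skew[OF _ differential_cotangent differential_cotangent, of p f g] pi_outside[of p]
    by (cases "p \<in> pts N") (auto simp: br_apply)
qed

lemma br_right:
  assumes "g \<in> Sm" "h \<in> Sm"
  shows "br f (g + h) = br f g + br f h" "br f (c *\<^sub>R g) = c *\<^sub>R br f g"
    "br f (g * h) = g * br f h + h * br f g"
proof -
  note d = differential_cotangent and s = subspace_scale[OF subspace_cotangent differential_cotangent]
  have "br f (g + h) p = (br f g + br f h) p" for p
    using assms pi_simps(5)[of p] d pi_outside[of p]
    by (cases "p \<in> pts N") (auto simp: br_apply differential_add)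
  then show "br f (g + h) = br f g + br f h" by auto
  have "br f (c *\<^sub>R g) p = (c *\<^sub>R br f g) p" for p
    using assms pi_simps(6)[of p] d pi_outside[of p]
    by (cases "p \<in> pts N") (auto simp: br_apply differential_scaleR)
  then show "br f (c *\<^sub>R g) = c *\<^sub>R br f g" by auto
  have "br f (g * h) p = (g * br f h + h * br f g) p" for p
  proof (cases "p \<in> pts N")
    case True
    then show ?thesis
      using assms by (simp add: br_apply differential_mult pi_simps(5,6)[OF True] d s)
  qed (simp add: br_apply pi_outside)
  then show "br f (g * h) = g * br f h + h * br f g" by auto
qed

lemma br_jacobi:
  assumes "f \<in> Sm" "g \<in> Sm" "h \<in> Sm"
  shows "br f (br g h) + br g (br h f) + br h (br f g) = 0"
  using poisson assms by (simp add: poisson_structure_def)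

lemma sharp_apply: "sharp N \<pi> \<alpha> p f = \<pi> p [\<alpha> p, dN f p]"
  by (simp add: sharp_def)

lemma sharp_vector_field:
  assumes \<alpha>: "\<alpha> \<in> Om" shows "sharp N \<pi> \<alpha> \<in> VF"
proof (rule vector_fieldsI)
  fix p assume p: "p \<in> pts N"
  note ap = one_formsD(1)[OF \<alpha> p] and d = differential_cotangent[OF p]
    and s = subspace_scale[OF subspace_cotangent differential_cotangent[OF p]]
  show "sharp N \<pi> \<alpha> p \<in> tangent N p"
  proof (rule tangentI)
    fix f assume "f \<notin> Sm"
    then have "dN f p = 0" by (simp add: differential_outside)
    moreover have "\<pi> p [\<alpha> p, 0 *\<^sub>R \<alpha> p] = 0 *\<^sub>R \<pi> p [\<alpha> p, \<alpha> p]" by (rule pi_simps(6)[OF p ap ap])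
    ultimately show "sharp N \<pi> \<alpha> p f = 0" by (simp add: sharp_apply)
  qed (simp_all only: sharp_apply differential_add differential_scaleR differential_mult pi_simps(5,6)[OF p ap] d s real_scaleR_def)
next
  fix p assume "p \<notin> pts N" then show "sharp N \<pi> \<alpha> p = 0" by (auto simp: sharp_apply pi_outside)
next
  fix f assume f: "f \<in> Sm"
  have "(\<lambda>p. sharp N \<pi> \<alpha> p f) = eval_mv \<pi> [\<alpha>, dN f]" by (auto simp: sharp_apply)
  then show "(\<lambda>p. sharp N \<pi> \<alpha> p f) \<in> Sm"
    using pi_smooth[OF \<alpha> differential_one_form[OF f]] by simp
qed

lemma sharp_add:
  assumes "\<alpha> \<in> Om" "\<beta> \<in> Om"
  shows "sharp N \<pi> (\<alpha> + \<beta>) = sharp N \<pi> \<alpha> + sharp N \<pi> \<beta>"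
proof (intro ext)
  fix p f show "sharp N \<pi> (\<alpha> + \<beta>) p f = (sharp N \<pi> \<alpha> + sharp N \<pi> \<beta>) p f"
    using pi_simps(3)[OF _ one_formsD(1)[OF assms(1)] differential_cotangent one_formsD(1)[OF assms(2)], of p f]
      pi_outside[of p] by (cases "p \<in> pts N") (auto simp: sharp_apply)
qed

lemma koszul_apply:
  assumes "\<alpha> \<in> Om" "\<beta> \<in> Om" "Y \<in> VF" "p \<in> pts N"
  shows "koszul N \<pi> \<alpha> \<beta> p (Y p) = lie_form_value (sharp N \<pi> \<alpha>) \<beta> Y p
    - lie_form_value (sharp N \<pi> \<beta>) \<alpha> Y p - Y p (eval_mv \<pi> [\<alpha>, \<beta>])"
  using lie_form(2)[OF sharp_vector_field[OF assms(1)] assms(2,3,4)]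
    lie_form(2)[OF sharp_vector_field[OF assms(2)] assms(1,3,4)] vector_fieldsD(1)[OF assms(3,4)] assms(4)
  by (simp add: koszul_def)

lemma koszul_one_form:
  assumes "\<alpha> \<in> Om" "\<beta> \<in> Om" shows "koszul N \<pi> \<alpha> \<beta> \<in> Om"
  unfolding koszul_def
  by (intro subspace_diff subspace_one_forms lie_form(1) sharp_vector_field differential_one_form pi_smooth assms)

lemma koszul_skew:
  assumes "\<alpha> \<in> Om" "\<beta> \<in> Om" "p \<in> pts N" shows "koszul N \<pi> \<alpha> \<beta> p = - koszul N \<pi> \<beta> \<alpha> p"
proof (rule cotangent_eqI[OF one_formsD(1)[OF koszul_one_form[OF assms(1,2)] assms(3)]
      subspace_neg[OF subspace_cotangent one_formsD(1)[OF koszul_one_form[OF assms(2,1)] assms(3)]] assms(3)])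
  fix Y assume Y: "Y \<in> VF"
  have "eval_mv \<pi> [\<alpha>, \<beta>] = - eval_mv \<pi> [\<beta>, \<alpha>]"
  proof
    fix p show "eval_mv \<pi> [\<alpha>, \<beta>] p = (- eval_mv \<pi> [\<beta>, \<alpha>]) p"
      using pi_skew[OF _ one_formsD(1)[OF assms(1)] one_formsD(1)[OF assms(2)], of p] pi_outside[of p]
      by (cases "p \<in> pts N") auto
  qed
  then have "Y p (eval_mv \<pi> [\<alpha>, \<beta>]) = - Y p (eval_mv \<pi> [\<beta>, \<alpha>])"
    using tangent_uminus[OF vector_fieldsD(1)[OF Y assms(3)] pi_smooth[OF assms(2,1)]] by simp
  then show "koszul N \<pi> \<alpha> \<beta> p (Y p) = (- koszul N \<pi> \<beta> \<alpha> p) (Y p)"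
    by (simp add: koszul_apply assms Y)
qed

lemma koszul_add_left:
  assumes "\<alpha> \<in> Om" "\<gamma> \<in> Om" "\<beta> \<in> Om" "p \<in> pts N"
  shows "koszul N \<pi> (\<alpha> + \<gamma>) \<beta> p = koszul N \<pi> \<alpha> \<beta> p + koszul N \<pi> \<gamma> \<beta> p"
proof -
  note ag = subspace_add[OF subspace_one_forms assms(1,2)]
  show ?thesis
  proof (rule cotangent_eqI[OF one_formsD(1)[OF koszul_one_form[OF ag assms(3)] assms(4)]
      subspace_add[OF subspace_cotangent one_formsD(1)[OF koszul_one_form[OF assms(1,3)] assms(4)]
        one_formsD(1)[OF koszul_one_form[OF assms(2,3)] assms(4)]] assms(4)])
    fix Y assume Y: "Y \<in> VF"
    have "eval_mv \<pi> [\<alpha> + \<gamma>, \<beta>] = eval_mv \<pi> [\<alpha>, \<beta>] + eval_mv \<pi> [\<gamma>, \<beta>]"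
    proof
      fix p show "eval_mv \<pi> [\<alpha> + \<gamma>, \<beta>] p = (eval_mv \<pi> [\<alpha>, \<beta>] + eval_mv \<pi> [\<gamma>, \<beta>]) p"
        using pi_simps(3)[OF _ one_formsD(1)[OF assms(1)] one_formsD(1)[OF assms(3)] one_formsD(1)[OF assms(2)], of p]
          pi_outside[of p] by (cases "p \<in> pts N") auto
    qed
    then have "Y p (eval_mv \<pi> [\<alpha> + \<gamma>, \<beta>]) = Y p (eval_mv \<pi> [\<alpha>, \<beta>]) + Y p (eval_mv \<pi> [\<gamma>, \<beta>])"
      using tangentD(1)[OF vector_fieldsD(1)[OF Y assms(4)] pi_smooth[OF assms(1,3)] pi_smooth[OF assms(2,3)]] by simp
    then show "koszul N \<pi> (\<alpha> + \<gamma>) \<beta> p (Y p) = (koszul N \<pi> \<alpha> \<beta> p + koszul N \<pi> \<gamma> \<beta> p) (Y p)"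
      unfolding koszul_apply[OF ag assms(3) Y assms(4)] plus_fun_apply koszul_apply[OF assms(1,3) Y assms(4)]
        koszul_apply[OF assms(2,3) Y assms(4)] sharp_add[OF assms(1,2)]
        lie_form_value_add_form[OF sharp_vector_field[OF assms(3)] assms(1,2) Y assms(4)]
        lie_form_value_add_field[OF sharp_vector_field[OF assms(1)] sharp_vector_field[OF assms(2)] assms(3) Y assms(4)]
      by simp
  qed
qed

text \<open>Each of the two Lie derivatives contributes Y{f, g}, and the last term of the Koszul
  bracket takes one of them away. This is the bridge from brackets of forms to brackets of
  functions.\<close>

lemma koszul_exact:
  assumes "f \<in> Sm" "g \<in> Sm"
  shows "koszul N \<pi> (dN f) (dN g) = dN (br f g)"
proof (rule one_forms_eqI[OF koszul_one_form[OF differential_one_form[OF assms(1)] differential_one_form[OF assms(2)]]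
    differential_one_form[OF br_smooth[OF assms]]])
  fix Y p assume Y: "Y \<in> VF" and p: "p \<in> pts N"
  have *: "lie_form_value (sharp N \<pi> (dN f)) (dN g) Y p = Y p (br f g)"
    if fg: "f \<in> Sm" "g \<in> Sm" for f g
  proof -
    note X = sharp_vector_field[OF differential_one_form[OF fg(1)]]
    have "(\<lambda>q. dN g q (Y q)) = (\<lambda>q. Y q g)"
      using vector_fieldsD(1,2)[OF Y] by (auto simp: differential_def fun_eq_iff)
    moreover have "(\<lambda>q. sharp N \<pi> (dN f) q g) = br f g"
      by (auto simp: sharp_apply br_apply)
    ultimately show ?thesis
      using p fg vector_fieldsD(1)[OF lie_bracket_vector_field[OF X Y] p]
      by (simp add: lie_form_value_def lie_bracket_apply)
  qed
  have "Y p (br g f) = - Y p (br f g)"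
    using br_skew[of g f] tangent_uminus[OF vector_fieldsD(1)[OF Y p] br_smooth[OF assms]] by simp
  then show "koszul N \<pi> (dN f) (dN g) p (Y p) = dN (br f g) p (Y p)"
    using *[OF assms] *[OF assms(2,1)] vector_fieldsD(1)[OF Y p] p
    by (simp add: koszul_apply differential_one_form assms Y poisson_bracket_def)
qed

text \<open>The bracket is of first order in \<alpha>, so at a zero of \<alpha> only its derivatives
  remain. Those along the vector field of \<beta> vanish by assumption. Those of the vector field of
  \<alpha> occur twice, in \<beta> of its commutator with Y and in Y of \<pi>(\<alpha>, \<beta>),
  and cancel.\<close>

lemma koszul_vanish:
  assumes \<alpha>: "\<alpha> \<in> Om" and \<beta>: "\<beta> \<in> Om" and p: "p \<in> pts N" and ap: "\<alpha> p = 0"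
    and d: "\<And>Y. Y \<in> VF ==> sharp N \<pi> \<beta> p (\<lambda>q. \<alpha> q (Y q)) = 0"
  shows "koszul N \<pi> \<alpha> \<beta> p = 0"
proof (rule cotangent_eqI[OF one_formsD(1)[OF koszul_one_form[OF \<alpha> \<beta>] p] subspace_0[OF subspace_cotangent] p])
  fix Y assume Y: "Y \<in> VF"
  note Yp = vector_fieldsD(1)[OF Y p]
  obtain B :: "'e set" and A x E where F: "finite B" "mopen A" "p \<in> A" "A \<subseteq> pts N"
    "\<And>b. b \<in> B ==> x b \<in> Sm" "\<And>b. b \<in> B ==> E b \<in> VF"
    "\<And>v q f. q \<in> A ==> v \<in> tangent N q ==> f \<in> Sm ==> v f = (\<Sum>b\<in>B. v (x b) * E b q f)"
    "\<And>b c q. b \<in> B ==> c \<in> B ==> q \<in> A ==> E b q (x c) = (if b = c then 1 else 0)"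
    by (rule frame_at[OF mopen_pts p]) (rule that)
  have EB: "E b q \<in> tangent N q" if "b \<in> B" "q \<in> A" for b q
    using vector_fieldsD(1)[OF F(6)[OF that(1)]] that(2) F(4) by blast
  have a0: "\<pi> p [\<alpha> p, c] = 0" for c
  proof (cases "c \<in> cotangent N p")
    case True
    have "\<pi> p [0 *\<^sub>R c, c] = 0 *\<^sub>R \<pi> p [c, c]" by (rule pi_simps(4)[OF p True True])
    then show ?thesis by (simp add: ap)
  qed (simp add: pi_simps(2)[OF p])
  \<comment> \<open>The components of the vector field of \<alpha> in the frame; they vanish at p
    together with \<alpha>.\<close>
  define u where "u b = (\<lambda>q. sharp N \<pi> \<alpha> q (x b))" for b
  have us: "u b \<in> Sm" if "b \<in> B" for b
    unfolding u_def by (rule vector_fieldsD(3)[OF sharp_vector_field[OF \<alpha>] F(5)[OF that]])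
  have u0: "u b p = 0" for b by (simp add: u_def sharp_apply a0)
  have sp: "sharp N \<pi> \<alpha> p = 0" by (auto simp: sharp_apply a0)
  note LB = vector_fieldsD(1)[OF lie_bracket_vector_field[OF sharp_vector_field[OF \<alpha>] Y] p]
  have "lie_bracket N (sharp N \<pi> \<alpha>) Y p = (\<Sum>b\<in>B. (- Y p (u b)) *\<^sub>R E b p)"
  proof (rule frame_tangent_expand[OF LB EB[OF _ F(3)]])
    fix f assume f: "f \<in> Sm"
    have "lie_bracket N (sharp N \<pi> \<alpha>) Y p f = (\<Sum>b\<in>B. lie_bracket N (sharp N \<pi> \<alpha>) Y p (x b) * E b p f)"
      by (rule F(7)[OF F(3) LB f])
    also have "\<dots> = (\<Sum>b\<in>B. - Y p (u b) * E b p f)"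
      by (rule sum.cong[OF refl]) (simp add: lie_bracket_apply F(5) sp u_def)
    finally show "lie_bracket N (sharp N \<pi> \<alpha>) Y p f = (\<Sum>b\<in>B. - Y p (u b) * E b p f)" .
  qed
  moreover have "\<beta> p (\<Sum>b\<in>B. (- Y p (u b)) *\<^sub>R E b p) = (\<Sum>b\<in>B. (- Y p (u b)) * \<beta> p (E b p))"
    by (rule cotangent_sum[OF one_formsD(1)[OF \<beta> p]]) (rule EB[OF _ F(3)])
  moreover have "Y p (eval_mv \<pi> [\<alpha>, \<beta>]) = (\<Sum>b\<in>B. Y p (u b) * \<beta> p (E b p))"
  proof (rule tangent_of_product_sum[OF Yp F(2,3) pi_smooth[OF \<alpha> \<beta>] us one_formsD(3)[OF \<beta> F(6)]])
    fix q assume q: "q \<in> A"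
    have qN: "q \<in> pts N" using q F(4) by blast
    note aq = one_formsD(1)[OF \<alpha> qN] and bq = one_formsD(1)[OF \<beta> qN]
    have "\<beta> q = (\<Sum>b\<in>B. \<beta> q (E b q) *\<^sub>R dN (x b) q)"
    proof (rule cotangent_eqI[OF bq _ qN])
      show "(\<Sum>b\<in>B. \<beta> q (E b q) *\<^sub>R dN (x b) q) \<in> cotangent N q"
        by (intro subspace_sum subspace_scale subspace_cotangent differential_cotangent qN)
      fix Z assume Z: "Z \<in> VF"
      have Zq: "Z q \<in> tangent N q" by (rule vector_fieldsD(1)[OF Z qN])
      have "Z q = (\<Sum>b\<in>B. Z q (x b) *\<^sub>R E b q)"
        by (rule frame_tangent_expand[OF Zq EB[OF _ q] F(7)[OF q Zq]])
      then have "\<beta> q (Z q) = \<beta> q (\<Sum>b\<in>B. Z q (x b) *\<^sub>R E b q)" by simp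
      also have "\<dots> = (\<Sum>b\<in>B. Z q (x b) * \<beta> q (E b q))"
        by (rule cotangent_sum[OF bq]) (rule EB[OF _ q])
      finally show "\<beta> q (Z q) = (\<Sum>b\<in>B. \<beta> q (E b q) *\<^sub>R dN (x b) q) (Z q)"
        using qN Zq by (simp add: sum_fun_apply mult.commute)
    qed
    then have "eval_mv \<pi> [\<alpha>, \<beta>] q = \<pi> q [\<alpha> q, \<Sum>b\<in>B. \<beta> q (E b q) *\<^sub>R dN (x b) q]" by simp
    also have "\<dots> = (\<Sum>b\<in>B. \<pi> q [\<alpha> q, \<beta> q (E b q) *\<^sub>R dN (x b) q])"
      using F(1)
    proof (induction B rule: finite_induct)
      case empty
      have "\<pi> q [\<alpha> q, 0 *\<^sub>R \<alpha> q] = 0 *\<^sub>R \<pi> q [\<alpha> q, \<alpha> q]" by (rule pi_simps(6)[OF qN aq aq])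
      then show ?case by (simp only: sum.empty scaleR_zero_left)
    next
      case (insert b B)
      show ?case unfolding sum.insert[OF insert(1,2)]
        by (subst pi_simps(5)[OF qN aq])
          (auto intro!: subspace_sum subspace_scale subspace_cotangent differential_cotangent qN insert(3))
    qed
    also have "\<dots> = (\<Sum>b\<in>B. u b q * \<beta> q (E b q))"
      by (rule sum.cong[OF refl]) (simp add: pi_simps(6)[OF qN aq differential_cotangent[OF qN]] u_def sharp_apply)
    finally show "eval_mv \<pi> [\<alpha>, \<beta>] q = (\<Sum>b\<in>B. u b q * \<beta> q (E b q))" .
  qed (simp_all add: u0)
  ultimately show "koszul N \<pi> \<alpha> \<beta> p (Y p) = 0 (Y p)"
    using d[OF Y] by (simp add: koszul_apply[OF \<alpha> \<beta> Y p] lie_form_value_def sp ap sum_negf)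
qed

text \<open>Change one argument at a time: \<open>koszul_vanish\<close> applied to the difference
  treats the first slot, and skew-symmetry carries this over to the second.\<close>

lemma koszul_cong:
  assumes "\<alpha> \<in> Om" "\<alpha>' \<in> Om" "\<beta> \<in> Om" "\<beta>' \<in> Om" and p: "p \<in> pts N"
    and e: "\<alpha> p = \<alpha>' p" "\<beta> p = \<beta>' p"
    and d: "\<And>\<gamma> Y. \<gamma> \<in> Om ==> Y \<in> VF ==> sharp N \<pi> \<gamma> p (\<lambda>q. (\<alpha> - \<alpha>') q (Y q)) = 0"
      "\<And>\<gamma> Y. \<gamma> \<in> Om ==> Y \<in> VF ==> sharp N \<pi> \<gamma> p (\<lambda>q. (\<beta> - \<beta>') q (Y q)) = 0"
  shows "koszul N \<pi> \<alpha> \<beta> p = koszul N \<pi> \<alpha>' \<beta>' p"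
proof -
  have a: "koszul N \<pi> \<alpha> \<beta> p = koszul N \<pi> \<alpha>' \<beta> p"
    if "\<alpha> \<in> Om" "\<alpha>' \<in> Om" "\<beta> \<in> Om" "\<alpha> p = \<alpha>' p"
      "\<And>Y. Y \<in> VF ==> sharp N \<pi> \<beta> p (\<lambda>q. (\<alpha> - \<alpha>') q (Y q)) = 0" for \<alpha> \<alpha>' \<beta>
  proof -
    have s: "\<alpha> - \<alpha>' \<in> Om" by (rule subspace_diff[OF subspace_one_forms that(1,2)])
    have z: "koszul N \<pi> (\<alpha> - \<alpha>') \<beta> p = 0" by (rule koszul_vanish[OF s that(3) p _ that(5)]) (simp add: that(4) fun_eq_iff)
    have "koszul N \<pi> ((\<alpha> - \<alpha>') + \<alpha>') \<beta> p = koszul N \<pi> (\<alpha> - \<alpha>') \<beta> p + koszul N \<pi> \<alpha>' \<beta> p"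
      by (rule koszul_add_left[OF s that(2,3) p])
    then show ?thesis by (simp only: z diff_add_cancel add_0)
  qed
  have "koszul N \<pi> \<alpha> \<beta> p = koszul N \<pi> \<alpha>' \<beta> p" by (rule a[OF assms(1-3) e(1) d(1)[OF assms(3)]])
  also have "\<dots> = - koszul N \<pi> \<beta> \<alpha>' p" by (rule koszul_skew[OF assms(2,3) p])
  also have "koszul N \<pi> \<beta> \<alpha>' p = koszul N \<pi> \<beta>' \<alpha>' p" by (rule a[OF assms(3,4,2) e(2) d(2)[OF assms(2)]])
  also have "- \<dots> = koszul N \<pi> \<alpha>' \<beta>' p" using koszul_skew[OF assms(2,4) p] by simp
  finally show ?thesis .
qed

end

section \<open>Submanifolds\<close>

context manifold
begin

lemma cotangent_frame_expand:
  assumes a: "a \<in> cotangent N q" and q: "q \<in> pts N" "q \<in> A"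
    and x: "\<And>b. b \<in> B ==> x b \<in> Sm" and E: "\<And>b. b \<in> B ==> E b \<in> VF"
    and F: "\<And>v q f. q \<in> A ==> v \<in> tangent N q ==> f \<in> Sm ==> v f = (\<Sum>b\<in>B. v (x b) * E b q f)"
  shows "a = (\<Sum>b\<in>B. a (E b q) *\<^sub>R dN (x b) q)"
proof (rule cotangent_eqI[OF a _ q(1)])
  show "(\<Sum>b\<in>B. a (E b q) *\<^sub>R dN (x b) q) \<in> cotangent N q"
    by (intro subspace_sum subspace_scale subspace_cotangent differential_cotangent q)
  fix Z assume Z: "Z \<in> VF"
  have Zq: "Z q \<in> tangent N q" by (rule vector_fieldsD(1)[OF Z q(1)])
  have EB: "E b q \<in> tangent N q" if "b \<in> B" for b by (rule vector_fieldsD(1)[OF E[OF that] q(1)])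
  have "Z q = (\<Sum>b\<in>B. Z q (x b) *\<^sub>R E b q)"
    by (rule frame_tangent_expand[OF Zq EB F[OF q(2) Zq]])
  then have "a (Z q) = a (\<Sum>b\<in>B. Z q (x b) *\<^sub>R E b q)" by simp
  also have "\<dots> = (\<Sum>b\<in>B. Z q (x b) * a (E b q))"
    by (rule cotangent_sum[OF a]) (rule EB)
  finally show "a (Z q) = (\<Sum>b\<in>B. a (E b q) *\<^sub>R dN (x b) q) (Z q)"
    using q Zq by (simp add: sum_fun_apply mult.commute)
qed

lemma differential_sum:
  assumes "\<And>b. b \<in> B ==> f b \<in> Sm"
  shows "dN (\<Sum>b\<in>B. c b *\<^sub>R f b) p = (\<Sum>b\<in>B. c b *\<^sub>R dN (f b) p)"
  using assms
proof (induction B rule: infinite_finite_induct)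
  case (insert b B)
  have s: "(\<Sum>b\<in>B. c b *\<^sub>R f b) \<in> Sm" "c b *\<^sub>R f b \<in> Sm"
    using insert(4) by (auto intro!: smooth_intros(5,6))
  have IH: "dN (\<Sum>b\<in>B. c b *\<^sub>R f b) p = (\<Sum>b\<in>B. c b *\<^sub>R dN (f b) p)"
    by (rule insert(3)) (rule insert(4), simp)
  show ?case unfolding sum.insert[OF insert(1,2)] differential_add[OF s(2,1)] IH
    using insert(4)[of b] by (simp only: differential_scaleR insertI1)
qed (auto simp: differential_def fun_eq_iff tangent_zero)

text \<open>Take the combination of coordinate functions with the components of a as constant
  coefficients.\<close>

lemma cotangent_exact:
  assumes "a \<in> cotangent N p" "p \<in> pts N"
  obtains f where "f \<in> Sm" "dN f p = a"
proof -
  obtain B :: "'e set" and A x E where F: "finite B" "mopen A" "p \<in> A" "A \<subseteq> pts N"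
    "\<And>b. b \<in> B ==> x b \<in> Sm" "\<And>b. b \<in> B ==> E b \<in> VF"
    "\<And>v q f. q \<in> A ==> v \<in> tangent N q ==> f \<in> Sm ==> v f = (\<Sum>b\<in>B. v (x b) * E b q f)"
    "\<And>b c q. b \<in> B ==> c \<in> B ==> q \<in> A ==> E b q (x c) = (if b = c then 1 else 0)"
    by (rule frame_at[OF mopen_pts assms(2)]) (rule that)
  have "a = (\<Sum>b\<in>B. a (E b p) *\<^sub>R dN (x b) p)"
    by (rule cotangent_frame_expand[OF assms F(3) F(5,6,7)])
  also have "\<dots> = dN (\<Sum>b\<in>B. a (E b p) *\<^sub>R x b) p"
    by (rule differential_sum[symmetric]) (rule F(5))
  finally show thesis
    by (intro that[of "\<Sum>b\<in>B. a (E b p) *\<^sub>R x b"] smooth_intros(5,6) F(5)) simp_all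
qed

end

section \<open>The submanifold S and its smooth structure\<close>

locale poisson_submanifold =
  fixes D :: "('a, 'e::euclidean_space) setting"
  assumes M_smooth: "smooth_manifold (amb D)"
    and M_poisson: "poisson_structure (amb D) (amb_poisson D)"
    and S_emb: "embedded_poisson_submanifold D"

sublocale poisson_submanifold \<subseteq> poisson "amb D" "amb_poisson D"
  by unfold_locales (fact M_smooth, fact M_poisson)

context poisson_submanifold
begin

abbreviation "SM \<equiv> sub_mfd D"
abbreviation "SS \<equiv> smooth_S D"
abbreviation "MV \<equiv> conormal_mv D"
abbreviation "rb \<equiv> restricted_bracket D"
abbreviation "CS \<equiv> conormal_sections D"

abbreviation "M \<equiv> amb D"
abbreviation "S \<equiv> sub_pts D"
abbreviation "W \<equiv> sub_model D"
abbreviation "V \<equiv> model (amb D)"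
abbreviation "slice U \<phi> \<equiv> (U, \<phi>) \<in> slice_charts (amb D) (sub_model D) (sub_pts D)"

lemma subspace_W: "subspace W" and W_V: "W \<subseteq> V" and S_M: "S \<subseteq> pts M"
  using S_emb by (auto simp: embedded_poisson_submanifold_def embedded_submanifold_def)

lemma slice_exists: assumes "p \<in> S" obtains U \<phi> where "slice U \<phi>" "p \<in> U"
proof -
  have "\<exists>c\<in>slice_charts M W S. p \<in> fst c"
    using S_emb assms by (simp add: embedded_poisson_submanifold_def embedded_submanifold_def case_prod_beta)
  then show thesis using that by (metis prod.collapse)
qed

lemma slice_adm: "slice U \<phi> ==> adm U \<phi>"
  and slice_image: "slice U \<phi> ==> \<phi> ` (U \<inter> S) = \<phi> ` U \<inter> W"
  by (simp_all add: slice_charts_def)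

lemma slice_iff: assumes "slice U \<phi>" "q \<in> U" shows "q \<in> S \<longleftrightarrow> \<phi> q \<in> W"
proof
  assume "\<phi> q \<in> W"
  then have "\<phi> q \<in> \<phi> ` (U \<inter> S)" using slice_image[OF assms(1)] assms(2) by blast
  then obtain r where "r \<in> U" "r \<in> S" "\<phi> q = \<phi> r" by blast
  then show "q \<in> S" using admissibleD(2)[OF slice_adm[OF assms(1)]] assms(2) by (metis inj_onD)
qed (use slice_image[OF assms(1)] assms(2) in blast)

lemma slice_inv: assumes "slice U \<phi>" "q \<in> U" "q \<in> S"
  shows "inv_into (U \<inter> S) \<phi> (\<phi> q) = q" "inv_into U \<phi> (\<phi> q) = q"
proof -
  have "inj_on \<phi> U" by (rule admissibleD(2)[OF slice_adm[OF assms(1)]])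
  then have "inj_on \<phi> (U \<inter> S)" by (rule inj_on_subset) blast
  then show "inv_into (U \<inter> S) \<phi> (\<phi> q) = q" "inv_into U \<phi> (\<phi> q) = q"
    using assms \<open>inj_on \<phi> U\<close> by (simp_all add: inv_into_f_f)
qed

lemma sub_simps [simp]: "pts SM = S" "model SM = W"
  by (simp_all add: sub_mfd_def submanifold_def)

lemma sub_charts: "(U', \<phi>) \<in> charts SM \<longleftrightarrow> (\<exists>U. U' = U \<inter> S \<and> slice U \<phi>)"
  by (auto simp: sub_mfd_def submanifold_def)

lemma slice_image_open:
  assumes "slice U \<phi>" "mopen A" shows "openin (top_of_set W) (\<phi> ` (A \<inter> S \<inter> U))"
proof -
  obtain T where T: "open T" "\<phi> ` (A \<inter> U) = V \<inter> T"
    using adm_image_open[OF slice_adm[OF assms(1)] assms(2)] by (auto simp: openin_open)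
  have "\<phi> ` (A \<inter> S \<inter> U) = W \<inter> T"
  proof (intro equalityI subsetI)
    fix y assume "y \<in> \<phi> ` (A \<inter> S \<inter> U)"
    then obtain q where q: "q \<in> A" "q \<in> S" "q \<in> U" "y = \<phi> q" by blast
    have "y \<in> V \<inter> T" using T(2) q by blast
    then show "y \<in> W \<inter> T" using slice_iff[OF assms(1) q(3)] q by simp
  next
    fix y assume y: "y \<in> W \<inter> T"
    then have "y \<in> V \<inter> T" using W_V by blast
    then obtain q where q: "q \<in> A" "q \<in> U" "y = \<phi> q" using T(2) by blast
    then have "q \<in> S" using slice_iff[OF assms(1) q(2)] y by simp
    then show "y \<in> \<phi> ` (A \<inter> S \<inter> U)" using q by blast
  qed
  then show ?thesis using T(1) by (auto simp: openin_open)
qed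

text \<open>In a slice chart the points of S near p are cut out by W, so openness in W lifts to
  openness in V. Hausdorffness and second countability then pass to S, and open sets of S are traces
  of open sets of M.\<close>

lemma sub_topology: "mfd_topology SM = subtopology (mfd_topology M) S"
proof (rule topology_eq[THEN iffD2], intro allI)
  fix O'
  have inj: "inj_on \<phi> U'" if c: "(U', \<phi>) \<in> charts SM" for U' \<phi>
  proof -
    obtain U where U: "U' = U \<inter> S" "slice U \<phi>" using c sub_charts by blast
    show ?thesis unfolding U(1) by (rule inj_on_subset[OF admissibleD(2)[OF slice_adm[OF U(2)]]]) blast
  qed
  note iff = openin_mfd[of "sub_mfd D" O', OF inj, simplified]
  show "openin (mfd_topology SM) O' \<longleftrightarrow> openin (subtopology (mfd_topology M) S) O'"
  proof
    assume "openin (mfd_topology SM) O'"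
    then have O': "O' \<subseteq> S" "\<And>U \<phi>. slice U \<phi> ==> openin (top_of_set W) (\<phi> ` (O' \<inter> (U \<inter> S)))"
      using iff by (auto simp: sub_charts)
    show "openin (subtopology (mfd_topology M) S) O'"
    proof (subst openin_subopen, intro ballI)
      fix p assume p: "p \<in> O'"
      then have "p \<in> S" using O'(1) by blast
      then obtain U \<phi> where U: "slice U \<phi>" "p \<in> U" by (rule slice_exists)
      obtain T where T: "open T" "\<phi> ` (O' \<inter> (U \<inter> S)) = W \<inter> T" using O'(2)[OF U(1)] by (auto simp: openin_open)
      define A where "A = {q \<in> U. \<phi> q \<in> V \<inter> T}"
      have A: "mopen A" unfolding A_def
        by (rule adm_preimage_open[OF slice_adm[OF U(1)]]) (use T(1) in \<open>auto simp: openin_open\<close>)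
      have "A \<inter> S \<subseteq> O'"
      proof
        fix q assume q: "q \<in> A \<inter> S"
        then have "\<phi> q \<in> W \<inter> T" using slice_iff[OF U(1), of q] by (auto simp: A_def)
        then obtain r where r: "r \<in> O'" "r \<in> U" "\<phi> q = \<phi> r" using T(2) by blast
        then have "q = r" using q admissibleD(2)[OF slice_adm[OF U(1)]] by (auto simp: A_def inj_on_def)
        then show "q \<in> O'" using r by simp
      qed
      moreover have "p \<in> A \<inter> S"
      proof -
        have "\<phi> p \<in> W \<inter> T" using T(2) p U(2) \<open>p \<in> S\<close> by blast
        then show ?thesis using U(2) \<open>p \<in> S\<close> W_V by (auto simp: A_def)
      qed
      ultimately show "\<exists>T. openin (subtopology (mfd_topology M) S) T \<and> p \<in> T \<and> T \<subseteq> O'"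
        using A by (intro exI[of _ "A \<inter> S"]) (auto simp: openin_subtopology)
    qed
  next
    assume "openin (subtopology (mfd_topology M) S) O'"
    then obtain A where A: "mopen A" "O' = A \<inter> S" by (auto simp: openin_subtopology)
    have "openin (top_of_set W) (\<phi> ` (O' \<inter> U'))" if c: "(U', \<phi>) \<in> charts SM" for U' \<phi>
    proof -
      obtain U where U: "U' = U \<inter> S" "slice U \<phi>" using c sub_charts by blast
      have "O' \<inter> U' = A \<inter> S \<inter> U" using A(2) U(1) by blast
      then show ?thesis using slice_image_open[OF U(2) A(1)] by simp
    qed
    then show "openin (mfd_topology SM) O'" using iff A(2) by auto
  qed
qed

lemma slice_transition_smooth:
  assumes "slice U \<phi>" "slice U' \<phi>'"
  shows "smooth_on (\<phi> ` (U \<inter> S \<inter> (U' \<inter> S))) (\<phi>' \<circ> inv_into (U \<inter> S) \<phi>)"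
proof -
  have "smooth_on (\<phi> ` (U' \<inter> U)) (\<phi>' \<circ> inv_into U \<phi>)"
    by (rule adm_transition_smooth[OF slice_adm[OF assms(2)] slice_adm[OF assms(1)]])
  then show ?thesis
    by (rule smooth_on_transfer) (use slice_inv[OF assms(1)] in auto)
qed

lemma sub_smooth_manifold: "smooth_manifold SM"
  unfolding smooth_manifold_def
proof (intro conjI)
  show "subspace (model SM)" using subspace_W by simp
  show "(\<Union>(U, \<phi>)\<in>charts SM. U) = pts SM"
  proof (intro equalityI subsetI)
    fix p assume "p \<in> pts SM"
    then have "p \<in> S" by simp
    then obtain U \<phi> where U: "slice U \<phi>" "p \<in> U" by (rule slice_exists)
    have "(U \<inter> S, \<phi>) \<in> charts SM" using U sub_charts by blast
    then show "p \<in> (\<Union>(U, \<phi>)\<in>charts SM. U)" using U \<open>p \<in> S\<close> by (intro UN_I[of "(U \<inter> S, \<phi>)"]) auto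
  qed (auto simp: sub_charts)
  have open': "openin (top_of_set W) (\<phi> ` (U \<inter> S \<inter> (U' \<inter> S)))" if "slice U \<phi>" "slice U' \<phi>'" for U \<phi> U' \<phi>'
  proof -
    have "U \<inter> S \<inter> (U' \<inter> S) = U' \<inter> S \<inter> U" by blast
    then show ?thesis using slice_image_open[OF that(1) adm_open[OF slice_adm[OF that(2)]]] by simp
  qed
  show "\<forall>c\<in>charts SM. admissible_chart SM c"
  proof clarify
    fix U0 \<phi> assume "(U0, \<phi>) \<in> charts SM"
    then obtain U where U: "U0 = U \<inter> S" "slice U \<phi>" using sub_charts by blast
    have "inj_on \<phi> (U \<inter> S)" by (rule inj_on_subset[OF admissibleD(2)[OF slice_adm[OF U(2)]]]) blast
    moreover have "openin (top_of_set W) (\<phi> ` (U \<inter> S))" using open'[OF U(2) U(2)] by simp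
    moreover have "openin (top_of_set W) (\<phi> ` (U \<inter> S \<inter> U')) \<and> openin (top_of_set W) (\<phi>' ` (U \<inter> S \<inter> U')) \<and>
        smooth_on (\<phi> ` (U \<inter> S \<inter> U')) (\<phi>' \<circ> inv_into (U \<inter> S) \<phi>) \<and>
        smooth_on (\<phi>' ` (U \<inter> S \<inter> U')) (\<phi> \<circ> inv_into U' \<phi>')" if c: "(U', \<phi>') \<in> charts SM" for U' \<phi>'
    proof -
      obtain U1 where U1: "U' = U1 \<inter> S" "slice U1 \<phi>'" using c sub_charts by blast
      have e: "U \<inter> S \<inter> (U1 \<inter> S) = U1 \<inter> S \<inter> (U \<inter> S)" by blast
      show ?thesis unfolding U1(1)
        using open'[OF U(2) U1(2)] open'[OF U1(2) U(2)] slice_transition_smooth[OF U(2) U1(2)]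
          slice_transition_smooth[OF U1(2) U(2)] by (simp add: e[symmetric])
    qed
    ultimately show "admissible_chart SM (U0, \<phi>)"
      unfolding admissible_chart_def U(1) by auto
  qed
  show "Hausdorff_space (mfd_topology SM)" "second_countable (mfd_topology SM)"
    unfolding sub_topology using smooth
    by (auto simp: smooth_manifold_def intro: Hausdorff_space_subtopology second_countable_subtopology)
qed

end

sublocale poisson_submanifold \<subseteq> S: poisson "sub_mfd D" "sub_poisson D"
  by unfold_locales (fact sub_smooth_manifold, use S_emb in \<open>simp add: embedded_poisson_submanifold_def\<close>)

context poisson_submanifold
begin

section \<open>Functions on S and vectors tangent to S\<close>

lemma S_mopen: "S.mopen B \<longleftrightarrow> (\<exists>A. mopen A \<and> B = A \<inter> S)"
  unfolding sub_topology by (auto simp: openin_subtopology)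

text \<open>S need not be closed, so only germs extend. Smoothness of f in a slice chart already
  means a local extension to the ambient Euclidean space; composed with the chart and cut off it
  becomes a function on M.\<close>

lemma smooth_S_lift:
  assumes f: "f \<in> SS" and p: "p \<in> S"
  obtains F A where "F \<in> Sm" "mopen A" "p \<in> A" "\<And>q. q \<in> A ==> q \<in> S ==> F q = f q"
proof -
  obtain U \<phi> where U: "slice U \<phi>" "p \<in> U" by (rule slice_exists[OF p])
  have "smooth_on (\<phi> ` (U \<inter> S)) (f \<circ> inv_into (U \<inter> S) \<phi>)"
  proof -
    have "(U \<inter> S, \<phi>) \<in> charts SM" using U sub_charts by blast
    then show ?thesis using f by (auto simp: smooth_functions_def)
  qed
  moreover have "\<phi> p \<in> \<phi> ` (U \<inter> S)" using U p by blast
  ultimately obtain T g where T: "open T" "\<phi> p \<in> T" "cinf_on T g"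
      "\<And>y. y \<in> \<phi> ` (U \<inter> S) ==> y \<in> T ==> g y = (f \<circ> inv_into (U \<inter> S) \<phi>) y"
    by (rule smooth_onE) (rule that)
  note a = slice_adm[OF U(1)]
  define A0 where "A0 = {q \<in> U. \<phi> q \<in> V \<inter> T}"
  have VT: "openin (top_of_set V) (V \<inter> T)" using T(1) by (auto simp: openin_open)
  have A0: "mopen A0" "p \<in> A0" unfolding A0_def
    using adm_preimage_open[OF a VT] U(2) T(2) adm_model[OF a U(2)] by auto
  have sn: "smooth_near (\<lambda>q. g (\<phi> q)) q" if "q \<in> A0" for q
    by (rule smooth_near_chart_fun[OF a _ VT]) (use that smooth_onI_cinf[OF T(1,3)] in \<open>auto simp: A0_def\<close>)
  obtain F A where F: "F \<in> Sm" "mopen A" "p \<in> A" "A \<subseteq> A0" "\<And>q. q \<in> A ==> F q = g (\<phi> q)"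
    by (rule smooth_extension[OF A0 sn]) (assumption, rule that)
  show thesis
  proof (rule that[OF F(1-3)])
    fix q assume q: "q \<in> A" "q \<in> S"
    then have "q \<in> U" "\<phi> q \<in> T" using F(4) by (auto simp: A0_def)
    then show "F q = f q" using F(5)[OF q(1)] T(4)[of "\<phi> q"] slice_inv[OF U(1) _ q(2)] q(2) by auto
  qed
qed

text \<open>Converse of \<open>smooth_S_lift\<close>. The two together allow smoothness on S to be
  settled by functions on M.\<close>

lemma smooth_SI:
  assumes "\<And>p. p \<notin> S ==> f p = 0"
    "\<And>p. p \<in> S ==> \<exists>F A. F \<in> Sm \<and> mopen A \<and> p \<in> A \<and> (\<forall>q\<in>A \<inter> S. F q = f q)"
  shows "f \<in> SS"
proof (rule S.smooth_functionsI)
  fix p assume "p \<notin> pts SM" then show "f p = 0" using assms(1) by simp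
next
  fix p assume "p \<in> pts SM"
  then have p: "p \<in> S" by simp
  obtain F A where F: "F \<in> Sm" "mopen A" "p \<in> A" "\<forall>q\<in>A \<inter> S. F q = f q"
    using assms(2)[OF p] by (elim exE conjE)
  obtain U \<phi> where U: "slice U \<phi>" "p \<in> U" by (rule slice_exists[OF p])
  have adm: "S.adm (U \<inter> S) \<phi>" using S.charts_adm U sub_charts by blast
  show "S.smooth_near f p"
  proof (rule S.smooth_nearI[OF adm, of "A \<inter> U \<inter> S"])
    show "S.mopen (A \<inter> U \<inter> S)"
      unfolding S_mopen using openin_Int[OF F(2) adm_open[OF slice_adm[OF U(1)]]] by blast
    show "smooth_on (\<phi> ` (A \<inter> U \<inter> S)) (f \<circ> inv_into (U \<inter> S) \<phi>)"
      by (rule smooth_on_transfer[OF smooth_in_adm[OF slice_adm[OF U(1)] F(1)]])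
        (use F(4) slice_inv[OF U(1)] in auto)
  qed (use F U p in auto)
qed

lemma restrict_S_smooth: assumes "F \<in> Sm" shows "restrict_S D F \<in> SS"
proof (rule smooth_SI)
  fix p assume "p \<in> S"
  then show "\<exists>G A. G \<in> Sm \<and> mopen A \<and> p \<in> A \<and> (\<forall>q\<in>A \<inter> S. G q = restrict_S D F q)"
    using assms mopen_pts S_M by (intro exI[of _ F] exI[of _ "pts M"]) (auto simp: restrict_S_def)
qed (simp add: restrict_S_def)

lemma S_tangent_local:
  assumes "v \<in> tangent SM p" "p \<in> S" "f \<in> SS" "g \<in> SS"
    and "mopen A" "p \<in> A" "\<And>q. q \<in> A ==> q \<in> S ==> f q = g q"
  shows "v f = v g"
  by (rule S.tangent_local[OF assms(1,3,4), of "A \<inter> S"]) (use assms S_mopen in auto)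

lemma restrict_S_add: "restrict_S D (F + G) = restrict_S D F + restrict_S D G"
  and restrict_S_mult: "restrict_S D (F * G) = restrict_S D F * restrict_S D G"
  and restrict_S_scale: "restrict_S D (c *\<^sub>R F) = c *\<^sub>R restrict_S D F"
  by (auto simp: restrict_S_def fun_eq_iff)

lemma push_apply: "F \<in> Sm ==> push D v F = v (restrict_S D F)"
  by (simp add: push_def)

lemma push_tangent: assumes "v \<in> tangent SM p" "p \<in> S" shows "push D v \<in> tangent M p"
proof (rule tangentI)
  fix F G assume FG: "F \<in> Sm" "G \<in> Sm"
  note r = restrict_S_smooth[OF FG(1)] restrict_S_smooth[OF FG(2)]
  show "push D v (F + G) = push D v F + push D v G"
    unfolding push_apply[OF FG(1)] push_apply[OF FG(2)] push_apply[OF smooth_intros(2)[OF FG]]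
      restrict_S_add by (rule tangentD(1)[OF assms(1) r])
  show "push D v (F * G) = F p * push D v G + G p * push D v F"
    unfolding push_apply[OF FG(1)] push_apply[OF FG(2)] push_apply[OF smooth_mult[OF FG]]
      restrict_S_mult tangentD(3)[OF assms(1) r] using assms(2) by (simp add: restrict_S_def)
next
  fix c F assume F: "F \<in> Sm"
  show "push D v (c *\<^sub>R F) = c * push D v F"
    unfolding push_apply[OF F] push_apply[OF smooth_intros(5)[OF F]] restrict_S_scale
    by (rule tangentD(2)[OF assms(1) restrict_S_smooth[OF F]])
qed (simp add: push_def)

lemma push_lift:
  assumes "v \<in> tangent SM p" "p \<in> S" "f \<in> SS" "F \<in> Sm"
    and "mopen A" "p \<in> A" "\<And>q. q \<in> A ==> q \<in> S ==> F q = f q"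
  shows "v f = push D v F"
  unfolding push_apply[OF assms(4)]
  by (rule S_tangent_local[OF assms(1-3) restrict_S_smooth[OF assms(4)] assms(5,6)])
    (use assms(7) in \<open>simp add: restrict_S_def\<close>)

lemma push_linear: "push D (v + w) = push D v + push D w" "push D (c *\<^sub>R v) = c *\<^sub>R push D v"
  by (auto simp: push_def fun_eq_iff)

lemma push_inj:
  assumes "v \<in> tangent SM p" "w \<in> tangent SM p" "p \<in> S" "push D v = push D w"
  shows "v = w"
proof
  fix f show "v f = w f"
  proof (cases "f \<in> SS")
    case True
    obtain F A where F: "F \<in> Sm" "mopen A" "p \<in> A" "\<And>q. q \<in> A ==> q \<in> S ==> F q = f q"
      by (rule smooth_S_lift[OF True assms(3)]) (rule that)
    show ?thesis
      using push_lift[OF assms(1,3) True F] push_lift[OF assms(2,3) True F] assms(4) by simp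
  qed (simp add: tangentD(4)[OF assms(1)] tangentD(4)[OF assms(2)])
qed

lemma subspace_tangent_S_in_M: "subspace (tangent_S_in_M D p)"
proof (rule subspaceI)
  show "0 \<in> tangent_S_in_M D p"
    unfolding tangent_S_in_M_def
    by (rule image_eqI[OF _ subspace_0[OF subspace_tangent]]) (auto simp: push_def fun_eq_iff)
next
  fix x y assume "x \<in> tangent_S_in_M D p" "y \<in> tangent_S_in_M D p"
  then obtain v w where v: "v \<in> tangent SM p" "x = push D v" and w: "w \<in> tangent SM p" "y = push D w"
    unfolding tangent_S_in_M_def by (elim imageE)
  show "x + y \<in> tangent_S_in_M D p"
    unfolding tangent_S_in_M_def v(2) w(2) push_linear(1)[symmetric]
    by (rule imageI[OF subspace_add[OF subspace_tangent v(1) w(1)]])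
next
  fix c x assume "x \<in> tangent_S_in_M D p"
  then obtain v where v: "v \<in> tangent SM p" "x = push D v"
    unfolding tangent_S_in_M_def by (elim imageE)
  show "c *\<^sub>R x \<in> tangent_S_in_M D p"
    unfolding tangent_S_in_M_def v(2) push_linear(2)[symmetric]
    by (rule imageI[OF subspace_scale[OF subspace_tangent v(1)]])
qed

lemma tangent_S_in_M_tangent: "p \<in> S ==> w \<in> tangent_S_in_M D p ==> w \<in> tangent M p"
  using push_tangent by (auto simp: tangent_S_in_M_def)

text \<open>Global functions representing germs of the vanishing ideal of S at p; away from p they
  are unrestricted.\<close>

definition vanishes_near :: "'a fn \<Rightarrow> 'a \<Rightarrow> bool"
  where "vanishes_near F p \<longleftrightarrow> F \<in> Sm \<and> (\<exists>A. mopen A \<and> p \<in> A \<and> (\<forall>q\<in>A \<inter> S. F q = 0))"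

text \<open>Tangency to S is annihilation of the vanishing ideal. For the converse, w induces a
  derivation of functions on S by acting on local lifts, which is independent of the lift precisely
  because w kills functions vanishing on S near p.\<close>

lemma tangent_S_in_M_iff:
  assumes p: "p \<in> S" and w: "w \<in> tangent M p"
  shows "w \<in> tangent_S_in_M D p \<longleftrightarrow> (\<forall>F. vanishes_near F p \<longrightarrow> w F = 0)"
proof
  assume "w \<in> tangent_S_in_M D p"
  then obtain v where v: "v \<in> tangent SM p" "w = push D v" by (auto simp: tangent_S_in_M_def)
  show "\<forall>F. vanishes_near F p \<longrightarrow> w F = 0"
  proof (intro allI impI)
    fix F assume "vanishes_near F p"
    then obtain A where A: "F \<in> Sm" "mopen A" "p \<in> A" "\<forall>q\<in>A \<inter> S. F q = 0"
      by (auto simp: vanishes_near_def)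
    have "v 0 = push D v F"
      by (rule push_lift[OF v(1) p S.smooth_intros(1) A(1-3)]) (use A(4) in simp)
    then show "w F = 0" using v(2) S.tangent_zero[OF v(1)] by simp
  qed
next
  assume k: "\<forall>F. vanishes_near F p \<longrightarrow> w F = 0"
  have well: "w F = w G" if "F \<in> Sm" "G \<in> Sm" "mopen A" "p \<in> A" "mopen B" "p \<in> B"
      "\<And>q. q \<in> A ==> q \<in> S ==> F q = f q" "\<And>q. q \<in> B ==> q \<in> S ==> G q = f q" for F G f A B
  proof -
    have "vanishes_near (F - G) p"
      unfolding vanishes_near_def
      using that smooth_intros(3)[OF that(1,2)] openin_Int[OF that(3,5)]
      by (intro conjI exI[of _ "A \<inter> B"]) auto
    then show ?thesis using k tangent_diff[OF w that(1,2)] by simp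
  qed
  define P where "P f F \<longleftrightarrow> F \<in> Sm \<and> (\<exists>A. mopen A \<and> p \<in> A \<and> (\<forall>q\<in>A \<inter> S. F q = f q))" for f F
  \<comment> \<open>The derivation on S: choose any lift of the germ of f and apply w.\<close>
  define v where "v f = (if f \<in> SS then w (SOME F. P f F) else 0)" for f
  have vF: "v f = w F" if f: "f \<in> SS" and F: "P f F" for f F
  proof -
    have 1: "P f (SOME F. P f F)" by (rule someI[of "P f", OF F])
    obtain A where A: "(SOME F. P f F) \<in> Sm" "mopen A" "p \<in> A" "\<forall>q\<in>A \<inter> S. (SOME F. P f F) q = f q"
      using 1 unfolding P_def[of f "SOME F. P f F"] by (elim exE conjE)
    obtain B where B: "F \<in> Sm" "mopen B" "p \<in> B" "\<forall>q\<in>B \<inter> S. F q = f q"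
      using F unfolding P_def by (elim exE conjE)
    have "w (SOME F. P f F) = w F"
      by (rule well[OF A(1) B(1) A(2,3) B(2,3), of f]) (use A(4) B(4) in auto)
    then show ?thesis using f by (simp add: v_def)
  qed
  have Pex: "\<exists>F. P f F" if f: "f \<in> SS" for f
  proof -
    obtain F A where "F \<in> Sm" "mopen A" "p \<in> A" "\<And>q. q \<in> A ==> q \<in> S ==> F q = f q"
      by (rule smooth_S_lift[OF f p]) (rule that)
    then show ?thesis unfolding P_def by (intro exI[of _ F] conjI exI[of _ A]) auto
  qed
  have "v \<in> tangent SM p"
  proof (rule tangentI)
    fix f g assume fg: "f \<in> SS" "g \<in> SS"
    obtain F where F: "P f F" using Pex[OF fg(1)] by blast
    obtain G where G: "P g G" using Pex[OF fg(2)] by blast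
    obtain A where A: "F \<in> Sm" "mopen A" "p \<in> A" "\<forall>q\<in>A \<inter> S. F q = f q"
      using F unfolding P_def by (elim exE conjE)
    obtain B where B: "G \<in> Sm" "mopen B" "p \<in> B" "\<forall>q\<in>B \<inter> S. G q = g q"
      using G unfolding P_def by (elim exE conjE)
    have AB: "mopen (A \<inter> B)" "p \<in> A \<inter> B" using A B by auto
    have "P (f + g) (F + G)" unfolding P_def
      using smooth_intros(2)[OF A(1) B(1)] AB A(4) B(4) by (intro conjI exI[of _ "A \<inter> B"]) auto
    then show "v (f + g) = v f + v g"
      using vF[OF S.smooth_intros(2)[OF fg]] vF[OF fg(1) F] vF[OF fg(2) G] tangentD(1)[OF w A(1) B(1)] by simp
    have "P (f * g) (F * G)" unfolding P_def
      using smooth_mult[OF A(1) B(1)] AB A(4) B(4) by (intro conjI exI[of _ "A \<inter> B"]) auto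
    moreover have "F p = f p" "G p = g p" using A B p by auto
    ultimately show "v (f * g) = f p * v g + g p * v f"
      using vF[OF S.smooth_mult[OF fg]] vF[OF fg(1) F] vF[OF fg(2) G] tangentD(3)[OF w A(1) B(1)] by simp
  next
    fix c f assume f: "f \<in> SS"
    obtain F where F: "P f F" using Pex[OF f] by blast
    obtain A where A: "F \<in> Sm" "mopen A" "p \<in> A" "\<forall>q\<in>A \<inter> S. F q = f q"
      using F unfolding P_def by (elim exE conjE)
    have "P (c *\<^sub>R f) (c *\<^sub>R F)" unfolding P_def
      using smooth_intros(5)[OF A(1)] A by (intro conjI exI[of _ A]) auto
    then show "v (c *\<^sub>R f) = c * v f"
      using vF[OF S.smooth_intros(5)[OF f]] vF[OF f F] tangentD(2)[OF w A(1)] by simp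
  qed (simp add: v_def)
  moreover have "w = push D v"
  proof
    fix F show "w F = push D v F"
    proof (cases "F \<in> Sm")
      case True
      have "P (restrict_S D F) F" unfolding P_def
        using True mopen_pts p S_M by (intro conjI exI[of _ "pts M"]) (auto simp: restrict_S_def)
      then show ?thesis using vF[OF restrict_S_smooth[OF True]] push_apply[OF True] by simp
    qed (simp add: push_def tangentD(4)[OF w])
  qed
  ultimately show "w \<in> tangent_S_in_M D p" by (auto simp: tangent_S_in_M_def)
qed

end

section \<open>The bracket along a Poisson submanifold\<close>

definition adapted_basis :: "'e::euclidean_space set \<Rightarrow> 'e set \<Rightarrow> 'e set \<Rightarrow> 'e set \<Rightarrow> bool"
  where "adapted_basis V W BW BN \<longleftrightarrow> finite BW \<and> finite BN \<and> BW \<inter> BN = {} \<and> BW \<subseteq> W \<and> BN \<subseteq> V \<and>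
    (\<forall>b\<in>BN. \<forall>w\<in>W. w \<bullet> b = 0) \<and> pairwise orthogonal (BW \<union> BN) \<and> (\<forall>b\<in>BW \<union> BN. norm b = 1) \<and>
    span BW = W \<and> span (BW \<union> BN) = V"

lemma adapted_basis_exists:
  assumes V: "subspace V" and W: "subspace W" "W \<subseteq> V"
  obtains BW BN where "adapted_basis V W BW BN"
proof -
  obtain BW where BW: "BW \<subseteq> W" "pairwise orthogonal BW" "\<And>b. b \<in> BW ==> norm b = 1"
      "independent BW" "span BW = W"
    by (rule orthonormal_basis_subspace[OF W(1)]) (rule that)
  define K where "K = {v \<in> V. \<forall>w\<in>W. w \<bullet> v = 0}"
  have K: "subspace K" unfolding K_def
    by (rule subspaceI) (use V in \<open>auto simp: subspace_0 subspace_add subspace_scale inner_add_right\<close>)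
  obtain BN where BN: "BN \<subseteq> K" "pairwise orthogonal BN" "\<And>b. b \<in> BN ==> norm b = 1"
      "independent BN" "span BN = K"
    by (rule orthonormal_basis_subspace[OF K]) (rule that)
  have 0: "w \<bullet> b = 0" if "w \<in> W" "b \<in> BN" for w b using BN(1) that by (auto simp: K_def)
  have disj: "BW \<inter> BN = {}"
  proof (rule ccontr)
    assume "BW \<inter> BN \<noteq> {}"
    then obtain b where b: "b \<in> BW" "b \<in> BN" by blast
    then have "b \<in> W" using BW(1) by blast
    then have "b = 0" using 0[of b b] b by simp
    then show False using BN(3)[OF b(2)] by simp
  qed
  have orth: "pairwise orthogonal (BW \<union> BN)"
    unfolding pairwise_def
  proof (intro ballI impI)
    fix b c assume bc: "b \<in> BW \<union> BN" "c \<in> BW \<union> BN" "b \<noteq> c"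
    show "orthogonal b c"
      using bc BW(1,2) BN(2) 0[of b c] 0[of c b]
      by (auto simp: pairwise_def orthogonal_def inner_commute)
  qed
  have "span (BW \<union> BN) = V"
  proof
    show "span (BW \<union> BN) \<subseteq> V"
      by (rule span_minimal[OF _ V]) (use BW(1) BN(1) W(2) in \<open>auto simp: K_def\<close>)
    show "V \<subseteq> span (BW \<union> BN)"
    proof
      fix v assume v: "v \<in> V"
      obtain y z where yz: "y \<in> span W" "\<And>w. w \<in> span W ==> orthogonal z w" "v = y + z"
        by (rule orthogonal_subspace_decomp_exists[of W v]) (rule that)
      have sW: "span W = W" using W(1) by (simp add: span_eq_iff)
      have "z = v - y" using yz(3) by simp
      then have "z \<in> V" using v yz(1) sW W(2) V by (auto intro: subspace_diff)
      then have "z \<in> K" using yz(2) sW by (auto simp: K_def orthogonal_def inner_commute)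
      then have "z \<in> span (BW \<union> BN)" using BN(5) span_mono[of BN "BW \<union> BN"] by auto
      moreover have "y \<in> span (BW \<union> BN)" using yz(1) sW BW(5) span_mono[of BW "BW \<union> BN"] by auto
      ultimately show "v \<in> span (BW \<union> BN)" using yz(3) span_add by blast
    qed
  qed
  then have "adapted_basis V W BW BN"
    unfolding adapted_basis_def
    using independent_imp_finite[OF BW(4)] independent_imp_finite[OF BN(4)] disj BW BN 0 orth
    by (auto simp: K_def)
  then show thesis by (rule that)
qed

context poisson_submanifold
begin

text \<open>What is kept of a slice chart once its coordinates and fields are global: the x c with c
  in BN are transverse coordinates that vanish on S, and the X b with b in BW span the directions of
  S.\<close>

definition adapted_frame :: "'e set \<Rightarrow> 'e set \<Rightarrow> 'a set \<Rightarrow> ('e \<Rightarrow> 'a fn) \<Rightarrow> ('e \<Rightarrow> 'a vfield) \<Rightarrow> bool"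
  where "adapted_frame BW BN A x X \<longleftrightarrow> adapted_basis V W BW BN \<and> mopen A \<and>
    (\<forall>b\<in>BW \<union> BN. x b \<in> Sm \<and> X b \<in> VF) \<and>
    (\<forall>q\<in>A. \<forall>v\<in>tangent M q. \<forall>f\<in>Sm. v f = (\<Sum>b\<in>BW \<union> BN. v (x b) * X b q f)) \<and>
    (\<forall>q\<in>A. \<forall>b\<in>BW \<union> BN. \<forall>c\<in>BW \<union> BN. X b q (x c) = (if b = c then 1 else 0)) \<and>
    (\<forall>q\<in>A \<inter> S. \<forall>c\<in>BN. x c q = 0) \<and>
    (\<forall>q\<in>A \<inter> S. \<forall>b\<in>BW. X b q \<in> tangent_S_in_M D q)"

lemma adapted_frame_exists:
  assumes sl: "slice U \<phi>" and U0: "mopen U0" "p \<in> U0" "U0 \<subseteq> U" and B: "adapted_basis V W BW BN"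
  obtains A x X where "adapted_frame BW BN A x X" "p \<in> A" "A \<subseteq> U0"
    "\<And>b q. b \<in> BW \<union> BN ==> q \<in> A ==> x b q = \<phi> q \<bullet> b"
proof -
  note a = slice_adm[OF sl]
  have fB: "finite (BW \<union> BN)" and oB: "pairwise orthogonal (BW \<union> BN)" and nB: "\<And>b. b \<in> BW \<union> BN ==> norm b = 1"
    and sB: "span (BW \<union> BN) = V" and BW: "BW \<subseteq> W" and BN: "\<And>b w. b \<in> BN ==> w \<in> W ==> w \<bullet> b = 0"
    using B unfolding adapted_basis_def by blast+
  obtain A x X where A: "mopen A" "p \<in> A" "A \<subseteq> U0"
    "\<And>b. b \<in> BW \<union> BN ==> x b \<in> Sm" "\<And>b. b \<in> BW \<union> BN ==> X b \<in> VF"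
    "\<And>b q. b \<in> BW \<union> BN ==> q \<in> A ==> x b q = \<phi> q \<bullet> b"
    "\<And>b q. b \<in> BW \<union> BN ==> q \<in> A ==> X b q = chart_der U \<phi> q b"
    "\<And>v q f. q \<in> A ==> v \<in> tangent M q ==> f \<in> Sm ==> v f = (\<Sum>b\<in>BW \<union> BN. v (x b) * X b q f)"
    "\<And>b c q. b \<in> BW \<union> BN ==> c \<in> BW \<union> BN ==> q \<in> A ==> X b q (x c) = (if b = c then 1 else 0)"
    by (rule frame[OF a fB oB nB sB U0]) (assumption, rule that)
  have AU: "q \<in> U" if "q \<in> A" for q using that A(3) U0 by blast
  have 1: "x c q = 0" if "q \<in> A \<inter> S" "c \<in> BN" for q c
    using that A(6)[of c q] BN slice_iff[OF sl AU] by auto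
  have 2: "X b q \<in> tangent_S_in_M D q" if q: "q \<in> A \<inter> S" and b: "b \<in> BW" for q b
  proof -
    have qS: "q \<in> S" and qA: "q \<in> A" using q by auto
    have bW: "b \<in> W" using b BW by blast
    have Xt: "X b q \<in> tangent M q" using vector_fieldsD(1)[OF A(5)] b qS S_M by blast
    show ?thesis
    proof (rule tangent_S_in_M_iff[OF qS Xt, THEN iffD2], intro allI impI)
      fix F assume "vanishes_near F q"
      then obtain O' where O': "F \<in> Sm" "mopen O'" "q \<in> O'" "\<forall>r\<in>O' \<inter> S. F r = 0"
        by (auto simp: vanishes_near_def)
      \<comment> \<open>For a direction b in W the coordinate line through \<phi> q stays in the
        image of S near parameter 0, so F is constantly 0 along it and its derivative
        vanishes.\<close>
      have op: "openin (top_of_set W) (\<phi> ` (O' \<inter> S \<inter> U))" by (rule slice_image_open[OF sl O'(2)])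
      have "\<forall>\<^sub>F t in nhds (0::real). \<phi> q + t *\<^sub>R b \<in> \<phi> ` (O' \<inter> S \<inter> U) \<inter> UNIV"
        by (rule line_in_open_eventually[OF subspace_W op _ bW]) (use O'(3) qS AU[OF qA] in auto)
      then have "\<forall>\<^sub>F t in nhds (0::real). (F \<circ> inv_into U \<phi>) (\<phi> q + t *\<^sub>R b) = 0"
      proof (rule eventually_mono)
        fix t assume "\<phi> q + t *\<^sub>R b \<in> \<phi> ` (O' \<inter> S \<inter> U) \<inter> UNIV"
        then obtain r where "r \<in> O'" "r \<in> S" "r \<in> U" "\<phi> q + t *\<^sub>R b = \<phi> r" by blast
        then show "(F \<circ> inv_into U \<phi>) (\<phi> q + t *\<^sub>R b) = 0" using O'(4) slice_inv(2)[OF sl, of r] by simp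
      qed
      moreover have "((\<lambda>t. (F \<circ> inv_into U \<phi>) (\<phi> q + t *\<^sub>R b)) has_real_derivative chart_der U \<phi> q b F) (at 0)"
        using chart_der_DERIV[OF a AU[OF qA] _ O'(1)] bW W_V by blast
      ultimately have "((\<lambda>t. 0::real) has_real_derivative chart_der U \<phi> q b F) (at 0)"
        using DERIV_cong_ev[of 0 0 "\<lambda>t. (F \<circ> inv_into U \<phi>) (\<phi> q + t *\<^sub>R b)" "\<lambda>t. 0"] by simp
      then have "chart_der U \<phi> q b F = 0" by (rule DERIV_unique) simp
      then show "X b q F = 0" using A(7)[of b q] b qA by simp
    qed
  qed
  have "adapted_frame BW BN A x X"
    unfolding adapted_frame_def using B A(1,4,5,8,9) 1 2 by (intro conjI ballI) simp_all
  then show thesis by (rule that) (use A in auto)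
qed

lemma adapted_frame_at:
  assumes "p \<in> S" "mopen U0" "p \<in> U0"
  obtains BW BN A x X where "adapted_frame BW BN A x X" "p \<in> A" "A \<subseteq> U0"
proof -
  obtain U \<phi> where U: "slice U \<phi>" "p \<in> U" by (rule slice_exists[OF assms(1)])
  obtain BW BN where B: "adapted_basis V W BW BN" by (rule adapted_basis_exists[OF subspace_model subspace_W W_V])
  obtain A x X where "adapted_frame BW BN A x X" "p \<in> A" "A \<subseteq> U0 \<inter> U"
    by (rule adapted_frame_exists[OF U(1) openin_Int[OF assms(2) adm_open[OF slice_adm[OF U(1)]]] _ _ B])
      (use assms U in auto)
  then show thesis by (intro that) auto
qed

lemma adapted_frameD:
  assumes "adapted_frame BW BN A x X"
  shows "finite BW" "finite BN" "BW \<inter> BN = {}" "mopen A"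
    "b \<in> BW \<union> BN ==> x b \<in> Sm" "b \<in> BW \<union> BN ==> X b \<in> VF"
    "q \<in> A ==> v \<in> tangent M q ==> f \<in> Sm ==> v f = (\<Sum>b\<in>BW \<union> BN. v (x b) * X b q f)"
    "q \<in> A ==> b \<in> BW \<union> BN ==> c \<in> BW \<union> BN ==> X b q (x c) = (if b = c then 1 else 0)"
    "q \<in> A ==> q \<in> S ==> c \<in> BN ==> x c q = 0"
    "q \<in> A ==> q \<in> S ==> b \<in> BW ==> X b q \<in> tangent_S_in_M D q"
    "adapted_basis V W BW BN"
  using assms unfolding adapted_frame_def adapted_basis_def by blast+

lemma adapted_frame_cotangent:
  assumes F: "adapted_frame BW BN A x X" and q: "q \<in> A" and a: "a \<in> cotangent M q"
  shows "a = (\<Sum>b\<in>BW \<union> BN. a (X b q) *\<^sub>R dN (x b) q)"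
proof (rule cotangent_frame_expand[OF a _ q])
  show "q \<in> pts M" using q mopen_subset[OF adapted_frameD(4)[OF F]] by blast
qed (use adapted_frameD(5,6)[OF F] in blast, use adapted_frameD(6)[OF F] in blast, rule adapted_frameD(7)[OF F])

section \<open>Brackets with functions that vanish on S\<close>

lemma bracket_S_restrict:
  "F \<in> Sm ==> G \<in> Sm ==>
    bracket_S D (restrict_S D F) (restrict_S D G) = restrict_S D (br F G)"
  using S_emb by (simp add: embedded_poisson_submanifold_def)

text \<open>The Poisson condition speaks of restrictions of global functions; a local lift agrees
  with the given function on an open part of S, and differentials on S see only germs.\<close>

lemma bracket_S_lift:
  assumes "f \<in> SS" "g \<in> SS" and F: "F \<in> Sm" and G: "G \<in> Sm"
    and A: "mopen A" "\<And>q. q \<in> A ==> q \<in> S ==> F q = f q" "\<And>q. q \<in> A ==> q \<in> S ==> G q = g q"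
    and q: "q \<in> A" "q \<in> S"
  shows "br F G q = bracket_S D f g q"
proof -
  have AS: "S.mopen (A \<inter> S)" using A(1) S_mopen by blast
  have "d_S D (restrict_S D F) q = d_S D f q"
    by (rule S.differential_local[OF restrict_S_smooth[OF F] assms(1) AS]) (use q A(2) in \<open>auto simp: restrict_S_def\<close>)
  moreover have "d_S D (restrict_S D G) q = d_S D g q"
    by (rule S.differential_local[OF restrict_S_smooth[OF G] assms(2) AS]) (use q A(3) in \<open>auto simp: restrict_S_def\<close>)
  ultimately have "bracket_S D f g q = bracket_S D (restrict_S D F) (restrict_S D G) q"
    by (simp add: S.br_apply)
  also have "\<dots> = br F G q" using bracket_S_restrict[OF F G] q by (simp add: restrict_S_def)
  finally show ?thesis by simp
qed

text \<open>A function vanishing on S near q is a local lift of 0, so its brackets restrict to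
  brackets with 0.\<close>

lemma br_vanish:
  assumes F: "vanishes_near F q" and G: "G \<in> Sm" and q: "q \<in> S"
  shows "br F G q = 0" "br G F q = 0"
proof -
  obtain A where A: "F \<in> Sm" "mopen A" "q \<in> A" "\<forall>r\<in>A \<inter> S. F r = 0"
    using F by (auto simp: vanishes_near_def)
  have "S.br 0 (restrict_S D G) = - S.br (restrict_S D G) 0" by (rule S.br_skew)
  moreover have "S.br (restrict_S D G) (0 *\<^sub>R 0) = 0 *\<^sub>R S.br (restrict_S D G) 0"
    by (rule S.br_right(2)[OF S.smooth_intros(1) S.smooth_intros(1)])
  ultimately have z: "S.br 0 (restrict_S D G) q = 0" by simp
  have "br F G q = bracket_S D 0 (restrict_S D G) q"
    by (rule bracket_S_lift[OF S.smooth_intros(1) restrict_S_smooth[OF G] A(1) G A(2)])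
      (use A q in \<open>auto simp: restrict_S_def\<close>)
  then show "br F G q = 0" using z by simp
  then show "br G F q = 0" using br_skew[of G F] by simp
qed

text \<open>Every covector at q is the differential of a function, which reduces the claim to
  \<open>br_vanish\<close>. Geometrically, the image of \<pi>-sharp at points of S is tangent to
  S.\<close>

lemma sharp_vanish:
  assumes "\<gamma> \<in> Om" "q \<in> S" "vanishes_near F q"
  shows "sharp M (amb_poisson D) \<gamma> q F = 0"
proof -
  have qM: "q \<in> pts M" using assms(2) S_M by blast
  obtain G where G: "G \<in> Sm" "dN G q = \<gamma> q"
    by (rule cotangent_exact[OF one_formsD(1)[OF assms(1) qM] qM])
  have "sharp M (amb_poisson D) \<gamma> q F = br G F q" by (simp add: sharp_apply br_apply G(2))
  then show ?thesis using br_vanish(2)[OF assms(3) G(1) assms(2)] by simp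
qed

section \<open>Sections of the cotangent bundle of M along S and their bracket\<close>

lemma restricted_formsD:
  assumes "a \<in> restricted_forms D"
  shows "q \<in> S ==> a q \<in> cotangent M q" "q \<notin> S ==> a q = 0"
    "X \<in> VF ==> (\<lambda>q. a q (X q)) \<in> SS"
  using assms by (auto simp: restricted_forms_def pairing_def)

lemma restricted_formsI:
  assumes "\<And>q. q \<in> S ==> a q \<in> cotangent M q" "\<And>q. q \<notin> S ==> a q = 0"
    "\<And>X. X \<in> VF ==> (\<lambda>q. a q (X q)) \<in> SS"
  shows "a \<in> restricted_forms D"
  using assms by (auto simp: restricted_forms_def pairing_def)

lemma subspace_restricted_forms: "subspace (restricted_forms D)"
proof (rule subspaceI)
  show "0 \<in> restricted_forms D"
    using subspace_0[OF subspace_cotangent] S.smooth_intros(1)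
    by (intro restricted_formsI) (simp_all add: zero_fun_def)
next
  fix X Y assume XY: "X \<in> restricted_forms D" "Y \<in> restricted_forms D"
  have e: "(\<lambda>p. (X + Y) p (Z p)) = (\<lambda>p. X p (Z p)) + (\<lambda>p. Y p (Z p))" for Z :: "'a vfield" by auto
  show "X + Y \<in> restricted_forms D"
  proof (rule restricted_formsI)
    fix Z assume f: "Z \<in> VF"
    show "(\<lambda>p. (X + Y) p (Z p)) \<in> SS"
      unfolding e by (rule S.smooth_intros(2)[OF restricted_formsD(3)[OF XY(1) f] restricted_formsD(3)[OF XY(2) f]])
  next
    fix p assume p: "p \<notin> S"
    show "(X + Y) p = 0" using restricted_formsD(2)[OF XY(1) p] restricted_formsD(2)[OF XY(2) p] by (auto simp: fun_eq_iff)
  qed (simp_all only: plus_fun_apply subspace_add[OF subspace_cotangent] restricted_formsD(1)[OF XY(1)] restricted_formsD(1)[OF XY(2)])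
next
  fix c X assume X: "X \<in> restricted_forms D"
  have e: "(\<lambda>p. (c *\<^sub>R X) p (Z p)) = c *\<^sub>R (\<lambda>p. X p (Z p))" for Z :: "'a vfield" by auto
  show "c *\<^sub>R X \<in> restricted_forms D"
  proof (rule restricted_formsI)
    fix Z assume f: "Z \<in> VF"
    show "(\<lambda>p. (c *\<^sub>R X) p (Z p)) \<in> SS"
      unfolding e by (rule S.smooth_intros(5)[OF restricted_formsD(3)[OF X f]])
  next
    fix p assume p: "p \<notin> S"
    show "(c *\<^sub>R X) p = 0" using restricted_formsD(2)[OF X p] by (auto simp: fun_eq_iff)
  qed (simp_all only: scaleR_fun_apply subspace_scale[OF subspace_cotangent] restricted_formsD(1)[OF X])
qed

lemma smult_section_apply [simp]: "smult_section f a q = f q *\<^sub>R a q"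
  by (simp add: smult_section_def)

lemma restricted_forms_smult:
  assumes f: "f \<in> SS" and a: "a \<in> restricted_forms D"
  shows "smult_section f a \<in> restricted_forms D"
proof (rule restricted_formsI)
  fix Z assume Z: "Z \<in> VF"
  have "(\<lambda>q. smult_section f a q (Z q)) = f * (\<lambda>q. a q (Z q))" by auto
  then show "(\<lambda>q. smult_section f a q (Z q)) \<in> SS"
    using S.smooth_mult[OF f restricted_formsD(3)[OF a Z]] by simp
next
  fix q assume "q \<notin> S" then show "smult_section f a q = 0" using restricted_formsD(2)[OF a] by (auto simp: fun_eq_iff)
next
  fix q assume "q \<in> S" then show "smult_section f a q \<in> cotangent M q"
    unfolding smult_section_apply by (intro subspace_scale[OF subspace_cotangent] restricted_formsD(1)[OF a])
qed

text \<open>F is a potential of the section a along S: only values at points of S are compared, so a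
  may have an arbitrary conormal part.\<close>

definition exact_on :: "'a set \<Rightarrow> 'a fn \<Rightarrow> 'a form \<Rightarrow> bool"
  where "exact_on A F a \<longleftrightarrow> mopen A \<and> F \<in> Sm \<and> (\<forall>q\<in>A \<inter> S. a q = dN F q)"

text \<open>Large enough for the affine bracket: it contains all conormal sections
  (\<open>conormal_locally_exact\<close>) and all lifts h(df) (\<open>hd_locally_exact\<close>), and
  it is closed under sums and under the bracket.\<close>

definition locally_exact :: "'a form set"
  where "locally_exact = {a. (\<forall>q. q \<notin> S \<longrightarrow> a q = 0) \<and> (\<forall>p\<in>S. \<exists>A F. p \<in> A \<and> exact_on A F a)}"

lemma locally_exactE:
  assumes "a \<in> locally_exact" "p \<in> S"
  obtains A F where "p \<in> A" "exact_on A F a"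
proof -
  have "\<exists>A F. p \<in> A \<and> exact_on A F a" using assms by (simp add: locally_exact_def)
  then show thesis by (elim exE conjE) (rule that)
qed

lemma exact_on_subset: "exact_on A F a ==> mopen B ==> B \<subseteq> A ==> exact_on B F a"
  unfolding exact_on_def by blast

lemma locally_exact_restricted: assumes a: "a \<in> locally_exact" shows "a \<in> restricted_forms D"
proof (rule restricted_formsI)
  fix q assume q: "q \<in> S"
  obtain A F where "q \<in> A" "exact_on A F a" by (rule locally_exactE[OF a q])
  then show "a q \<in> cotangent M q" using q S_M differential_cotangent[of q F] by (auto simp: exact_on_def)
next
  fix q assume "q \<notin> S" then show "a q = 0" using a by (simp add: locally_exact_def)
next
  fix X assume X: "X \<in> VF"
  show "(\<lambda>q. a q (X q)) \<in> SS"
  proof (rule smooth_SI)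
    fix p assume "p \<notin> S" then show "a p (X p) = 0" using a by (simp add: locally_exact_def)
  next
    fix p assume p: "p \<in> S"
    obtain A F where A: "p \<in> A" "exact_on A F a" by (rule locally_exactE[OF a p])
    have "X q F = a q (X q)" if "q \<in> A \<inter> S" for q
    proof -
      have "q \<in> pts M" using that S_M by blast
      then show ?thesis using that A(2) vector_fieldsD(1)[OF X] by (simp add: exact_on_def)
    qed
    then show "\<exists>F A. F \<in> Sm \<and> mopen A \<and> p \<in> A \<and> (\<forall>q\<in>A \<inter> S. F q = a q (X q))"
      using A vector_fieldsD(3)[OF X] by (intro exI[of _ "\<lambda>q. X q F"] exI[of _ A]) (auto simp: exact_on_def)
  qed
qed

text \<open>The difference of two extensions has coefficient functions vanishing on S near p, and
  these are annihilated by \<pi>-sharp at p (\<open>sharp_vanish\<close>), as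
  \<open>koszul_cong\<close> demands.\<close>

lemma koszul_restrict:
  assumes \<alpha>: "\<alpha> \<in> Om" "\<alpha>' \<in> Om" and \<beta>: "\<beta> \<in> Om" "\<beta>' \<in> Om"
    and A: "mopen A" "p \<in> A" "p \<in> S"
      "\<And>q. q \<in> A ==> q \<in> S ==> \<alpha> q = \<alpha>' q" "\<And>q. q \<in> A ==> q \<in> S ==> \<beta> q = \<beta>' q"
  shows "koszul M (amb_poisson D) \<alpha> \<beta> p = koszul M (amb_poisson D) \<alpha>' \<beta>' p"
proof -
  have *: "sharp M (amb_poisson D) \<gamma> p (\<lambda>q. (\<alpha> - \<alpha>') q (Y q)) = 0"
    if "\<gamma> \<in> Om" "Y \<in> VF" "\<alpha> \<in> Om" "\<alpha>' \<in> Om"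
      "\<And>q. q \<in> A ==> q \<in> S ==> \<alpha> q = \<alpha>' q" for \<gamma> Y \<alpha> \<alpha>'
  proof (rule sharp_vanish[OF that(1) A(3)])
    show "vanishes_near (\<lambda>q. (\<alpha> - \<alpha>') q (Y q)) p"
      unfolding vanishes_near_def
      using one_formsD(3)[OF subspace_diff[OF subspace_one_forms that(3,4)] that(2)] A that(5)
      by (intro conjI exI[of _ A]) auto
  qed
  have pM: "p \<in> pts M" using A(3) S_M by blast
  show ?thesis
    by (rule koszul_cong[OF \<alpha> \<beta> pM A(4)[OF A(2,3)] A(5)[OF A(2,3)]])
      (rule *[OF _ _ \<alpha> A(4)], assumption+, rule *[OF _ _ \<beta> A(5)])
qed

text \<open>Shows that the \<open>THE\<close> in \<open>restricted_bracket\<close> is attained. With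
  local potentials F and G the Koszul bracket is d{F, G} by \<open>koszul_exact\<close>, and
  \<open>koszul_restrict\<close> makes it independent of potentials and extensions, so the local
  values glue. Afterwards brackets of sections are computed as brackets of functions on M.\<close>

lemma restricted_bracket:
  assumes a: "a \<in> locally_exact" and b: "b \<in> locally_exact"
  shows "rb a b \<in> locally_exact"
    "exact_on A F a ==> exact_on A G b ==> exact_on A (br F G) (rb a b)"
proof -
  define is_c where "is_c c \<longleftrightarrow> c \<in> restricted_forms D \<and>
    (\<forall>\<alpha>\<in>Om. \<forall>\<beta>\<in>Om. \<forall>U. mopen U \<longrightarrow>
      (\<forall>p\<in>U \<inter> S. \<alpha> p = a p \<and> \<beta> p = b p) \<longrightarrow>
      (\<forall>p\<in>U \<inter> S. c p = koszul M (amb_poisson D) \<alpha> \<beta> p))" for c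
  have k: "koszul M (amb_poisson D) \<alpha> \<beta> p = dN (br F G) p"
    if "exact_on A F a" "exact_on A G b" "\<alpha> \<in> Om" "\<beta> \<in> Om" "mopen U"
      "\<forall>p\<in>U \<inter> S. \<alpha> p = a p \<and> \<beta> p = b p" "p \<in> U" "p \<in> A" "p \<in> S" for A F G \<alpha> \<beta> U p
  proof -
    have FG: "F \<in> Sm" "G \<in> Sm" "mopen A" using that by (auto simp: exact_on_def)
    have "koszul M (amb_poisson D) \<alpha> \<beta> p = koszul M (amb_poisson D) (dN F) (dN G) p"
      by (rule koszul_restrict[OF that(3) differential_one_form[OF FG(1)] that(4) differential_one_form[OF FG(2)]
          openin_Int[OF FG(3) that(5)]])
        (use that in \<open>auto simp: exact_on_def\<close>)
    then show ?thesis using koszul_exact[OF FG(1,2)] by simp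
  qed
  \<comment> \<open>Pointwise choice of a pair of local potentials; that every pair gives the same
    value is the next fact.\<close>
  define c where "c p = (if p \<in> S then SOME w. \<exists>A F G. p \<in> A \<and> exact_on A F a \<and> exact_on A G b \<and>
      w = dN (br F G) p else 0)" for p
  have c: "c p = dN (br F G) p" if "p \<in> S" "p \<in> A" "exact_on A F a" "exact_on A G b" for p A F G
  proof -
    let ?P = "\<lambda>w. \<exists>A F G. p \<in> A \<and> exact_on A F a \<and> exact_on A G b \<and> w = dN (br F G) p"
    have "?P (dN (br F G) p)" using that by blast
    then have "?P (SOME w. ?P w)" by (rule someI[of ?P])
    then obtain A' F' G' where A': "p \<in> A'" "exact_on A' F' a" "exact_on A' G' b"
      "(SOME w. ?P w) = dN (br F' G') p" by (elim exE conjE)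
    have FG: "F \<in> Sm" "G \<in> Sm" "mopen A" using that by (auto simp: exact_on_def)
    have "koszul M (amb_poisson D) (dN F) (dN G) p = dN (br F' G') p"
      by (rule k[OF A'(2,3) differential_one_form[OF FG(1)] differential_one_form[OF FG(2)] FG(3)])
        (use that A' in \<open>auto simp: exact_on_def\<close>)
    then show ?thesis using koszul_exact[OF FG(1,2)] A'(4) that(1) by (simp add: c_def)
  qed
  have both: "\<exists>A F G. p \<in> A \<and> exact_on A F a \<and> exact_on A G b" if p: "p \<in> S" for p
  proof -
    obtain A F where A: "p \<in> A" "exact_on A F a" by (rule locally_exactE[OF a p])
    obtain B G where B: "p \<in> B" "exact_on B G b" by (rule locally_exactE[OF b p])
    have "mopen (A \<inter> B)" using A B by (auto simp: exact_on_def)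
    then show ?thesis
      using A B exact_on_subset[OF A(2), of "A \<inter> B"] exact_on_subset[OF B(2), of "A \<inter> B"]
      by (intro exI[of _ "A \<inter> B"] exI[of _ F] exI[of _ G]) auto
  qed
  have c_exact: "exact_on A (br F G) c" if "exact_on A F a" "exact_on A G b" for A F G
    using that c br_smooth by (auto simp: exact_on_def)
  have cLE: "c \<in> locally_exact"
    unfolding locally_exact_def
  proof (intro CollectI conjI allI impI ballI)
    fix p assume "p \<in> S"
    then obtain A F G where "p \<in> A" "exact_on A F a" "exact_on A G b" using both by blast
    then show "\<exists>A F. p \<in> A \<and> exact_on A F c" using c_exact by blast
  qed (simp add: c_def)
  have "is_c c" unfolding is_c_def
  proof (intro conjI ballI allI impI locally_exact_restricted[OF cLE])
    fix \<alpha> \<beta> U p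
    assume h: "\<alpha> \<in> Om" "\<beta> \<in> Om" "mopen U" "\<forall>p\<in>U \<inter> S. \<alpha> p = a p \<and> \<beta> p = b p" and p: "p \<in> U \<inter> S"
    have pS: "p \<in> S" "p \<in> U" using p by auto
    obtain A F G where A: "p \<in> A" "exact_on A F a" "exact_on A G b" using both[OF pS(1)] by (elim exE conjE)
    show "c p = koszul M (amb_poisson D) \<alpha> \<beta> p"
      using c[OF pS(1) A] k[OF A(2,3) h pS(2) A(1) pS(1)] by simp
  qed
  moreover have "c' = c" if c': "is_c c'" for c'
  proof
    fix p show "c' p = c p"
    proof (cases "p \<in> S")
      case True
      obtain A F G where A: "p \<in> A" "exact_on A F a" "exact_on A G b" using both[OF True] by (elim exE conjE)
      have FG: "F \<in> Sm" "G \<in> Sm" "mopen A" using A by (auto simp: exact_on_def)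
      \<comment> \<open>Uniqueness: \<open>dN F\<close> and \<open>dN G\<close> are global forms
        that extend a and b along A, so the defining property can be applied to them.\<close>
      have "\<forall>q\<in>A \<inter> S. dN F q = a q \<and> dN G q = b q" using A by (auto simp: exact_on_def)
      then have "c' p = koszul M (amb_poisson D) (dN F) (dN G) p"
        using c' differential_one_form[OF FG(1)] differential_one_form[OF FG(2)] FG(3) A(1) True unfolding is_c_def by blast
      then show ?thesis using c[OF True A] koszul_exact[OF FG(1,2)] by simp
    next
      case False
      have "c' \<in> restricted_forms D" using c' unfolding is_c_def by (rule conjunct1)
      then show ?thesis using restricted_formsD(2)[of c' p] False by (simp add: c_def)
    qed
  qed
  ultimately have "rb a b = c"
    unfolding restricted_bracket_def is_c_def[symmetric] by (intro the_equality)
  then show "rb a b \<in> locally_exact"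
    "exact_on A F a ==> exact_on A G b ==> exact_on A (br F G) (rb a b)"
    using cLE c_exact by simp_all
qed

section \<open>Conormal sections and their potentials\<close>

lemma conormal_sectionsD:
  assumes "\<eta> \<in> CS"
  shows "\<eta> \<in> restricted_forms D" "q \<in> S ==> v \<in> tangent_S_in_M D q ==> \<eta> q v = 0"
  using assms by (auto simp: conormal_sections_def conormal_def)

lemma conormal_sectionsI:
  assumes "\<eta> \<in> restricted_forms D" "\<And>q v. q \<in> S ==> v \<in> tangent_S_in_M D q ==> \<eta> q v = 0"
  shows "\<eta> \<in> CS"
  using assms restricted_formsD(1)[OF assms(1)] by (auto simp: conormal_sections_def conormal_def)

lemma subspace_CS: "subspace (CS)"
proof (rule subspaceI)
  show "0 \<in> CS"
    by (rule conormal_sectionsI[OF subspace_0[OF subspace_restricted_forms]]) simp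
  show "x + y \<in> CS" if "x \<in> CS" "y \<in> CS" for x y
    by (rule conormal_sectionsI[OF subspace_add[OF subspace_restricted_forms conormal_sectionsD(1)[OF that(1)] conormal_sectionsD(1)[OF that(2)]]])
      (simp add: conormal_sectionsD(2)[OF that(1)] conormal_sectionsD(2)[OF that(2)])
  show "c *\<^sub>R x \<in> CS" if "x \<in> CS" for c x
    by (rule conormal_sectionsI[OF subspace_scale[OF subspace_restricted_forms conormal_sectionsD(1)[OF that]]])
      (simp add: conormal_sectionsD(2)[OF that])
qed

lemma conormal_smult:
  assumes "f \<in> SS" "\<eta> \<in> CS" shows "smult_section f \<eta> \<in> CS"
  by (rule conormal_sectionsI[OF restricted_forms_smult[OF assms(1) conormal_sectionsD(1)[OF assms(2)]]])
    (simp add: conormal_sectionsD(2)[OF assms(2)])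

lemma lifts_finite:
  assumes "finite C" "p \<in> S" "\<And>c. c \<in> C ==> f c \<in> SS"
  obtains F A where "mopen A" "p \<in> A" "\<And>c. c \<in> C ==> F c \<in> Sm"
    "\<And>c q. c \<in> C ==> q \<in> A ==> q \<in> S ==> F c q = f c q"
proof -
  have "\<exists>F A. F \<in> Sm \<and> mopen A \<and> p \<in> A \<and> (\<forall>q\<in>A \<inter> S. F q = f c q)" if c: "c \<in> C" for c
  proof -
    obtain F A where "F \<in> Sm" "mopen A" "p \<in> A" "\<And>q. q \<in> A ==> q \<in> S ==> F q = f c q"
      by (rule smooth_S_lift[OF assms(3)[OF c] assms(2)]) (rule that)
    then show ?thesis by (intro exI[of _ F] exI[of _ A]) auto
  qed
  then have "\<forall>c\<in>C. \<exists>P. fst P \<in> Sm \<and> mopen (snd P) \<and> p \<in> snd P \<and> (\<forall>q\<in>snd P \<inter> S. fst P q = f c q)"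
    by (metis fst_conv snd_conv)
  from bchoice[OF this] obtain P where P: "\<forall>c\<in>C. fst (P c) \<in> Sm \<and> mopen (snd (P c)) \<and> p \<in> snd (P c) \<and>
      (\<forall>q\<in>snd (P c) \<inter> S. fst (P c) q = f c q)" by blast
  have o: "mopen (\<Inter>(insert (pts M) ((\<lambda>c. snd (P c)) ` C)))"
    by (rule openin_Inter) (use P assms(1) mopen_pts in auto)
  show thesis
    by (rule that[OF o, of "\<lambda>c. fst (P c)"]) (use P assms(2) S_M in auto)
qed

text \<open>At a common zero of the x c the Leibniz rule leaves only the terms differentiating x
  c.\<close>

lemma differential_combination:
  assumes "\<And>c. c \<in> C ==> F c \<in> Sm" "\<And>c. c \<in> C ==> x c \<in> Sm"
    and "\<And>c. c \<in> C ==> x c q = 0"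
  shows "dN (\<Sum>c\<in>C. F c * x c) q = (\<Sum>c\<in>C. F c q *\<^sub>R dN (x c) q)"
proof -
  have "dN (\<Sum>c\<in>C. 1 *\<^sub>R (F c * x c)) q = (\<Sum>c\<in>C. 1 *\<^sub>R dN (F c * x c) q)"
    by (rule differential_sum) (use assms smooth_mult in auto)
  also have "\<dots> = (\<Sum>c\<in>C. F c q *\<^sub>R dN (x c) q)"
    by (rule sum.cong[OF refl]) (simp add: differential_mult assms fun_eq_iff)
  finally show ?thesis by simp
qed

text \<open>In an adapted frame a conormal section is a combination of the dx_c for transverse c. As
  the x_c vanish on S, multiplying each by an extension of its coefficient and summing yields a
  potential. The clause on vanishing coefficients is there for \<open>br1_pointwise\<close>.\<close>

lemma conormal_lift_sum:
  assumes \<eta>: "\<eta> \<in> CS" and p: "p \<in> S"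
  obtains A and C :: "'e set" and F x where "p \<in> A" "finite C" "exact_on A (\<Sum>c\<in>C. F c * x c) \<eta>"
    "\<And>c. c \<in> C ==> F c \<in> Sm" "\<And>c. c \<in> C ==> x c \<in> Sm"
    "\<And>c q. c \<in> C ==> q \<in> A ==> q \<in> S ==> x c q = 0" "\<And>c. c \<in> C ==> \<eta> p = 0 ==> F c p = 0"
proof -
  have pM: "p \<in> pts M" using p S_M by blast
  obtain BW BN A x X where fr: "adapted_frame BW BN A x X" "p \<in> A" "A \<subseteq> pts M"
    by (rule adapted_frame_at[OF p mopen_pts pM])
  note fD = adapted_frameD[OF fr(1)]
  have s: "(\<lambda>q. \<eta> q (X c q)) \<in> SS" if "c \<in> BN" for c
    by (rule restricted_formsD(3)[OF conormal_sectionsD(1)[OF \<eta>]]) (use that fD(6) in blast)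
  obtain F B where F: "mopen B" "p \<in> B" "\<And>c. c \<in> BN ==> F c \<in> Sm"
    "\<And>c q. c \<in> BN ==> q \<in> B ==> q \<in> S ==> F c q = \<eta> q (X c q)"
    by (rule lifts_finite[OF fD(2) p, of "\<lambda>c q. \<eta> q (X c q)"]) (erule s, rule that)
  have xs: "x c \<in> Sm" if "c \<in> BN" for c using that fD(5) by blast
  let ?F = "\<Sum>c\<in>BN. F c * x c"
  have Fs: "?F \<in> Sm" by (intro smooth_intros(6) smooth_mult F(3) xs)
  have "\<eta> q = dN ?F q" if q: "q \<in> A \<inter> B" "q \<in> S" for q
  proof -
    have qA: "q \<in> A" and qB: "q \<in> B" using q by auto
    have "\<eta> q = (\<Sum>b\<in>BW \<union> BN. \<eta> q (X b q) *\<^sub>R dN (x b) q)"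
      by (rule adapted_frame_cotangent[OF fr(1) qA restricted_formsD(1)[OF conormal_sectionsD(1)[OF \<eta>] q(2)]])
    also have "\<dots> = (\<Sum>b\<in>BN. \<eta> q (X b q) *\<^sub>R dN (x b) q)"
    proof (rule sum.mono_neutral_right)
      show "\<forall>b\<in>BW \<union> BN - BN. \<eta> q (X b q) *\<^sub>R dN (x b) q = 0"
        using conormal_sectionsD(2)[OF \<eta> q(2) fD(10)[OF qA q(2)]] by (auto simp: fun_eq_iff)
    qed (use fD in auto)
    also have "\<dots> = (\<Sum>b\<in>BN. F b q *\<^sub>R dN (x b) q)"
      by (rule sum.cong[OF refl]) (simp add: F(4)[OF _ qB q(2)])
    also have "\<dots> = dN ?F q"
      by (rule differential_combination[symmetric]) (use F(3) xs fD(9)[OF qA q(2)] in auto)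
    finally show ?thesis .
  qed
  then have e: "exact_on (A \<inter> B) ?F \<eta>" using Fs F(1) fD(4) by (auto simp: exact_on_def)
  show thesis
    by (rule that[OF _ fD(2) e F(3) xs]) (use F(2,4) fr(2) fD(9) p in auto)
qed

lemma conormal_lift:
  assumes "\<eta> \<in> CS" "p \<in> S"
  obtains A F where "p \<in> A" "exact_on A F \<eta>" "\<And>q. q \<in> A ==> q \<in> S ==> F q = 0"
proof -
  obtain A and C :: "'e set" and F x where A: "p \<in> A" "finite C" "exact_on A (\<Sum>c\<in>C. F c * x c) \<eta>"
    "\<And>c. c \<in> C ==> F c \<in> Sm" "\<And>c. c \<in> C ==> x c \<in> Sm"
    "\<And>c q. c \<in> C ==> q \<in> A ==> q \<in> S ==> x c q = 0" "\<And>c. c \<in> C ==> \<eta> p = 0 ==> F c p = 0"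
    by (rule conormal_lift_sum[OF assms]) (rule that)
  show thesis by (rule that[OF A(1,3)]) (simp add: sum_fun_apply A(6))
qed

lemma conormal_locally_exact: assumes "\<eta> \<in> CS" shows "\<eta> \<in> locally_exact"
  unfolding locally_exact_def
proof (intro CollectI conjI allI impI ballI)
  fix p assume p: "p \<in> S"
  obtain A F where "p \<in> A" "exact_on A F \<eta>" by (rule conormal_lift[OF assms p])
  then show "\<exists>A F. p \<in> A \<and> exact_on A F \<eta>" by blast
qed (use restricted_formsD(2)[OF conormal_sectionsD(1)[OF assms]] in blast)

lemma differential_vanish_conormal:
  assumes "vanishes_near F q" "q \<in> S" "v \<in> tangent_S_in_M D q"
  shows "dN F q v = 0"
proof -
  have "q \<in> pts M" using assms(2) S_M by blast
  then show ?thesis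
    using tangent_S_in_M_iff[OF assms(2) tangent_S_in_M_tangent[OF assms(2,3)]] assms
      tangent_S_in_M_tangent[OF assms(2,3)] by simp
qed

text \<open>Positive codimension yields a transverse coordinate x_c. Cut off by a bump supported in
  the frame domain, it vanishes on all of S, so its differential is conormal everywhere on S; at p
  it is 1 on X_c.\<close>

lemma conormal_nonzero:
  assumes d: "dim W < dim V" and p: "p \<in> S"
  obtains \<eta> where "\<eta> \<in> CS" "\<eta> p \<noteq> 0"
proof -
  have pM: "p \<in> pts M" using p S_M by blast
  obtain BW BN A x X where fr: "adapted_frame BW BN A x X" "p \<in> A" "A \<subseteq> pts M"
    by (rule adapted_frame_at[OF p mopen_pts pM])
  note fD = adapted_frameD[OF fr(1)]
  have "BN \<noteq> {}"
  proof
    assume "BN = {}"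
    then have "V = W" using fD(11) by (auto simp: adapted_basis_def)
    then show False using d by simp
  qed
  then obtain c where c: "c \<in> BN" by blast
  have xc: "x c \<in> Sm" using c fD(5) by blast
  obtain \<rho> A' C where \<rho>: "\<rho> \<in> Sm" "mopen A'" "p \<in> A'" "A' \<subseteq> A" "\<And>q. q \<in> A' ==> \<rho> q = 1"
    "mopen (pts M - C)" "C \<subseteq> A" "\<And>q. q \<notin> C ==> \<rho> q = 0"
    by (rule bump[OF fD(4) fr(2)]) (rule that)
  define F where "F = \<rho> * x c"
  have Fs: "F \<in> Sm" unfolding F_def by (rule smooth_mult[OF \<rho>(1) xc])
  have F0: "F q = 0" if "q \<in> S" for q
    using \<rho>(7,8) fD(9)[OF _ that c] by (cases "q \<in> C") (auto simp: F_def)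
  have Fv: "vanishes_near F q" if "q \<in> S" for q
    unfolding vanishes_near_def using Fs F0 mopen_pts that S_M by (intro conjI exI[of _ "pts M"]) auto
  define \<eta> where "\<eta> q = (if q \<in> S then dN F q else 0)" for q
  have "\<eta> \<in> locally_exact"
    unfolding locally_exact_def
  proof (intro CollectI conjI allI impI ballI)
    fix q assume "q \<in> S"
    then show "\<exists>A F. q \<in> A \<and> exact_on A F \<eta>"
      using mopen_pts Fs S_M by (intro exI[of _ "pts M"] exI[of _ F]) (auto simp: exact_on_def \<eta>_def)
  qed (simp add: \<eta>_def)
  then have "\<eta> \<in> CS"
    by (intro conormal_sectionsI locally_exact_restricted)
      (simp_all add: \<eta>_def differential_vanish_conormal[OF Fv])
  moreover have "\<eta> p \<noteq> 0"
  proof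
    assume "\<eta> p = 0"
    moreover have "\<eta> p (X c p) = 1"
    proof -
      have Xc: "X c p \<in> tangent M p" using vector_fieldsD(1)[OF fD(6) pM] c by blast
      have "X c p F = X c p (x c)"
        by (rule tangent_local[OF Xc Fs xc \<rho>(2,3)]) (use \<rho>(5) in \<open>simp add: F_def\<close>)
      also have "\<dots> = 1" using fD(8)[OF fr(2), of c c] c by simp
      finally show ?thesis using p pM Xc by (simp add: \<eta>_def)
    qed
    ultimately show False by simp
  qed
  ultimately show thesis by (rule that)
qed

end

section \<open>The splitting of an exponential map\<close>

text \<open>The projection in \<open>normal_chart\<close> just drops the components along BN;
  minimality of the distance is the theorem of Pythagoras.\<close>

lemma closest_point_adapted_basis:
  fixes V :: "'e::euclidean_space set"
  assumes B: "adapted_basis V W BW BN" and W: "subspace W"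
  shows "closest_point W ((\<Sum>b\<in>BW \<union> BN. c b *\<^sub>R b)) = (\<Sum>b\<in>BW. c b *\<^sub>R b)"
proof -
  have fin: "finite BW" "finite BN" "BW \<inter> BN = {}" and BW: "BW \<subseteq> W" and BN: "\<And>b w. b \<in> BN ==> w \<in> W ==> w \<bullet> b = 0"
    using B unfolding adapted_basis_def by blast+
  let ?w = "\<Sum>b\<in>BW. c b *\<^sub>R b" and ?n = "\<Sum>b\<in>BN. c b *\<^sub>R b"
  have e: "(\<Sum>b\<in>BW \<union> BN. c b *\<^sub>R b) = ?w + ?n" by (rule sum.union_disjoint[OF fin])
  have wW: "?w \<in> W" using BW by (intro subspace_sum[OF W] subspace_scale[OF W]) auto
  have orth: "u \<bullet> ?n = 0" if "u \<in> W" for u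
    using BN that by (simp add: inner_sum_right)
  have "?w = closest_point W (?w + ?n)"
  proof (rule closest_point_unique[OF subspace_imp_convex[OF W] closed_subspace[OF W] wW], intro ballI)
    fix z assume z: "z \<in> W"
    have "(?w - z) \<bullet> ?n = 0" by (rule orth[OF subspace_diff[OF W wW z]])
    then have "(norm ((?w - z) + ?n))\<^sup>2 = (norm (?w - z))\<^sup>2 + (norm ?n)\<^sup>2"
      by (intro norm_add_Pythagorean) (simp add: orthogonal_def)
    then have "(norm ?n)\<^sup>2 \<le> (norm ((?w - z) + ?n))\<^sup>2" by simp
    then have "norm ?n \<le> norm ((?w - z) + ?n)" by (simp add: power2_le_iff_abs_le)
    then show "dist (?w + ?n) ?w \<le> dist (?w + ?n) z" by (simp add: dist_norm algebra_simps)
  qed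
  then show ?thesis by (simp add: e)
qed

context poisson_submanifold
begin

section \<open>Charts of the normal bundle\<close>

abbreviation "T p \<equiv> tangent_S_in_M D p"

text \<open>The fibre coordinate in \<open>normal_chart\<close>, before passing to cosets.\<close>

definition normal_part :: "('a \<Rightarrow> 'e) \<Rightarrow> 'a \<Rightarrow> 'a tvec \<Rightarrow> 'e"
  where "normal_part \<phi> p v = chart_differential M \<phi> p v - closest_point W (chart_differential M \<phi> p v)"

lemma apply_local_eq:
  assumes v: "v \<in> tangent M p" and f: "f \<in> Sm" and A: "mopen A" "p \<in> A" "\<And>q. q \<in> A ==> f q = g q"
  shows "apply_local M p v g = v f"
  unfolding apply_local_def
proof (rule the_equality)
  show "\<exists>f'\<in>Sm. \<exists>A. mopen A \<and> p \<in> A \<and> (\<forall>q\<in>A. f' q = g q) \<and> v f = v f'"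
    using f A by (intro bexI[of _ f] exI[of _ A]) auto
next
  fix r assume "\<exists>f'\<in>Sm. \<exists>A. mopen A \<and> p \<in> A \<and> (\<forall>q\<in>A. f' q = g q) \<and> r = v f'"
  then obtain f' B where B: "f' \<in> Sm" "mopen B" "p \<in> B" "\<forall>q\<in>B. f' q = g q" "r = v f'" by blast
  show "r = v f" unfolding B(5)
    by (rule tangent_local[OF v B(1) f openin_Int[OF A(1) B(2)]]) (use A B in auto)
qed

lemma chart_differential_frame:
  assumes fr: "adapted_frame BW BN A x X" and p: "p \<in> A" and v: "v \<in> tangent M p"
    and x: "\<And>b q. b \<in> BW \<union> BN ==> q \<in> A ==> x b q = \<phi> q \<bullet> b" and \<phi>: "\<And>q. q \<in> A ==> \<phi> q \<in> V"
  shows "chart_differential M \<phi> p v = (\<Sum>b\<in>BW \<union> BN. v (x b) *\<^sub>R b)"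
proof -
  note fD = adapted_frameD[OF fr]
  let ?B = "BW \<union> BN"
  have B: "pairwise orthogonal ?B" "\<And>b. b \<in> ?B ==> norm b = 1" "span ?B = V" "finite ?B"
    using fD(11) unfolding adapted_basis_def by blast+
  have ap: "apply_local M p v (\<lambda>q. \<phi> q \<bullet> i) = (\<Sum>b\<in>?B. v (x b) * (b \<bullet> i))" for i
  proof -
    let ?f = "\<Sum>b\<in>?B. (b \<bullet> i) *\<^sub>R x b"
    have s: "(b \<bullet> i) *\<^sub>R x b \<in> Sm" if "b \<in> ?B" for b
      by (rule smooth_intros(5)[OF fD(5)[OF that]])
    have "?f q = \<phi> q \<bullet> i" if q: "q \<in> A" for q
    proof -
      have "\<phi> q = (\<Sum>b\<in>?B. (\<phi> q \<bullet> b) *\<^sub>R b)"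
        using orthonormal_basis_expand[OF B(1,2) _ B(4), of "\<phi> q"] \<phi>[OF q] B(3) by simp
      then have "\<phi> q \<bullet> i = (\<Sum>b\<in>?B. (\<phi> q \<bullet> b) *\<^sub>R b) \<bullet> i" by simp
      also have "\<dots> = (\<Sum>b\<in>?B. (\<phi> q \<bullet> b) * (b \<bullet> i))" by (simp add: inner_sum_left)
      also have "\<dots> = ?f q" unfolding sum_fun_apply
        by (rule sum.cong[OF refl]) (simp add: x[OF _ q])
      finally show ?thesis by simp
    qed
    then have "apply_local M p v (\<lambda>q. \<phi> q \<bullet> i) = v ?f"
      by (intro apply_local_eq[OF v smooth_intros(6)[OF s] fD(4) p])
    also have "\<dots> = (\<Sum>b\<in>?B. v ((b \<bullet> i) *\<^sub>R x b))" by (rule tangent_sum[OF v s])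
    also have "\<dots> = (\<Sum>b\<in>?B. v (x b) * (b \<bullet> i))"
      by (rule sum.cong[OF refl]) (simp only: tangentD(2)[OF v fD(5)] mult.commute)
    finally show ?thesis .
  qed
  have "chart_differential M \<phi> p v = (\<Sum>i\<in>Basis. (\<Sum>b\<in>?B. v (x b) * (b \<bullet> i)) *\<^sub>R i)"
    unfolding chart_differential_def ap ..
  also have "\<dots> = (\<Sum>i\<in>Basis. ((\<Sum>b\<in>?B. v (x b) *\<^sub>R b) \<bullet> i) *\<^sub>R i)"
    by (simp add: inner_sum_left)
  also have "\<dots> = (\<Sum>b\<in>?B. v (x b) *\<^sub>R b)" by (rule euclidean_representation)
  finally show ?thesis .
qed

lemma normal_part_frame:
  assumes fr: "adapted_frame BW BN A x X" and p: "p \<in> A" and v: "v \<in> tangent M p"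
    and x: "\<And>b q. b \<in> BW \<union> BN ==> q \<in> A ==> x b q = \<phi> q \<bullet> b" and \<phi>: "\<And>q. q \<in> A ==> \<phi> q \<in> V"
  shows "normal_part \<phi> p v = (\<Sum>b\<in>BN. v (x b) *\<^sub>R b)"
proof -
  note fD = adapted_frameD[OF fr]
  have "(\<Sum>b\<in>BW \<union> BN. v (x b) *\<^sub>R b) = (\<Sum>b\<in>BW. v (x b) *\<^sub>R b) + (\<Sum>b\<in>BN. v (x b) *\<^sub>R b)"
    by (rule sum.union_disjoint[OF fD(1,2,3)])
  moreover have "chart_differential M \<phi> p v = (\<Sum>b\<in>BW \<union> BN. v (x b) *\<^sub>R b)"
    by (rule chart_differential_frame[OF fr p v x \<phi>])
  ultimately show ?thesis
    using closest_point_adapted_basis[OF fD(11) subspace_W, of "\<lambda>b. v (x b)"] by (simp add: normal_part_def)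
qed

text \<open>The infinitely many conditions of \<open>tangent_S_in_M_iff\<close> reduce to those for
  the transverse coordinates: if they hold, v is a combination of frame vectors that are tangent to
  S.\<close>

lemma tangent_S_in_M_frame:
  assumes fr: "adapted_frame BW BN A x X" and p: "p \<in> A" "p \<in> S" and v: "v \<in> tangent M p"
  shows "v \<in> T p \<longleftrightarrow> (\<forall>c\<in>BN. v (x c) = 0)"
proof
  note fD = adapted_frameD[OF fr]
  assume "v \<in> T p"
  moreover have "vanishes_near (x c) p" if "c \<in> BN" for c
    unfolding vanishes_near_def using fD(4,5,9) that p by (intro conjI exI[of _ A]) auto
  ultimately show "\<forall>c\<in>BN. v (x c) = 0" using tangent_S_in_M_iff[OF p(2) v] by blast
next
  note fD = adapted_frameD[OF fr]
  assume 0: "\<forall>c\<in>BN. v (x c) = 0"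
  have pM: "p \<in> pts M" using p S_M by blast
  have "v = (\<Sum>b\<in>BW. v (x b) *\<^sub>R X b p)"
  proof (rule frame_tangent_expand[OF v])
    fix b assume "b \<in> BW" then show "X b p \<in> tangent M p" using vector_fieldsD(1)[OF fD(6) pM] by blast
  next
    fix f assume f: "f \<in> Sm"
    have "v f = (\<Sum>b\<in>BW \<union> BN. v (x b) * X b p f)" by (rule fD(7)[OF p(1) v f])
    also have "\<dots> = (\<Sum>b\<in>BW. v (x b) * X b p f)"
      by (rule sum.mono_neutral_right) (use 0 fD in auto)
    finally show "v f = (\<Sum>b\<in>BW. v (x b) * X b p f)" .
  qed
  also have "\<dots> \<in> T p"
    by (intro subspace_sum subspace_scale subspace_tangent_S_in_M fD(10)[OF p])
  finally show "v \<in> T p" .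
qed

context
  fixes U \<phi> BW BN
  assumes sl: "slice U \<phi>" and B: "adapted_basis V W BW BN"
begin

lemma basis_facts:
  "finite BN" "\<And>b w. b \<in> BN ==> w \<in> W ==> w \<bullet> b = 0" "BN \<subseteq> V" "finite BW" "BW \<inter> BN = {}" "BW \<subseteq> W"
  using B unfolding adapted_basis_def by blast+

lemma slice_frame_at:
  assumes "p \<in> U"
  obtains A x X where "adapted_frame BW BN A x X" "p \<in> A" "A \<subseteq> U"
    "\<And>b q. b \<in> BW \<union> BN ==> q \<in> A ==> x b q = \<phi> q \<bullet> b" "\<And>q. q \<in> A ==> \<phi> q \<in> V"
proof -
  obtain A x X where A: "adapted_frame BW BN A x X" "p \<in> A" "A \<subseteq> U"
    "\<And>b q. b \<in> BW \<union> BN ==> q \<in> A ==> x b q = \<phi> q \<bullet> b"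
    by (rule adapted_frame_exists[OF sl adm_open[OF slice_adm[OF sl]] assms subset_refl B]) (rule that)
  show thesis by (rule that[OF A]) (use A(3) adm_model[OF slice_adm[OF sl]] in auto)
qed

lemma normal_part_facts:
  assumes p: "p \<in> U" "p \<in> S" and v: "v \<in> tangent M p"
  shows "normal_part \<phi> p v \<in> V" "w \<in> W ==> w \<bullet> normal_part \<phi> p v = 0"
    "normal_part \<phi> p v = 0 \<longleftrightarrow> v \<in> T p"
    "v' \<in> tangent M p ==> normal_part \<phi> p (v + v') = normal_part \<phi> p v + normal_part \<phi> p v'"
    "normal_part \<phi> p (c *\<^sub>R v) = c *\<^sub>R normal_part \<phi> p v"
proof -
  obtain A x X where A: "adapted_frame BW BN A x X" "p \<in> A" "A \<subseteq> U"
    "\<And>b q. b \<in> BW \<union> BN ==> q \<in> A ==> x b q = \<phi> q \<bullet> b" "\<And>q. q \<in> A ==> \<phi> q \<in> V"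
    by (rule slice_frame_at[OF p(1)]) (rule that)
  note fD = adapted_frameD[OF A(1)]
  have np: "normal_part \<phi> p v = (\<Sum>b\<in>BN. v (x b) *\<^sub>R b)" if "v \<in> tangent M p" for v
    by (rule normal_part_frame[OF A(1,2) that A(4,5)])
  have xs: "x b \<in> Sm" if "b \<in> BN" for b using fD(5) that by blast
  show "normal_part \<phi> p v \<in> V"
    unfolding np[OF v] using basis_facts(3) by (intro subspace_sum subspace_scale subspace_model) auto
  show "w \<in> W ==> w \<bullet> normal_part \<phi> p v = 0"
    unfolding np[OF v] using basis_facts(2) by (simp add: inner_sum_right)
  have orth: "b \<bullet> b' = (if b = b' then 1 else 0)" if "b \<in> BN" "b' \<in> BN" for b b'
    using B that unfolding adapted_basis_def
    by (auto simp: pairwise_def orthogonal_def norm_eq_1)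
  have "v (x b) = 0" if "normal_part \<phi> p v = 0" "b \<in> BN" for b
  proof -
    have "0 = (\<Sum>b'\<in>BN. v (x b') *\<^sub>R b') \<bullet> b" using that np[OF v] by simp
    also have "\<dots> = (\<Sum>b'\<in>BN. if b' = b then v (x b') else 0)"
      unfolding inner_sum_left by (rule sum.cong[OF refl]) (simp add: orth[OF _ that(2)])
    also have "\<dots> = v (x b)" using that(2) basis_facts(1) by simp
    finally show ?thesis by simp
  qed
  moreover have "normal_part \<phi> p v = 0" if "\<forall>c\<in>BN. v (x c) = 0" using np[OF v] that by simp
  ultimately show "normal_part \<phi> p v = 0 \<longleftrightarrow> v \<in> T p"
    using tangent_S_in_M_frame[OF A(1,2) p(2) v] by blast
  show "v' \<in> tangent M p ==> normal_part \<phi> p (v + v') = normal_part \<phi> p v + normal_part \<phi> p v'"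
    using np[OF v] np[of v'] np[OF subspace_add[OF subspace_tangent v]]
    by (simp add: scaleR_left_distrib sum.distrib)
  show "normal_part \<phi> p (c *\<^sub>R v) = c *\<^sub>R normal_part \<phi> p v"
    using np[OF v] np[OF subspace_scale[OF subspace_tangent v]] by (simp add: scaleR_sum_right)
qed

text \<open>The normal part is additive and kills vectors tangent to S, so the \<open>THE\<close> in
  \<open>normal_chart\<close> has the same candidate for every representative of the coset.\<close>

lemma normal_chart_coset:
  assumes p: "p \<in> U" "p \<in> S" and v: "v \<in> tangent M p"
  shows "normal_chart D \<phi> (p, v +o T p) = \<phi> p + normal_part \<phi> p v"
proof -
  have h: "normal_part \<phi> p v' = normal_part \<phi> p v" if v': "v' \<in> v +o T p" for v'
  proof -
    obtain w where w: "w \<in> T p" "v' = v + w" using v' by (auto simp: elt_set_plus_def)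
    have wt: "w \<in> tangent M p" by (rule tangent_S_in_M_tangent[OF p(2) w(1)])
    show ?thesis unfolding w(2) normal_part_facts(4)[OF p v wt]
      using normal_part_facts(3)[OF p wt] w(1) by simp
  qed
  have m: "v \<in> v +o T p" using subspace_0[OF subspace_tangent_S_in_M] by (auto simp: elt_set_plus_def intro!: bexI[of _ 0])
  have "(THE y. \<forall>v'\<in>v +o T p. y = normal_part \<phi> p v') = normal_part \<phi> p v"
    by (rule the_equality) (intro ballI, rule h[symmetric], assumption, erule bspec[OF _ m])
  then show ?thesis by (simp add: normal_chart_def normal_part_def)
qed

text \<open>Base coordinate and fibre coordinate are orthogonal, so their sum determines both. Equal
  fibre coordinates over one point give equal cosets because the normal part vanishes only on
  vectors tangent to S.\<close>

lemma normal_chart_inj: "inj_on (normal_chart D \<phi>) (Sigma (U \<inter> S) (normal_space D))"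
proof (rule inj_onI, clarify)
  fix p c p' c'
  assume p: "p \<in> U" "p \<in> S" and c: "c \<in> normal_space D p" and p': "p' \<in> U" "p' \<in> S" and c': "c' \<in> normal_space D p'"
    and e: "normal_chart D \<phi> (p, c) = normal_chart D \<phi> (p', c')"
  obtain v where v: "v \<in> tangent M p" "c = v +o T p" using c by (auto simp: normal_space_def)
  obtain v' where v': "v' \<in> tangent M p'" "c' = v' +o T p'" using c' by (auto simp: normal_space_def)
  let ?n = "normal_part \<phi> p v" and ?n' = "normal_part \<phi> p' v'"
  have eq: "\<phi> p + ?n = \<phi> p' + ?n'"
    using e normal_chart_coset[OF p v(1)] normal_chart_coset[OF p' v'(1)] v(2) v'(2) by simp
  have W: "\<phi> p \<in> W" "\<phi> p' \<in> W" using slice_iff[OF sl] p p' by auto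
  then have d: "\<phi> p - \<phi> p' \<in> W" by (rule subspace_diff[OF subspace_W])
  have "\<phi> p - \<phi> p' = ?n' - ?n" using eq by (simp add: algebra_simps)
  then have "(\<phi> p - \<phi> p') \<bullet> (\<phi> p - \<phi> p') = (\<phi> p - \<phi> p') \<bullet> (?n' - ?n)" by simp
  also have "\<dots> = 0"
    using normal_part_facts(2)[OF p v(1) d] normal_part_facts(2)[OF p' v'(1) d] by (simp add: inner_diff_right)
  finally have "\<phi> p = \<phi> p'" by simp
  then have pp: "p = p'" using admissibleD(2)[OF slice_adm[OF sl]] p p' by (meson inj_onD)
  have m: "(-1) *\<^sub>R v' \<in> tangent M p" unfolding pp by (rule subspace_scale[OF subspace_tangent v'(1)])
  have vp: "v' \<in> tangent M p" using v'(1) pp by simp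
  have "normal_part \<phi> p (v + (-1) *\<^sub>R v') = 0"
    unfolding normal_part_facts(4)[OF p v(1) m] normal_part_facts(5)[OF p vp] using eq pp by simp
  then have t: "v + (-1) *\<^sub>R v' \<in> T p"
    using normal_part_facts(3)[OF p subspace_add[OF subspace_tangent v(1) m]] by blast
  have "c = c'"
  proof (intro equalityI subsetI)
    fix z assume "z \<in> c"
    then obtain w where w: "w \<in> T p" "z = v + w" unfolding v(2) by (auto simp: elt_set_plus_def)
    then show "z \<in> c'" unfolding v'(2) elt_set_plus_def
      using subspace_add[OF subspace_tangent_S_in_M t w(1)] pp
      by (intro CollectI bexI[of _ "v + (-1) *\<^sub>R v' + w"]) (auto simp: fun_eq_iff)
  next
    fix z assume "z \<in> c'"
    then obtain w where w: "w \<in> T p" "z = v' + w" unfolding v'(2) using pp by (auto simp: elt_set_plus_def)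
    then show "z \<in> c" unfolding v(2) elt_set_plus_def
      using subspace_diff[OF subspace_tangent_S_in_M w(1) t]
      by (intro CollectI bexI[of _ "w - (v + (-1) *\<^sub>R v')"]) (auto simp: fun_eq_iff)
  qed
  then show "p = p' \<and> c = c'" using pp by simp
qed

text \<open>The fibre coordinate ranges over the whole orthogonal complement of W in V, so the image
  consists of all points of V that project into the chart image of S.\<close>

lemma normal_chart_image:
  "normal_chart D \<phi> ` Sigma (U \<inter> S) (normal_space D) = V \<inter> closest_point W -` (\<phi> ` (U \<inter> S))"
proof (intro equalityI subsetI)
  fix y assume "y \<in> normal_chart D \<phi> ` Sigma (U \<inter> S) (normal_space D)"
  then obtain p v where p: "p \<in> U" "p \<in> S" and v: "v \<in> tangent M p" and y: "y = normal_chart D \<phi> (p, v +o T p)"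
    by (auto simp: normal_space_def)
  obtain A x X where A: "adapted_frame BW BN A x X" "p \<in> A" "A \<subseteq> U"
    "\<And>b q. b \<in> BW \<union> BN ==> q \<in> A ==> x b q = \<phi> q \<bullet> b" "\<And>q. q \<in> A ==> \<phi> q \<in> V"
    by (rule slice_frame_at[OF p(1)]) (rule that)
  have \<phi>W: "\<phi> p \<in> W" using slice_iff[OF sl] p by auto
  have "\<phi> p \<in> span BW" using \<phi>W B by (simp add: adapted_basis_def)
  moreover have "pairwise orthogonal BW" "\<And>b. b \<in> BW ==> norm b = 1"
    using B unfolding adapted_basis_def by (auto intro: pairwise_subset)
  ultimately have \<phi>e: "\<phi> p = (\<Sum>b\<in>BW. (\<phi> p \<bullet> b) *\<^sub>R b)"
    using orthonormal_basis_expand[of BW "\<phi> p"] basis_facts(4) by simp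
  have "y = \<phi> p + (\<Sum>b\<in>BN. v (x b) *\<^sub>R b)"
    using normal_chart_coset[OF p v] normal_part_frame[OF A(1,2) v A(4,5)] y by simp
  also have "\<dots> = (\<Sum>b\<in>BW. (\<phi> p \<bullet> b) *\<^sub>R b) + (\<Sum>b\<in>BN. v (x b) *\<^sub>R b)" using \<phi>e by simp
  \<comment> \<open>One coefficient function on the whole basis, as
    \<open>closest_point_adapted_basis\<close> requires.\<close>
  also have "\<dots> = (\<Sum>b\<in>BW. (if b \<in> BW then \<phi> p \<bullet> b else v (x b)) *\<^sub>R b)
      + (\<Sum>b\<in>BN. (if b \<in> BW then \<phi> p \<bullet> b else v (x b)) *\<^sub>R b)"
    using basis_facts(5) by (intro arg_cong2[of _ _ _ _ "(+)"] sum.cong) auto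
  also have "\<dots> = (\<Sum>b\<in>BW \<union> BN. (if b \<in> BW then \<phi> p \<bullet> b else v (x b)) *\<^sub>R b)"
    by (rule sum.union_disjoint[OF basis_facts(4,1,5), symmetric])
  finally have y2: "y = (\<Sum>b\<in>BW \<union> BN. (if b \<in> BW then \<phi> p \<bullet> b else v (x b)) *\<^sub>R b)" .
  have "closest_point W y = (\<Sum>b\<in>BW. (if b \<in> BW then \<phi> p \<bullet> b else v (x b)) *\<^sub>R b)"
    unfolding y2 by (rule closest_point_adapted_basis[OF B subspace_W])
  also have "\<dots> = \<phi> p" using \<phi>e by simp
  finally have "closest_point W y = \<phi> p" .
  moreover have "y \<in> V"
    using normal_chart_coset[OF p v] y subspace_add[OF subspace_model adm_model[OF slice_adm[OF sl] p(1)] normal_part_facts(1)[OF p v]]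
    by simp
  ultimately show "y \<in> V \<inter> closest_point W -` (\<phi> ` (U \<inter> S))" using p by auto
next
  fix y assume "y \<in> V \<inter> closest_point W -` (\<phi> ` (U \<inter> S))"
  then obtain p where y: "y \<in> V" and p: "p \<in> U" "p \<in> S" and cp: "closest_point W y = \<phi> p" by auto
  obtain A x X where A: "adapted_frame BW BN A x X" "p \<in> A" "A \<subseteq> U"
    "\<And>b q. b \<in> BW \<union> BN ==> q \<in> A ==> x b q = \<phi> q \<bullet> b" "\<And>q. q \<in> A ==> \<phi> q \<in> V"
    by (rule slice_frame_at[OF p(1)]) (rule that)
  note fD = adapted_frameD[OF A(1)]
  have pM: "p \<in> pts M" using p S_M by blast
  have ys: "y \<in> span (BW \<union> BN)" and oB: "pairwise orthogonal (BW \<union> BN)" and nB: "\<And>b. b \<in> BW \<union> BN ==> norm b = 1"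
    using y B unfolding adapted_basis_def by blast+
  have ye: "y = (\<Sum>b\<in>BW \<union> BN. (y \<bullet> b) *\<^sub>R b)"
    using orthonormal_basis_expand[OF oB nB ys] basis_facts by simp
  then have "closest_point W y = (\<Sum>b\<in>BW. (y \<bullet> b) *\<^sub>R b)"
    using closest_point_adapted_basis[OF B subspace_W, of "\<lambda>b. y \<bullet> b"] by simp
  then have ye2: "y = \<phi> p + (\<Sum>b\<in>BN. (y \<bullet> b) *\<^sub>R b)"
    using ye sum.union_disjoint[OF basis_facts(4,1,5), of "\<lambda>b. (y \<bullet> b) *\<^sub>R b"] cp by simp
  \<comment> \<open>By duality of the frame, the tangent vector with prescribed transverse
    components.\<close>
  define v where "v = (\<Sum>c\<in>BN. (y \<bullet> c) *\<^sub>R X c p)"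
  have Xt: "X c p \<in> tangent M p" if "c \<in> BN" for c using vector_fieldsD(1)[OF fD(6) pM] that by blast
  have v: "v \<in> tangent M p" unfolding v_def by (intro subspace_sum subspace_scale subspace_tangent Xt)
  have "v (x b) = y \<bullet> b" if b: "b \<in> BN" for b
  proof -
    have "v (x b) = (\<Sum>c\<in>BN. (y \<bullet> c) * X c p (x b))" by (simp add: v_def sum_fun_apply)
    also have "\<dots> = (\<Sum>c\<in>BN. if c = b then y \<bullet> c else 0)"
      by (rule sum.cong[OF refl]) (use fD(8)[OF A(2)] b in simp)
    also have "\<dots> = y \<bullet> b" using b basis_facts(1) by simp
    finally show ?thesis .
  qed
  then have "normal_part \<phi> p v = (\<Sum>b\<in>BN. (y \<bullet> b) *\<^sub>R b)"
    using normal_part_frame[OF A(1,2) v A(4,5)] by simp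
  then have "y = normal_chart D \<phi> (p, v +o T p)" using normal_chart_coset[OF p v] ye2 by simp
  moreover have "(p, v +o T p) \<in> Sigma (U \<inter> S) (normal_space D)"
    using p v by (auto simp: normal_space_def)
  ultimately show "y \<in> normal_chart D \<phi> ` Sigma (U \<inter> S) (normal_space D)" by (rule image_eqI)
qed

lemma normal_chart_image_open:
  "openin (top_of_set V) (normal_chart D \<phi> ` Sigma (U \<inter> S) (normal_space D))"
proof -
  have "pts M \<inter> S \<inter> U = U \<inter> S" using S_M by blast
  then have "openin (top_of_set W) (\<phi> ` (U \<inter> S))" using slice_image_open[OF sl mopen_pts] by simp
  then obtain T' where T': "open T'" "\<phi> ` (U \<inter> S) = W \<inter> T'" unfolding openin_open by blast
  have cl: "closest_point W y \<in> W" for y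
    by (rule closest_point_in_set[OF closed_subspace[OF subspace_W]]) (use subspace_0[OF subspace_W] in blast)
  have "continuous_on UNIV (closest_point W)"
    by (rule continuous_on_closest_point[OF subspace_imp_convex[OF subspace_W] closed_subspace[OF subspace_W]])
      (use subspace_0[OF subspace_W] in blast)
  then have "open (closest_point W -` T')" by (rule open_vimage[OF T'(1)])
  moreover have "V \<inter> closest_point W -` (\<phi> ` (U \<inter> S)) = V \<inter> closest_point W -` T'" using cl T'(2) by auto
  ultimately show ?thesis unfolding normal_chart_image by (auto simp: openin_open)
qed

end

end

section \<open>The exponential map near the zero section\<close>

locale exponential_setting = poisson_submanifold D for D :: "('a, 'e::euclidean_space) setting" +
  assumes rank: "dim (sub_model D) < dim (model (amb D))"
    and expo: "exponential_map D"
begin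

abbreviation "nb \<equiv> normal_bundle D"

lemma nb_simps: "pts nb = Sigma S (normal_space D)" "model nb = V"
  by (simp_all add: normal_bundle_def)

lemma nb_charts: "(Y, \<Phi>) \<in> charts nb \<longleftrightarrow> (\<exists>U \<phi>. slice U \<phi> \<and> Y = Sigma (U \<inter> S) (normal_space D) \<and> \<Phi> = normal_chart D \<phi>)"
  by (auto simp: normal_bundle_def)

lemma nb_inj: assumes "(Y, \<Phi>) \<in> charts nb" shows "inj_on \<Phi> Y"
proof -
  obtain U \<phi> where U: "slice U \<phi>" "Y = Sigma (U \<inter> S) (normal_space D)" "\<Phi> = normal_chart D \<phi>"
    using assms nb_charts by blast
  obtain BW BN where B: "adapted_basis V W BW BN" by (rule adapted_basis_exists[OF subspace_model subspace_W W_V])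
  show ?thesis unfolding U(2,3) by (rule normal_chart_inj[OF U(1) B])
qed

lemma nb_open_iff: "openin (mfd_topology nb) A \<longleftrightarrow>
    A \<subseteq> pts nb \<and> (\<forall>(Y, \<Phi>)\<in>charts nb. openin (top_of_set V) (\<Phi> ` (A \<inter> Y)))"
  using openin_mfd[of nb A, OF nb_inj] by (simp add: nb_simps)

lemma nb_topspace: "topspace (mfd_topology nb) = pts nb"
proof (rule antisym)
  show "topspace (mfd_topology nb) \<subseteq> pts nb"
    using openin_topspace[of "mfd_topology nb"] nb_open_iff by blast
  have "openin (mfd_topology nb) (pts nb)"
    unfolding nb_open_iff
  proof (intro conjI subset_refl, clarify)
    fix Y \<Phi> assume "(Y, \<Phi>) \<in> charts nb"
    then obtain U \<phi> where U: "slice U \<phi>" "Y = Sigma (U \<inter> S) (normal_space D)" "\<Phi> = normal_chart D \<phi>"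
      using nb_charts by blast
    obtain BW BN where B: "adapted_basis V W BW BN" by (rule adapted_basis_exists[OF subspace_model subspace_W W_V])
    have "pts nb \<inter> Y = Y" unfolding U(2) nb_simps by auto
    then show "openin (top_of_set V) (\<Phi> ` (pts nb \<inter> Y))"
      unfolding U(2,3) using normal_chart_image_open[OF U(1) B] by simp
  qed
  then show "pts nb \<subseteq> topspace (mfd_topology nb)" by (rule openin_subset)
qed

definition "expo_image = expmap D ` pts nb"

lemma expo_facts:
  "mopen expo_image" "smooth_map nb (open_submanifold M expo_image) (expmap D)"
  "p \<in> S ==> expmap D (p, T p) = p"
  "p \<in> S ==> v \<in> tangent M p ==> normal_velocity D p v \<in> v +o T p"
  using expo by (simp_all add: exponential_map_def Let_def diffeomorphism_def expo_image_def)

lemma open_sub_openin: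
  assumes "mopen A" "A \<subseteq> expo_image" shows "openin (mfd_topology (open_submanifold M expo_image)) A"
proof -
  have inj: "inj_on \<phi> Y" if c: "(Y, \<phi>) \<in> charts (open_submanifold M expo_image)" for Y \<phi>
  proof -
    obtain U where "Y = U \<inter> expo_image" "(U, \<phi>) \<in> charts M" using c by (auto simp: open_submanifold_def)
    then show ?thesis using inj_charts[of U \<phi>] by (auto intro: inj_on_subset)
  qed
  have "openin (top_of_set V) (\<phi> ` (A \<inter> Y))" if c: "(Y, \<phi>) \<in> charts (open_submanifold M expo_image)" for Y \<phi>
  proof -
    obtain U where U: "Y = U \<inter> expo_image" "(U, \<phi>) \<in> charts M" using c by (auto simp: open_submanifold_def)
    have "A \<inter> Y = A \<inter> U" using U(1) assms(2) by blast
    then show ?thesis using adm_image_open[OF charts_adm[OF U(2)] assms(1)] by simp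
  qed
  then show ?thesis
    using openin_mfd[of "open_submanifold M expo_image" A, OF inj] assms(2)
    by (auto simp: open_submanifold_def)
qed

lemma expo_preimage_open:
  assumes "mopen A" "A \<subseteq> expo_image" shows "openin (mfd_topology nb) {x \<in> pts nb. expmap D x \<in> A}"
proof -
  have "continuous_map (mfd_topology nb) (mfd_topology (open_submanifold M expo_image)) (expmap D)"
    using expo_facts(2) by (simp add: smooth_map_def)
  from openin_continuous_map_preimage[OF this open_sub_openin[OF assms]] show ?thesis
    unfolding nb_topspace .
qed

lemma coset_zero: "v \<in> T p ==> v +o T p = T p"
proof (intro equalityI subsetI)
  fix w assume "v \<in> T p" "w \<in> v +o T p"
  then show "w \<in> T p" using subspace_add[OF subspace_tangent_S_in_M, of v] by (auto simp: elt_set_plus_def)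
next
  fix w assume "v \<in> T p" "w \<in> T p"
  then show "w \<in> v +o T p" using subspace_diff[OF subspace_tangent_S_in_M, of w p v]
    by (auto simp: elt_set_plus_def intro!: bexI[of _ "w - v"])
qed

text \<open>In the normal chart the curve t \<mapsto> e(tv) starts at the base coordinate and runs
  in the direction of the normal part of v. So the normal velocity applied to F is a directional
  derivative of F composed with e, linear in the transverse components of v, and its coefficients
  G_c are smooth because e is.\<close>

lemma normal_velocity_local:
  assumes p0: "p0 \<in> S" and F: "F \<in> Sm"
    and sl: "slice U \<phi>" and fr: "adapted_frame BW BN A x X" "p0 \<in> A" "A \<subseteq> U"
      "\<And>b q. b \<in> BW \<union> BN ==> q \<in> A ==> x b q = \<phi> q \<bullet> b"
  obtains G B where "mopen B" "p0 \<in> B" "B \<subseteq> A" "\<And>c. c \<in> BN ==> G c \<in> Sm"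
    "\<And>p v. p \<in> B ==> p \<in> S ==> v \<in> tangent M p ==> normal_velocity D p v F = (\<Sum>c\<in>BN. v (x c) * G c p)"
proof -
  note fD = adapted_frameD[OF fr(1)] and a = slice_adm[OF sl]
  have AU: "q \<in> U" if "q \<in> A" for q using that fr(3) by blast
  have p0M: "p0 \<in> pts M" using p0 S_M by blast
  let ?Y = "Sigma (U \<inter> S) (normal_space D)" and ?\<Phi> = "normal_chart D \<phi>"
  have Yc: "(?Y, ?\<Phi>) \<in> charts nb" using sl nb_charts by blast
  have inj: "inj_on ?\<Phi> ?Y" by (rule nb_inj[OF Yc])
  obtain U1 \<phi>1 where c1: "(U1, \<phi>1) \<in> charts M" "p0 \<in> U1" by (rule charts_cover[OF p0M])
  note a1 = charts_adm[OF c1(1)]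
  \<comment> \<open>Cut down to the image of the exponential map, this is a chart domain of the open
    submanifold in terms of which the smoothness of e is stated.\<close>
  define A1 where "A1 = U1 \<inter> expo_image"
  have A1: "mopen A1" "A1 \<subseteq> expo_image" unfolding A1_def using openin_Int[OF adm_open[OF a1] expo_facts(1)] by auto
  have T_space: "T p \<in> normal_space D p" for p
    unfolding normal_space_def using coset_zero[OF subspace_0[OF subspace_tangent_S_in_M]] subspace_0[OF subspace_tangent]
    by (intro CollectI exI[of _ 0]) auto
  have p0A1: "expmap D (p0, T p0) \<in> A1"
  proof -
    have "(p0, T p0) \<in> pts nb" using p0 T_space by (simp add: nb_simps)
    then have "expmap D (p0, T p0) \<in> expo_image" unfolding expo_image_def by (rule imageI)
    then show ?thesis using expo_facts(3)[OF p0] c1(2) by (simp add: A1_def)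
  qed
  define O' where "O' = ?\<Phi> ` ({x \<in> pts nb. expmap D x \<in> A1} \<inter> ?Y)"
  have O'open: "openin (top_of_set V) O'"
    using expo_preimage_open[OF A1] Yc unfolding nb_open_iff O'_def by blast
  have O'eq: "O' = ?\<Phi> ` (?Y \<inter> expmap D -` A1)" unfolding O'_def nb_simps by (rule arg_cong[of _ _ "image ?\<Phi>"]) auto
  have s1: "smooth_on O' (\<phi>1 \<circ> expmap D \<circ> inv_into ?Y ?\<Phi>)"
  proof -
    have "(A1, \<phi>1) \<in> charts (open_submanifold M expo_image)" using c1 by (auto simp: open_submanifold_def A1_def)
    moreover have "\<forall>c\<in>charts nb. \<forall>c'\<in>charts (open_submanifold M expo_image).
        smooth_on (snd c ` (fst c \<inter> expmap D -` fst c')) (snd c' \<circ> expmap D \<circ> inv_into (fst c) (snd c))"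
      using expo_facts(2) unfolding smooth_map_def by (simp add: case_prod_beta)
    ultimately have "smooth_on (?\<Phi> ` (?Y \<inter> expmap D -` A1)) (\<phi>1 \<circ> expmap D \<circ> inv_into ?Y ?\<Phi>)"
      using Yc by (metis fst_conv snd_conv)
    then show ?thesis using O'eq by simp
  qed
  define E where "E y = F (expmap D (inv_into ?Y ?\<Phi> y))" for y
  have E: "E (?\<Phi> (p, c)) = F (expmap D (p, c))" if "p \<in> U" "p \<in> S" "c \<in> normal_space D p" for p c
    using inv_into_f_f[OF inj, of "(p, c)"] that by (simp add: E_def)
  have "smooth_on O' (\<lambda>y. (F \<circ> inv_into U1 \<phi>1) ((\<phi>1 \<circ> expmap D \<circ> inv_into ?Y ?\<Phi>) y))"
  proof (rule smooth_on_comp[OF s1 _ smooth_in_adm[OF a1 F]])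
    show "(\<phi>1 \<circ> expmap D \<circ> inv_into ?Y ?\<Phi>) ` O' \<subseteq> \<phi>1 ` U1"
      unfolding O'eq using inv_into_f_f[OF inj] by (auto simp: A1_def)
  qed
  then have sE: "smooth_on O' E"
  proof (rule smooth_on_cong)
    fix y assume "y \<in> O'"
    then obtain z where z: "z \<in> ?Y" "expmap D z \<in> A1" "y = ?\<Phi> z" unfolding O'eq by blast
    have "inv_into U1 \<phi>1 (\<phi>1 (expmap D z)) = expmap D z" by (rule inv_chart[OF a1]) (use z(2) in \<open>simp add: A1_def\<close>)
    then show "(F \<circ> inv_into U1 \<phi>1) ((\<phi>1 \<circ> expmap D \<circ> inv_into ?Y ?\<Phi>) y) = E y"
      using inv_into_f_f[OF inj z(1)] z(3) by (simp add: E_def)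
  qed
  \<comment> \<open>\<phi> and the normal chart share one model space, and for q on S the point
    \<phi> q is the chart image of the zero vector over q. Partial derivatives of E composed with
    \<phi> are thus functions near p0 on M itself, which on S are derivatives along the fibres at
    the zero section.\<close>
  define B0 where "B0 = {q \<in> U. \<phi> q \<in> O'} \<inter> A"
  have np0: "normal_part \<phi> p0 0 = 0"
    using normal_part_facts(3)[OF sl fD(11) AU[OF fr(2)] p0 subspace_0[OF subspace_tangent]]
      subspace_0[OF subspace_tangent_S_in_M] by blast
  have B0: "mopen B0" "p0 \<in> B0"
  proof -
    show "mopen B0" unfolding B0_def using adm_preimage_open[OF a O'open] fD(4) by blast
    have "?\<Phi> (p0, T p0) = \<phi> p0"
      using normal_chart_coset[OF sl fD(11) AU[OF fr(2)] p0 subspace_0[OF subspace_tangent]] np0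
        coset_zero[OF subspace_0[OF subspace_tangent_S_in_M]] by simp
    moreover have "(p0, T p0) \<in> ?Y \<inter> expmap D -` A1" using p0 p0A1 AU[OF fr(2)] T_space by simp
    ultimately have "\<phi> p0 \<in> O'" unfolding O'eq by (metis image_eqI)
    then show "p0 \<in> B0" using fr(2) AU by (simp add: B0_def)
  qed
  have sn: "smooth_near (\<lambda>q. dird E (\<phi> q) c) q" if "c \<in> BN" "q \<in> B0" for c q
  proof (rule smooth_near_chart_fun[OF a _ O'open])
    have "c \<in> V" using that fD(11) unfolding adapted_basis_def by blast
    then show "smooth_on O' (\<lambda>y. dird E y c)" by (rule smooth_on_dird[OF subspace_model O'open _ sE])
  qed (use that in \<open>auto simp: B0_def\<close>)
  \<comment> \<open>The partial derivatives of E exist only on B0; the bump makes them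
    global.\<close>
  obtain \<rho> B C where \<rho>: "\<rho> \<in> Sm" "mopen B" "p0 \<in> B" "B \<subseteq> B0" "\<And>q. q \<in> B ==> \<rho> q = 1"
    "mopen (pts M - C)" "C \<subseteq> B0" "\<And>q. q \<notin> C ==> \<rho> q = 0"
    by (rule bump[OF B0]) (rule that)
  show thesis
  proof (rule that[OF \<rho>(2,3)])
    show "B \<subseteq> A" using \<rho>(4) by (auto simp: B0_def)
    show "(\<lambda>q. \<rho> q * dird E (\<phi> q) c) \<in> Sm" if "c \<in> BN" for c
      by (rule smooth_cutoff[OF \<rho>(1,6,7,8) sn[OF that]])
    fix p v assume p: "p \<in> B" "p \<in> S" and v: "v \<in> tangent M p"
    have pA: "p \<in> A" and pU: "p \<in> U" and pO: "\<phi> p \<in> O'" using p \<rho>(4) by (auto simp: B0_def)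
    have "F (expmap D (p, (t *\<^sub>R v) +o T p)) = E (\<phi> p + t *\<^sub>R normal_part \<phi> p v)" for t
    proof -
      have tv: "t *\<^sub>R v \<in> tangent M p" by (rule subspace_scale[OF subspace_tangent v])
      have "(t *\<^sub>R v) +o T p \<in> normal_space D p" using tv by (auto simp: normal_space_def)
      from E[OF pU p(2) this] show ?thesis
        unfolding normal_chart_coset[OF sl fD(11) pU p(2) tv] normal_part_facts(5)[OF sl fD(11) pU p(2) v] by simp
    qed
    then have "normal_velocity D p v F = dird E (\<phi> p) (normal_part \<phi> p v)"
      using F by (simp add: normal_velocity_def velocity_def dird_def)
    also have "normal_part \<phi> p v = (\<Sum>c\<in>BN. v (x c) *\<^sub>R c)"
      by (rule normal_part_frame[OF fr(1) pA v fr(4) adm_model[OF a AU]])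
    also have "dird E (\<phi> p) \<dots> = (\<Sum>c\<in>BN. v (x c) * dird E (\<phi> p) c)"
      by (rule dird_linear[OF subspace_model O'open sE pO fD(2)]) (use fD(11) in \<open>auto simp: adapted_basis_def\<close>)
    also have "\<dots> = (\<Sum>c\<in>BN. v (x c) * (\<rho> p * dird E (\<phi> p) c))" using \<rho>(5)[OF p(1)] by simp
    finally show "normal_velocity D p v F = (\<Sum>c\<in>BN. v (x c) * (\<rho> p * dird E (\<phi> p) c))" .
  qed
qed

lemma normal_velocity_frame:
  assumes p0: "p0 \<in> S" and F: "F \<in> Sm"
  obtains BW BN A x X G where "adapted_frame BW BN A x X" "p0 \<in> A" "\<And>c. c \<in> BN ==> G c \<in> Sm"
    "\<And>p v. p \<in> A ==> p \<in> S ==> v \<in> tangent M p ==> normal_velocity D p v F = (\<Sum>c\<in>BN. v (x c) * G c p)"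
proof -
  obtain U \<phi> where U: "slice U \<phi>" "p0 \<in> U" by (rule slice_exists[OF p0])
  obtain BW BN where B: "adapted_basis V W BW BN" by (rule adapted_basis_exists[OF subspace_model subspace_W W_V])
  obtain A x X where A: "adapted_frame BW BN A x X" "p0 \<in> A" "A \<subseteq> U"
    "\<And>b q. b \<in> BW \<union> BN ==> q \<in> A ==> x b q = \<phi> q \<bullet> b"
    by (rule adapted_frame_exists[OF U(1) adm_open[OF slice_adm[OF U(1)]] U(2) subset_refl B]) (rule that)
  obtain G B where G: "mopen B" "p0 \<in> B" "B \<subseteq> A" "\<And>c. c \<in> BN ==> G c \<in> Sm"
    "\<And>p v. p \<in> B ==> p \<in> S ==> v \<in> tangent M p ==> normal_velocity D p v F = (\<Sum>c\<in>BN. v (x c) * G c p)"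
    by (rule normal_velocity_local[OF p0 F U(1) A]) (assumption, assumption, rule that)
  have "adapted_frame BW BN B x X"
    using A(1) G(1,3) unfolding adapted_frame_def by blast
  then show thesis by (rule that[OF _ G(2,4,5)])
qed

end

context poisson_submanifold
begin

section \<open>Bilinearity of the bracket along S\<close>

lemma locally_exact_pair:
  assumes "a \<in> locally_exact" "b \<in> locally_exact" "p \<in> S"
  obtains A F G where "p \<in> A" "exact_on A F a" "exact_on A G b"
proof -
  obtain A F where A: "p \<in> A" "exact_on A F a" by (rule locally_exactE[OF assms(1,3)])
  obtain B G where B: "p \<in> B" "exact_on B G b" by (rule locally_exactE[OF assms(2,3)])
  have "mopen (A \<inter> B)" using A B by (auto simp: exact_on_def)
  then show thesis
    using A B exact_on_subset[OF A(2), of "A \<inter> B"] exact_on_subset[OF B(2), of "A \<inter> B"]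
    by (intro that[of "A \<inter> B" F G]) auto
qed

lemma exact_on_add: "exact_on A F a ==> exact_on A G b ==> exact_on A (F + G) (a + b)"
  by (auto simp: exact_on_def differential_add intro: smooth_intros)

lemma exact_on_scaleR: "exact_on A F a ==> exact_on A (c *\<^sub>R F) (c *\<^sub>R a)"
  by (auto simp: exact_on_def differential_scaleR intro: smooth_intros)

lemma subspace_locally_exact: "subspace locally_exact"
proof (rule subspaceI)
  show "0 \<in> locally_exact"
    unfolding locally_exact_def
  proof (intro CollectI conjI allI impI ballI)
    fix p assume "p \<in> S"
    then show "\<exists>A F. p \<in> A \<and> exact_on A F 0"
      using mopen_pts S_M smooth_intros(1)
      by (intro exI[of _ "pts M"] exI[of _ 0]) (auto simp: exact_on_def differential_def fun_eq_iff tangent_zero)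
  qed simp
next
  fix a b assume ab: "a \<in> locally_exact" "b \<in> locally_exact"
  show "a + b \<in> locally_exact"
    unfolding locally_exact_def
  proof (intro CollectI conjI allI impI ballI)
    fix p assume p: "p \<in> S"
    obtain A F G where "p \<in> A" "exact_on A F a" "exact_on A G b" by (rule locally_exact_pair[OF ab p])
    then show "\<exists>A F. p \<in> A \<and> exact_on A F (a + b)" using exact_on_add by blast
  qed (use ab in \<open>auto simp: locally_exact_def fun_eq_iff\<close>)
next
  fix c a assume a: "a \<in> locally_exact"
  show "c *\<^sub>R a \<in> locally_exact"
    unfolding locally_exact_def
  proof (intro CollectI conjI allI impI ballI)
    fix p assume p: "p \<in> S"
    obtain A F where "p \<in> A" "exact_on A F a" by (rule locally_exactE[OF a p])
    then show "\<exists>A F. p \<in> A \<and> exact_on A F (c *\<^sub>R a)" using exact_on_scaleR by blast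
  qed (use a in \<open>auto simp: locally_exact_def fun_eq_iff\<close>)
qed

lemma locally_exact_outside: "a \<in> locally_exact ==> q \<notin> S ==> a q = 0"
  by (simp add: locally_exact_def)

lemma exact_onD: "exact_on A F a ==> q \<in> A ==> q \<in> S ==> a q = dN F q"
  "exact_on A F a ==> F \<in> Sm" "exact_on A F a ==> mopen A"
  by (auto simp: exact_on_def)

lemma locally_exact_eqI:
  assumes "a \<in> locally_exact" "b \<in> locally_exact"
    "\<And>p. p \<in> S ==> \<exists>A F. p \<in> A \<and> exact_on A F a \<and> exact_on A F b"
  shows "a = b"
proof
  fix p show "a p = b p"
  proof (cases "p \<in> S")
    case True
    then obtain A F where "p \<in> A" "exact_on A F a" "exact_on A F b" using assms(3) by blast
    then show ?thesis using exact_onD(1) True by metis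
  qed (simp add: locally_exact_outside assms)
qed

text \<open>Potentials of a sum add, and the bracket of functions is additive; one common potential
  of both sides settles the identity.\<close>

lemma restricted_bracket_add_left:
  assumes "a \<in> locally_exact" "b \<in> locally_exact" "c \<in> locally_exact"
  shows "rb (a + b) c = rb a c + rb b c"
proof (rule locally_exact_eqI)
  note ab = subspace_add[OF subspace_locally_exact assms(1,2)]
  show "rb (a + b) c \<in> locally_exact" by (rule restricted_bracket(1)[OF ab assms(3)])
  show "rb a c + rb b c \<in> locally_exact"
    by (intro subspace_add[OF subspace_locally_exact] restricted_bracket(1) assms)
  fix p assume p: "p \<in> S"
  obtain A F G where A: "p \<in> A" "exact_on A F a" "exact_on A G b" by (rule locally_exact_pair[OF assms(1,2) p])
  obtain B H where B: "p \<in> B" "exact_on B H c" by (rule locally_exactE[OF assms(3) p])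
  let ?C = "A \<inter> B"
  have C: "mopen ?C" using exact_onD(3)[OF A(2)] exact_onD(3)[OF B(2)] by blast
  note e = exact_on_subset[OF A(2) C Int_lower1] exact_on_subset[OF A(3) C Int_lower1] exact_on_subset[OF B(2) C Int_lower2]
  have "br (F + G) H = br F H + br G H"
  proof -
    have "br (F + G) H = - br H (F + G)" by (rule br_skew)
    also have "\<dots> = - (br H F + br H G)" by (simp only: br_right(1)[OF exact_onD(2)[OF A(2)] exact_onD(2)[OF A(3)]])
    also have "\<dots> = br F H + br G H" using br_skew[of F H] br_skew[of G H] by simp
    finally show ?thesis .
  qed
  then show "\<exists>A F. p \<in> A \<and> exact_on A F (rb (a + b) c)
      \<and> exact_on A F (rb a c + rb b c)"
    using restricted_bracket(2)[OF ab assms(3) exact_on_add[OF e(1,2)] e(3)] A(1) B(1)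
      exact_on_add[OF restricted_bracket(2)[OF assms(1,3) e(1,3)] restricted_bracket(2)[OF assms(2,3) e(2,3)]]
    by (intro exI[of _ ?C] exI[of _ "br (F + G) H"]) simp
qed

lemma restricted_bracket_skew:
  assumes "a \<in> locally_exact" "b \<in> locally_exact"
  shows "rb a b = - rb b a"
proof (rule locally_exact_eqI)
  show "rb a b \<in> locally_exact" by (rule restricted_bracket(1)[OF assms])
  show "- rb b a \<in> locally_exact"
    by (intro subspace_neg[OF subspace_locally_exact] restricted_bracket(1) assms)
  fix p assume p: "p \<in> S"
  obtain A F G where A: "p \<in> A" "exact_on A F a" "exact_on A G b" by (rule locally_exact_pair[OF assms(1,2) p])
  have "exact_on A ((-1) *\<^sub>R br G F) ((-1) *\<^sub>R rb b a)"
    by (rule exact_on_scaleR[OF restricted_bracket(2)[OF assms(2,1) A(3,2)]])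
  moreover have "(-1) *\<^sub>R br G F = br F G" using br_skew[of F G] by simp
  ultimately show "\<exists>A F. p \<in> A \<and> exact_on A F (rb a b) \<and> exact_on A F (- rb b a)"
    using restricted_bracket(2)[OF assms A(2,3)] A(1) by (intro exI[of _ A] exI[of _ "br F G"]) simp
qed

lemma restricted_bracket_add_right:
  assumes "a \<in> locally_exact" "b \<in> locally_exact" "c \<in> locally_exact"
  shows "rb a (b + c) = rb a b + rb a c"
  using restricted_bracket_skew[OF assms(1) subspace_add[OF subspace_locally_exact assms(2,3)]]
    restricted_bracket_add_left[OF assms(2,3,1)] restricted_bracket_skew[OF assms(1,2)] restricted_bracket_skew[OF assms(1,3)]
  by simp

end

context exponential_setting
begin

section \<open>The splitting and the lift h\<close>

abbreviation "nv \<equiv> normal_velocity D"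

lemma nv_tangent:
  assumes p: "p \<in> S" and v: "v \<in> tangent M p"
  shows "v - nv p v \<in> T p" "nv p v \<in> tangent M p"
proof -
  obtain w where w: "w \<in> T p" "nv p v = v + w" using expo_facts(4)[OF assms] by (auto simp: elt_set_plus_def)
  have "v - nv p v = - w" using w(2) by simp
  then show "v - nv p v \<in> T p" using subspace_neg[OF subspace_tangent_S_in_M w(1)] by simp
  show "nv p v \<in> tangent M p"
    unfolding w(2) by (rule subspace_add[OF subspace_tangent v tangent_S_in_M_tangent[OF p w(1)]])
qed

lemma nv_outside: "f \<notin> Sm ==> nv p v f = 0"
  by (simp add: normal_velocity_def velocity_def)

text \<open>All three facts are read off from the local formula: the transverse components are
  linear in v and vanish on vectors tangent to S.\<close>

lemma nv_linear:
  assumes p: "p \<in> S" and v: "v \<in> tangent M p" and w: "w \<in> tangent M p"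
  shows "nv p (v + w) = nv p v + nv p w" "nv p (c *\<^sub>R v) = c *\<^sub>R nv p v" "v \<in> T p ==> nv p v = 0"
proof -
  have *: "nv p (v + w) f = nv p v f + nv p w f \<and> nv p (c *\<^sub>R v) f = c * nv p v f \<and> (v \<in> T p \<longrightarrow> nv p v f = 0)" for f
  proof (cases "f \<in> Sm")
    case True
    obtain BW BN A x X G where fr: "adapted_frame BW BN A x X" "p \<in> A" "\<And>c. c \<in> BN ==> G c \<in> Sm"
      "\<And>q v. q \<in> A ==> q \<in> S ==> v \<in> tangent M q ==> nv q v f = (\<Sum>c\<in>BN. v (x c) * G c q)"
      by (rule normal_velocity_frame[OF p True]) (rule that)
    note n = fr(4)[OF fr(2) p]
    have "nv p v f = 0" if "v \<in> T p"
      unfolding n[OF v] using tangent_S_in_M_frame[OF fr(1,2) p v] that by simp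
    then show ?thesis
      unfolding n[OF subspace_add[OF subspace_tangent v w]] n[OF v] n[OF w] n[OF subspace_scale[OF subspace_tangent v]]
      by (simp add: distrib_right sum.distrib sum_distrib_left mult.assoc)
  qed (simp add: nv_outside)
  show "nv p (v + w) = nv p v + nv p w" "nv p (c *\<^sub>R v) = c *\<^sub>R nv p v" "v \<in> T p ==> nv p v = 0"
    using * by (auto simp: fun_eq_iff)
qed

definition proj_S :: "'a \<Rightarrow> 'a tvec \<Rightarrow> 'a tvec"
  where "proj_S p w = (THE u. u \<in> tangent SM p \<and> push D u = w)"

lemma proj_S:
  assumes "p \<in> S" "w \<in> T p" shows "proj_S p w \<in> tangent SM p" "push D (proj_S p w) = w"
proof -
  obtain u where u: "u \<in> tangent SM p" "w = push D u" using assms(2) unfolding tangent_S_in_M_def by blast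
  have "proj_S p w = u" unfolding proj_S_def
    by (rule the_equality) (use u push_inj[OF _ u(1) assms(1)] in auto)
  then show "proj_S p w \<in> tangent SM p" "push D (proj_S p w) = w" using u by auto
qed

lemma proj_S_push: "p \<in> S ==> u \<in> tangent SM p ==> proj_S p (push D u) = u"
  unfolding proj_S_def by (rule the_equality) (auto intro: push_inj)

lemma proj_S_linear:
  assumes p: "p \<in> S" and v: "v \<in> T p" and w: "w \<in> T p"
  shows "proj_S p (v + w) = proj_S p v + proj_S p w" "proj_S p (c *\<^sub>R v) = c *\<^sub>R proj_S p v"
proof -
  note pv = proj_S[OF p v] and pw = proj_S[OF p w]
  have "push D (proj_S p v + proj_S p w) = v + w" unfolding push_linear pv pw ..
  then show "proj_S p (v + w) = proj_S p v + proj_S p w"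
    using proj_S_push[OF p subspace_add[OF subspace_tangent pv(1) pw(1)]] by simp
  have "push D (c *\<^sub>R proj_S p v) = c *\<^sub>R v" unfolding push_linear pv ..
  then show "proj_S p (c *\<^sub>R v) = c *\<^sub>R proj_S p v"
    using proj_S_push[OF p subspace_scale[OF subspace_tangent pv(1)], of c] by simp
qed

text \<open>v - \<open>nv p v\<close> is the component of v along S in the splitting, and \<alpha>
  is evaluated on it.\<close>

lemma lift_candidate_cotangent:
  assumes p: "p \<in> S" and \<alpha>: "\<alpha> \<in> cotangent SM p"
  shows "(\<lambda>v. if v \<in> tangent M p then \<alpha> (proj_S p (v - nv p v)) else 0) \<in> cotangent M p" (is "?a \<in> _")
proof (rule cotangentI)
  fix v w assume v: "v \<in> tangent M p" and w: "w \<in> tangent M p"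
  note tv = nv_tangent(1)[OF p v] and tw = nv_tangent(1)[OF p w]
  have "v + w - nv p (v + w) = (v - nv p v) + (w - nv p w)" unfolding nv_linear(1)[OF p v w] by simp
  then have "proj_S p (v + w - nv p (v + w)) = proj_S p (v - nv p v) + proj_S p (w - nv p w)"
    using proj_S_linear(1)[OF p tv tw] by (simp only:)
  then have "\<alpha> (proj_S p (v + w - nv p (v + w))) = \<alpha> (proj_S p (v - nv p v)) + \<alpha> (proj_S p (w - nv p w))"
    using cotangentD(1)[OF \<alpha> proj_S(1)[OF p tv] proj_S(1)[OF p tw]] by (simp only:)
  then show "?a (v + w) = ?a v + ?a w"
    using v w subspace_add[OF subspace_tangent v w] by (simp only: if_True)
next
  fix c v assume v: "v \<in> tangent M p"
  note tv = nv_tangent(1)[OF p v]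
  have "c *\<^sub>R v - nv p (c *\<^sub>R v) = c *\<^sub>R (v - nv p v)" unfolding nv_linear(2)[OF p v v] by (simp add: scaleR_diff_right)
  then show "?a (c *\<^sub>R v) = c * ?a v"
    using v subspace_scale[OF subspace_tangent v] proj_S_linear(2)[OF p tv tv] cotangentD(2)[OF \<alpha> proj_S(1)[OF p tv]] by simp
qed simp

text \<open>The conditions in \<open>lift_covec\<close> prescribe a covector on two subspaces that
  together span the tangent space of M, hence uniqueness. Existence needs \<open>nv p\<close> to be
  a projection, so that the two prescriptions are compatible.\<close>

lemma lift_covec_eq:
  assumes p: "p \<in> S" and \<alpha>: "\<alpha> \<in> cotangent SM p"
  shows "lift_covec D p \<alpha> = (\<lambda>v. if v \<in> tangent M p then \<alpha> (proj_S p (v - nv p v)) else 0)" (is "_ = ?a")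
  unfolding lift_covec_def
proof (rule the_equality)
  have "?a \<in> cotangent M p" by (rule lift_candidate_cotangent[OF p \<alpha>])
  moreover have "?a (push D v) = \<alpha> v" if v: "v \<in> tangent SM p" for v
  proof -
    have t: "push D v \<in> tangent M p" by (rule push_tangent[OF v p])
    have "nv p (push D v) = 0" by (rule nv_linear(3)[OF p t t]) (use v in \<open>simp add: tangent_S_in_M_def\<close>)
    then show ?thesis using t proj_S_push[OF p v] by simp
  qed
  moreover have "?a (nv p v) = 0" if v: "v \<in> tangent M p" for v
  proof -
    note tv = nv_tangent(1)[OF p v] and n = nv_tangent(2)[OF p v]
    \<comment> \<open>Idempotence: v - \<open>nv p v\<close> is tangent to S and therefore killed by
      \<open>nv p\<close>.\<close>
    have "nv p ((v - nv p v) + nv p v) = nv p (v - nv p v) + nv p (nv p v)"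
      by (rule nv_linear(1)[OF p tangent_S_in_M_tangent[OF p tv] n])
    then have "nv p (nv p v) = nv p v" using nv_linear(3)[OF p tangent_S_in_M_tangent[OF p tv] v tv] by simp
    then have "nv p v - nv p (nv p v) = 0 *\<^sub>R (v - nv p v)" by simp
    then have "proj_S p (nv p v - nv p (nv p v)) = 0 *\<^sub>R proj_S p (v - nv p v)"
      using proj_S_linear(2)[OF p tv tv, of 0] by simp
    then show ?thesis using n cotangent_zero[OF \<alpha>] by simp
  qed
  ultimately show "?a \<in> cotangent M p \<and> (\<forall>v\<in>tangent SM p. ?a (push D v) = \<alpha> v) \<and>
      (\<forall>v\<in>tangent M p. ?a (nv p v) = 0)" by blast
next
  fix a assume a: "a \<in> cotangent M p \<and> (\<forall>v\<in>tangent SM p. a (push D v) = \<alpha> v) \<and> (\<forall>v\<in>tangent M p. a (nv p v) = 0)"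
  show "a = ?a"
  proof
    fix v show "a v = ?a v"
    proof (cases "v \<in> tangent M p")
      case True
      note tv = nv_tangent(1)[OF p True] and n = nv_tangent(2)[OF p True]
      have "a ((v - nv p v) + nv p v) = a (v - nv p v) + a (nv p v)"
        by (rule cotangentD(1)[OF conjunct1[OF a] tangent_S_in_M_tangent[OF p tv] n])
      also have "a (nv p v) = 0" using a True by blast
      also have "a (v - nv p v) = a (push D (proj_S p (v - nv p v)))" using proj_S(2)[OF p tv] by simp
      also have "\<dots> = \<alpha> (proj_S p (v - nv p v))" using a proj_S(1)[OF p tv] by blast
      finally show ?thesis using True by simp
    next
      case False
      then show ?thesis using a cotangentD(3)[of a M p v] by simp
    qed
  qed
qed

abbreviation "hdf f \<equiv> lift_form D (d_S D f)"

text \<open>h(df) on v is the derivative of f along the component of v tangent to S, which any local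
  lift of f computes.\<close>

lemma hd_apply:
  assumes p: "p \<in> S" and f: "f \<in> SS" and v: "v \<in> tangent M p"
    and F: "F \<in> Sm" "mopen A" "p \<in> A" "\<And>q. q \<in> A ==> q \<in> S ==> F q = f q"
  shows "hdf f p v = v F - nv p v F"
proof -
  note tv = nv_tangent(1)[OF p v]
  have "hdf f p v = d_S D f p (proj_S p (v - nv p v))"
    using lift_covec_eq[OF p S.differential_cotangent[of p f]] p v by (simp add: lift_form_def)
  also have "\<dots> = proj_S p (v - nv p v) f" using proj_S(1)[OF p tv] p by simp
  also have "\<dots> = push D (proj_S p (v - nv p v)) F" by (rule push_lift[OF proj_S(1)[OF p tv] p f F])
  also have "\<dots> = v F - nv p v F" using proj_S(2)[OF p tv] by simp
  finally show ?thesis .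
qed

lemma hd_cotangent:
  assumes p: "p \<in> S" shows "hdf f p \<in> cotangent M p"
proof -
  have d: "d_S D f p \<in> cotangent SM p" using S.differential_cotangent[of p f] p by simp
  show ?thesis
    using lift_candidate_cotangent[OF p d] lift_covec_eq[OF p d] p by (simp add: lift_form_def)
qed

lemma hd_outside: "p \<notin> S ==> hdf f p = 0"
  by (simp add: lift_form_def)

text \<open>Correct an arbitrary extension F0 of f by subtracting its first-order part in the normal
  directions. The result still restricts to f and is annihilated by the image of \<open>nv\<close>,
  so its differential on S is h(df).\<close>

lemma hd_lift:
  assumes f: "f \<in> SS" and p: "p \<in> S"
  obtains A F where "p \<in> A" "exact_on A F (hdf f)" "\<And>q. q \<in> A ==> q \<in> S ==> F q = f q"
proof -
  obtain F0 A0 where F0: "F0 \<in> Sm" "mopen A0" "p \<in> A0" "\<And>q. q \<in> A0 ==> q \<in> S ==> F0 q = f q"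
    by (rule smooth_S_lift[OF f p]) (rule that)
  obtain BW BN A x X G where fr: "adapted_frame BW BN A x X" "p \<in> A" "\<And>c. c \<in> BN ==> G c \<in> Sm"
    "\<And>q v. q \<in> A ==> q \<in> S ==> v \<in> tangent M q ==> nv q v F0 = (\<Sum>c\<in>BN. v (x c) * G c q)"
    by (rule normal_velocity_frame[OF p F0(1)]) (rule that)
  note fD = adapted_frameD[OF fr(1)]
  have xs: "x c \<in> Sm" if "c \<in> BN" for c using fD(5) that by blast
  \<comment> \<open>Vanishes on S, and on S its differential is v \<mapsto>
    \<open>nv q v F0\<close>.\<close>
  let ?H = "\<Sum>c\<in>BN. G c * x c"
  have Hs: "?H \<in> Sm" by (intro smooth_intros(6) smooth_mult fr(3) xs)
  define F where "F = F0 + (-1) *\<^sub>R ?H"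
  have Fs: "F \<in> Sm" unfolding F_def by (intro smooth_intros F0(1) Hs)
  have B: "mopen (A0 \<inter> A)" using F0(2) fD(4) by blast
  have "hdf f q = dN F q" if q: "q \<in> A0 \<inter> A" "q \<in> S" for q
  proof
    have qM: "q \<in> pts M" and qA: "q \<in> A" using q S_M by auto
    fix v show "hdf f q v = dN F q v"
    proof (cases "v \<in> tangent M q")
      case True
      have "hdf f q v = v F0 - nv q v F0" by (rule hd_apply[OF q(2) f True F0(1,2)]) (use q F0(4) in auto)
      also have "nv q v F0 = (\<Sum>c\<in>BN. v (x c) * G c q)" by (rule fr(4)[OF qA q(2) True])
      also have "\<dots> = (\<Sum>c\<in>BN. G c q *\<^sub>R dN (x c) q) v"
        unfolding sum_fun_apply by (rule sum.cong[OF refl]) (simp add: qM True)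
      also have "\<dots> = dN ?H q v"
        by (rule arg_cong[of _ _ "\<lambda>a. a v"], rule differential_combination[symmetric]) (use fr(3) xs fD(9)[OF qA q(2)] in auto)
      also have "v F0 - \<dots> = dN F q v"
        unfolding F_def using qM True F0(1) Hs tangentD(1)[OF True F0(1) smooth_intros(5)[OF Hs, of "-1"]]
          tangentD(2)[OF True Hs, of "-1"] by simp
      finally show ?thesis .
    next
      case False
      then show ?thesis using cotangentD(3)[OF hd_cotangent[OF q(2)]] by (simp add: differential_def)
    qed
  qed
  then have "exact_on (A0 \<inter> A) F (hdf f)" using B Fs by (auto simp: exact_on_def)
  moreover have "F q = f q" if "q \<in> A0 \<inter> A" "q \<in> S" for q
    using that F0(4) fD(9)[of q] by (simp add: F_def sum_fun_apply)
  ultimately show thesis using F0(3) fr(2) by (intro that[of "A0 \<inter> A" F]) auto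
qed

lemma hd_locally_exact: assumes "f \<in> SS" shows "hdf f \<in> locally_exact"
  unfolding locally_exact_def
proof (intro CollectI conjI allI impI ballI)
  fix p assume p: "p \<in> S"
  obtain A F where "p \<in> A" "exact_on A F (hdf f)" by (rule hd_lift[OF assms p])
  then show "\<exists>A F. p \<in> A \<and> exact_on A F (hdf f)" by blast
qed (simp add: hd_outside)

text \<open>Both v and \<open>nv p v\<close> are derivations at p, so the difference of their values
  on lifts inherits linearity and the Leibniz rule.\<close>

lemma hd_algebra:
  assumes f: "f \<in> SS" and g: "g \<in> SS" and p: "p \<in> S"
  shows "hdf (f + g) p = hdf f p + hdf g p" "hdf (c *\<^sub>R f) p = c *\<^sub>R hdf f p" "hdf (f * g) p = f p *\<^sub>R hdf g p + g p *\<^sub>R hdf f p"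
proof -
  obtain F A where F: "F \<in> Sm" "mopen A" "p \<in> A" "\<And>q. q \<in> A ==> q \<in> S ==> F q = f q"
    by (rule smooth_S_lift[OF f p]) (rule that)
  obtain G B where G: "G \<in> Sm" "mopen B" "p \<in> B" "\<And>q. q \<in> B ==> q \<in> S ==> G q = g q"
    by (rule smooth_S_lift[OF g p]) (rule that)
  have AB: "mopen (A \<inter> B)" "p \<in> A \<inter> B" using F G by auto
  have pt: "F p = f p" "G p = g p" using F G p by auto
  have "hdf (f + g) p v = hdf f p v + hdf g p v \<and> hdf (c *\<^sub>R f) p v = c * hdf f p v \<and>
      hdf (f * g) p v = f p * hdf g p v + g p * hdf f p v" for v
  proof (cases "v \<in> tangent M p")
    case v: True
    note n = nv_tangent(2)[OF p v]
    have 1: "hdf f p v = v F - nv p v F" by (rule hd_apply[OF p f v F])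
    have 2: "hdf g p v = v G - nv p v G" by (rule hd_apply[OF p g v G])
    have 3: "hdf (f + g) p v = v (F + G) - nv p v (F + G)"
      by (rule hd_apply[OF p S.smooth_intros(2)[OF f g] v smooth_intros(2)[OF F(1) G(1)] AB])
        (use F(4) G(4) in auto)
    have 4: "hdf (c *\<^sub>R f) p v = v (c *\<^sub>R F) - nv p v (c *\<^sub>R F)"
      by (rule hd_apply[OF p S.smooth_intros(5)[OF f] v smooth_intros(5)[OF F(1)] F(2,3)])
        (use F(4) in auto)
    have 5: "hdf (f * g) p v = v (F * G) - nv p v (F * G)"
      by (rule hd_apply[OF p S.smooth_mult[OF f g] v smooth_mult[OF F(1) G(1)] AB])
        (use F(4) G(4) in auto)
    show ?thesis
      unfolding 1 2 3 4 5 tangentD(1)[OF v F(1) G(1)] tangentD(1)[OF n F(1) G(1)] tangentD(2)[OF v F(1)] tangentD(2)[OF n F(1)]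
        tangentD(3)[OF v F(1) G(1)] tangentD(3)[OF n F(1) G(1)] pt by (simp add: algebra_simps)
  qed (simp add: cotangentD(3)[OF hd_cotangent[OF p]])
  then show "hdf (f + g) p = hdf f p + hdf g p" "hdf (c *\<^sub>R f) p = c *\<^sub>R hdf f p" "hdf (f * g) p = f p *\<^sub>R hdf g p + g p *\<^sub>R hdf f p"
    by (auto simp: fun_eq_iff)
qed

end

section \<open>Affine functions as jets\<close>

context exponential_setting
begin

text \<open>Besides the differential, as in \<open>exact_on\<close>, this fixes the values of F on
  S; the differential of a product of lifts depends on them.\<close>

definition lifts :: "'a set \<Rightarrow> 'a fn \<Rightarrow> 'a aff \<Rightarrow> bool"
  where "lifts A F x \<longleftrightarrow> mopen A \<and> F \<in> Sm \<and>
    (\<forall>q\<in>A \<inter> S. F q = fst x q \<and> dN F q = hdf (fst x) q + snd x q)"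

abbreviation "Aff \<equiv> aff_carrier D"
abbreviation "ab \<equiv> aff_bracket D"

lemma Aff_iff: "x \<in> Aff \<longleftrightarrow> fst x \<in> SS \<and> snd x \<in> CS"
  by (auto simp: aff_carrier_def mem_Times_iff)

lemma liftsD:
  assumes "lifts A F x"
  shows "mopen A" "F \<in> Sm" "q \<in> A ==> q \<in> S ==> F q = fst x q"
    "q \<in> A ==> q \<in> S ==> dN F q = hdf (fst x) q + snd x q"
  using assms by (auto simp: lifts_def)

lemma liftsI:
  assumes "mopen A" "F \<in> Sm" "\<And>q. q \<in> A ==> q \<in> S ==> F q = fst x q"
    "\<And>q. q \<in> A ==> q \<in> S ==> dN F q = hdf (fst x) q + snd x q"
  shows "lifts A F x"
  using assms by (auto simp: lifts_def)

lemma lifts_subset: "lifts A F x ==> mopen B ==> B \<subseteq> A ==> lifts B F x"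
  unfolding lifts_def by blast

lemma lifts_exists:
  assumes x: "x \<in> Aff" and p: "p \<in> S"
  obtains A F where "p \<in> A" "lifts A F x"
proof -
  have f: "fst x \<in> SS" and \<eta>: "snd x \<in> CS" using x Aff_iff by auto
  obtain A F where F: "p \<in> A" "exact_on A F (hdf (fst x))" "\<And>q. q \<in> A ==> q \<in> S ==> F q = fst x q"
    by (rule hd_lift[OF f p]) (rule that)
  obtain B G where G: "p \<in> B" "exact_on B G (snd x)" "\<And>q. q \<in> B ==> q \<in> S ==> G q = 0"
    by (rule conormal_lift[OF \<eta> p]) (rule that)
  note Fs = exact_onD(2)[OF F(2)] and Gs = exact_onD(2)[OF G(2)]
  have "lifts (A \<inter> B) (F + G) x"
  proof (rule liftsI)
    show "mopen (A \<inter> B)" using exact_onD(3)[OF F(2)] exact_onD(3)[OF G(2)] by blast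
    show "F + G \<in> Sm" by (rule smooth_intros(2)[OF Fs Gs])
    fix q assume q: "q \<in> A \<inter> B" "q \<in> S"
    show "(F + G) q = fst x q" using F(3) G(3) q by simp
    show "dN (F + G) q = hdf (fst x) q + snd x q"
      unfolding differential_add[OF Fs Gs] using exact_onD(1)[OF F(2) _ q(2)] exact_onD(1)[OF G(2) _ q(2)] q by simp
  qed
  then show thesis using F(1) G(1) by (intro that[of "A \<inter> B" "F + G"]) simp_all
qed

lemma lifts_exists2:
  assumes "x \<in> Aff" "y \<in> Aff" "p \<in> S"
  obtains A F G where "p \<in> A" "lifts A F x" "lifts A G y"
proof -
  obtain A F where A: "p \<in> A" "lifts A F x" by (rule lifts_exists[OF assms(1,3)])
  obtain B G where B: "p \<in> B" "lifts B G y" by (rule lifts_exists[OF assms(2,3)])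
  have o: "mopen (A \<inter> B)" using liftsD(1)[OF A(2)] liftsD(1)[OF B(2)] by blast
  show thesis
    by (rule that[OF _ lifts_subset[OF A(2) o Int_lower1] lifts_subset[OF B(2) o Int_lower2]]) (use A B in simp)
qed

lemma lifts_exists3:
  assumes "x \<in> Aff" "y \<in> Aff" "z \<in> Aff" "p \<in> S"
  obtains A F G H where "p \<in> A" "lifts A F x" "lifts A G y" "lifts A H z"
proof -
  obtain A F G where A: "p \<in> A" "lifts A F x" "lifts A G y" by (rule lifts_exists2[OF assms(1,2,4)])
  obtain B H where B: "p \<in> B" "lifts B H z" by (rule lifts_exists[OF assms(3,4)])
  have o: "mopen (A \<inter> B)" using liftsD(1)[OF A(2)] liftsD(1)[OF B(2)] by blast
  show thesis
    by (rule that[OF _ lifts_subset[OF A(2) o Int_lower1] lifts_subset[OF A(3) o Int_lower1] lifts_subset[OF B(2) o Int_lower2]])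
      (use A B in simp)
qed

text \<open>A lift determines both components near p: its values give the function, and its
  differential minus h of that function gives the section. Identities below are proved by exhibiting
  a common lift of both sides.\<close>

lemma aff_eqI:
  assumes x: "x \<in> Aff" and y: "y \<in> Aff"
    and l: "\<And>p. p \<in> S ==> \<exists>A F. p \<in> A \<and> lifts A F x \<and> lifts A F y"
  shows "x = y"
proof -
  have fx: "fst x \<in> SS" "snd x \<in> restricted_forms D" and fy: "fst y \<in> SS" "snd y \<in> restricted_forms D"
    using x y conormal_sectionsD(1) by (auto simp: Aff_iff)
  have e1: "fst x = fst y"
  proof
    fix p show "fst x p = fst y p"
    proof (cases "p \<in> S")
      case True
      obtain A F where "p \<in> A" "lifts A F x" "lifts A F y" using l[OF True] by (elim exE conjE)
      then show ?thesis using liftsD(3)[of A F x p] liftsD(3)[of A F y p] True by simp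
    next
      case False
      then show ?thesis using S.smooth_functions_outside[OF fx(1)] S.smooth_functions_outside[OF fy(1)] by simp
    qed
  qed
  moreover have "snd x = snd y"
  proof
    fix p show "snd x p = snd y p"
    proof (cases "p \<in> S")
      case True
      obtain A F where "p \<in> A" "lifts A F x" "lifts A F y" using l[OF True] by (elim exE conjE)
      then have "hdf (fst x) p + snd x p = hdf (fst y) p + snd y p"
        using liftsD(4)[of A F x p] liftsD(4)[of A F y p] True by simp
      then show ?thesis unfolding e1 by (rule add_left_imp_eq)
    next
      case False
      then show ?thesis using restricted_formsD(2)[OF fx(2)] restricted_formsD(2)[OF fy(2)] by simp
    qed
  qed
  ultimately show ?thesis by (rule prod_eqI)
qed

lemma lifts_exact_on:
  assumes "x \<in> Aff" "lifts A F x" shows "exact_on A F (hdf (fst x) + snd x)"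
  using assms by (auto simp: lifts_def exact_on_def)

lemma subspace_Aff: "subspace Aff"
  unfolding aff_carrier_def
  by (rule subspaceI)
    (auto simp: zero_prod_def S.smooth_intros subspace_0[OF subspace_CS]
      subspace_add[OF subspace_CS] subspace_scale[OF subspace_CS])

lemma aff_mult_closed: assumes "x \<in> Aff" "y \<in> Aff" shows "aff_mult x y \<in> Aff"
  using assms
  by (auto simp: Aff_iff aff_mult_def case_prod_beta S.smooth_mult
    intro!: subspace_add[OF subspace_CS] conormal_smult)

lemma lifts_add:
  assumes "x \<in> Aff" "y \<in> Aff" "lifts A F x" "lifts A G y" shows "lifts A (F + G) (x + y)"
proof (rule liftsI)
  note Fs = liftsD(2)[OF assms(3)] and Gs = liftsD(2)[OF assms(4)]
  have s: "fst x \<in> SS" "fst y \<in> SS" using assms by (auto simp: Aff_iff)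
  show "mopen A" by (rule liftsD(1)[OF assms(3)])
  show "F + G \<in> Sm" by (rule smooth_intros(2)[OF Fs Gs])
  fix q assume q: "q \<in> A" "q \<in> S"
  show "(F + G) q = fst (x + y) q" using liftsD(3)[OF assms(3) q] liftsD(3)[OF assms(4) q] by simp
  show "dN (F + G) q = hdf (fst (x + y)) q + snd (x + y) q"
    unfolding differential_add[OF Fs Gs] liftsD(4)[OF assms(3) q] liftsD(4)[OF assms(4) q] fst_add snd_add
      hd_algebra(1)[OF s q(2)] by (simp add: fun_eq_iff)
qed

lemma lifts_scaleR:
  assumes "x \<in> Aff" "lifts A F x" shows "lifts A (c *\<^sub>R F) (c *\<^sub>R x)"
proof (rule liftsI)
  note Fs = liftsD(2)[OF assms(2)]
  have s: "fst x \<in> SS" using assms by (auto simp: Aff_iff)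
  show "mopen A" by (rule liftsD(1)[OF assms(2)])
  show "c *\<^sub>R F \<in> Sm" by (rule smooth_intros(5)[OF Fs])
  fix q assume q: "q \<in> A" "q \<in> S"
  show "(c *\<^sub>R F) q = fst (c *\<^sub>R x) q" using liftsD(3)[OF assms(2) q] by simp
  show "dN (c *\<^sub>R F) q = hdf (fst (c *\<^sub>R x)) q + snd (c *\<^sub>R x) q"
    unfolding differential_scaleR[OF Fs] liftsD(4)[OF assms(2) q] fst_scaleR snd_scaleR
      hd_algebra(2)[OF s s q(2)] by (simp add: fun_eq_iff algebra_simps)
qed

lemma lifts_mult:
  assumes "x \<in> Aff" "y \<in> Aff" "lifts A F x" "lifts A G y" shows "lifts A (F * G) (aff_mult x y)"
proof (rule liftsI)
  note Fs = liftsD(2)[OF assms(3)] and Gs = liftsD(2)[OF assms(4)]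
  have s: "fst x \<in> SS" "fst y \<in> SS" using assms by (auto simp: Aff_iff)
  have fs: "fst (aff_mult x y) = fst x * fst y" "snd (aff_mult x y) = smult_section (fst x) (snd y) + smult_section (fst y) (snd x)"
    by (simp_all add: aff_mult_def case_prod_beta)
  show "mopen A" by (rule liftsD(1)[OF assms(3)])
  show "F * G \<in> Sm" by (rule smooth_mult[OF Fs Gs])
  fix q assume q: "q \<in> A" "q \<in> S"
  show "(F * G) q = fst (aff_mult x y) q" using liftsD(3)[OF assms(3) q] liftsD(3)[OF assms(4) q] fs by simp
  show "dN (F * G) q = hdf (fst (aff_mult x y)) q + snd (aff_mult x y) q"
    unfolding differential_mult[OF Fs Gs] liftsD(3,4)[OF assms(3) q] liftsD(3,4)[OF assms(4) q] fs
      hd_algebra(3)[OF s q(2)] by (simp add: fun_eq_iff algebra_simps)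
qed

section \<open>Closure of the affine functions under the bracket\<close>

lemma conormalI_exact:
  assumes "c \<in> locally_exact" "\<And>p. p \<in> S ==> \<exists>A F. p \<in> A \<and> exact_on A F c \<and> (\<forall>q\<in>A \<inter> S. F q = 0)"
  shows "c \<in> CS"
proof (rule conormal_sectionsI[OF locally_exact_restricted[OF assms(1)]])
  fix q v assume q: "q \<in> S" and v: "v \<in> T q"
  obtain A F where A: "q \<in> A" "exact_on A F c" "\<forall>q\<in>A \<inter> S. F q = 0" using assms(2)[OF q] by (elim exE conjE)
  have "vanishes_near F q" unfolding vanishes_near_def using A exact_onD(2,3)[OF A(2)] by blast
  then have "dN F q v = 0" by (rule differential_vanish_conormal[OF _ q v])
  then show "c q v = 0" using exact_onD(1)[OF A(2,1) q] by simp
qed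

lemma br_zero_on:
  assumes "F \<in> Sm" "G \<in> Sm" "mopen A" "\<And>q. q \<in> A ==> q \<in> S ==> G q = 0" "q \<in> A" "q \<in> S"
  shows "br F G q = 0"
  by (rule br_vanish(2)[OF _ assms(1,6)]) (use assms in \<open>auto simp: vanishes_near_def\<close>)

text \<open>The potential of a conormal section can be chosen to vanish on S, and then so does its
  bracket with any potential.\<close>

lemma restricted_bracket_conormal:
  assumes a: "a \<in> locally_exact" and \<xi>: "\<xi> \<in> CS"
  shows "rb a \<xi> \<in> CS"
proof (rule conormalI_exact)
  note LE = conormal_locally_exact[OF \<xi>]
  show "rb a \<xi> \<in> locally_exact" by (rule restricted_bracket(1)[OF a LE])
  fix p assume p: "p \<in> S"
  obtain A F where A: "p \<in> A" "exact_on A F a" by (rule locally_exactE[OF a p])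
  obtain B G where B: "p \<in> B" "exact_on B G \<xi>" "\<And>q. q \<in> B ==> q \<in> S ==> G q = 0"
    by (rule conormal_lift[OF \<xi> p]) (rule that)
  have o: "mopen (A \<inter> B)" using exact_onD(3)[OF A(2)] exact_onD(3)[OF B(2)] by blast
  have "exact_on (A \<inter> B) (br F G) (rb a \<xi>)"
    by (rule restricted_bracket(2)[OF a LE exact_on_subset[OF A(2) o Int_lower1] exact_on_subset[OF B(2) o Int_lower2]])
  moreover have "\<forall>q\<in>(A \<inter> B) \<inter> S. br F G q = 0"
    using br_zero_on[OF exact_onD(2)[OF A(2)] exact_onD(2)[OF B(2)] exact_onD(3)[OF B(2)] B(3)] by blast
  ultimately show "\<exists>A F. p \<in> A \<and> exact_on A F (rb a \<xi>) \<and> (\<forall>q\<in>A \<inter> S. F q = 0)"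
    using A(1) B(1) by (intro exI[of _ "A \<inter> B"] exI[of _ "br F G"]) simp
qed

lemma cder_conormal: "f \<in> SS ==> \<xi> \<in> CS ==> cder D (d_S D f) \<xi> \<in> CS"
  unfolding cder_def by (rule restricted_bracket_conormal[OF hd_locally_exact])

lemma bracket_1_conormal: "\<eta> \<in> CS ==> \<xi> \<in> CS ==> bracket_1 D \<eta> \<xi> \<in> CS"
  unfolding bracket_1_def by (rule restricted_bracket_conormal[OF conormal_locally_exact])

lemma curv_eq:
  assumes "f \<in> SS" "g \<in> SS"
  shows "curv D (d_S D f) (d_S D g) = rb (hdf f) (hdf g) - hdf (bracket_S D f g)"
  unfolding curv_def S.koszul_exact[OF assms] ..

text \<open>If F, G and H are potentials of h(df), h(dg) and h(d{f, g}) that restrict to f, g and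
  {f, g}, then {F, G} - H vanishes on S, and its differential along S is the curvature.\<close>

lemma curv_conormal:
  assumes f: "f \<in> SS" and g: "g \<in> SS"
  shows "curv D (d_S D f) (d_S D g) \<in> CS"
  unfolding curv_eq[OF assms]
proof (rule conormalI_exact)
  let ?k = "bracket_S D f g"
  have k: "?k \<in> SS" by (rule S.br_smooth[OF f g])
  note LE = hd_locally_exact[OF f] hd_locally_exact[OF g] hd_locally_exact[OF k]
  show "rb (hdf f) (hdf g) - hdf ?k \<in> locally_exact"
    by (rule subspace_diff[OF subspace_locally_exact restricted_bracket(1)[OF LE(1,2)] LE(3)])
  fix p assume p: "p \<in> S"
  obtain A F where A: "p \<in> A" "exact_on A F (hdf f)" "\<And>q. q \<in> A ==> q \<in> S ==> F q = f q"
    by (rule hd_lift[OF f p]) (rule that)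
  obtain B G where B: "p \<in> B" "exact_on B G (hdf g)" "\<And>q. q \<in> B ==> q \<in> S ==> G q = g q"
    by (rule hd_lift[OF g p]) (rule that)
  obtain C H where C: "p \<in> C" "exact_on C H (hdf ?k)" "\<And>q. q \<in> C ==> q \<in> S ==> H q = ?k q"
    by (rule hd_lift[OF k p]) (rule that)
  let ?E = "A \<inter> B \<inter> C"
  have o: "mopen (A \<inter> B)" "mopen ?E"
    using exact_onD(3)[OF A(2)] exact_onD(3)[OF B(2)] exact_onD(3)[OF C(2)] by blast+
  have "exact_on ?E (br F G) (rb (hdf f) (hdf g))"
    by (rule restricted_bracket(2)[OF LE(1,2) exact_on_subset[OF A(2) o(2)] exact_on_subset[OF B(2) o(2)]]) auto
  moreover have "exact_on ?E ((-1) *\<^sub>R H) ((-1) *\<^sub>R hdf ?k)"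
    by (rule exact_on_scaleR[OF exact_on_subset[OF C(2) o(2) Int_lower2]])
  ultimately have "exact_on ?E (br F G + (-1) *\<^sub>R H) (rb (hdf f) (hdf g) + (-1) *\<^sub>R hdf ?k)"
    by (rule exact_on_add)
  moreover have "br F G q = ?k q" if "q \<in> ?E" "q \<in> S" for q
    by (rule bracket_S_lift[OF f g exact_onD(2)[OF A(2)] exact_onD(2)[OF B(2)] o(1)]) (use A(3) B(3) that in auto)
  then have "\<forall>q\<in>?E \<inter> S. (br F G + (-1) *\<^sub>R H) q = 0" using C(3) by simp
  ultimately show "\<exists>A F. p \<in> A \<and> exact_on A F (rb (hdf f) (hdf g) - hdf ?k) \<and> (\<forall>q\<in>A \<inter> S. F q = 0)"
    using A(1) B(1) C(1) by (intro exI[of _ ?E] exI[of _ "br F G + (-1) *\<^sub>R H"]) simp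
qed

lemma ab_simps:
  "fst (ab x y) = bracket_S D (fst x) (fst y)"
  "snd (ab x y) = cder D (d_S D (fst x)) (snd y) - cder D (d_S D (fst y)) (snd x) + bracket_1 D (snd x) (snd y)
     + curv D (d_S D (fst x)) (d_S D (fst y))"
  by (simp_all add: aff_bracket_def case_prod_beta)

lemma ab_closed: assumes "x \<in> Aff" "y \<in> Aff" shows "ab x y \<in> Aff"
  using assms
  by (auto simp: Aff_iff ab_simps S.br_smooth
    intro!: subspace_add[OF subspace_CS] subspace_diff[OF subspace_CS]
      cder_conormal bracket_1_conormal curv_conormal)

text \<open>Expand the bracket of h(df) + \<eta> with h(dg) + \<xi>: the term with two lifts is
  h(d{f, g}) plus curvature, the mixed terms are contravariant derivatives, the last one is
  \<open>bracket_1\<close>. The second component of the affine bracket is thus what d{F, G} has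
  beyond h(d{f, g}) on S.\<close>

lemma lifts_bracket:
  assumes x: "x \<in> Aff" and y: "y \<in> Aff" and Fx: "lifts A F x" and Gy: "lifts A G y"
  shows "lifts A (br F G) (ab x y)"
proof (rule liftsI)
  note Fs = liftsD(2)[OF Fx] and Gs = liftsD(2)[OF Gy]
  have s: "fst x \<in> SS" "fst y \<in> SS" and c: "snd x \<in> CS" "snd y \<in> CS"
    using x y by (auto simp: Aff_iff)
  note h = hd_locally_exact[OF s(1)] hd_locally_exact[OF s(2)] and n = conormal_locally_exact[OF c(1)] conormal_locally_exact[OF c(2)]
  note hn = subspace_add[OF subspace_locally_exact h(1) n(1)] subspace_add[OF subspace_locally_exact h(2) n(2)]
  show "mopen A" by (rule liftsD(1)[OF Fx])
  show "br F G \<in> Sm" by (rule br_smooth[OF Fs Gs])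
  fix q assume q: "q \<in> A" "q \<in> S"
  show "br F G q = fst (ab x y) q"
    unfolding ab_simps by (rule bracket_S_lift[OF s Fs Gs liftsD(1)[OF Fx] liftsD(3)[OF Fx] liftsD(3)[OF Gy] q])
  let ?r = "rb"
  have "dN (br F G) q = ?r (hdf (fst x) + snd x) (hdf (fst y) + snd y) q"
    using exact_onD(1)[OF restricted_bracket(2)[OF hn lifts_exact_on[OF x Fx] lifts_exact_on[OF y Gy]] q] by simp
  also have "?r (hdf (fst x) + snd x) (hdf (fst y) + snd y) =
      ?r (hdf (fst x)) (hdf (fst y)) + ?r (hdf (fst x)) (snd y) + (?r (snd x) (hdf (fst y)) + ?r (snd x) (snd y))"
    unfolding restricted_bracket_add_left[OF h(1) n(1) hn(2)] restricted_bracket_add_right[OF h(1) h(2) n(2)]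
      restricted_bracket_add_right[OF n(1) h(2) n(2)] ..
  also have "?r (snd x) (hdf (fst y)) = - ?r (hdf (fst y)) (snd x)" by (rule restricted_bracket_skew[OF n(1) h(2)])
  also have "?r (hdf (fst x)) (hdf (fst y)) + ?r (hdf (fst x)) (snd y) + (- ?r (hdf (fst y)) (snd x) + ?r (snd x) (snd y)) =
      hdf (fst (ab x y)) + snd (ab x y)"
    unfolding ab_simps curv_eq[OF s] cder_def bracket_1_def by (simp add: algebra_simps)
  finally show "dN (br F G) q = hdf (fst (ab x y)) q + snd (ab x y) q" by (simp add: fun_eq_iff)
qed

section \<open>The Poisson algebra identities\<close>

lemma ab_skew: assumes x: "x \<in> Aff" and y: "y \<in> Aff" shows "ab x y = - ab y x"
proof (rule aff_eqI[OF ab_closed[OF x y] subspace_neg[OF subspace_Aff ab_closed[OF y x]]])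
  fix p assume p: "p \<in> S"
  obtain A F G where A: "p \<in> A" "lifts A F x" "lifts A G y" by (rule lifts_exists2[OF x y p])
  have "lifts A ((-1) *\<^sub>R br G F) ((-1) *\<^sub>R ab y x)"
    by (rule lifts_scaleR[OF ab_closed[OF y x] lifts_bracket[OF y x A(3,2)]])
  moreover have "(-1) *\<^sub>R br G F = br F G" using br_skew[of F G] by simp
  ultimately show "\<exists>A F. p \<in> A \<and> lifts A F (ab x y) \<and> lifts A F (- ab y x)"
    using lifts_bracket[OF x y A(2,3)] A(1) by (intro exI[of _ A] exI[of _ "br F G"]) simp
qed

lemma ab_add_right:
  assumes x: "x \<in> Aff" and y: "y \<in> Aff" and z: "z \<in> Aff" shows "ab x (y + z) = ab x y + ab x z"
proof (rule aff_eqI)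
  note yz = subspace_add[OF subspace_Aff y z]
  show "ab x (y + z) \<in> Aff" by (rule ab_closed[OF x yz])
  show "ab x y + ab x z \<in> Aff" by (rule subspace_add[OF subspace_Aff ab_closed[OF x y] ab_closed[OF x z]])
  fix p assume p: "p \<in> S"
  obtain A F G H where A: "p \<in> A" "lifts A F x" "lifts A G y" "lifts A H z" by (rule lifts_exists3[OF x y z p])
  have "lifts A (br F (G + H)) (ab x (y + z))" by (rule lifts_bracket[OF x yz A(2) lifts_add[OF y z A(3,4)]])
  moreover have "lifts A (br F G + br F H) (ab x y + ab x z)"
    by (rule lifts_add[OF ab_closed[OF x y] ab_closed[OF x z] lifts_bracket[OF x y A(2,3)] lifts_bracket[OF x z A(2,4)]])
  ultimately show "\<exists>A F. p \<in> A \<and> lifts A F (ab x (y + z)) \<and> lifts A F (ab x y + ab x z)"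
    using A(1) br_right(1)[OF liftsD(2)[OF A(3)] liftsD(2)[OF A(4)], of F]
    by (intro exI[of _ A] exI[of _ "br F (G + H)"]) simp
qed

lemma ab_scaleR_right:
  assumes x: "x \<in> Aff" and y: "y \<in> Aff" shows "ab x (c *\<^sub>R y) = c *\<^sub>R ab x y"
proof (rule aff_eqI)
  note cy = subspace_scale[OF subspace_Aff y, of c]
  show "ab x (c *\<^sub>R y) \<in> Aff" by (rule ab_closed[OF x cy])
  show "c *\<^sub>R ab x y \<in> Aff" by (rule subspace_scale[OF subspace_Aff ab_closed[OF x y]])
  fix p assume p: "p \<in> S"
  obtain A F G where A: "p \<in> A" "lifts A F x" "lifts A G y" by (rule lifts_exists2[OF x y p])
  have "lifts A (br F (c *\<^sub>R G)) (ab x (c *\<^sub>R y))" by (rule lifts_bracket[OF x cy A(2) lifts_scaleR[OF y A(3)]])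
  moreover have "lifts A (c *\<^sub>R br F G) (c *\<^sub>R ab x y)"
    by (rule lifts_scaleR[OF ab_closed[OF x y] lifts_bracket[OF x y A(2,3)]])
  ultimately show "\<exists>A F. p \<in> A \<and> lifts A F (ab x (c *\<^sub>R y)) \<and> lifts A F (c *\<^sub>R ab x y)"
    using A(1) br_right(2)[OF liftsD(2)[OF A(3)] liftsD(2)[OF A(3)], of F c]
    by (intro exI[of _ A] exI[of _ "br F (c *\<^sub>R G)"]) simp
qed

lemma ab_add_left:
  assumes "x \<in> Aff" "y \<in> Aff" "z \<in> Aff" shows "ab (x + y) z = ab x z + ab y z"
  using ab_skew[OF subspace_add[OF subspace_Aff assms(1,2)] assms(3)] ab_add_right[OF assms(3,1,2)]
    ab_skew[OF assms(1,3)] ab_skew[OF assms(2,3)] by simp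

lemma ab_scaleR_left:
  assumes "x \<in> Aff" "y \<in> Aff" shows "ab (c *\<^sub>R x) y = c *\<^sub>R ab x y"
  using ab_skew[OF subspace_scale[OF subspace_Aff assms(1)] assms(2)] ab_scaleR_right[OF assms(2,1)]
    ab_skew[OF assms] by simp

lemma ab_mult_right:
  assumes x: "x \<in> Aff" and y: "y \<in> Aff" and z: "z \<in> Aff"
  shows "ab x (aff_mult y z) = aff_mult (ab x y) z + aff_mult y (ab x z)"
proof (rule aff_eqI)
  note yz = aff_mult_closed[OF y z] and xy = ab_closed[OF x y] and xz = ab_closed[OF x z]
  show "ab x (aff_mult y z) \<in> Aff" by (rule ab_closed[OF x yz])
  show "aff_mult (ab x y) z + aff_mult y (ab x z) \<in> Aff"
    by (rule subspace_add[OF subspace_Aff aff_mult_closed[OF xy z] aff_mult_closed[OF y xz]])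
  fix p assume p: "p \<in> S"
  obtain A F G H where A: "p \<in> A" "lifts A F x" "lifts A G y" "lifts A H z" by (rule lifts_exists3[OF x y z p])
  have "lifts A (br F (G * H)) (ab x (aff_mult y z))" by (rule lifts_bracket[OF x yz A(2) lifts_mult[OF y z A(3,4)]])
  moreover have "lifts A (br F G * H + G * br F H) (aff_mult (ab x y) z + aff_mult y (ab x z))"
    by (intro lifts_add aff_mult_closed xy xz y z lifts_mult lifts_bracket x A)
  moreover have "br F (G * H) = br F G * H + G * br F H"
    using br_right(3)[OF liftsD(2)[OF A(3)] liftsD(2)[OF A(4)], of F] by (simp add: algebra_simps)
  ultimately show "\<exists>A F. p \<in> A \<and> lifts A F (ab x (aff_mult y z)) \<and> lifts A F (aff_mult (ab x y) z + aff_mult y (ab x z))"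
    using A(1) by (intro exI[of _ A] exI[of _ "br F (G * H)"]) simp
qed

text \<open>Put as a derivation property of \<open>ab x\<close>, the form in which Hamiltonian
  derivations use it.\<close>

lemma ab_jacobi:
  assumes x: "x \<in> Aff" and y: "y \<in> Aff" and z: "z \<in> Aff"
  shows "ab x (ab y z) = ab (ab x y) z + ab y (ab x z)"
proof (rule aff_eqI)
  note yz = ab_closed[OF y z] and xy = ab_closed[OF x y] and xz = ab_closed[OF x z]
  show "ab x (ab y z) \<in> Aff" by (rule ab_closed[OF x yz])
  show "ab (ab x y) z + ab y (ab x z) \<in> Aff"
    by (rule subspace_add[OF subspace_Aff ab_closed[OF xy z] ab_closed[OF y xz]])
  fix p assume p: "p \<in> S"
  obtain A F G H where A: "p \<in> A" "lifts A F x" "lifts A G y" "lifts A H z" by (rule lifts_exists3[OF x y z p])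
  note Fs = liftsD(2)[OF A(2)] and Gs = liftsD(2)[OF A(3)] and Hs = liftsD(2)[OF A(4)]
  have "lifts A (br F (br G H)) (ab x (ab y z))" by (rule lifts_bracket[OF x yz A(2) lifts_bracket[OF y z A(3,4)]])
  moreover have "lifts A (br (br F G) H + br G (br F H)) (ab (ab x y) z + ab y (ab x z))"
    by (rule lifts_add[OF ab_closed[OF xy z] ab_closed[OF y xz] lifts_bracket[OF xy z lifts_bracket[OF x y A(2,3)] A(4)]
      lifts_bracket[OF y xz A(3) lifts_bracket[OF x z A(2,4)]]])
  moreover have "br F (br G H) = br (br F G) H + br G (br F H)"
  proof -
    have "br G (br H F) = br G ((-1) *\<^sub>R br F H)" using br_skew[of H F] by simp
    also have "\<dots> = (-1) *\<^sub>R br G (br F H)" by (rule br_right(2)[OF br_smooth[OF Fs Hs] br_smooth[OF Fs Hs]])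
    finally have 1: "br G (br H F) = - br G (br F H)" by simp
    have 2: "br H (br F G) = - br (br F G) H" by (rule br_skew)
    show ?thesis using br_jacobi[OF Fs Gs Hs] unfolding 1 2 by (simp add: algebra_simps)
  qed
  ultimately show "\<exists>A F. p \<in> A \<and> lifts A F (ab x (ab y z)) \<and> lifts A F (ab (ab x y) z + ab y (ab x z))"
    using A(1) by (intro exI[of _ A] exI[of _ "br F (br G H)"]) simp
qed

end

section \<open>Tensors from derivations\<close>

lemma alt_multilinear_1I:
  assumes "\<And>a. a \<in> V ==> F [a] \<in> B" "\<And>a b. a \<in> V ==> b \<in> V ==> F [a + b] = F [a] + F [b]"
    "\<And>a c. a \<in> V ==> F [c *\<^sub>R a] = c *\<^sub>R F [a]" "\<And>xs. \<not> (length xs = 1 \<and> set xs \<subseteq> V) ==> F xs = 0"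
  shows "F \<in> alt_multilinear V 1 B"
  unfolding alt_multilinear_def
proof (intro CollectI conjI allI impI)
  fix xs assume "length xs = 1 \<and> set xs \<subseteq> V"
  then obtain a where "xs = [a]" "a \<in> V" by (auto simp: length_Suc_conv)
  then show "F xs \<in> B" using assms(1) by simp
next
  fix xs and i :: nat assume "length xs = 1 \<and> set xs \<subseteq> V \<and> i < 1"
  then obtain a where "xs = [a]" "i = 0" by (auto simp: length_Suc_conv)
  then show "linear_from V (\<lambda>a. F (xs[i := a]))" using assms(2,3) by (simp add: linear_from_def)
qed (use assms(4) in auto)

lemma alt_multilinear_2I:
  assumes "\<And>a b. a \<in> V ==> b \<in> V ==> F [a, b] \<in> B"
    "\<And>b. b \<in> V ==> linear_from V (\<lambda>a. F [a, b])" "\<And>a. a \<in> V ==> linear_from V (\<lambda>b. F [a, b])"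
    "\<And>a. a \<in> V ==> F [a, a] = 0" "\<And>xs. \<not> (length xs = 2 \<and> set xs \<subseteq> V) ==> F xs = 0"
  shows "F \<in> alt_multilinear V 2 B"
  unfolding alt_multilinear_def
proof (intro CollectI conjI allI impI)
  have two: "\<exists>a b. xs = [a, b] \<and> a \<in> V \<and> b \<in> V" if "length xs = 2" "set xs \<subseteq> V" for xs
    using that by (auto simp: length_Suc_conv numeral_2_eq_2)
  fix xs assume "length xs = 2 \<and> set xs \<subseteq> V"
  then show "F xs \<in> B" using two assms(1) by blast
next
  have two: "\<exists>a b. xs = [a, b] \<and> a \<in> V \<and> b \<in> V" if "length xs = 2" "set xs \<subseteq> V" for xs
    using that by (auto simp: length_Suc_conv numeral_2_eq_2)
  fix xs and i :: nat assume h: "length xs = 2 \<and> set xs \<subseteq> V \<and> i < 2"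
  then obtain a b where ab: "xs = [a, b]" "a \<in> V" "b \<in> V" using two by blast
  have "i = 0 \<or> i = 1" using h by auto
  then show "linear_from V (\<lambda>a. F (xs[i := a]))" using assms(2)[OF ab(3)] assms(3)[OF ab(2)] ab(1) by auto
next
  fix xs and i j :: nat assume h: "length xs = 2 \<and> set xs \<subseteq> V \<and> i < j \<and> j < 2 \<and> xs ! i = xs ! j"
  then obtain a b where ab: "xs = [a, b]" "a \<in> V" by (auto simp: length_Suc_conv numeral_2_eq_2)
  have ij: "i = 0" "j = 1" using h by auto
  have "a = b" using h unfolding ij ab(1) by simp
  then show "F xs = 0" using assms(4)[OF ab(2)] ab(1) by simp
qed (use assms(5) in auto)

context exponential_setting
begin

abbreviation "dS \<equiv> d_S D"
abbreviation "De f \<xi> \<equiv> cder D (d_S D f) \<xi>"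
abbreviation "br1 \<equiv> bracket_1 D"
abbreviation "K f g \<equiv> curv D (d_S D f) (d_S D g)"

lemma mvD:
  assumes "Q \<in> MV k"
  shows "p \<in> S ==> Q p \<in> alt_multilinear (cotangent SM p) k (conormal D p)"
    "p \<notin> S ==> Q p = 0"
    "length \<alpha>s = k ==> set \<alpha>s \<subseteq> one_forms SM ==> eval_mv Q \<alpha>s \<in> CS"
  using assms by (simp_all add: conormal_mv_def multivector_fields_def)

lemma mvI:
  assumes "\<And>p. p \<in> S ==> Q p \<in> alt_multilinear (cotangent SM p) k (conormal D p)"
    "\<And>p. p \<notin> S ==> Q p = 0"
    "\<And>\<alpha>s. length \<alpha>s = k ==> set \<alpha>s \<subseteq> one_forms SM ==> eval_mv Q \<alpha>s \<in> CS"
  shows "Q \<in> MV k"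
  using assms by (simp add: conormal_mv_def multivector_fields_def)

text \<open>Derivations from functions on S to conormal sections. With
  \<open>mv_1_derivation\<close> and \<open>derivation_tensor\<close> they are the same as sections
  of TS tensor the conormal bundle, which is how tensors are produced from formulas on
  functions.\<close>

definition section_derivation :: "('a fn \<Rightarrow> 'a form) \<Rightarrow> bool"
  where "section_derivation X \<longleftrightarrow> (\<forall>f\<in>SS. X f \<in> CS \<and> (\<forall>c. X (c *\<^sub>R f) = c *\<^sub>R X f)) \<and>
    (\<forall>f\<in>SS. \<forall>g\<in>SS. X (f + g) = X f + X g \<and> X (f * g) = smult_section f (X g) + smult_section g (X f))"

lemma section_derivationD:
  assumes "section_derivation X" "f \<in> SS"
  shows "X f \<in> CS" "X (c *\<^sub>R f) = c *\<^sub>R X f" "g \<in> SS ==> X (f + g) = X f + X g"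
    "g \<in> SS ==> X (f * g) = smult_section f (X g) + smult_section g (X f)"
  using assms unfolding section_derivation_def by blast+

lemma mv_1_derivation:
  assumes Q: "Q \<in> MV 1" shows "section_derivation (\<lambda>f. eval_mv Q [dS f])"
proof -
  have l: "Q p [dS (f + g) p] = Q p [dS f p] + Q p [dS g p] \<and> Q p [dS (c *\<^sub>R f) p] = c *\<^sub>R Q p [dS f p] \<and>
      Q p [dS (f * g) p] = f p *\<^sub>R Q p [dS g p] + g p *\<^sub>R Q p [dS f p]"
    if f: "f \<in> SS" and g: "g \<in> SS" for f g c p
  proof (cases "p \<in> S")
    case True
    note d = S.differential_cotangent[of p, unfolded sub_simps, OF True]
    note s = subspace_scale[OF subspace_cotangent d]
    note a = alt_multilinear_1[OF mvD(1)[OF Q True]]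
    show ?thesis
      unfolding S.differential_add[OF f g] S.differential_scaleR[OF f] S.differential_mult[OF f g]
      by (simp only: a(2,3) d s)
  qed (simp add: mvD(2)[OF Q] fun_eq_iff)
  show ?thesis
    unfolding section_derivation_def
  proof (intro conjI ballI allI)
    fix f assume f: "f \<in> SS"
    show "eval_mv Q [dS f] \<in> CS" by (rule mvD(3)[OF Q]) (use S.differential_one_form[OF f] in auto)
    show "eval_mv Q [dS (c *\<^sub>R f)] = c *\<^sub>R eval_mv Q [dS f]" for c
      using l[OF f f] by (auto simp: fun_eq_iff)
    fix g assume g: "g \<in> SS"
    show "eval_mv Q [dS (f + g)] = eval_mv Q [dS f] + eval_mv Q [dS g]"
      using l[OF f g] by (auto simp: fun_eq_iff)
    show "eval_mv Q [dS (f * g)] = smult_section f (eval_mv Q [dS g]) + smult_section g (eval_mv Q [dS f])"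
      using l[OF f g] by (auto simp: fun_eq_iff)
  qed
qed

text \<open>For fixed w the number X f p w is a point derivation in f: the contraction of the
  desired tensor with w in its values, a vector tangent to S.\<close>

definition tensor_vec :: "('a fn \<Rightarrow> 'a form) \<Rightarrow> 'a \<Rightarrow> 'a tvec \<Rightarrow> 'a tvec"
  where "tensor_vec X p w = (\<lambda>f. if f \<in> SS then X f p w else 0)"

lemma tensor_vec_tangent:
  assumes X: "section_derivation X" and p: "p \<in> S" shows "tensor_vec X p w \<in> tangent SM p"
  by (rule tangentI)
    (simp_all add: tensor_vec_def S.smooth_intros section_derivationD[OF X])

lemma tensor_vec_linear:
  assumes X: "section_derivation X" and p: "p \<in> S" and v: "v \<in> tangent M p" and w: "w \<in> tangent M p"
  shows "tensor_vec X p (v + w) = tensor_vec X p v + tensor_vec X p w" "tensor_vec X p (c *\<^sub>R v) = c *\<^sub>R tensor_vec X p v"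
proof -
  have c: "X f p \<in> cotangent M p" if "f \<in> SS" for f
    by (rule restricted_formsD(1)[OF conormal_sectionsD(1)[OF section_derivationD(1)[OF X that]] p])
  show "tensor_vec X p (v + w) = tensor_vec X p v + tensor_vec X p w" "tensor_vec X p (c *\<^sub>R v) = c *\<^sub>R tensor_vec X p v"
    by (auto simp: tensor_vec_def fun_eq_iff cotangentD(1)[OF c v w] cotangentD(2)[OF c v])
qed

lemma tensor_vec_zero:
  assumes X: "section_derivation X" and p: "p \<in> S"
  shows "v \<in> T p ==> tensor_vec X p v = 0" "v \<notin> tangent M p ==> tensor_vec X p v = 0"
  using conormal_sectionsD(2)[OF section_derivationD(1)[OF X] p]
    cotangentD(3)[OF restricted_formsD(1)[OF conormal_sectionsD(1)[OF section_derivationD(1)[OF X]] p]]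
  by (auto simp: tensor_vec_def fun_eq_iff)

lemma tensor_vec_field:
  assumes X: "section_derivation X" and Y: "Y \<in> VF"
  shows "(\<lambda>p. if p \<in> S then tensor_vec X p (Y p) else 0) \<in> vector_fields SM"
proof (rule vector_fieldsI)
  fix f assume f: "f \<in> SS"
  note XR = conormal_sectionsD(1)[OF section_derivationD(1)[OF X f]]
  have "(\<lambda>p. (if p \<in> S then tensor_vec X p (Y p) else 0) f) = (\<lambda>p. X f p (Y p))"
    using f restricted_formsD(2)[OF XR] by (auto simp: tensor_vec_def fun_eq_iff)
  then show "(\<lambda>p. (if p \<in> S then tensor_vec X p (Y p) else 0) f) \<in> SS"
    using restricted_formsD(3)[OF XR Y] by simp
qed (simp_all add: tensor_vec_tangent[OF X])

lemma conormal_fibreI: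
  assumes "a \<in> cotangent M p" "\<And>v. v \<in> T p ==> a v = 0" shows "a \<in> conormal D p"
  using assms by (simp add: conormal_def)

text \<open>Contract in the values first: \<open>tensor_vec X p w\<close> is a tangent vector, on
  which a covector a is evaluated. No function with differential a has to be chosen, and smoothness
  follows because \<open>tensor_vec\<close> along a smooth field is a smooth field on S.\<close>

lemma derivation_tensor:
  assumes X: "section_derivation X"
  obtains Q where "Q \<in> MV 1" "\<And>f. f \<in> SS ==> eval_mv Q [dS f] = X f"
proof -
  define Q where "Q p xs = (if p \<in> S \<and> length xs = 1 \<and> set xs \<subseteq> cotangent SM p
    then (\<lambda>w. hd xs (tensor_vec X p w)) else 0)" for p xs
  have Q1: "Q p [a] = (\<lambda>w. a (tensor_vec X p w))" if "p \<in> S" "a \<in> cotangent SM p" for p a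
    using that by (simp add: Q_def)
  have con: "(\<lambda>w. a (tensor_vec X p w)) \<in> conormal D p" if p: "p \<in> S" and a: "a \<in> cotangent SM p" for p a
    by (intro conormal_fibreI cotangentI)
      (simp_all add: tensor_vec_linear[OF X p] tensor_vec_zero[OF X p] cotangentD(1,2)[OF a] tensor_vec_tangent[OF X p] cotangent_zero[OF a])
  have "Q \<in> MV 1"
  proof (rule mvI)
    fix p assume p: "p \<in> S"
    show "Q p \<in> alt_multilinear (cotangent SM p) 1 (conormal D p)"
    proof (rule alt_multilinear_1I)
      fix a b assume a: "a \<in> cotangent SM p" and b: "b \<in> cotangent SM p"
      show "Q p [a + b] = Q p [a] + Q p [b]"
        using Q1[OF p a] Q1[OF p b] Q1[OF p subspace_add[OF subspace_cotangent a b]] by (simp add: fun_eq_iff)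
    next
      fix a c assume a: "a \<in> cotangent SM p"
      show "Q p [a] \<in> conormal D p" using Q1[OF p a] con[OF p a] by simp
      show "Q p [c *\<^sub>R a] = c *\<^sub>R Q p [a]"
        using Q1[OF p a] Q1[OF p subspace_scale[OF subspace_cotangent a]] by (simp add: fun_eq_iff)
    qed (auto simp: Q_def)
  next
    fix \<alpha>s assume "length \<alpha>s = 1" "set \<alpha>s \<subseteq> one_forms SM"
    then obtain \<alpha> where \<alpha>: "\<alpha>s = [\<alpha>]" "\<alpha> \<in> one_forms SM" by (auto simp: length_Suc_conv)
    have c: "\<alpha> q \<in> cotangent SM q" if "q \<in> S" for q using one_formsD(1)[OF \<alpha>(2)] that by simp
    show "eval_mv Q \<alpha>s \<in> CS" unfolding \<alpha>(1)
    proof (rule conormal_sectionsI, rule restricted_formsI)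
      fix q assume q: "q \<in> S"
      show "eval_mv Q [\<alpha>] q \<in> cotangent M q" using con[OF q c[OF q]] Q1[OF q c[OF q]] by (simp add: conormal_def)
      show "eval_mv Q [\<alpha>] q v = 0" if "v \<in> T q" for v using con[OF q c[OF q]] Q1[OF q c[OF q]] that by (simp add: conormal_def)
    next
      fix Y assume Y: "Y \<in> VF"
      have "(\<lambda>q. eval_mv Q [\<alpha>] q (Y q)) = (\<lambda>q. \<alpha> q ((\<lambda>p. if p \<in> S then tensor_vec X p (Y p) else 0) q))"
        using Q1 c one_formsD(2)[OF \<alpha>(2)] by (auto simp: fun_eq_iff Q_def)
      then show "(\<lambda>q. eval_mv Q [\<alpha>] q (Y q)) \<in> SS"
        using one_formsD(3)[OF \<alpha>(2) tensor_vec_field[OF X Y]] by simp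
    qed (simp add: Q_def)
  qed (auto simp: Q_def fun_eq_iff)
  moreover have "eval_mv Q [dS f] = X f" if f: "f \<in> SS" for f
  proof
    fix p
    note XR = conormal_sectionsD(1)[OF section_derivationD(1)[OF X f]]
    show "eval_mv Q [dS f] p = X f p"
    proof (cases "p \<in> S")
      case True
      then show ?thesis
        using Q1[OF True, of "dS f p"] S.differential_cotangent[of p f] tensor_vec_tangent[OF X True] f
        by (auto simp: tensor_vec_def fun_eq_iff)
    qed (simp add: Q_def restricted_formsD(2)[OF XR])
  qed
  ultimately show thesis by (rule that)
qed

lemma S_cotangent_exact:
  assumes "a \<in> cotangent SM p" "p \<in> S" obtains f where "f \<in> SS" "dS f p = a"
  using S.cotangent_exact[OF assms(1)] assms(2) by auto

text \<open>Every covector of S at p is the differential of a function, so values on exact forms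
  determine the tensor.\<close>

lemma mv_1_eqI:
  assumes Q: "Q \<in> MV 1" "Q' \<in> MV 1"
    and e: "\<And>f. f \<in> SS ==> eval_mv Q [dS f] = eval_mv Q' [dS f]"
  shows "Q = Q'"
proof (intro ext)
  fix p xs w show "Q p xs w = Q' p xs w"
  proof (cases "p \<in> S \<and> length xs = 1 \<and> set xs \<subseteq> cotangent SM p")
    case True
    then obtain a where a: "xs = [a]" "a \<in> cotangent SM p" by (auto simp: length_Suc_conv)
    obtain f where f: "f \<in> SS" "dS f p = a" by (rule S_cotangent_exact[OF a(2)]) (use True in auto)
    have "eval_mv Q [dS f] p = eval_mv Q' [dS f] p" using e[OF f(1)] by simp
    then show ?thesis using a(1) f(2) by simp
  next
    case False
    then show ?thesis
      using alt_multilinear_1(4)[OF mvD(1)[OF Q(1)], of p xs] alt_multilinear_1(4)[OF mvD(1)[OF Q(2)], of p xs]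
        mvD(2)[OF Q(1), of p] mvD(2)[OF Q(2), of p] by (cases "p \<in> S") auto
  qed
qed

lemma mv_2_eqI:
  assumes Q: "Q \<in> MV 2" "Q' \<in> MV 2"
    and e: "\<And>f g. f \<in> SS ==> g \<in> SS ==> eval_mv Q [dS f, dS g] = eval_mv Q' [dS f, dS g]"
  shows "Q = Q'"
proof (intro ext)
  have z: "R p xs = 0" if R: "R \<in> MV 2" and n: "\<not> (p \<in> S \<and> length xs = 2 \<and> set xs \<subseteq> cotangent SM p)" for R p xs
  proof (cases "p \<in> S")
    case True
    then show ?thesis using mvD(1)[OF R True] n unfolding alt_multilinear_def by blast
  qed (simp add: mvD(2)[OF R])
  fix p xs w show "Q p xs w = Q' p xs w"
  proof (cases "p \<in> S \<and> length xs = 2 \<and> set xs \<subseteq> cotangent SM p")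
    case True
    then obtain a b where a: "xs = [a, b]" "a \<in> cotangent SM p" "b \<in> cotangent SM p"
      by (auto simp: length_Suc_conv numeral_2_eq_2)
    obtain f where f: "f \<in> SS" "dS f p = a" by (rule S_cotangent_exact[OF a(2)]) (use True in auto)
    obtain g where g: "g \<in> SS" "dS g p = b" by (rule S_cotangent_exact[OF a(3)]) (use True in auto)
    have "eval_mv Q [dS f, dS g] p = eval_mv Q' [dS f, dS g] p" using e[OF f(1) g(1)] by simp
    then show ?thesis using a(1) f(2) g(2) by simp
  next
    case False
    then show ?thesis using z[OF Q(1) False] z[OF Q(2) False] by simp
  qed
qed

text \<open>The device of \<open>derivation_tensor\<close> used twice. For fixed f the section
  derivation B f has a tangent vector as contraction with w; evaluating b on it gives a derivation
  in f, hence another tangent vector, on which a is evaluated.\<close>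

lemma biderivation_tensor:
  assumes B1: "\<And>f. f \<in> SS ==> section_derivation (B f)"
    and B2: "\<And>g. g \<in> SS ==> section_derivation (\<lambda>f. B f g)"
    and B3: "\<And>f. f \<in> SS ==> B f f = 0"
  obtains R where "R \<in> MV 2" "\<And>f g. f \<in> SS ==> g \<in> SS ==> eval_mv R [dS f, dS g] = B f g"
proof -
  \<comment> \<open>The covector b fills the second argument of B and w the values; what remains is
    a tangent vector waiting for the first argument.\<close>
  define u :: "'a \<Rightarrow> 'a covec \<Rightarrow> 'a tvec \<Rightarrow> 'a tvec"
    where "u p b w = (\<lambda>f. if f \<in> SS then b (tensor_vec (B f) p w) else 0)" for p b w
  have tv: "tensor_vec (B (f + g)) p w = tensor_vec (B f) p w + tensor_vec (B g) p w"
      "tensor_vec (B (c *\<^sub>R f)) p w = c *\<^sub>R tensor_vec (B f) p w"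
      "tensor_vec (B (f * g)) p w = f p *\<^sub>R tensor_vec (B g) p w + g p *\<^sub>R tensor_vec (B f) p w"
    if f: "f \<in> SS" and g: "g \<in> SS" for f g p w c
    using section_derivationD(2)[OF B2 f] section_derivationD(3,4)[OF B2 f g] by (auto simp: tensor_vec_def fun_eq_iff)
  have u_tangent: "u p b w \<in> tangent SM p" if p: "p \<in> S" and b: "b \<in> cotangent SM p" for p b w
  proof (rule tangentI)
    fix f g assume fg: "f \<in> SS" "g \<in> SS"
    note tf = tensor_vec_tangent[OF B1[OF fg(1)] p, of w] and tg = tensor_vec_tangent[OF B1[OF fg(2)] p, of w]
    show "u p b w (f + g) = u p b w f + u p b w g"
      using fg S.smooth_intros(2)[OF fg] by (simp only: u_def if_True tv(1)[OF fg] cotangentD(1)[OF b tf tg])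
    show "u p b w (f * g) = f p * u p b w g + g p * u p b w f"
      using fg S.smooth_mult[OF fg]
      by (simp only: u_def if_True tv(3)[OF fg] cotangentD(1)[OF b subspace_scale[OF subspace_tangent tg] subspace_scale[OF subspace_tangent tf]]
        cotangentD(2)[OF b tf] cotangentD(2)[OF b tg])
  next
    fix c f assume f: "f \<in> SS"
    note tf = tensor_vec_tangent[OF B1[OF f] p, of w]
    show "u p b w (c *\<^sub>R f) = c * u p b w f"
      using f S.smooth_intros(5)[OF f] by (simp only: u_def if_True tv(2)[OF f f] cotangentD(2)[OF b tf])
  qed (simp add: u_def)
  have u_lin_w: "u p b (v + w) = u p b v + u p b w" "u p b (c *\<^sub>R v) = c *\<^sub>R u p b v"
    if p: "p \<in> S" and b: "b \<in> cotangent SM p" and v: "v \<in> tangent M p" and w: "w \<in> tangent M p" for p b v w c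
  proof -
    have "u p b (v + w) f = u p b v f + u p b w f \<and> u p b (c *\<^sub>R v) f = c * u p b v f" for f
    proof (cases "f \<in> SS")
      case True
      show ?thesis
        unfolding u_def tensor_vec_linear[OF B1[OF True] p v w]
        using True by (simp only: if_True cotangentD(1,2)[OF b] tensor_vec_tangent[OF B1[OF True] p])
    qed (simp add: u_def)
    then show "u p b (v + w) = u p b v + u p b w" "u p b (c *\<^sub>R v) = c *\<^sub>R u p b v" by (auto simp: fun_eq_iff)
  qed
  have u_lin_b: "u p (a + b) w = u p a w + u p b w" "u p (c *\<^sub>R a) w = c *\<^sub>R u p a w" for p a b w c
    by (auto simp: u_def fun_eq_iff)
  have u_zero: "u p b v = 0" if p: "p \<in> S" and b: "b \<in> cotangent SM p" and v: "v \<in> T p \<or> v \<notin> tangent M p" for p b v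
  proof
    fix f show "u p b v f = (0::'a tvec) f"
    proof (cases "f \<in> SS")
      case True
      have "tensor_vec (B f) p v = 0" using v tensor_vec_zero[OF B1[OF True] p] by blast
      then show ?thesis using cotangent_zero[OF b] by (simp add: u_def)
    qed (simp add: u_def)
  qed
  define R where "R p xs = (if p \<in> S \<and> length xs = 2 \<and> set xs \<subseteq> cotangent SM p
    then (\<lambda>w. (xs ! 0) (u p (xs ! 1) w)) else 0)" for p xs
  have R2: "R p [a, b] = (\<lambda>w. a (u p b w))" if "p \<in> S" "a \<in> cotangent SM p" "b \<in> cotangent SM p" for p a b
    using that by (simp add: R_def)
  have con: "(\<lambda>w. a (u p b w)) \<in> conormal D p"
    if p: "p \<in> S" and a: "a \<in> cotangent SM p" and b: "b \<in> cotangent SM p" for p a b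
    by (intro conormal_fibreI cotangentI)
      (simp_all add: u_lin_w[OF p b] u_zero[OF p b] cotangentD(1,2)[OF a] u_tangent[OF p b] cotangent_zero[OF a])
  have Rd: "R p [dS f p, dS g p] = B f g p" if p: "p \<in> S" and f: "f \<in> SS" and g: "g \<in> SS" for p f g
  proof -
    have d: "dS h p \<in> cotangent SM p" for h using S.differential_cotangent[of p h] p by simp
    have "dS f p (u p (dS g p) w) = B f g p w" for w
      using p f g u_tangent[OF p d, of g w] tensor_vec_tangent[OF B1[OF f] p, of w] by (simp add: u_def tensor_vec_def)
    then show ?thesis unfolding R2[OF p d d] by (rule ext)
  qed
  have "R \<in> MV 2"
  proof (rule mvI)
    fix p assume p: "p \<in> S"
    show "R p \<in> alt_multilinear (cotangent SM p) 2 (conormal D p)"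
    proof (rule alt_multilinear_2I)
      fix a b assume a: "a \<in> cotangent SM p" and b: "b \<in> cotangent SM p"
      show "R p [a, b] \<in> conormal D p" using R2[OF p a b] con[OF p a b] by simp
    next
      fix b assume b: "b \<in> cotangent SM p"
      show "linear_from (cotangent SM p) (\<lambda>a. R p [a, b])"
        unfolding linear_from_def
      proof (intro conjI ballI allI)
        fix a c assume a: "a \<in> cotangent SM p" and c: "c \<in> cotangent SM p"
        show "R p [a + c, b] = R p [a, b] + R p [c, b]"
          unfolding R2[OF p a b] R2[OF p c b] R2[OF p subspace_add[OF subspace_cotangent a c] b]
          by (simp add: fun_eq_iff)
      next
        fix r a assume a: "a \<in> cotangent SM p"
        show "R p [r *\<^sub>R a, b] = r *\<^sub>R R p [a, b]"
          unfolding R2[OF p a b] R2[OF p subspace_scale[OF subspace_cotangent a] b]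
          by (simp add: fun_eq_iff)
      qed
    next
      fix a assume a: "a \<in> cotangent SM p"
      show "linear_from (cotangent SM p) (\<lambda>b. R p [a, b])"
        unfolding linear_from_def
      proof (intro conjI ballI allI)
        fix b c assume b: "b \<in> cotangent SM p" and c: "c \<in> cotangent SM p"
        show "R p [a, b + c] = R p [a, b] + R p [a, c]"
          unfolding R2[OF p a b] R2[OF p a c] R2[OF p a subspace_add[OF subspace_cotangent b c]] u_lin_b
          by (simp add: fun_eq_iff cotangentD(1)[OF a u_tangent[OF p b] u_tangent[OF p c]])
      next
        fix r b assume b: "b \<in> cotangent SM p"
        show "R p [a, r *\<^sub>R b] = r *\<^sub>R R p [a, b]"
          unfolding R2[OF p a b] R2[OF p a subspace_scale[OF subspace_cotangent b]] u_lin_b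
          by (simp add: fun_eq_iff cotangentD(2)[OF a u_tangent[OF p b]])
      qed
      \<comment> \<open>Alternation of B is known for functions, so on the diagonal the covector is
        realised as a differential.\<close>
      obtain f where f: "f \<in> SS" "dS f p = a" by (rule S_cotangent_exact[OF a p])
      show "R p [a, a] = 0" using Rd[OF p f(1) f(1)] B3[OF f(1)] f(2) by simp
    qed (auto simp: R_def)
  next
    fix \<alpha>s assume "length \<alpha>s = 2" "set \<alpha>s \<subseteq> one_forms SM"
    then obtain \<alpha> \<beta> where \<alpha>: "\<alpha>s = [\<alpha>, \<beta>]" "\<alpha> \<in> one_forms SM" "\<beta> \<in> one_forms SM"
      by (auto simp: length_Suc_conv numeral_2_eq_2)
    have c: "\<alpha> q \<in> cotangent SM q" "\<beta> q \<in> cotangent SM q" if "q \<in> S" for q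
      using one_formsD(1)[OF \<alpha>(2)] one_formsD(1)[OF \<alpha>(3)] that by simp_all
    show "eval_mv R \<alpha>s \<in> CS" unfolding \<alpha>(1)
    proof (rule conormal_sectionsI, rule restricted_formsI)
      fix q assume q: "q \<in> S"
      show "eval_mv R [\<alpha>, \<beta>] q \<in> cotangent M q" using con[OF q c[OF q]] R2[OF q c[OF q]] by (simp add: conormal_def)
      show "eval_mv R [\<alpha>, \<beta>] q v = 0" if "v \<in> T q" for v using con[OF q c[OF q]] R2[OF q c[OF q]] that by (simp add: conormal_def)
    next
      fix Y assume Y: "Y \<in> VF"
      define U where "U = (\<lambda>q. if q \<in> S then u q (\<beta> q) (Y q) else 0)"
      have "U \<in> vector_fields SM"
      proof (rule vector_fieldsI)
        fix f assume f: "f \<in> SS"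
        have "(\<lambda>q. U q f) = (\<lambda>q. \<beta> q ((\<lambda>p. if p \<in> S then tensor_vec (B f) p (Y p) else 0) q))"
          using f one_formsD(2)[OF \<alpha>(3)] by (auto simp: U_def u_def fun_eq_iff)
        then show "(\<lambda>q. U q f) \<in> SS"
          using one_formsD(3)[OF \<alpha>(3) tensor_vec_field[OF B1[OF f] Y]] by simp
      qed (use u_tangent c in \<open>auto simp: U_def\<close>)
      moreover have "(\<lambda>q. eval_mv R [\<alpha>, \<beta>] q (Y q)) = (\<lambda>q. \<alpha> q (U q))"
        using R2 c one_formsD(2)[OF \<alpha>(2)] by (auto simp: U_def fun_eq_iff R_def)
      ultimately show "(\<lambda>q. eval_mv R [\<alpha>, \<beta>] q (Y q)) \<in> SS" using one_formsD(3)[OF \<alpha>(2)] by simp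
    qed (simp add: R_def)
  qed (auto simp: R_def fun_eq_iff)
  moreover have "eval_mv R [dS f, dS g] = B f g" if f: "f \<in> SS" and g: "g \<in> SS" for f g
  proof
    fix p
    note XR = conormal_sectionsD(1)[OF section_derivationD(1)[OF B1[OF f] g]]
    show "eval_mv R [dS f, dS g] p = B f g p"
      using Rd[OF _ f g, of p] restricted_formsD(2)[OF XR, of p] by (cases "p \<in> S") (auto simp: R_def fun_eq_iff)
  qed
  ultimately show thesis by (rule that)
qed

section \<open>The affine bracket in components\<close>

lemma Aff_pair: "f \<in> SS ==> \<eta> \<in> CS ==> (f, \<eta>) \<in> Aff"
  by (simp add: Aff_iff)

lemmas S0 = S.smooth_intros(1)
lemmas C0 = subspace_0[OF subspace_CS]

lemma hdf_0: "hdf 0 = 0"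
proof
  fix p show "hdf 0 p = (0::'a form) p"
    using hd_algebra(2)[OF S0 S0, of p 0] hd_outside[of p 0] by (cases "p \<in> S") auto
qed

lemma restricted_bracket_0:
  assumes "c \<in> locally_exact" shows "rb 0 c = 0" "rb c 0 = 0"
proof -
  note z = subspace_0[OF subspace_locally_exact]
  show 1: "rb 0 c = 0" using restricted_bracket_add_left[OF z z assms] by simp
  show "rb c 0 = 0" using restricted_bracket_skew[OF assms z] 1 by simp
qed

lemma bracket_S_0: "f \<in> SS ==> bracket_S D f 0 = 0" "f \<in> SS ==> bracket_S D 0 f = 0"
proof -
  assume f: "f \<in> SS"
  show 1: "bracket_S D f 0 = 0" using S.br_right(1)[OF S0 S0, of f] by simp
  show "bracket_S D 0 f = 0" using S.br_skew[of 0 f] 1 by simp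
qed

lemma zero_components:
  "f \<in> SS ==> De f 0 = 0" "\<xi> \<in> CS ==> De 0 \<xi> = 0" "\<xi> \<in> CS ==> br1 0 \<xi> = 0" "\<xi> \<in> CS ==> br1 \<xi> 0 = 0"
  "f \<in> SS ==> K f 0 = 0" "f \<in> SS ==> K 0 f = 0"
  by (simp_all add: cder_def bracket_1_def curv_eq S0 hdf_0 restricted_bracket_0 hd_locally_exact conormal_locally_exact bracket_S_0)

lemma ab_ff: "f \<in> SS ==> g \<in> SS ==> ab (f, 0) (g, 0) = (bracket_S D f g, K f g)"
  and ab_fe: "f \<in> SS ==> \<xi> \<in> CS ==> ab (f, 0) (0, \<xi>) = (0, De f \<xi>)"
  and ab_ef: "f \<in> SS ==> \<xi> \<in> CS ==> ab (0, \<xi>) (f, 0) = (0, - De f \<xi>)"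
  and ab_ee: "\<eta> \<in> CS ==> \<xi> \<in> CS ==> ab (0, \<eta>) (0, \<xi>) = (0, br1 \<eta> \<xi>)"
  by (simp_all add: aff_bracket_def zero_components bracket_S_0 S0 C0)

lemma smult_0 [simp]: "smult_section f 0 = 0" "smult_section 0 \<eta> = 0"
  by (auto simp: smult_section_def fun_eq_iff)

lemma aff_mult_simps:
  "aff_mult (f, 0) (g, 0) = (f * g, 0)" "aff_mult (f, 0) (0, \<xi>) = (0, smult_section f \<xi>)"
  "aff_mult (f, \<eta>) (0, \<xi>) = (0, smult_section f \<xi>)" "aff_mult (f, 0) (g, \<eta>) = (f * g, smult_section f \<eta>)"
  "aff_mult (f, \<eta>) (g, 0) = (f * g, smult_section g \<eta>)"
  by (auto simp: aff_mult_def fun_eq_iff)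

text \<open>Each identity is a component of an identity of the Poisson algebra evaluated on elements
  f \<oplus> 0 and 0 \<oplus> \<xi>, where the other terms vanish.\<close>

lemma De_linear:
  assumes f: "f \<in> SS" and g: "g \<in> SS" and \<eta>: "\<eta> \<in> CS" and \<xi>: "\<xi> \<in> CS"
  shows "De f (\<eta> + \<xi>) = De f \<eta> + De f \<xi>" "De f (c *\<^sub>R \<xi>) = c *\<^sub>R De f \<xi>"
    "De (f + g) \<xi> = De f \<xi> + De g \<xi>" "De (c *\<^sub>R f) \<xi> = c *\<^sub>R De f \<xi>"
    "De f (smult_section g \<xi>) = smult_section g (De f \<xi>) + smult_section (bracket_S D f g) \<xi>"
    "De (f * g) \<xi> = smult_section f (De g \<xi>) + smult_section g (De f \<xi>)"
proof -
  note F = Aff_pair[OF f C0] and G = Aff_pair[OF g C0] and E = Aff_pair[OF S0 \<eta>] and X = Aff_pair[OF S0 \<xi>]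
  show "De f (\<eta> + \<xi>) = De f \<eta> + De f \<xi>"
    using ab_add_right[OF F E X] ab_fe[OF f \<eta>] ab_fe[OF f \<xi>] ab_fe[OF f subspace_add[OF subspace_CS \<eta> \<xi>]] by simp
  show "De f (c *\<^sub>R \<xi>) = c *\<^sub>R De f \<xi>"
    using ab_scaleR_right[OF F X, of c] ab_fe[OF f \<xi>] ab_fe[OF f subspace_scale[OF subspace_CS \<xi>, of c]] by simp
  show "De (f + g) \<xi> = De f \<xi> + De g \<xi>"
    using ab_add_left[OF F G X] ab_fe[OF f \<xi>] ab_fe[OF g \<xi>] ab_fe[OF S.smooth_intros(2)[OF f g] \<xi>] by simp
  show "De (c *\<^sub>R f) \<xi> = c *\<^sub>R De f \<xi>"
    using ab_scaleR_left[OF F X, of c] ab_fe[OF f \<xi>] ab_fe[OF S.smooth_intros(5)[OF f] \<xi>, of c] by simp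
  show "De f (smult_section g \<xi>) = smult_section g (De f \<xi>) + smult_section (bracket_S D f g) \<xi>"
    using ab_mult_right[OF F G X] ab_fe[OF f conormal_smult[OF g \<xi>]] ab_ff[OF f g] ab_fe[OF f \<xi>]
    by (simp add: aff_mult_simps add.commute)
  have "- De (f * g) \<xi> = smult_section g (- De f \<xi>) + smult_section f (- De g \<xi>)"
    using ab_mult_right[OF X F G] ab_ef[OF S.smooth_mult[OF f g] \<xi>] ab_ef[OF f \<xi>] ab_ef[OF g \<xi>]
    by (simp add: aff_mult_simps)
  then have "De (f * g) \<xi> = - (smult_section g (- De f \<xi>) + smult_section f (- De g \<xi>))" by (metis minus_minus)
  then show "De (f * g) \<xi> = smult_section f (De g \<xi>) + smult_section g (De f \<xi>)" by (auto simp: fun_eq_iff)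
qed

text \<open>Linearity over functions comes from the square-zero product: the term with the
  derivative of f is a product of two conormal sections.\<close>

lemma br1_linear:
  assumes f: "f \<in> SS" and \<eta>: "\<eta> \<in> CS" and \<xi>: "\<xi> \<in> CS" and \<zeta>: "\<zeta> \<in> CS"
  shows "br1 \<zeta> (\<eta> + \<xi>) = br1 \<zeta> \<eta> + br1 \<zeta> \<xi>" "br1 (\<eta> + \<xi>) \<zeta> = br1 \<eta> \<zeta> + br1 \<xi> \<zeta>"
    "br1 \<eta> (c *\<^sub>R \<xi>) = c *\<^sub>R br1 \<eta> \<xi>" "br1 (c *\<^sub>R \<eta>) \<xi> = c *\<^sub>R br1 \<eta> \<xi>"
    "br1 \<eta> (smult_section f \<xi>) = smult_section f (br1 \<eta> \<xi>)" "br1 \<eta> \<xi> = - br1 \<xi> \<eta>"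
proof -
  note F = Aff_pair[OF f C0] and E = Aff_pair[OF S0 \<eta>] and X = Aff_pair[OF S0 \<xi>] and Z = Aff_pair[OF S0 \<zeta>]
  note a = subspace_add[OF subspace_CS \<eta> \<xi>]
  show "br1 \<zeta> (\<eta> + \<xi>) = br1 \<zeta> \<eta> + br1 \<zeta> \<xi>"
    using ab_add_right[OF Z E X] ab_ee[OF \<zeta> \<eta>] ab_ee[OF \<zeta> \<xi>] ab_ee[OF \<zeta> a] by simp
  show "br1 (\<eta> + \<xi>) \<zeta> = br1 \<eta> \<zeta> + br1 \<xi> \<zeta>"
    using ab_add_left[OF E X Z] ab_ee[OF \<eta> \<zeta>] ab_ee[OF \<xi> \<zeta>] ab_ee[OF a \<zeta>] by simp
  show "br1 \<eta> (c *\<^sub>R \<xi>) = c *\<^sub>R br1 \<eta> \<xi>"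
    using ab_scaleR_right[OF E X, of c] ab_ee[OF \<eta> \<xi>] ab_ee[OF \<eta> subspace_scale[OF subspace_CS \<xi>, of c]] by simp
  show "br1 (c *\<^sub>R \<eta>) \<xi> = c *\<^sub>R br1 \<eta> \<xi>"
    using ab_scaleR_left[OF E X, of c] ab_ee[OF \<eta> \<xi>] ab_ee[OF subspace_scale[OF subspace_CS \<eta>, of c] \<xi>] by simp
  show "br1 \<eta> (smult_section f \<xi>) = smult_section f (br1 \<eta> \<xi>)"
    using ab_mult_right[OF E F X] ab_ee[OF \<eta> conormal_smult[OF f \<xi>]] ab_ef[OF f \<eta>] ab_ee[OF \<eta> \<xi>]
    by (simp add: aff_mult_simps)
  show "br1 \<eta> \<xi> = - br1 \<xi> \<eta>" using ab_skew[OF E X] ab_ee[OF \<eta> \<xi>] ab_ee[OF \<xi> \<eta>] by simp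
qed

end

section \<open>Poisson derivations\<close>

context exponential_setting
begin

abbreviation "qv Q f \<equiv> eval_mv Q [d_S D f]"
abbreviation "lf u f \<equiv> lie_fn u f"

section \<open>The contravariant differential in degrees 0 and 1\<close>

lemma dD_exact_0: "dD_exact D 0 Q f = De (f 0) (eval_mv Q [])"
proof -
  have 1: "{(i, j). i < j \<and> j \<le> (0::nat)} = {}" by auto
  show ?thesis unfolding dD_exact_def 1 by simp
qed

lemma dD_exact_1: "dD_exact D 1 Q f = De (f 0) (qv Q (f 1)) - De (f 1) (qv Q (f 0)) - qv Q (bracket_S D (f 0) (f 1))"
proof -
  have 1: "{(i, j). i < j \<and> j \<le> (1::nat)} = {(0, 1)}" "{..1::nat} = {0, 1}" "[0..<Suc 1] = [0, 1]"
    by (auto simp: upt_rec)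
  show ?thesis unfolding dD_exact_def 1 by simp
qed

lemma mv_0_value: assumes "Q \<in> MV 0" shows "eval_mv Q [] \<in> CS"
  by (rule mvD(3)[OF assms]) auto

text \<open>The \<open>THE\<close> in \<open>dD\<close> is attained because the contravariant
  derivative of a fixed section is a derivation in f, and unique because exact forms exhaust the
  covectors at each point.\<close>

lemma dD_0:
  assumes Q: "Q \<in> MV 0"
  shows "dD D 0 Q \<in> MV 1" "f \<in> SS ==> qv (dD D 0 Q) f = De f (eval_mv Q [])"
proof -
  note z = mv_0_value[OF Q]
  have "section_derivation (\<lambda>f. De f (eval_mv Q []))"
    unfolding section_derivation_def
    by (intro conjI ballI allI cder_conormal z De_linear(4)[OF _ _ z z] De_linear(3,6)[OF _ _ z z]) assumption+
  then obtain R where R: "R \<in> MV 1" "\<And>f. f \<in> SS ==> qv R f = De f (eval_mv Q [])"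
    by (rule derivation_tensor) (rule that)
  have "dD D 0 Q = R"
    unfolding dD_def
  proof (rule the_equality)
    show "R \<in> MV (Suc 0) \<and> (\<forall>f. (\<forall>i\<le>0. f i \<in> SS) \<longrightarrow>
        eval_mv R (map (\<lambda>m. dS (f m)) [0..<Suc 0]) = dD_exact D 0 Q f)"
      using R by (simp add: dD_exact_0)
  next
    fix R' assume R': "R' \<in> MV (Suc 0) \<and> (\<forall>f. (\<forall>i\<le>0. f i \<in> SS) \<longrightarrow>
        eval_mv R' (map (\<lambda>m. dS (f m)) [0..<Suc 0]) = dD_exact D 0 Q f)"
    show "R' = R"
    proof (rule mv_1_eqI)
      show "R' \<in> MV 1" using R' by simp
      fix f assume f: "f \<in> SS"
      show "qv R' f = qv R f"
        using conjunct2[OF R', rule_format, of "\<lambda>_. f"] f R(2)[OF f] by (simp add: dD_exact_0)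
    qed (rule R(1))
  qed
  then show "dD D 0 Q \<in> MV 1" "f \<in> SS ==> qv (dD D 0 Q) f = De f (eval_mv Q [])"
    using R by simp_all
qed

lemma section_derivation_uminus:
  assumes "section_derivation X" shows "section_derivation (\<lambda>f. - X f)"
  unfolding section_derivation_def
proof (intro conjI ballI allI)
  fix f assume f: "f \<in> SS"
  show "- X f \<in> CS" by (rule subspace_neg[OF subspace_CS section_derivationD(1)[OF assms f]])
  show "- X (c *\<^sub>R f) = c *\<^sub>R (- X f)" for c using section_derivationD(2)[OF assms f] by simp
  fix g assume g: "g \<in> SS"
  show "- X (f + g) = - X f + - X g" using section_derivationD(3)[OF assms f g] by simp
  show "- X (f * g) = smult_section f (- X g) + smult_section g (- X f)"
    using section_derivationD(4)[OF assms f g] by (auto simp: fun_eq_iff)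
qed

lemma smult_linear:
  "smult_section f (\<eta> + \<xi>) = smult_section f \<eta> + smult_section f \<xi>"
  "smult_section f (\<eta> - \<xi>) = smult_section f \<eta> - smult_section f \<xi>"
  "smult_section f (- \<eta>) = - smult_section f \<eta>"
  "smult_section (f + g) \<eta> = smult_section f \<eta> + smult_section g \<eta>"
  "smult_section (f - g) \<eta> = smult_section f \<eta> - smult_section g \<eta>"
  "smult_section (c *\<^sub>R f) \<eta> = c *\<^sub>R smult_section f \<eta>"
  "smult_section f (c *\<^sub>R \<eta>) = c *\<^sub>R smult_section f \<eta>"
  by (auto simp: smult_section_def fun_eq_iff algebra_simps)

text \<open>The formula is a skew biderivation: the Leibniz defects of the contravariant derivative
  along df and of Q({f, gh}) are the same and cancel. \<open>biderivation_tensor\<close> then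
  provides the tensor.\<close>

lemma dD_1:
  assumes Q: "Q \<in> MV 1"
  shows "dD D 1 Q \<in> MV 2"
    "f \<in> SS ==> g \<in> SS ==>
      eval_mv (dD D 1 Q) [dS f, dS g] = De f (qv Q g) - De g (qv Q f) - qv Q (bracket_S D f g)"
proof -
  define B where "B f g = De f (qv Q g) - De g (qv Q f) - qv Q (bracket_S D f g)" for f g
  note q = section_derivationD[OF mv_1_derivation[OF Q]]
  have skew: "B f g = - B g f" if "f \<in> SS" "g \<in> SS" for f g
  proof -
    have "bracket_S D g f = (-1) *\<^sub>R bracket_S D f g" using S.br_skew[of g f] by simp
    then have "qv Q (bracket_S D g f) = - qv Q (bracket_S D f g)"
      using q(2)[OF S.br_smooth[OF that], of "-1"] by simp
    then show ?thesis by (simp add: B_def)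
  qed
  have B1: "section_derivation (B f)" if f: "f \<in> SS" for f
    unfolding section_derivation_def
  proof (intro conjI ballI allI)
    fix g assume g: "g \<in> SS"
    note qf = q(1)[OF f] and qg = q(1)[OF g]
    show "B f g \<in> CS" unfolding B_def
      by (intro subspace_diff[OF subspace_CS] cder_conormal f g qf qg q(1) S.br_smooth)
    show "B f (c *\<^sub>R g) = c *\<^sub>R B f g" for c
      unfolding B_def q(2)[OF g] S.br_right(2)[OF g g] q(2)[OF S.br_smooth[OF f g]]
        De_linear(2)[OF f g qg qg] De_linear(4)[OF g f qf qf] by (simp add: scaleR_diff_right)
    fix h assume h: "h \<in> SS"
    note qh = q(1)[OF h]
    show "B f (g + h) = B f g + B f h"
      unfolding B_def q(3)[OF g h] S.br_right(1)[OF g h] q(3)[OF S.br_smooth[OF f g] S.br_smooth[OF f h]]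
        De_linear(1)[OF f g qg qh] De_linear(3)[OF g h qf qf] by simp
    have "B f (g * h) = De f (smult_section g (qv Q h)) + De f (smult_section h (qv Q g))
        - (smult_section g (De h (qv Q f)) + smult_section h (De g (qv Q f)))
        - (qv Q (g * bracket_S D f h) + qv Q (h * bracket_S D f g))"
      unfolding B_def q(4)[OF g h] S.br_right(3)[OF g h]
        q(3)[OF S.smooth_mult[OF g S.br_smooth[OF f h]] S.smooth_mult[OF h S.br_smooth[OF f g]]]
        De_linear(1)[OF f g conormal_smult[OF g qh] conormal_smult[OF h qg]] De_linear(6)[OF g h qf qf] ..
    also have "\<dots> = smult_section g (B f h) + smult_section h (B f g)"
      unfolding De_linear(5)[OF f g qh qh] De_linear(5)[OF f h qg qg] q(4)[OF g S.br_smooth[OF f h]]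
        q(4)[OF h S.br_smooth[OF f g]] B_def smult_linear by simp
    finally show "B f (g * h) = smult_section g (B f h) + smult_section h (B f g)" .
  qed
  \<comment> \<open>The first argument is handled by the second and skew-symmetry.\<close>
  have B2: "section_derivation (\<lambda>f. B f g)" if g: "g \<in> SS" for g
  proof -
    note m = section_derivationD[OF section_derivation_uminus[OF B1[OF g]]]
    show ?thesis
      unfolding section_derivation_def
    proof (intro conjI ballI allI)
      fix f assume f: "f \<in> SS"
      show "B f g \<in> CS" using m(1)[OF f] skew[OF f g] by simp
      show "B (c *\<^sub>R f) g = c *\<^sub>R B f g" for c
        using m(2)[OF f, of c] skew[OF f g] skew[OF S.smooth_intros(5)[OF f] g, of c] by simp
      fix h assume h: "h \<in> SS"
      show "B (f + h) g = B f g + B h g"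
        using m(3)[OF f h] skew[OF f g] skew[OF h g] skew[OF S.smooth_intros(2)[OF f h] g] by simp
      show "B (f * h) g = smult_section f (B h g) + smult_section h (B f g)"
        using m(4)[OF f h] skew[OF f g] skew[OF h g] skew[OF S.smooth_mult[OF f h] g] by simp
    qed
  qed
  have B3: "B f f = 0" if f: "f \<in> SS" for f
  proof
    fix p
    have "B f f = - B f f" by (rule skew[OF f f])
    then have "B f f p w = - B f f p w" for w by (metis fun_Compl_def)
    then show "B f f p = (0::'a form) p" by (auto simp: fun_eq_iff)
  qed
  obtain R where R: "R \<in> MV 2"
    "\<And>f g. f \<in> SS ==> g \<in> SS ==> eval_mv R [dS f, dS g] = B f g"
    by (rule biderivation_tensor[of B, OF B1 B2 B3]) (assumption, assumption, assumption, rule that)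
  have two: "[0..<Suc 1] = [0, 1]" "Suc 1 = 2" by (simp_all add: upt_rec)
  have "dD D 1 Q = R"
    unfolding dD_def
  proof (rule the_equality)
    show "R \<in> MV (Suc 1) \<and> (\<forall>f. (\<forall>i\<le>1. f i \<in> SS) \<longrightarrow>
        eval_mv R (map (\<lambda>m. dS (f m)) [0..<Suc 1]) = dD_exact D 1 Q f)"
    proof (intro conjI allI impI)
      show "R \<in> MV (Suc 1)" unfolding two(2) by (rule R(1))
      fix f :: "nat \<Rightarrow> 'a fn" assume "\<forall>i\<le>1. f i \<in> SS"
      then have "f 0 \<in> SS" "f 1 \<in> SS" by auto
      then show "eval_mv R (map (\<lambda>m. dS (f m)) [0..<Suc 1]) = dD_exact D 1 Q f"
        unfolding two(1) dD_exact_1 using R(2)[of "f 0" "f 1"] by (simp add: B_def)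
    qed
  next
    fix R' assume R': "R' \<in> MV (Suc 1) \<and> (\<forall>f. (\<forall>i\<le>1. f i \<in> SS) \<longrightarrow>
        eval_mv R' (map (\<lambda>m. dS (f m)) [0..<Suc 1]) = dD_exact D 1 Q f)"
    show "R' = R"
    proof (rule mv_2_eqI)
      show "R' \<in> MV 2" using conjunct1[OF R'] unfolding two(2) .
      fix f g assume fg: "f \<in> SS" "g \<in> SS"
      let ?h = "\<lambda>i::nat. if i = 0 then f else g"
      have "eval_mv R' (map (\<lambda>m. dS (?h m)) [0..<Suc 1]) = dD_exact D 1 Q ?h"
        using conjunct2[OF R', rule_format, of ?h] fg by simp
      then show "eval_mv R' [dS f, dS g] = eval_mv R [dS f, dS g]"
        unfolding two(1) dD_exact_1 using R(2)[OF fg] by (simp add: B_def)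
    qed (rule R(1))
  qed
  then show "dD D 1 Q \<in> MV 2"
    "f \<in> SS ==> g \<in> SS ==>
      eval_mv (dD D 1 Q) [dS f, dS g] = De f (qv Q g) - De g (qv Q f) - qv Q (bracket_S D f g)"
    using R by (simp_all add: B_def)
qed

section \<open>Symbols of derivative endomorphisms\<close>

lemma section_zero:
  assumes u: "u \<in> SS" and z: "\<And>\<eta>. \<eta> \<in> CS ==> smult_section u \<eta> = 0" shows "u = 0"
proof
  fix p show "u p = (0::'a fn) p"
  proof (cases "p \<in> S")
    case True
    obtain \<eta> where \<eta>: "\<eta> \<in> CS" "\<eta> p \<noteq> 0" by (rule conormal_nonzero[OF rank True])
    have "smult_section u \<eta> p = 0" using z[OF \<eta>(1)] by simp
    then show ?thesis using \<eta>(2) by (auto simp: fun_eq_iff)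
  next
    case False
    then show ?thesis using S.smooth_functions_outside[OF u] by simp
  qed
qed

lemma symbolD:
  assumes "is_symbol D \<delta> u"
  shows "u \<in> vector_fields SM" "f \<in> SS ==> lf u f \<in> SS"
    "f \<in> SS ==> \<eta> \<in> CS ==> \<delta> (smult_section f \<eta>) = smult_section f (\<delta> \<eta>) + smult_section (lf u f) \<eta>"
  using assms by (auto simp: is_symbol_def vector_fields_def)

text \<open>Two symbols differ, on each f, by a function that annihilates every conormal section.
  Positive codimension, through \<open>section_zero\<close>, makes that function 0.\<close>

lemma symbol_unique:
  assumes u: "is_symbol D \<delta> u" and u': "is_symbol D \<delta> u'" shows "u = u'"
proof (intro ext)
  fix p f show "u p f = u' p f"
  proof (cases "f \<in> SS")
    case True
    have "lf u f - lf u' f = 0"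
    proof (rule section_zero)
      show "lf u f - lf u' f \<in> SS"
        by (rule S.smooth_intros(3)[OF symbolD(2)[OF u True] symbolD(2)[OF u' True]])
      fix \<eta> assume \<eta>: "\<eta> \<in> CS"
      show "smult_section (lf u f - lf u' f) \<eta> = 0"
        using symbolD(3)[OF u True \<eta>] symbolD(3)[OF u' True \<eta>] by (simp add: smult_linear)
    qed
    then have "(lf u f - lf u' f) p = 0" by simp
    then show ?thesis by (simp add: lie_fn_def)
  next
    case False
    have z: "v p f = 0" if v: "v \<in> vector_fields SM" for v
      using tangentD(4)[OF vector_fieldsD(1)[OF v] False] vector_fieldsD(2)[OF v] by (cases "p \<in> S") auto
    show ?thesis unfolding z[OF symbolD(1)[OF u]] z[OF symbolD(1)[OF u']] ..
  qed
qed

lemma symbol_eq: "is_symbol D \<delta> u ==> symbol D \<delta> = u"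
  unfolding symbol_def by (rule the_equality) (auto intro: symbol_unique)

lemma derivative_endosD:
  assumes "\<delta> \<in> derivative_endos D"
  shows "is_symbol D \<delta> (symbol D \<delta>)" "\<eta> \<in> CS ==> \<delta> \<eta> \<in> CS" "\<eta> \<notin> CS ==> \<delta> \<eta> = 0"
    "\<eta> \<in> CS ==> \<xi> \<in> CS ==> \<delta> (\<eta> + \<xi>) = \<delta> \<eta> + \<delta> \<xi>" "\<eta> \<in> CS ==> \<delta> (c *\<^sub>R \<eta>) = c *\<^sub>R \<delta> \<eta>" "\<delta> 0 = 0"
proof -
  obtain u where "is_symbol D \<delta> u" using assms by (auto simp: derivative_endos_def)
  then show "is_symbol D \<delta> (symbol D \<delta>)" using symbol_eq by simp
  have l: "\<delta> \<in> linear_maps CS CS" using assms by (simp add: derivative_endos_def)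
  then show "\<eta> \<in> CS ==> \<delta> \<eta> \<in> CS" "\<eta> \<notin> CS ==> \<delta> \<eta> = 0"
    "\<eta> \<in> CS ==> \<xi> \<in> CS ==> \<delta> (\<eta> + \<xi>) = \<delta> \<eta> + \<delta> \<xi>" "\<eta> \<in> CS ==> \<delta> (c *\<^sub>R \<eta>) = c *\<^sub>R \<delta> \<eta>"
    by (auto simp: linear_maps_def linear_from_def)
  have "\<delta> (0 *\<^sub>R 0) = 0 *\<^sub>R \<delta> 0" using l C0 unfolding linear_maps_def linear_from_def by blast
  then show "\<delta> 0 = 0" by simp
qed

section \<open>Decomposition of Poisson derivations\<close>

definition pairX :: "('a, 'a covec) mvfield \<Rightarrow> ('a form \<Rightarrow> 'a form) \<Rightarrow> 'a aff \<Rightarrow> 'a aff"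
  where "pairX Q \<delta> = X_Q D Q + X_delta D \<delta>"

lemma pairX_apply:
  "x \<in> Aff ==> pairX Q \<delta> x = (lf (symbol D \<delta>) (fst x), qv Q (fst x) + \<delta> (snd x))"
  "x \<notin> Aff ==> pairX Q \<delta> x = 0"
  by (simp_all add: pairX_def X_Q_def X_delta_def zero_prod_def)

definition mp_cond :: "('a form \<Rightarrow> 'a form) \<Rightarrow> ('a, 'a covec) mvfield \<Rightarrow> bool"
  where "mp_cond \<delta> Q \<longleftrightarrow> (\<forall>\<eta>\<in>CS. \<forall>\<xi>\<in>CS. \<delta> (br1 \<eta> \<xi>) = br1 (\<delta> \<eta>) \<xi> + br1 \<eta> (\<delta> \<xi>)) \<and>
    (\<forall>f\<in>SS. \<forall>\<eta>\<in>CS. \<delta> (De f \<eta>) - De f (\<delta> \<eta>) - De (lf (symbol D \<delta>) f) \<eta> = br1 (qv Q f) \<eta>) \<and>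
    (\<forall>f\<in>SS. \<forall>g\<in>SS. eval_mv (dD D 1 Q) [dS f, dS g] =
      \<delta> (K f g) - K (lf (symbol D \<delta>) f) g - K f (lf (symbol D \<delta>) g))"

lemma MP_iff: "\<delta> \<in> MP D \<longleftrightarrow> \<delta> \<in> derivative_endos D \<and> (\<exists>Q\<in>MV 1. mp_cond \<delta> Q)"
  unfolding MP_def mp_cond_def Let_def by blast

lemma poiss_PD:
  assumes "X \<in> poiss_P D"
  shows "x \<in> Aff ==> X x \<in> Aff" "x \<notin> Aff ==> X x = 0" "x \<in> Aff ==> y \<in> Aff ==> X (x + y) = X x + X y"
    "x \<in> Aff ==> X (c *\<^sub>R x) = c *\<^sub>R X x"
    "x \<in> Aff ==> y \<in> Aff ==> X (aff_mult x y) = aff_mult (X x) y + aff_mult x (X y)"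
    "x \<in> Aff ==> y \<in> Aff ==> X (ab x y) = ab (X x) y + ab x (X y)"
  using assms by (auto simp: poiss_P_def linear_maps_def linear_from_def simp del: split_paired_All)

lemma poiss_PI:
  assumes "\<And>x. x \<in> Aff ==> X x \<in> Aff" "\<And>x. x \<notin> Aff ==> X x = 0" "\<And>x y. x \<in> Aff ==> y \<in> Aff ==> X (x + y) = X x + X y"
    "\<And>x c. x \<in> Aff ==> X (c *\<^sub>R x) = c *\<^sub>R X x"
    "\<And>x y. x \<in> Aff ==> y \<in> Aff ==> X (aff_mult x y) = aff_mult (X x) y + aff_mult x (X y)"
    "\<And>x y. x \<in> Aff ==> y \<in> Aff ==> X (ab x y) = ab (X x) y + ab x (X y)"
  shows "X \<in> poiss_P D"
  using assms by (auto simp: poiss_P_def linear_maps_def linear_from_def)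

lemma vector_field_lf:
  assumes u: "u \<in> vector_fields SM" and f: "f \<in> SS" and g: "g \<in> SS"
  shows "lf u (f + g) = lf u f + lf u g" "lf u (c *\<^sub>R f) = c *\<^sub>R lf u f" "lf u (f * g) = f * lf u g + g * lf u f"
proof -
  have "u p (f + g) = u p f + u p g \<and> u p (c *\<^sub>R f) = c * u p f \<and> u p (f * g) = f p * u p g + g p * u p f" for p
    using tangentD(1,3)[OF vector_fieldsD(1)[OF u] f g, of p] tangentD(2)[OF vector_fieldsD(1)[OF u] f, of p c]
      vector_fieldsD(2)[OF u, of p] by (cases "p \<in> S") auto
  then show "lf u (f + g) = lf u f + lf u g" "lf u (c *\<^sub>R f) = c *\<^sub>R lf u f" "lf u (f * g) = f * lf u g + g * lf u f"
    by (auto simp: lie_fn_def fun_eq_iff)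
qed

text \<open>Compare the symbols of both sides of the second condition.\<close>

lemma mp_cond_symbol_poisson:
  assumes \<delta>: "\<delta> \<in> derivative_endos D" and Q: "Q \<in> MV 1" and m: "mp_cond \<delta> Q"
    and f: "f \<in> SS" and g: "g \<in> SS"
  defines "u \<equiv> symbol D \<delta>"
  shows "lf u (bracket_S D f g) = bracket_S D (lf u f) g + bracket_S D f (lf u g)"
proof -
  note sy = symbolD[OF derivative_endosD(1)[OF \<delta>], folded u_def] and d = derivative_endosD[OF \<delta>]
  have uf: "lf u f \<in> SS" and ug: "lf u g \<in> SS" using sy(2) f g by auto
  note b = S.br_smooth[OF f g] S.br_smooth[OF uf g] S.br_smooth[OF f ug]
  note ub = sy(2)[OF b(1)]
  let ?e = "lf u (bracket_S D f g) - (bracket_S D (lf u f) g + bracket_S D f (lf u g))"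
  have "?e = 0"
  proof (rule section_zero)
    show "?e \<in> SS"
      by (rule S.smooth_intros(3)[OF ub S.smooth_intros(2)[OF b(2,3)]])
    fix \<eta> assume \<eta>: "\<eta> \<in> CS"
    note gn = conormal_smult[OF g \<eta>] and dn = d(2)[OF \<eta>] and Dn = cder_conormal[OF f \<eta>] and qf = section_derivationD(1)[OF mv_1_derivation[OF Q] f]
    \<comment> \<open>Apply the second clause of \<open>mp_cond\<close> to g \<eta> and subtract g
      times the clause for \<eta>: all terms in which \<delta> or a contravariant derivative acts on
      \<eta> cancel, and a function times \<eta> is left.\<close>
    have "\<delta> (De f (smult_section g \<eta>)) - De f (\<delta> (smult_section g \<eta>)) - De (lf u f) (smult_section g \<eta>)
        = br1 (qv Q f) (smult_section g \<eta>)"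
      using m f gn unfolding mp_cond_def u_def by blast
    moreover have "br1 (qv Q f) (smult_section g \<eta>) = smult_section g (br1 (qv Q f) \<eta>)" by (rule br1_linear(5)[OF g qf \<eta> \<eta>])
    moreover have "\<delta> (De f \<eta>) - De f (\<delta> \<eta>) - De (lf u f) \<eta> = br1 (qv Q f) \<eta>"
      using m f \<eta> unfolding mp_cond_def u_def by blast
    moreover have "\<delta> (De f (smult_section g \<eta>)) = (smult_section g (\<delta> (De f \<eta>)) + smult_section (lf u g) (De f \<eta>))
        + (smult_section (bracket_S D f g) (\<delta> \<eta>) + smult_section (lf u (bracket_S D f g)) \<eta>)"
      unfolding De_linear(5)[OF f g \<eta> \<eta>] d(4)[OF conormal_smult[OF g Dn] conormal_smult[OF b(1) \<eta>]]
        sy(3)[OF g Dn] sy(3)[OF b(1) \<eta>] ..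
    moreover have "De f (\<delta> (smult_section g \<eta>)) = (smult_section g (De f (\<delta> \<eta>)) + smult_section (bracket_S D f g) (\<delta> \<eta>))
        + (smult_section (lf u g) (De f \<eta>) + smult_section (bracket_S D f (lf u g)) \<eta>)"
      unfolding sy(3)[OF g \<eta>] De_linear(1)[OF f g conormal_smult[OF g dn] conormal_smult[OF ug \<eta>]]
        De_linear(5)[OF f g dn dn] De_linear(5)[OF f ug \<eta> \<eta>] ..
    moreover have "De (lf u f) (smult_section g \<eta>) = smult_section g (De (lf u f) \<eta>) + smult_section (bracket_S D (lf u f) g) \<eta>"
      by (rule De_linear(5)[OF uf g \<eta> \<eta>])
    ultimately have "(smult_section g (\<delta> (De f \<eta>)) + smult_section (lf u g) (De f \<eta>))
        + (smult_section (bracket_S D f g) (\<delta> \<eta>) + smult_section (lf u (bracket_S D f g)) \<eta>)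
      - ((smult_section g (De f (\<delta> \<eta>)) + smult_section (bracket_S D f g) (\<delta> \<eta>))
        + (smult_section (lf u g) (De f \<eta>) + smult_section (bracket_S D f (lf u g)) \<eta>))
      - (smult_section g (De (lf u f) \<eta>) + smult_section (bracket_S D (lf u f) g) \<eta>)
      = smult_section g (\<delta> (De f \<eta>)) - smult_section g (De f (\<delta> \<eta>)) - smult_section g (De (lf u f) \<eta>)"
      by (metis smult_linear(2))
    then have "smult_section (lf u (bracket_S D f g)) \<eta> - smult_section (bracket_S D f (lf u g)) \<eta>
        - smult_section (bracket_S D (lf u f) g) \<eta> = 0"
      by (simp add: algebra_simps)
    then show "smult_section ?e \<eta> = 0" unfolding smult_linear by (simp add: algebra_simps)
  qed
  then show ?thesis by simp
qed

text \<open>In the bracket identity the first components agree because the symbol is a Poisson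
  vector field. In the second, \<open>e1\<close> and \<open>e2\<close> rewrite \<delta> of the
  contravariant derivatives by the second clause of \<open>mp_cond\<close>, \<open>e3\<close> and
  \<open>e4\<close> treat \<open>bracket_1\<close> and the curvature by the first and third, and
  \<open>e5\<close> matches the order of arguments.\<close>

lemma pairX_poiss:
  assumes \<delta>: "\<delta> \<in> derivative_endos D" and Q: "Q \<in> MV 1" and m: "mp_cond \<delta> Q"
  shows "pairX Q \<delta> \<in> poiss_P D"
proof (rule poiss_PI)
  let ?u = "symbol D \<delta>"
  note sy = symbolD[OF derivative_endosD(1)[OF \<delta>]] and d = derivative_endosD[OF \<delta>] and q = section_derivationD[OF mv_1_derivation[OF Q]]
  have A: "pairX Q \<delta> x \<in> Aff" if x: "x \<in> Aff" for x
    using x unfolding pairX_apply(1)[OF x] Aff_iff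
    by (auto intro!: subspace_add[OF subspace_CS] q(1) sy(2) d(2))
  then show "x \<in> Aff ==> pairX Q \<delta> x \<in> Aff" for x .
  show "x \<notin> Aff ==> pairX Q \<delta> x = 0" for x by (rule pairX_apply(2))
  show "pairX Q \<delta> (c *\<^sub>R x) = c *\<^sub>R pairX Q \<delta> x" if x: "x \<in> Aff" for c x
    unfolding pairX_apply(1)[OF x] pairX_apply(1)[OF subspace_scale[OF subspace_Aff x]]
    using x q(2) d(5) vector_field_lf(2)[OF sy(1) _ S0] by (simp add: Aff_iff scaleR_add_right)
  fix x y assume x: "x \<in> Aff" and y: "y \<in> Aff"
  obtain f \<eta> where xf: "x = (f, \<eta>)" by (cases x)
  obtain g \<xi> where yg: "y = (g, \<xi>)" by (cases y)
  have f: "f \<in> SS" and \<eta>: "\<eta> \<in> CS" and g: "g \<in> SS" and \<xi>: "\<xi> \<in> CS"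
    using x y by (auto simp: xf yg Aff_iff)
  have uf: "lf ?u f \<in> SS" and ug: "lf ?u g \<in> SS" using sy(2) f g by auto
  note qf = q(1)[OF f] and qg = q(1)[OF g] and dn = d(2)[OF \<eta>] and dx = d(2)[OF \<xi>]
  have X: "pairX Q \<delta> x = (lf ?u f, qv Q f + \<delta> \<eta>)" "pairX Q \<delta> y = (lf ?u g, qv Q g + \<delta> \<xi>)"
    using pairX_apply(1)[OF x] pairX_apply(1)[OF y] by (simp_all add: xf yg)
  show "pairX Q \<delta> (x + y) = pairX Q \<delta> x + pairX Q \<delta> y"
    unfolding X pairX_apply(1)[OF subspace_add[OF subspace_Aff x y]]
    using q(3)[OF f g] d(4)[OF \<eta> \<xi>] vector_field_lf(1)[OF sy(1) f g] by (simp add: xf yg)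
  have "pairX Q \<delta> (aff_mult x y) = (lf ?u (f * g), qv Q (f * g) + \<delta> (smult_section f \<xi> + smult_section g \<eta>))"
    using pairX_apply(1)[OF aff_mult_closed[OF x y]] by (simp add: xf yg aff_mult_def)
  also have "\<dots> = aff_mult (pairX Q \<delta> x) y + aff_mult x (pairX Q \<delta> y)"
    unfolding X[unfolded xf yg] xf yg aff_mult_def vector_field_lf(3)[OF sy(1) f g] q(4)[OF f g]
      d(4)[OF conormal_smult[OF f \<xi>] conormal_smult[OF g \<eta>]] sy(3)[OF f \<xi>] sy(3)[OF g \<eta>]
    by (simp add: smult_linear algebra_simps)
  finally show "pairX Q \<delta> (aff_mult x y) = aff_mult (pairX Q \<delta> x) y + aff_mult x (pairX Q \<delta> y)" .
  note Dx = cder_conormal[OF f \<xi>] and Dn = cder_conormal[OF g \<eta>] and b1 = bracket_1_conormal[OF \<eta> \<xi>] and k = curv_conormal[OF f g]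
  note c2 = subspace_diff[OF subspace_CS Dx Dn]
  note c3 = subspace_add[OF subspace_CS c2 b1]
  have dd: "\<delta> (De f \<xi> - De g \<eta> + br1 \<eta> \<xi> + K f g) = \<delta> (De f \<xi>) - \<delta> (De g \<eta>) + \<delta> (br1 \<eta> \<xi>) + \<delta> (K f g)"
  proof -
    have "\<delta> (De f \<xi> - De g \<eta>) = \<delta> (De f \<xi>) - \<delta> (De g \<eta>)"
      using d(4)[OF c2 Dn] by simp
    then show ?thesis unfolding d(4)[OF c3 k] d(4)[OF c2 b1] by simp
  qed
  have e1: "\<delta> (De f \<xi>) = De f (\<delta> \<xi>) + De (lf ?u f) \<xi> + br1 (qv Q f) \<xi>"
  proof -
    have "\<delta> (De f \<xi>) - De f (\<delta> \<xi>) - De (lf ?u f) \<xi> = br1 (qv Q f) \<xi>"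
      using m f \<xi> unfolding mp_cond_def by blast
    then show ?thesis by (simp only: diff_eq_eq add_ac)
  qed
  have e2: "\<delta> (De g \<eta>) = De g (\<delta> \<eta>) + De (lf ?u g) \<eta> + br1 (qv Q g) \<eta>"
  proof -
    have "\<delta> (De g \<eta>) - De g (\<delta> \<eta>) - De (lf ?u g) \<eta> = br1 (qv Q g) \<eta>"
      using m g \<eta> unfolding mp_cond_def by blast
    then show ?thesis by (simp only: diff_eq_eq add_ac)
  qed
  have e3: "\<delta> (br1 \<eta> \<xi>) = br1 (\<delta> \<eta>) \<xi> + br1 \<eta> (\<delta> \<xi>)" using m \<eta> \<xi> unfolding mp_cond_def by blast
  have "eval_mv (dD D 1 Q) [dS f, dS g] = \<delta> (K f g) - K (lf ?u f) g - K f (lf ?u g)"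
    using m f g unfolding mp_cond_def by blast
  then have e4: "\<delta> (K f g) = De f (qv Q g) - De g (qv Q f) - qv Q (bracket_S D f g) + K (lf ?u f) g + K f (lf ?u g)"
    unfolding dD_1(2)[OF Q f g] by (simp add: algebra_simps)
  have e5: "br1 \<eta> (qv Q g) = - br1 (qv Q g) \<eta>" by (rule br1_linear(6)[OF f \<eta> qg qg])
  have "pairX Q \<delta> (ab x y) = (lf ?u (bracket_S D f g), qv Q (bracket_S D f g) + \<delta> (De f \<xi> - De g \<eta> + br1 \<eta> \<xi> + K f g))"
    using pairX_apply(1)[OF ab_closed[OF x y]] by (simp add: xf yg ab_simps)
  also have "\<dots> = ab (pairX Q \<delta> x) y + ab x (pairX Q \<delta> y)"
    unfolding X[unfolded xf yg] xf yg aff_bracket_def dd e1 e2 e3 e4 mp_cond_symbol_poisson[OF \<delta> Q m f g]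
    using De_linear(1)[OF g g qf dn] De_linear(1)[OF f f qg dx] br1_linear(2)[OF f qf dn \<xi>] br1_linear(1)[OF f qg dx \<eta>] e5
    by (simp add: algebra_simps)
  finally show "pairX Q \<delta> (ab x y) = ab (pairX Q \<delta> x) y + ab x (pairX Q \<delta> y)" .
qed

lemma poiss_mp_cond:
  assumes \<delta>: "\<delta> \<in> derivative_endos D" and Q: "Q \<in> MV 1" and X: "pairX Q \<delta> \<in> poiss_P D"
  shows "mp_cond \<delta> Q"
proof -
  let ?u = "symbol D \<delta>"
  note sy = symbolD[OF derivative_endosD(1)[OF \<delta>]] and d = derivative_endosD[OF \<delta>] and q = section_derivationD[OF mv_1_derivation[OF Q]]
  have q0: "qv Q 0 = 0" using q(2)[OF S0, of 0] by simp
  have u0: "lf ?u 0 = 0" using vector_field_lf(2)[OF sy(1) S0 S0, of 0] by simp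
  have Xf: "pairX Q \<delta> (f, 0) = (lf ?u f, qv Q f)" if "f \<in> SS" for f
    using pairX_apply(1)[OF Aff_pair[OF that C0]] d(6) by simp
  have Xe: "pairX Q \<delta> (0, \<eta>) = (0, \<delta> \<eta>)" if "\<eta> \<in> CS" for \<eta>
    using pairX_apply(1)[OF Aff_pair[OF S0 that]] q0 u0 by simp
  show ?thesis
    unfolding mp_cond_def
  proof (intro conjI ballI)
    fix \<eta> \<xi> assume \<eta>: "\<eta> \<in> CS" and \<xi>: "\<xi> \<in> CS"
    have "pairX Q \<delta> (ab (0, \<eta>) (0, \<xi>)) = ab (0, \<delta> \<eta>) (0, \<xi>) + ab (0, \<eta>) (0, \<delta> \<xi>)"
      using poiss_PD(6)[OF X Aff_pair[OF S0 \<eta>] Aff_pair[OF S0 \<xi>]] Xe[OF \<eta>] Xe[OF \<xi>] by simp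
    then show "\<delta> (br1 \<eta> \<xi>) = br1 (\<delta> \<eta>) \<xi> + br1 \<eta> (\<delta> \<xi>)"
      using Xe[OF bracket_1_conormal[OF \<eta> \<xi>]] ab_ee[OF \<eta> \<xi>] ab_ee[OF d(2)[OF \<eta>] \<xi>] ab_ee[OF \<eta> d(2)[OF \<xi>]] by simp
  next
    fix f \<eta> assume f: "f \<in> SS" and \<eta>: "\<eta> \<in> CS"
    note uf = sy(2)[OF f]
    have "ab (lf ?u f, qv Q f) (0, \<eta>) = (0, De (lf ?u f) \<eta> + br1 (qv Q f) \<eta>)"
      by (simp add: aff_bracket_def zero_components bracket_S_0 uf q(1)[OF f])
    then have "(0, \<delta> (De f \<eta>)) = (0, De (lf ?u f) \<eta> + br1 (qv Q f) \<eta>) + (0::'a fn, De f (\<delta> \<eta>))"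
      using poiss_PD(6)[OF X Aff_pair[OF f C0] Aff_pair[OF S0 \<eta>]] Xf[OF f] Xe[OF \<eta>] Xe[OF cder_conormal[OF f \<eta>]]
        ab_fe[OF f \<eta>] ab_fe[OF f d(2)[OF \<eta>]] by simp
    then show "\<delta> (De f \<eta>) - De f (\<delta> \<eta>) - De (lf ?u f) \<eta> = br1 (qv Q f) \<eta>" by simp
  next
    fix f g assume f: "f \<in> SS" and g: "g \<in> SS"
    note uf = sy(2)[OF f] and ug = sy(2)[OF g] and b = S.br_smooth[OF f g] and k = curv_conormal[OF f g]
    have "ab (lf ?u f, qv Q f) (g, 0) = (bracket_S D (lf ?u f) g, - De g (qv Q f) + K (lf ?u f) g)"
      by (simp add: aff_bracket_def zero_components uf q(1)[OF f])
    moreover have "ab (f, 0) (lf ?u g, qv Q g) = (bracket_S D f (lf ?u g), De f (qv Q g) + K f (lf ?u g))"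
      by (simp add: aff_bracket_def zero_components ug q(1)[OF g])
    moreover have "pairX Q \<delta> (bracket_S D f g, K f g) = (lf ?u (bracket_S D f g), qv Q (bracket_S D f g) + \<delta> (K f g))"
      using pairX_apply(1)[OF Aff_pair[OF b k]] by simp
    ultimately have "qv Q (bracket_S D f g) + \<delta> (K f g) = - De g (qv Q f) + K (lf ?u f) g + (De f (qv Q g) + K f (lf ?u g))"
      using poiss_PD(6)[OF X Aff_pair[OF f C0] Aff_pair[OF g C0]] Xf[OF f] Xf[OF g] ab_ff[OF f g] by simp
    then show "eval_mv (dD D 1 Q) [dS f, dS g] = \<delta> (K f g) - K (lf ?u f) g - K f (lf ?u g)"
      unfolding dD_1(2)[OF Q f g] by (simp add: algebra_simps eq_diff_eq diff_eq_eq)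
  qed
qed

text \<open>Reads \<delta> off a derivation by restricting it to conormal sections
  (\<open>dlt_pairX\<close>). Being linear in X without any condition, it replaces the relation
  between X and its decomposition.\<close>

definition dlt :: "('a aff \<Rightarrow> 'a aff) \<Rightarrow> 'a form \<Rightarrow> 'a form"
  where "dlt X = (\<lambda>\<eta>. if \<eta> \<in> CS then snd (X (0, \<eta>)) else 0)"

text \<open>The second component of X gives Q on functions and \<delta> on sections; the first
  component on functions is a vector field, which the Leibniz rule identifies as the symbol of
  \<delta>. It remains to see that sections have no first component.\<close>

lemma poiss_decomposition:
  assumes X: "X \<in> poiss_P D"
  obtains Q where "Q \<in> MV 1" "dlt X \<in> derivative_endos D" "X = pairX Q (dlt X)"
proof -
  note P = poiss_PD[OF X]
  have F: "(f, 0) \<in> Aff" if "f \<in> SS" for f by (rule Aff_pair[OF that C0])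
  have E: "(0, \<eta>) \<in> Aff" if "\<eta> \<in> CS" for \<eta> by (rule Aff_pair[OF S0 that])
  have XF: "fst (X (f, 0)) \<in> SS" "snd (X (f, 0)) \<in> CS" if "f \<in> SS" for f
    using P(1)[OF F[OF that]] by (simp_all add: Aff_iff)
  have XE: "fst (X (0, \<eta>)) \<in> SS" "snd (X (0, \<eta>)) \<in> CS" if "\<eta> \<in> CS" for \<eta>
    using P(1)[OF E[OF that]] by (simp_all add: Aff_iff)
  have X0: "X 0 = 0" using P(4)[OF subspace_0[OF subspace_Aff], of 0] by simp
  \<comment> \<open>Let t(\<eta>) be the first component. Applying X to the zero product of 0
    \<oplus> \<eta> and 0 \<oplus> \<xi> gives t(\<eta>) \<xi> + t(\<xi>) \<eta> = 0. At a zero of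
    \<eta> use a \<xi> that does not vanish there, which exists by positive codimension; elsewhere
    take \<xi> = \<eta>.\<close>
  have tau: "fst (X (0, \<eta>)) = 0" if \<eta>: "\<eta> \<in> CS" for \<eta>
  proof
    let ?t = "\<lambda>\<eta>. fst (X (0, \<eta>))"
    have r: "smult_section (?t \<eta>) \<xi> + smult_section (?t \<xi>) \<eta> = 0" if \<eta>: "\<eta> \<in> CS" and \<xi>: "\<xi> \<in> CS" for \<eta> \<xi>
    proof -
      have "aff_mult (0, \<eta>) (0, \<xi>) = 0" by (simp add: aff_mult_def zero_prod_def)
      then have "aff_mult (X (0, \<eta>)) (0, \<xi>) + aff_mult (0, \<eta>) (X (0, \<xi>)) = 0"
        using P(5)[OF E[OF \<eta>] E[OF \<xi>]] X0 by simp
      then have "snd (aff_mult (X (0, \<eta>)) (0, \<xi>) + aff_mult (0, \<eta>) (X (0, \<xi>))) = snd (0::'a aff)" by simp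
      then show ?thesis by (simp add: aff_mult_def case_prod_beta)
    qed
    fix p show "?t \<eta> p = (0::'a fn) p"
    proof (cases "p \<in> S")
      case True
      obtain \<xi> where \<xi>: "\<xi> \<in> CS" "\<xi> p \<noteq> 0" by (rule conormal_nonzero[OF rank True])
      show ?thesis
      proof (cases "\<eta> p = 0")
        case z: True
        have "(smult_section (?t \<eta>) \<xi> + smult_section (?t \<xi>) \<eta>) p = 0" using r[OF \<eta> \<xi>(1)] by simp
        then have "?t \<eta> p *\<^sub>R \<xi> p = 0" using z by (simp add: fun_eq_iff)
        then show ?thesis using \<xi>(2) by (auto simp: fun_eq_iff)
      next
        case nz: False
        have "(smult_section (?t \<eta>) \<eta> + smult_section (?t \<eta>) \<eta>) p = 0" using r[OF \<eta> \<eta>] by simp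
        then have "?t \<eta> p *\<^sub>R \<eta> p = 0" by (simp add: fun_eq_iff)
        then show ?thesis using nz by (auto simp: fun_eq_iff)
      qed
    next
      case False
      then show ?thesis using S.smooth_functions_outside[OF XE(1)[OF \<eta>]] by simp
    qed
  qed
  have mFF: "aff_mult (X (f, 0)) (g, 0) = (fst (X (f, 0)) * g, smult_section g (snd (X (f, 0))))"
    "aff_mult (f, 0) (X (g, 0)) = (f * fst (X (g, 0)), smult_section f (snd (X (g, 0))))" for f g
    by (simp_all add: aff_mult_def case_prod_beta)
  have add: "X (f + g, 0) = X (f, 0) + X (g, 0)" if "f \<in> SS" "g \<in> SS" for f g
    using P(3)[OF F[OF that(1)] F[OF that(2)]] by simp
  have scale: "X (c *\<^sub>R f, 0) = c *\<^sub>R X (f, 0)" if "f \<in> SS" for f c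
    using P(4)[OF F[OF that], of c] by simp
  have mult: "X (f * g, 0) = (f * fst (X (g, 0)) + g * fst (X (f, 0)), smult_section f (snd (X (g, 0))) + smult_section g (snd (X (f, 0))))"
    if "f \<in> SS" "g \<in> SS" for f g
    using P(5)[OF F[OF that(1)] F[OF that(2)]] unfolding aff_mult_simps mFF by (simp add: algebra_simps)
  have "section_derivation (\<lambda>f. snd (X (f, 0)))"
    unfolding section_derivation_def using XF(2) add scale mult by simp
  then obtain Q where Q: "Q \<in> MV 1" "\<And>f. f \<in> SS ==> qv Q f = snd (X (f, 0))"
    by (rule derivation_tensor) (rule that)
  \<comment> \<open>The default 0 follows the convention that fields vanish off S and tangent
    vectors on functions that are not smooth.\<close>
  define u where "u p f = (if p \<in> S \<and> f \<in> SS then fst (X (f, 0)) p else 0)" for p f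
  have luf: "lf u f = fst (X (f, 0))" if f: "f \<in> SS" for f
  proof
    fix p show "lf u f p = fst (X (f, 0)) p"
      using f S.smooth_functions_outside[OF XF(1)[OF f], of p] by (cases "p \<in> S") (auto simp: lie_fn_def u_def)
  qed
  have u: "u \<in> vector_fields SM"
  proof (rule vector_fieldsI)
    fix p assume "p \<in> pts SM"
    then have p: "p \<in> S" by simp
    show "u p \<in> tangent SM p"
      by (rule tangentI) (simp_all add: u_def p add scale mult S.smooth_intros)
  next
    fix f assume f: "f \<in> SS"
    then show "(\<lambda>p. u p f) \<in> SS" using luf[OF f] XF(1)[OF f] by (simp add: lie_fn_def)
  qed (auto simp: u_def)
  have lin: "dlt X \<in> linear_maps CS CS"
  proof -
    have "X (0, \<eta> + \<xi>) = X (0, \<eta>) + X (0, \<xi>)" if "\<eta> \<in> CS" "\<xi> \<in> CS" for \<eta> \<xi>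
      using P(3)[OF E[OF that(1)] E[OF that(2)]] by simp
    moreover have "X (0, c *\<^sub>R \<eta>) = c *\<^sub>R X (0, \<eta>)" if "\<eta> \<in> CS" for c \<eta>
      using P(4)[OF E[OF that], of c] by simp
    ultimately show ?thesis
      using XE(2) subspace_add[OF subspace_CS] subspace_scale[OF subspace_CS]
      by (auto simp: linear_maps_def linear_from_def dlt_def)
  qed
  have sy: "is_symbol D (dlt X) u"
    unfolding is_symbol_def
  proof (intro conjI ballI u)
    fix f \<eta> assume f: "f \<in> SS" and \<eta>: "\<eta> \<in> CS"
    have "X (aff_mult (f, 0) (0, \<eta>)) = aff_mult (X (f, 0)) (0, \<eta>) + aff_mult (f, 0) (X (0, \<eta>))"
      by (rule P(5)[OF F[OF f] E[OF \<eta>]])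
    then have "snd (X (0, smult_section f \<eta>)) = smult_section (fst (X (f, 0))) \<eta> + smult_section f (snd (X (0, \<eta>)))"
      unfolding aff_mult_simps by (simp add: aff_mult_def case_prod_beta)
    then show "dlt X (smult_section f \<eta>) = smult_section f (dlt X \<eta>) + smult_section (lf u f) \<eta>"
      using conormal_smult[OF f \<eta>] \<eta> luf[OF f] by (simp add: dlt_def)
  qed
  have de: "dlt X \<in> derivative_endos D" using lin sy by (auto simp: derivative_endos_def)
  have "X = pairX Q (dlt X)"
  proof
    fix x show "X x = pairX Q (dlt X) x"
    proof (cases "x \<in> Aff")
      case True
      obtain f \<eta> where x: "x = (f, \<eta>)" by (cases x)
      have f: "f \<in> SS" and \<eta>: "\<eta> \<in> CS" using True by (auto simp: x Aff_iff)
      have "X x = X (f, 0) + X (0, \<eta>)" using P(3)[OF F[OF f] E[OF \<eta>]] by (simp add: x)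
      then show ?thesis
        using pairX_apply(1)[OF True, of Q "dlt X"] symbol_eq[OF sy] luf[OF f] Q(2)[OF f] tau[OF \<eta>] \<eta>
        by (simp add: x dlt_def prod_eq_iff)
    next
      case False
      then show ?thesis using P(2) pairX_apply(2) by simp
    qed
  qed
  then show thesis by (rule that[OF Q(1) de])
qed

lemma dlt_pairX:
  assumes \<delta>: "\<delta> \<in> derivative_endos D" and Q: "Q \<in> MV 1" shows "dlt (pairX Q \<delta>) = \<delta>"
proof
  fix \<eta> show "dlt (pairX Q \<delta>) \<eta> = \<delta> \<eta>"
  proof (cases "\<eta> \<in> CS")
    case True
    have "qv Q 0 = 0" using section_derivationD(2)[OF mv_1_derivation[OF Q] S0, of 0] by simp
    then show ?thesis using True pairX_apply(1)[OF Aff_pair[OF S0 True]] by (simp add: dlt_def)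
  qed (simp add: dlt_def derivative_endosD(3)[OF \<delta>])
qed

lemma MP_eq: "MP D = dlt ` poiss_P D"
proof (intro equalityI subsetI)
  fix \<delta> assume "\<delta> \<in> MP D"
  then obtain Q where d: "\<delta> \<in> derivative_endos D" "Q \<in> MV 1" "mp_cond \<delta> Q" unfolding MP_iff by blast
  then show "\<delta> \<in> dlt ` poiss_P D" using pairX_poiss[OF d] dlt_pairX[OF d(1,2)] by (metis image_eqI)
next
  fix \<delta> assume "\<delta> \<in> dlt ` poiss_P D"
  then obtain X where X: "X \<in> poiss_P D" "\<delta> = dlt X" by blast
  obtain Q where Q: "Q \<in> MV 1" "dlt X \<in> derivative_endos D" "X = pairX Q (dlt X)"
    by (rule poiss_decomposition[OF X(1)]) (rule that)
  have "mp_cond (dlt X) Q" by (rule poiss_mp_cond[OF Q(2,1)]) (use Q(3) X(1) in simp)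
  then show "\<delta> \<in> MP D" unfolding MP_iff X(2) using Q(1,2) by blast
qed

end

section \<open>The two exact sequences\<close>

lemma subspace_image_on:
  assumes U: "subspace U" and f: "\<And>x y. x \<in> U ==> y \<in> U ==> f (x + y) = f x + f y" "\<And>c x. x \<in> U ==> f (c *\<^sub>R x) = c *\<^sub>R f x"
  shows "subspace (f ` U)"
proof (rule subspaceI)
  have "f (0 *\<^sub>R 0) = 0 *\<^sub>R f 0" by (rule f(2)[OF subspace_0[OF U]])
  then have "f 0 = 0" by simp
  then show "0 \<in> f ` U" using subspace_0[OF U] by (metis image_eqI)
next
  fix a b assume "a \<in> f ` U" "b \<in> f ` U"
  then obtain x y where "x \<in> U" "y \<in> U" "a = f x" "b = f y" by blast
  then show "a + b \<in> f ` U" using f(1) subspace_add[OF U] by (metis image_eqI)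
next
  fix c a assume "a \<in> f ` U"
  then obtain x where "x \<in> U" "a = f x" by blast
  then show "c *\<^sub>R a \<in> f ` U" using f(2) subspace_scale[OF U] by (metis image_eqI)
qed

lemma subspace_preimage_on:
  assumes U: "subspace U" and V: "subspace V" and f: "\<And>x y. x \<in> U ==> y \<in> U ==> f (x + y) = f x + f y" "\<And>c x. x \<in> U ==> f (c *\<^sub>R x) = c *\<^sub>R f x"
  shows "subspace {x \<in> U. f x \<in> V}"
proof -
  have "f (0 *\<^sub>R 0) = 0 *\<^sub>R f 0" by (rule f(2)[OF subspace_0[OF U]])
  then have "f 0 = 0" by simp
  then show ?thesis
    by (intro subspaceI) (simp_all add: f subspace_0 subspace_add subspace_scale U V)
qed

lemma subspace_alt_multilinear:
  assumes "subspace B" shows "subspace (alt_multilinear V k B)"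
  unfolding alt_multilinear_def linear_from_def
  by (intro subspaceI) (simp_all add: assms subspace_0 subspace_add subspace_scale algebra_simps)

lemma eval_mv_linear:
  "eval_mv (Q + R) as = eval_mv Q as + eval_mv R as" "eval_mv (c *\<^sub>R Q) as = c *\<^sub>R eval_mv Q as" "eval_mv 0 as = 0"
  by (auto simp: eval_mv_def fun_eq_iff)

text \<open>f is constant on cosets of its kernel, so the union in \<open>arrow_J\<close> is over
  equal sets.\<close>

lemma union_kernel_coset:
  assumes A: "Module.module real_ring A" and B: "Module.module real_ring B" and f: "f \<in> module_homs A B" and a: "a \<in> carrier A"
  shows "(\<Union>C\<in>a_kernel A B f +>\<^bsub>A\<^esub> a. f C) = f a"
proof -
  note sub = submod_kernel[OF A B f]
  interpret B: Module.module real_ring B by (rule B)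
  have "f C = f a" if C: "C \<in> a_kernel A B f +>\<^bsub>A\<^esub> a" for C
  proof -
    have "\<exists>n\<in>a_kernel A B f. C = n \<oplus>\<^bsub>A\<^esub> a" using C mem_coset[OF A sub a] by blast
    then obtain n where n: "n \<in> carrier A" "f n = \<zero>\<^bsub>B\<^esub>" "C = n \<oplus>\<^bsub>A\<^esub> a"
      unfolding a_kernel_conv by blast
    show ?thesis using module_homsD(2)[OF f n(1) a] module_homsD(1)[OF f a] n by simp
  qed
  moreover have "a \<in> a_kernel A B f +>\<^bsub>A\<^esub> a" by (rule coset_self[OF A sub a])
  ultimately show ?thesis by blast
qed

context exponential_setting
begin

section \<open>The center and multivector fields with central values\<close>

lemma subspace_conormal: "subspace (conormal D p)"
  unfolding conormal_def
  by (intro subspaceI) (auto simp: subspace_0 subspace_add subspace_scale subspace_cotangent)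

lemma subspace_conormal_mv: "subspace (MV k)"
  unfolding conormal_mv_def multivector_fields_def
  by (intro subspaceI)
    (simp_all add: eval_mv_linear subspace_0 subspace_add subspace_scale subspace_CS subspace_alt_multilinear[OF subspace_conormal])

text \<open>\<xi> has a potential that is a sum of F_c x_c with F_c(p) = 0 and x_c = 0 on S, and
  \<eta> a potential G vanishing on S. By the Leibniz rule {G, F_c x_c} is F_c {G, x_c} + x_c {G,
  F_c}; all four factors vanish at p, hence so does the differential.\<close>

lemma br1_pointwise:
  assumes \<xi>: "\<xi> \<in> CS" and \<eta>: "\<eta> \<in> CS" and p: "p \<in> S" and z: "\<xi> p = 0"
  shows "br1 \<xi> \<eta> p = 0"
proof -
  obtain A and C :: "'e set" and F x where A: "p \<in> A" "finite C" "exact_on A (\<Sum>c\<in>C. F c * x c) \<xi>"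
    "\<And>c. c \<in> C ==> F c \<in> Sm" "\<And>c. c \<in> C ==> x c \<in> Sm"
    "\<And>c q. c \<in> C ==> q \<in> A ==> q \<in> S ==> x c q = 0" "\<And>c. c \<in> C ==> \<xi> p = 0 ==> F c p = 0"
    by (rule conormal_lift_sum[OF \<xi> p]) (rule that, assumption+)
  obtain B G where B: "p \<in> B" "exact_on B G \<eta>" "\<And>q. q \<in> B ==> q \<in> S ==> G q = 0"
    by (rule conormal_lift[OF \<eta> p]) (rule that)
  note Gs = exact_onD(2)[OF B(2)] and Ao = exact_onD(3)[OF A(3)] and Bo = exact_onD(3)[OF B(2)]
  have o: "mopen (A \<inter> B)" using Ao Bo by blast
  have "exact_on (A \<inter> B) (br (\<Sum>c\<in>C. F c * x c) G) (br1 \<xi> \<eta>)"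
    unfolding bracket_1_def
    by (rule restricted_bracket(2)[OF conormal_locally_exact[OF \<xi>] conormal_locally_exact[OF \<eta>]
      exact_on_subset[OF A(3) o Int_lower1] exact_on_subset[OF B(2) o Int_lower2]])
  from exact_onD(1)[OF this _ p] have e: "br1 \<xi> \<eta> p = dN (br (\<Sum>c\<in>C. F c * x c) G) p"
    using A(1) B(1) by blast
  have s0: "0 \<in> Sm" by (rule subspace_0[OF subspace_smooth_functions])
  have "(\<Sum>c\<in>C'. F c * x c) \<in> Sm \<and> dN (br G (\<Sum>c\<in>C'. F c * x c)) p = 0"
    if "C' \<subseteq> C" for C'
    using finite_subset[OF that A(2)] that
  proof (induction C' rule: finite_induct)
    case empty
    have "br G (0 *\<^sub>R 0) = 0 *\<^sub>R br G 0" by (rule br_right(2)[OF s0 s0])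
    then have b: "br G 0 = 0" by simp
    have "dN (0 *\<^sub>R 0) p = 0 *\<^sub>R dN 0 p" by (rule differential_scaleR[OF s0])
    then have d: "dN 0 p = 0" by simp
    show ?case using s0 b d by (simp only: sum.empty simp_thms)
  next
    case (insert c C')
    let ?R = "\<Sum>c\<in>C'. F c * x c"
    have c: "c \<in> C" and R: "?R \<in> Sm" "dN (br G ?R) p = 0"
      using insert.IH insert.prems by blast+
    note Fs = A(4)[OF c] and xs = A(5)[OF c]
    note Fx = smooth_mult[OF Fs xs] and bx = br_smooth[OF Gs xs] and bF = br_smooth[OF Gs Fs]
    have "br G (x c) p = 0" by (rule br_zero_on[OF Gs xs Ao A(6)[OF c] A(1) p])
    moreover have "br G (F c) p = 0"
      using br_skew[of G "F c"] br_zero_on[OF Fs Gs Bo B(3,1) p] by simp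
    ultimately have "dN (br G (F c * x c)) p = 0"
      unfolding br_right(3)[OF Fs xs] differential_add[OF smooth_mult[OF Fs bx] smooth_mult[OF xs bF]]
        differential_mult[OF Fs bx] differential_mult[OF xs bF]
      using A(6)[OF c A(1) p] A(7)[OF c z] by simp
    then have "dN (br G (F c * x c + ?R)) p = 0"
      unfolding br_right(1)[OF Fx R(1)] differential_add[OF br_smooth[OF Gs Fx] br_smooth[OF Gs R(1)]]
      using R(2) by simp
    then show ?case unfolding sum.insert[OF insert(1,2)] using smooth_intros(2)[OF Fx R(1)] by blast
  qed
  from this[OF order_refl]
  have R: "(\<Sum>c\<in>C. F c * x c) \<in> Sm" "dN (br G (\<Sum>c\<in>C. F c * x c)) p = 0" by auto
  have "br (\<Sum>c\<in>C. F c * x c) G = (-1) *\<^sub>R br G (\<Sum>c\<in>C. F c * x c)"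
    using br_skew[of "\<Sum>c\<in>C. F c * x c" G] by simp
  then show ?thesis unfolding e using differential_scaleR[OF br_smooth[OF Gs R(1)], of "-1" p] R(2) by simp
qed

lemma conormal_outside: "\<xi> \<in> CS ==> p \<notin> S ==> \<xi> p = 0"
  using restricted_formsD(2)[OF conormal_sectionsD(1)] by blast

lemma center_GD:
  assumes "z \<in> center_G D" shows "z \<in> CS" "\<eta> \<in> CS ==> br1 z \<eta> = 0"
  using assms by (auto simp: center_G_def)

lemma subspace_center_G: "subspace (center_G D)"
proof (rule subspaceI)
  show "0 \<in> center_G D" by (simp add: center_G_def C0 zero_components)
next
  fix x y assume x: "x \<in> center_G D" and y: "y \<in> center_G D"
  note x1 = center_GD[OF x] and y1 = center_GD[OF y]
  show "x + y \<in> center_G D"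
    unfolding center_G_def
    using subspace_add[OF subspace_CS x1(1) y1(1)] br1_linear(2)[OF S0 x1(1) y1(1)] x1(2) y1(2) by simp
next
  fix c x assume x: "x \<in> center_G D"
  note x1 = center_GD[OF x]
  show "c *\<^sub>R x \<in> center_G D"
    unfolding center_G_def
    using subspace_scale[OF subspace_CS x1(1)] br1_linear(4)[OF S0 x1(1) _ C0] x1(2) by simp
qed

lemma subspace_central_mv: "subspace (central_mv D k)"
  unfolding central_mv_def
  by (intro subspaceI)
    (simp_all add: eval_mv_linear subspace_0 subspace_add subspace_scale subspace_conormal_mv subspace_center_G)

text \<open>At a given point a one-form agrees with an exact one, and by
  \<open>br1_pointwise\<close> the bracket sees only the value of its argument there; so it is
  enough to test centrality on exact forms.\<close>

lemma central_mv_1_iff: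
  "Q \<in> central_mv D 1 \<longleftrightarrow> Q \<in> MV 1 \<and> (\<forall>f\<in>SS. qv Q f \<in> center_G D)"
proof
  assume "Q \<in> central_mv D 1"
  then show "Q \<in> MV 1 \<and> (\<forall>f\<in>SS. qv Q f \<in> center_G D)"
    using S.differential_one_form by (auto simp: central_mv_def)
next
  assume "Q \<in> MV 1 \<and> (\<forall>f\<in>SS. qv Q f \<in> center_G D)"
  then have Q: "Q \<in> MV 1" and z: "\<forall>f\<in>SS. qv Q f \<in> center_G D" by auto
  have "eval_mv Q [\<alpha>] \<in> center_G D" if \<alpha>: "\<alpha> \<in> one_forms SM" for \<alpha>
  proof -
    have a: "eval_mv Q [\<alpha>] \<in> CS" by (rule mvD(3)[OF Q]) (use \<alpha> in auto)
    have "br1 (eval_mv Q [\<alpha>]) \<eta> p = 0" if \<eta>: "\<eta> \<in> CS" for \<eta> p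
    proof (cases "p \<in> S")
      case True
      obtain f where f: "f \<in> SS" "dS f p = \<alpha> p"
        by (rule S_cotangent_exact[OF one_formsD(1)[OF \<alpha>] True]) (simp add: True)
      have q: "qv Q f \<in> center_G D" using z f(1) by blast
      note d = subspace_diff[OF subspace_CS a center_GD(1)[OF q]]
      have "br1 (eval_mv Q [\<alpha>] - qv Q f) \<eta> p = 0"
        by (rule br1_pointwise[OF d \<eta> True]) (simp add: eval_mv_def f(2))
      then show ?thesis
        using br1_linear(2)[OF S0 d center_GD(1)[OF q] \<eta>] center_GD(2)[OF q \<eta>] by simp
    next
      case False
      then show ?thesis by (rule conormal_outside[OF bracket_1_conormal[OF a \<eta>]])
    qed
    then show ?thesis using a unfolding center_G_def by auto
  qed
  then show "Q \<in> central_mv D 1" using Q by (auto simp: central_mv_def length_Suc_conv)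
qed

section \<open>Linearity of the symbol and Hamiltonian derivations\<close>

lemma lf_0: "lf 0 f = 0"
  by (auto simp: lie_fn_def fun_eq_iff)

lemma is_symbol_0: "is_symbol D 0 0"
  by (simp add: is_symbol_def subspace_0[OF S.subspace_vector_fields] lf_0)

lemma is_symbol_add:
  assumes "is_symbol D \<delta> u" "is_symbol D \<epsilon> v" shows "is_symbol D (\<delta> + \<epsilon>) (u + v)"
proof -
  have "lf (u + v) f = lf u f + lf v f" for f by (auto simp: lie_fn_def)
  then show ?thesis
    using assms subspace_add[OF S.subspace_vector_fields] by (auto simp: is_symbol_def smult_linear)
qed

lemma is_symbol_scaleR:
  assumes "is_symbol D \<delta> u" shows "is_symbol D (c *\<^sub>R \<delta>) (c *\<^sub>R u)"
proof -
  have "lf (c *\<^sub>R u) f = c *\<^sub>R lf u f" for f by (auto simp: lie_fn_def)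
  then show ?thesis
    using assms subspace_scale[OF S.subspace_vector_fields]
    by (auto simp: is_symbol_def smult_linear scaleR_add_right)
qed

text \<open>Sums and multiples of symbols are symbols, and uniqueness turns this into linearity of
  the operator \<open>symbol D\<close>.\<close>

lemma symbol_linear:
  assumes "\<delta> \<in> derivative_endos D"
  shows "\<epsilon> \<in> derivative_endos D ==> symbol D (\<delta> + \<epsilon>) = symbol D \<delta> + symbol D \<epsilon>"
    "symbol D (c *\<^sub>R \<delta>) = c *\<^sub>R symbol D \<delta>"
  using symbol_eq[OF is_symbol_add[OF derivative_endosD(1)[OF assms] derivative_endosD(1)]]
    symbol_eq[OF is_symbol_scaleR[OF derivative_endosD(1)[OF assms]]] by auto

lemma symbol_0: "symbol D 0 = 0"
  by (rule symbol_eq[OF is_symbol_0])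

lemma zero_derivative_endo: "0 \<in> derivative_endos D"
  using is_symbol_0 by (auto simp: derivative_endos_def linear_maps_def linear_from_def C0)

lemma aff_mult_linear:
  "aff_mult (x + y) z = aff_mult x z + aff_mult y z" "aff_mult x (y + z) = aff_mult x y + aff_mult x z"
  "aff_mult (c *\<^sub>R x) y = c *\<^sub>R aff_mult x y" "aff_mult x (c *\<^sub>R y) = c *\<^sub>R aff_mult x y"
  by (auto simp: aff_mult_def case_prod_beta smult_linear prod_eq_iff fun_eq_iff algebra_simps)

lemma subspace_poiss_P: "subspace (poiss_P D)"
proof (rule subspaceI)
  have "ab 0 y = 0" "ab y 0 = 0" if "y \<in> Aff" for y
    using ab_scaleR_left[OF that that, of 0] ab_scaleR_right[OF that that, of 0] by simp_all
  moreover have "aff_mult 0 y = 0" "aff_mult y 0 = 0" for y :: "'a aff"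
    using aff_mult_linear(3)[of 0 0 y] aff_mult_linear(4)[of y 0 0] by simp_all
  ultimately show "0 \<in> poiss_P D"
    by (intro poiss_PI) (simp_all add: subspace_0[OF subspace_Aff])
next
  fix X Y assume X: "X \<in> poiss_P D" and Y: "Y \<in> poiss_P D"
  note Xd = poiss_PD[OF X] and Yd = poiss_PD[OF Y]
  show "X + Y \<in> poiss_P D"
    by (rule poiss_PI)
      (simp_all add: Xd Yd subspace_add[OF subspace_Aff] aff_mult_linear ab_add_left ab_add_right scaleR_add_right)
next
  fix c X assume X: "X \<in> poiss_P D"
  note Xd = poiss_PD[OF X]
  show "c *\<^sub>R X \<in> poiss_P D"
    by (rule poiss_PI)
      (simp_all add: Xd subspace_scale[OF subspace_Aff] aff_mult_linear ab_scaleR_left ab_scaleR_right scaleR_add_right)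
qed

definition Ham :: "'a aff \<Rightarrow> 'a aff \<Rightarrow> 'a aff"
  where "Ham x = (\<lambda>y. if y \<in> Aff then ab x y else 0)"

lemma ham_P_eq: "ham_P D = Ham ` Aff"
  by (auto simp: ham_P_def Ham_def)

lemma Ham_linear: "x \<in> Aff ==> y \<in> Aff ==> Ham (x + y) = Ham x + Ham y" "x \<in> Aff ==> Ham (c *\<^sub>R x) = c *\<^sub>R Ham x"
  by (auto simp: Ham_def ab_add_left ab_scaleR_left fun_eq_iff)

lemma subspace_ham_P: "subspace (ham_P D)"
  unfolding ham_P_eq by (rule subspace_image_on[OF subspace_Aff]) (rule Ham_linear, assumption+)+

lemma Ham_poiss: assumes "x \<in> Aff" shows "Ham x \<in> poiss_P D"
  by (rule poiss_PI)
    (simp_all add: Ham_def assms ab_closed ab_add_right ab_scaleR_right ab_mult_right ab_jacobi[OF assms]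
      aff_mult_closed subspace_add[OF subspace_Aff] subspace_scale[OF subspace_Aff])

lemma ham_P_poiss: "ham_P D \<subseteq> poiss_P D"
  unfolding ham_P_eq using Ham_poiss by blast

lemma dlt_linear: "dlt (X + Y) = dlt X + dlt Y" "dlt (c *\<^sub>R X) = c *\<^sub>R dlt X"
  by (auto simp: dlt_def fun_eq_iff)

lemma subspace_MP: "subspace (MP D)"
  unfolding MP_eq by (rule subspace_image_on[OF subspace_poiss_P]) (rule dlt_linear)+

definition cp :: "'a fn \<Rightarrow> 'a form \<Rightarrow> 'a form"
  where "cp h = (\<lambda>\<eta>. if \<eta> \<in> CS then De h \<eta> else 0)"

definition inn :: "'a form \<Rightarrow> 'a form \<Rightarrow> 'a form"
  where "inn \<zeta> = (\<lambda>\<eta>. if \<eta> \<in> CS then br1 \<zeta> \<eta> else 0)"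

lemma dlt_Ham: assumes h: "h \<in> SS" and \<zeta>: "\<zeta> \<in> CS" shows "dlt (Ham (h, \<zeta>)) = cp h + inn \<zeta>"
proof
  fix \<eta> show "dlt (Ham (h, \<zeta>)) \<eta> = (cp h + inn \<zeta>) \<eta>"
    using Aff_pair[OF S0, of \<eta>] h \<zeta> by (simp add: dlt_def Ham_def cp_def inn_def ab_simps zero_components)
qed

lemma CP_eq: "CP D = cp ` SS" and InnG_eq: "InnG D = inn ` CS"
  by (auto simp: CP_def InnG_def cp_def inn_def)

lemma CP_InnG_eq: "CP D + InnG D = dlt ` ham_P D"
proof (intro equalityI subsetI)
  fix \<delta> assume "\<delta> \<in> CP D + InnG D"
  then obtain h \<zeta> where "h \<in> SS" "\<zeta> \<in> CS" "\<delta> = cp h + inn \<zeta>"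
    unfolding CP_eq InnG_eq by (auto elim!: set_plus_elim)
  then show "\<delta> \<in> dlt ` ham_P D" unfolding ham_P_eq using dlt_Ham Aff_pair by (metis imageI)
next
  fix \<delta> assume "\<delta> \<in> dlt ` ham_P D"
  then obtain x where x: "x \<in> Aff" "\<delta> = dlt (Ham x)" unfolding ham_P_eq by blast
  then have f: "fst x \<in> SS" "snd x \<in> CS" by (auto simp: Aff_iff)
  then show "\<delta> \<in> CP D + InnG D"
    using dlt_Ham[OF f] x(2) unfolding CP_eq InnG_eq by (auto intro: set_plus_intro)
qed

lemma subspace_CP_InnG: "subspace (CP D + InnG D)"
  unfolding CP_InnG_eq by (rule subspace_image_on[OF subspace_ham_P]) (rule dlt_linear)+

lemma CP_InnG_MP: "CP D + InnG D \<subseteq> MP D"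
  unfolding CP_InnG_eq MP_eq using ham_P_poiss by blast

lemma MP_derivative_endo: "MP D \<subseteq> derivative_endos D"
  by (auto simp: MP_def)

lemma symbol_MP_linear:
  "\<delta> \<in> MP D ==> \<epsilon> \<in> MP D ==> symbol D (\<delta> + \<epsilon>) = symbol D \<delta> + symbol D \<epsilon>"
  "\<delta> \<in> MP D ==> symbol D (c *\<^sub>R \<delta>) = c *\<^sub>R symbol D \<delta>"
  using symbol_linear MP_derivative_endo by blast+

abbreviation "hamf h \<equiv> sharp SM (sub_poisson D) (dS h)"

lemma is_symbol_cp: assumes h: "h \<in> SS" shows "is_symbol D (cp h) (hamf h)"
proof -
  have "lf (hamf h) f = bracket_S D h f" for f
    by (auto simp: lie_fn_def S.sharp_apply S.br_apply fun_eq_iff)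
  then show ?thesis
    unfolding is_symbol_def
    using S.sharp_vector_field[OF S.differential_one_form[OF h]] De_linear(5)[OF h _ C0] conormal_smult by (simp add: cp_def)
qed

lemma is_symbol_inn: assumes "\<zeta> \<in> CS" shows "is_symbol D (inn \<zeta>) 0"
  unfolding is_symbol_def
  using br1_linear(5)[OF _ assms _ C0] conormal_smult
  by (simp add: inn_def lf_0 subspace_0[OF S.subspace_vector_fields])

lemma symbol_cp_inn:
  assumes "h \<in> SS" "\<zeta> \<in> CS" shows "symbol D (cp h + inn \<zeta>) = hamf h"
  using symbol_eq[OF is_symbol_add[OF is_symbol_cp[OF assms(1)] is_symbol_inn[OF assms(2)]]] by simp

lemma symbol_CP_InnG: "symbol D ` (CP D + InnG D) = ham_S D"
proof (intro equalityI subsetI)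
  fix u assume "u \<in> symbol D ` (CP D + InnG D)"
  then obtain h \<zeta> where "h \<in> SS" "\<zeta> \<in> CS" "u = symbol D (cp h + inn \<zeta>)"
    unfolding CP_eq InnG_eq by (auto elim!: set_plus_elim)
  then show "u \<in> ham_S D" using symbol_cp_inn by (auto simp: ham_S_def)
next
  fix u assume "u \<in> ham_S D"
  then obtain h where h: "h \<in> SS" "u = hamf h" by (auto simp: ham_S_def)
  have "cp h + inn 0 \<in> CP D + InnG D"
    unfolding CP_eq InnG_eq using h(1) C0 by (intro set_plus_intro imageI)
  then show "u \<in> symbol D ` (CP D + InnG D)" using symbol_cp_inn[OF h(1) C0] h(2) by (metis imageI)
qed

text \<open>Inner derivations have symbol 0, so the symbol of \<open>cp h + inn \<zeta>\<close> is
  that of \<open>cp h\<close>; it vanishes for the sum exactly when it does for the first summand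
  alone. This gives injectivity in the vertical sequence.\<close>

lemma CP0_InnG_eq: "CP0 D + InnG D = {\<delta> \<in> CP D + InnG D. symbol D \<delta> \<in> {0}}"
proof (intro equalityI subsetI)
  fix \<delta> assume "\<delta> \<in> CP0 D + InnG D"
  then obtain h \<zeta> where h: "h \<in> SS" "\<zeta> \<in> CS" "\<delta> = cp h + inn \<zeta>" "symbol D (cp h) = 0"
    unfolding CP0_def MP0_def CP_eq InnG_eq by (auto elim!: set_plus_elim)
  have "symbol D \<delta> = 0" using symbol_cp_inn[OF h(1,2)] symbol_eq[OF is_symbol_cp[OF h(1)]] h(3,4) by simp
  moreover have "\<delta> \<in> CP D + InnG D" unfolding CP_eq InnG_eq h(3) using h(1,2) by (intro set_plus_intro imageI)
  ultimately show "\<delta> \<in> {\<delta> \<in> CP D + InnG D. symbol D \<delta> \<in> {0}}" by simp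
next
  fix \<delta> assume "\<delta> \<in> {\<delta> \<in> CP D + InnG D. symbol D \<delta> \<in> {0}}"
  then have \<delta>: "\<delta> \<in> CP D + InnG D" "symbol D \<delta> = 0" by auto
  then obtain h \<zeta> where h: "h \<in> SS" "\<zeta> \<in> CS" "\<delta> = cp h + inn \<zeta>"
    unfolding CP_eq InnG_eq by (auto elim!: set_plus_elim)
  \<comment> \<open>\<open>CP0 D\<close> demands membership in \<open>MP D\<close>, which is
    available for elements of \<open>CP D + InnG D\<close>; hence the summand with \<zeta> =
    0.\<close>
  have "cp h + inn 0 \<in> CP D + InnG D"
    unfolding CP_eq InnG_eq using h(1) C0 by (intro set_plus_intro imageI)
  moreover have "inn 0 = 0" using zero_components(3) by (auto simp: inn_def fun_eq_iff)
  ultimately have "cp h \<in> MP D" using CP_InnG_MP by auto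
  moreover have "symbol D (cp h) = 0" using symbol_cp_inn[OF h(1,2)] symbol_eq[OF is_symbol_cp[OF h(1)]] h(3) \<delta>(2) by simp
  ultimately have "cp h \<in> CP0 D" using h(1) by (auto simp: CP0_def MP0_def CP_eq)
  then show "\<delta> \<in> CP0 D + InnG D" unfolding h(3) InnG_eq using h(2) by (intro set_plus_intro imageI)
qed

text \<open>The symbol maps \<open>MP D\<close> onto its image with kernel \<open>MP0 D\<close> and
  carries \<open>CP D + InnG D\<close> onto \<open>ham_S D\<close>. Injectivity on the left says
  that \<open>CP0 D + InnG D\<close> is the part of \<open>CP D + InnG D\<close> over the zero
  symbol.\<close>

lemma vertical_sequence:
  "short_exact
      (quot_module (vspace (MP0 D)) (CP0 D + InnG D))
      (quot_module (vspace (MP D)) (CP D + InnG D))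
      (quot_module (vspace (symbol D ` MP D)) (ham_S D))
      (arrow_incl D) (arrow_symbol D)"
proof -
  let ?C = "CP D + InnG D" and ?N = "CP0 D + InnG D" and ?I = "symbol D ` MP D"
  have z0: "subspace {0::'a vfield}" by (rule subspace_single_0)
  note M = subspace_MP and C = subspace_CP_InnG and CM = CP_InnG_MP
  have M0: "MP0 D = {\<delta> \<in> MP D. symbol D \<delta> \<in> {0}}" by (auto simp: MP0_def)
  have M0s: "subspace (MP0 D)"
    unfolding M0 by (rule subspace_preimage_on[OF M z0]) (rule symbol_MP_linear, assumption+)+
  have Ns: "subspace ?N"
    unfolding CP0_InnG_eq by (rule subspace_preimage_on[OF C z0]) (use CM in \<open>auto intro: symbol_MP_linear\<close>)
  have NM: "?N \<subseteq> MP0 D" unfolding CP0_InnG_eq M0 using CM by blast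
  have NC: "?N \<subseteq> ?C" unfolding CP0_InnG_eq by blast
  have Is: "subspace ?I" by (rule subspace_image_on[OF M]) (rule symbol_MP_linear, assumption+)+
  have Hs: "subspace (ham_S D)"
    unfolding symbol_CP_InnG[symmetric]
    by (rule subspace_image_on[OF C]) (use CM in \<open>auto intro: symbol_MP_linear\<close>)
  have HI: "ham_S D \<subseteq> ?I" unfolding symbol_CP_InnG[symmetric] using CM by blast
  note mM = module_vspace[OF M] and mM0 = module_vspace[OF M0s] and mI = module_vspace[OF Is]
  note sC = submod_vspace[OF M C CM] and sN = submod_vspace[OF M0s Ns NM] and sH = submod_vspace[OF Is Hs HI]
  let ?B = "quot_module (vspace (MP D)) ?C" and ?D = "quot_module (vspace ?I) (ham_S D)"
  note zB = quot_simps(3)[OF mM sC] and zD = quot_simps(3)[OF mI sH]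
  have cB: "b \<in> carrier ?B \<longleftrightarrow> (\<exists>x\<in>MP D. b = ?C +>\<^bsub>vspace (MP D)\<^esub> x)" for b
    unfolding quot_simps(1)[OF mM sC] coset_carrier[OF mM sC] by simp
  have as: "arrow_symbol D (?C +>\<^bsub>vspace (MP D)\<^esub> \<delta>) = ham_S D +>\<^bsub>vspace ?I\<^esub> symbol D \<delta>" if "\<delta> \<in> MP D" for \<delta>
    unfolding arrow_symbol_def
    by (rule union_coset_induced[OF M C CM Hs that])
      (use symbol_MP_linear(1) symbol_CP_InnG in auto)
  show ?thesis
  proof (rule short_exact_quotI[OF mM0 sN module_quot[OF mM sC] module_quot[OF mI sH]])
    have "(\<lambda>\<delta>. \<delta>) \<in> module_homs (vspace (MP0 D)) (vspace (MP D))"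
      by (rule linear_vspace_hom) (auto simp: MP0_def)
    then show "(\<lambda>\<delta>. ?C +>\<^bsub>vspace (MP D)\<^esub> \<delta>) \<in> module_homs (vspace (MP0 D)) ?B"
      by (rule module_homs_comp[OF _ proj_hom[OF mM sC]])
  next
    fix \<delta> assume "\<delta> \<in> carrier (vspace (MP0 D))"
    then have \<delta>: "\<delta> \<in> MP0 D" by simp
    show "arrow_incl D (?N +>\<^bsub>vspace (MP0 D)\<^esub> \<delta>) = ?C +>\<^bsub>vspace (MP D)\<^esub> \<delta>"
      unfolding arrow_incl_def
      by (rule union_coset_induced[OF M0s Ns NM C \<delta>]) (use NC in auto)
    assume "?C +>\<^bsub>vspace (MP D)\<^esub> \<delta> = \<zero>\<^bsub>?B\<^esub>"
    then have "\<delta> \<in> ?C" using coset_eq_zero[OF mM sC, of \<delta>] \<delta> unfolding zB by (simp add: MP0_def)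
    then show "\<delta> \<in> ?N" using \<delta> unfolding CP0_InnG_eq by (simp add: MP0_def)
  next
    have "(\<lambda>\<delta>. symbol D \<delta>) \<in> module_homs (vspace (MP D)) (vspace ?I)"
      by (rule linear_vspace_hom) (auto simp: symbol_MP_linear)
    then have "(\<lambda>\<delta>. ham_S D +>\<^bsub>vspace ?I\<^esub> symbol D \<delta>) \<in> module_homs (vspace (MP D)) ?D"
      by (rule module_homs_comp[OF _ proj_hom[OF mI sH]])
    then show "arrow_symbol D \<in> module_homs ?B ?D"
      by (rule induced_hom[OF mM sC]) (simp add: as)
  next
    show "carrier ?D \<subseteq> arrow_symbol D ` carrier ?B"
    proof
      fix c assume "c \<in> carrier ?D"
      then obtain \<delta> where \<delta>: "\<delta> \<in> MP D" "c = ham_S D +>\<^bsub>vspace ?I\<^esub> symbol D \<delta>"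
        unfolding quot_simps(1)[OF mI sH] coset_carrier[OF mI sH] by auto
      then have "c = arrow_symbol D (?C +>\<^bsub>vspace (MP D)\<^esub> \<delta>)" using as by simp
      moreover have "?C +>\<^bsub>vspace (MP D)\<^esub> \<delta> \<in> carrier ?B" unfolding cB using \<delta>(1) by blast
      ultimately show "c \<in> arrow_symbol D ` carrier ?B" by blast
    qed
  next
    fix b assume "b \<in> carrier ?B"
    then obtain \<delta> where \<delta>: "\<delta> \<in> MP D" and b: "b = ?C +>\<^bsub>vspace (MP D)\<^esub> \<delta>" unfolding cB by blast
    have "arrow_symbol D b = \<zero>\<^bsub>?D\<^esub> \<longleftrightarrow> symbol D \<delta> \<in> ham_S D"
      unfolding b as[OF \<delta>] zD using coset_eq_zero[OF mI sH, of "symbol D \<delta>"] \<delta> by simp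
    also have "\<dots> \<longleftrightarrow> b \<in> (\<lambda>\<delta>. ?C +>\<^bsub>vspace (MP D)\<^esub> \<delta>) ` MP0 D"
    proof
      assume "symbol D \<delta> \<in> ham_S D"
      \<comment> \<open>A Hamiltonian vector field is the symbol of some n in \<open>?C\<close>;
        subtracting n keeps the class of \<delta> and moves \<delta> into
        \<open>MP0 D\<close>.\<close>
      then obtain n where n: "n \<in> ?C" "symbol D \<delta> = symbol D n" unfolding symbol_CP_InnG[symmetric] by blast
      have nM: "n \<in> MP D" using n(1) CM by blast
      have "symbol D (\<delta> - n) = 0"
        using symbol_MP_linear(1)[OF \<delta> subspace_scale[OF M nM, of "-1"]] symbol_MP_linear(2)[OF nM, of "-1"] n(2) by simp
      then have "\<delta> - n \<in> MP0 D" using subspace_diff[OF M \<delta> nM] by (simp add: MP0_def)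
      moreover have "b = ?C +>\<^bsub>vspace (MP D)\<^esub> (\<delta> - n)"
        unfolding b by (rule coset_vspace_eq[OF C]) (use n(1) in simp)
      ultimately show "b \<in> (\<lambda>\<delta>. ?C +>\<^bsub>vspace (MP D)\<^esub> \<delta>) ` MP0 D" by blast
    next
      assume "b \<in> (\<lambda>\<delta>. ?C +>\<^bsub>vspace (MP D)\<^esub> \<delta>) ` MP0 D"
      then obtain \<epsilon> where e: "\<epsilon> \<in> MP0 D" "b = ?C +>\<^bsub>vspace (MP D)\<^esub> \<epsilon>" by blast
      have "ham_S D +>\<^bsub>vspace ?I\<^esub> symbol D \<delta> = ham_S D +>\<^bsub>vspace ?I\<^esub> symbol D \<epsilon>"
        using as[OF \<delta>] as[of \<epsilon>] e b by (simp add: MP0_def)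
      then have "symbol D \<delta> \<in> ham_S D +>\<^bsub>vspace ?I\<^esub> symbol D \<epsilon>"
        using coset_self[OF mI sH, of "symbol D \<delta>"] \<delta> by simp
      then show "symbol D \<delta> \<in> ham_S D" using e(1) by (simp add: coset_vspace MP0_def)
    qed
    finally show "arrow_symbol D b = \<zero>\<^bsub>?D\<^esub> \<longleftrightarrow> b \<in> (\<lambda>\<delta>. ?C +>\<^bsub>vspace (MP D)\<^esub> \<delta>) ` carrier (vspace (MP0 D))"
      by simp
  qed
qed


section \<open>Central cocycles and the horizontal sequence\<close>

lemma X_delta_0: "X_delta D 0 = 0"
  by (auto simp: X_delta_def symbol_0 lf_0 fun_eq_iff zero_prod_def)

lemma X_Q_pairX: "X_Q D Q = pairX Q 0"
  unfolding pairX_def X_delta_0 by simp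

lemma X_Q_linear: "X_Q D (Q + R) = X_Q D Q + X_Q D R" "X_Q D (c *\<^sub>R Q) = c *\<^sub>R X_Q D Q"
  by (auto simp: X_Q_def eval_mv_linear fun_eq_iff)

text \<open>For \<delta> = 0 the first clause is trivial, the second says that all Q(df) are
  central, and the third is the cocycle condition.\<close>

lemma mp_cond_0_iff:
  assumes Q: "Q \<in> MV 1"
  shows "mp_cond 0 Q \<longleftrightarrow> Q \<in> central_mv D 1 \<and> dD D 1 Q = 0"
proof -
  have z0: "(0::'a form \<Rightarrow> 'a form) \<xi> = 0" for \<xi> by simp
  have z: "De (lf (symbol D 0) f) \<eta> = 0" if "\<eta> \<in> CS" for f \<eta>
    unfolding symbol_0 lf_0 by (rule zero_components(2)[OF that])
  have k: "K (lf (symbol D 0) f) g = 0" "K g (lf (symbol D 0) f) = 0" if "g \<in> SS" for f g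
    unfolding symbol_0 lf_0 by (rule zero_components(6)[OF that], rule zero_components(5)[OF that])
  have "mp_cond 0 Q \<longleftrightarrow> (\<forall>f\<in>SS. \<forall>\<eta>\<in>CS. br1 (qv Q f) \<eta> = 0)
      \<and> (\<forall>f\<in>SS. \<forall>g\<in>SS. eval_mv (dD D 1 Q) [dS f, dS g] = 0)"
    (is "_ \<longleftrightarrow> ?a \<and> ?b")
  proof
    assume m: "mp_cond 0 Q"
    show "?a \<and> ?b"
    proof (intro conjI ballI)
      fix f \<eta> assume f: "f \<in> SS" and \<eta>: "\<eta> \<in> CS"
      have "0 (De f \<eta>) - De f (0 \<eta>) - De (lf (symbol D 0) f) \<eta> = br1 (qv Q f) \<eta>"
        using m f \<eta> unfolding mp_cond_def by blast
      then have "0 = br1 (qv Q f) \<eta>"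
        unfolding z[OF \<eta>] unfolding z0 zero_components(1)[OF f] by (simp only: diff_0_right)
      then show "br1 (qv Q f) \<eta> = 0" by (rule sym)
    next
      fix f g assume f: "f \<in> SS" and g: "g \<in> SS"
      have "eval_mv (dD D 1 Q) [dS f, dS g] = 0 (K f g) - K (lf (symbol D 0) f) g - K f (lf (symbol D 0) g)"
        using m f g unfolding mp_cond_def by blast
      then show "eval_mv (dD D 1 Q) [dS f, dS g] = 0"
        unfolding k(1)[OF g] k(2)[OF f] unfolding z0 by (simp only: diff_0_right)
    qed
  next
    assume m: "?a \<and> ?b"
    show "mp_cond 0 Q"
      unfolding mp_cond_def
    proof (intro conjI ballI)
      fix \<eta> \<xi> assume e: "\<eta> \<in> CS" and x: "\<xi> \<in> CS"
      show "0 (br1 \<eta> \<xi>) = br1 (0 \<eta>) \<xi> + br1 \<eta> (0 \<xi>)"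
        unfolding z0 zero_components(3)[OF x] zero_components(4)[OF e] by (simp only: add_0)
    next
      fix f \<eta> assume f: "f \<in> SS" and \<eta>: "\<eta> \<in> CS"
      have "br1 (qv Q f) \<eta> = 0" using m f \<eta> by blast
      then show "0 (De f \<eta>) - De f (0 \<eta>) - De (lf (symbol D 0) f) \<eta> = br1 (qv Q f) \<eta>"
        unfolding z[OF \<eta>] unfolding z0 zero_components(1)[OF f] by (simp only: diff_0_right)
    next
      fix f g assume f: "f \<in> SS" and g: "g \<in> SS"
      have "eval_mv (dD D 1 Q) [dS f, dS g] = 0" using m f g by blast
      then show "eval_mv (dD D 1 Q) [dS f, dS g] = 0 (K f g) - K (lf (symbol D 0) f) g - K f (lf (symbol D 0) g)"
        unfolding k(1)[OF g] k(2)[OF f] unfolding z0 by (simp only: diff_0_right)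
    qed
  qed
  moreover have "?a \<longleftrightarrow> Q \<in> central_mv D 1"
    unfolding central_mv_1_iff center_G_def using Q section_derivationD(1)[OF mv_1_derivation[OF Q]] by blast
  moreover have "?b \<longleftrightarrow> dD D 1 Q = 0"
  proof
    assume ?b
    then show "dD D 1 Q = 0"
      by (intro mv_2_eqI[OF dD_1(1)[OF Q] subspace_0[OF subspace_conormal_mv]]) (simp add: eval_mv_linear)
  qed (simp add: eval_mv_linear)
  ultimately show ?thesis by simp
qed

text \<open>Presents the cocycles as the preimage of the Poisson derivations under the linear map Q
  \<mapsto> \<open>X_Q D Q\<close>, from which it is immediate that they form a subspace and that J
  lands in the Poisson derivations.\<close>

lemma central_cocycles_eq:
  "{Q \<in> central_mv D 1. dD D 1 Q = 0} = {Q \<in> MV 1. X_Q D Q \<in> poiss_P D}"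
proof -
  have "mp_cond 0 Q \<longleftrightarrow> X_Q D Q \<in> poiss_P D" if Q: "Q \<in> MV 1" for Q
    unfolding X_Q_pairX
    using pairX_poiss[OF zero_derivative_endo Q] poiss_mp_cond[OF zero_derivative_endo Q] by blast
  moreover have "Q \<in> MV 1" if "Q \<in> central_mv D 1" for Q using that by (simp add: central_mv_def)
  ultimately show ?thesis using mp_cond_0_iff by blast
qed

lemma dD_0_linear:
  assumes Q: "Q \<in> central_mv D 0"
  shows "R \<in> central_mv D 0 ==> dD D 0 (Q + R) = dD D 0 Q + dD D 0 R" "dD D 0 (c *\<^sub>R Q) = c *\<^sub>R dD D 0 Q"
proof -
  have mv: "Q \<in> MV 0" if "Q \<in> central_mv D 0" for Q using that by (simp add: central_mv_def)
  note q = mv[OF Q]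
  note dq = dD_0[OF q]
  show "dD D 0 (Q + R) = dD D 0 Q + dD D 0 R" if "R \<in> central_mv D 0"
  proof -
    note r = mv[OF that]
    note a = subspace_add[OF subspace_conormal_mv q r]
    show ?thesis
    proof (rule mv_1_eqI[OF dD_0(1)[OF a] subspace_add[OF subspace_conormal_mv dq(1) dD_0(1)[OF r]]])
      fix f assume f: "f \<in> SS"
      show "qv (dD D 0 (Q + R)) f = qv (dD D 0 Q + dD D 0 R) f"
        unfolding dD_0(2)[OF a f] eval_mv_linear dD_0(2)[OF q f] dD_0(2)[OF r f]
        by (rule De_linear(1)[OF f f mv_0_value[OF q] mv_0_value[OF r]])
    qed
  qed
  note s = subspace_scale[OF subspace_conormal_mv q, of c]
  show "dD D 0 (c *\<^sub>R Q) = c *\<^sub>R dD D 0 Q"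
  proof (rule mv_1_eqI[OF dD_0(1)[OF s] subspace_scale[OF subspace_conormal_mv dq(1)]])
    fix f assume f: "f \<in> SS"
    show "qv (dD D 0 (c *\<^sub>R Q)) f = qv (c *\<^sub>R dD D 0 Q) f"
      unfolding dD_0(2)[OF s f] eval_mv_linear dD_0(2)[OF q f]
      by (rule De_linear(2)[OF f f C0 mv_0_value[OF q]])
  qed
qed

text \<open>The Hamiltonian derivation of a central section kills sections and acts on functions by
  the contravariant derivative; the minus sign comes from the second slot of the affine
  bracket.\<close>

lemma X_Q_dD_0:
  assumes Q: "Q \<in> central_mv D 0" shows "X_Q D (dD D 0 Q) = Ham (0, - eval_mv Q [])"
proof
  have q: "Q \<in> MV 0" using Q by (simp add: central_mv_def)
  let ?z = "eval_mv Q []"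
  have z: "?z \<in> center_G D" using Q by (simp add: central_mv_def)
  then have mz: "- ?z \<in> center_G D" by (rule subspace_neg[OF subspace_center_G])
  note zC = center_GD(1)[OF z]
  fix y show "X_Q D (dD D 0 Q) y = Ham (0, - ?z) y"
  proof (cases "y \<in> Aff")
    case True
    obtain f \<eta> where y: "y = (f, \<eta>)" by (cases y)
    have f: "f \<in> SS" and \<eta>: "\<eta> \<in> CS" using True by (auto simp: y Aff_iff)
    have "De f (- ?z) = - De f ?z" using De_linear(2)[OF f f C0 zC, of "-1"] by simp
    moreover have "br1 (- ?z) \<eta> = 0" by (rule center_GD(2)[OF mz \<eta>])
    ultimately have "ab (0, - ?z) (f, \<eta>) = (0, De f ?z)"
      unfolding aff_bracket_def by (simp add: zero_components bracket_S_0 f \<eta>)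
    then show ?thesis using True dD_0(2)[OF q f] by (simp add: X_Q_def Ham_def y)
  next
    case False
    then show ?thesis by (simp add: X_Q_def Ham_def)
  qed
qed

text \<open>Coboundaries give Hamiltonian derivations, so J is well defined, and dividing by its
  kernel makes it injective. Exactness in the middle is the statement that \<open>dlt\<close> of X
  is in \<open>CP D + InnG D\<close> exactly when X is Hamiltonian up to some X_Q with Q a central
  cocycle.\<close>

lemma horizontal_sequence:
  "short_exact
      (quot_module (H1_dD D) (a_kernel (H1_dD D) (H1_P D) (J_map D)))
      (H1_P D)
      (quot_module (vspace (MP D)) (CP D + InnG D))
      (arrow_J D) (arrow_delta D)"
proof -
  define Z where "Z = {Q \<in> central_mv D 1. dD D 1 Q = 0}"
  define B where "B = dD D 0 ` central_mv D 0"
  let ?C = "CP D + InnG D" and ?P = "poiss_P D" and ?H = "ham_P D" and ?M = "vspace (MP D)"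
  have ZX: "Z = {Q \<in> MV 1. X_Q D Q \<in> ?P}" unfolding Z_def by (rule central_cocycles_eq)
  note M = subspace_MP and C = subspace_CP_InnG and CM = CP_InnG_MP
    and P = subspace_poiss_P and H = subspace_ham_P and HP = ham_P_poiss
  have Zs: "subspace Z"
    unfolding ZX by (rule subspace_preimage_on[OF subspace_conormal_mv P]) (rule X_Q_linear)+
  have Bs: "subspace B" unfolding B_def
    by (rule subspace_image_on[OF subspace_central_mv]) (rule dD_0_linear, assumption+)+
  have BH: "X_Q D R \<in> ?H" if "R \<in> B" for R
  proof -
    obtain Q where Q: "Q \<in> central_mv D 0" "R = dD D 0 Q" using \<open>R \<in> B\<close> unfolding B_def by blast
    have "eval_mv Q [] \<in> center_G D" using Q(1) by (simp add: central_mv_def)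
    then have "(0, - eval_mv Q []) \<in> Aff"
      by (intro Aff_pair S0 center_GD(1) subspace_neg[OF subspace_center_G])
    then show ?thesis unfolding Q(2) X_Q_dD_0[OF Q(1)] ham_P_eq by (rule imageI)
  qed
  have BZ: "B \<subseteq> Z"
  proof
    fix R assume R: "R \<in> B"
    have "R \<in> MV 1" using R dD_0(1) unfolding B_def by (auto simp: central_mv_def)
    then show "R \<in> Z" unfolding ZX using BH[OF R] HP by blast
  qed
  have H1: "H1_dD D = quot_module (vspace Z) B" unfolding H1_dD_def Z_def B_def ..
  have HP1: "H1_P D = quot_module (vspace ?P) ?H" unfolding H1_P_def ..
  note mM = module_vspace[OF M] and mP = module_vspace[OF P] and mZ = module_vspace[OF Zs]
  note sC = submod_vspace[OF M C CM] and sH = submod_vspace[OF P H HP] and sB = submod_vspace[OF Zs Bs BZ]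
  note mA = module_quot[OF mZ sB, folded H1] and mB = module_quot[OF mP sH, folded HP1]
  have cA: "a \<in> carrier (H1_dD D) \<longleftrightarrow> (\<exists>Q\<in>Z. a = B +>\<^bsub>vspace Z\<^esub> Q)" for a
    unfolding H1 quot_simps(1)[OF mZ sB] coset_carrier[OF mZ sB] by simp
  have cB: "b \<in> carrier (H1_P D) \<longleftrightarrow> (\<exists>X\<in>?P. b = ?H +>\<^bsub>vspace ?P\<^esub> X)" for b
    unfolding HP1 quot_simps(1)[OF mP sH] coset_carrier[OF mP sH] by simp
  have J: "J_map D (B +>\<^bsub>vspace Z\<^esub> Q) = ?H +>\<^bsub>vspace ?P\<^esub> X_Q D Q" if "Q \<in> Z" for Q
    unfolding J_map_def
    by (rule union_coset_induced[OF Zs Bs BZ H that]) (rule X_Q_linear, rule BH)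
  have "X_Q D \<in> module_homs (vspace Z) (vspace ?P)"
    by (rule linear_vspace_hom) (simp_all add: ZX X_Q_linear)
  then have "(\<lambda>Q. ?H +>\<^bsub>vspace ?P\<^esub> X_Q D Q) \<in> module_homs (vspace Z) (H1_P D)"
    unfolding HP1 by (rule module_homs_comp[OF _ proj_hom[OF mP sH]])
  then have Jh: "J_map D \<in> module_homs (H1_dD D) (H1_P D)"
    unfolding H1 by (rule induced_hom[OF mZ sB]) (simp add: J)
  \<comment> \<open>The union ranges over all decompositions of all representatives. By
    \<open>dlt_pairX\<close> the \<delta> of a decomposition is \<open>dlt\<close> of the
    representative, and representatives differ by Hamiltonian derivations, whose \<open>dlt\<close>
    lies in \<open>?C\<close>.\<close>
  have ad: "arrow_delta D (?H +>\<^bsub>vspace ?P\<^esub> X) = ?C +>\<^bsub>?M\<^esub> dlt X" if X: "X \<in> ?P" for X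
    unfolding arrow_delta_def
  proof (rule union_coset_vspace[OF C])
    have s: "X \<in> ?H +>\<^bsub>vspace ?P\<^esub> X" using coset_self[OF mP sH, of X] X by simp
    obtain Q where Q: "Q \<in> MV 1" "dlt X \<in> derivative_endos D" "X = pairX Q (dlt X)"
      by (rule poiss_decomposition[OF X]) (rule that)
    have "X_Q D Q + X_delta D (dlt X) \<in> ?H +>\<^bsub>vspace ?P\<^esub> X"
      using s Q(3)[symmetric] unfolding pairX_def by simp
    then show "dlt X \<in> {\<delta> \<in> derivative_endos D. \<exists>Q\<in>MV 1. X_Q D Q + X_delta D \<delta> \<in> ?H +>\<^bsub>vspace ?P\<^esub> X}"
      using Q(1,2) by blast
  next
    fix \<delta> assume "\<delta> \<in> {\<delta> \<in> derivative_endos D. \<exists>Q\<in>MV 1. X_Q D Q + X_delta D \<delta> \<in> ?H +>\<^bsub>vspace ?P\<^esub> X}"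
    then obtain Q where \<delta>: "\<delta> \<in> derivative_endos D" and Q: "Q \<in> MV 1" "pairX Q \<delta> \<in> ?H +>\<^bsub>vspace ?P\<^esub> X"
      unfolding pairX_def by blast
    obtain n where n: "n \<in> ?H" "pairX Q \<delta> = n + X" using Q(2) unfolding coset_vspace by blast
    have "\<delta> = dlt n + dlt X" using dlt_pairX[OF \<delta> Q(1)] n(2) dlt_linear(1) by simp
    then have "\<delta> - dlt X = dlt n" by simp
    then show "\<delta> - dlt X \<in> ?C" unfolding CP_InnG_eq using n(1) by blast
  qed
  have "dlt \<in> module_homs (vspace ?P) ?M"
    by (rule linear_vspace_hom) (auto simp: MP_eq dlt_linear)
  then have dh: "(\<lambda>X. ?C +>\<^bsub>?M\<^esub> dlt X) \<in> module_homs (vspace ?P) (quot_module ?M ?C)"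
    by (rule module_homs_comp[OF _ proj_hom[OF mM sC]])
  note zC = quot_simps(3)[OF mM sC]
  show ?thesis
  proof (rule short_exact_quotI[OF mA submod_kernel[OF mA mB Jh] mB module_quot[OF mM sC] Jh])
    fix a assume a: "a \<in> carrier (H1_dD D)"
    show "arrow_J D (a_kernel (H1_dD D) (H1_P D) (J_map D) +>\<^bsub>H1_dD D\<^esub> a) = J_map D a"
      unfolding arrow_J_def by (rule union_kernel_coset[OF mA mB Jh a])
    assume "J_map D a = \<zero>\<^bsub>H1_P D\<^esub>"
    then show "a \<in> a_kernel (H1_dD D) (H1_P D) (J_map D)" using a by (simp add: a_kernel_conv)
  next
    show "arrow_delta D \<in> module_homs (H1_P D) (quot_module ?M ?C)"
      unfolding HP1 by (rule induced_hom[OF mP sH dh]) (simp add: ad)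
  next
    show "carrier (quot_module ?M ?C) \<subseteq> arrow_delta D ` carrier (H1_P D)"
    proof
      fix c assume "c \<in> carrier (quot_module ?M ?C)"
      then obtain X where X: "X \<in> ?P" "c = ?C +>\<^bsub>?M\<^esub> dlt X"
        unfolding quot_simps(1)[OF mM sC] coset_carrier[OF mM sC] by (auto simp: MP_eq)
      then have "c = arrow_delta D (?H +>\<^bsub>vspace ?P\<^esub> X)" using ad by simp
      moreover have "?H +>\<^bsub>vspace ?P\<^esub> X \<in> carrier (H1_P D)" unfolding cB using X(1) by blast
      ultimately show "c \<in> arrow_delta D ` carrier (H1_P D)" by blast
    qed
  next
    fix b assume "b \<in> carrier (H1_P D)"
    then obtain X where X: "X \<in> ?P" and b: "b = ?H +>\<^bsub>vspace ?P\<^esub> X" unfolding cB by blast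
    have "arrow_delta D b = \<zero>\<^bsub>quot_module ?M ?C\<^esub> \<longleftrightarrow> dlt X \<in> ?C"
      unfolding b ad[OF X] zC using coset_eq_zero[OF mM sC, of "dlt X"] X by (simp add: MP_eq)
    also have "\<dots> \<longleftrightarrow> b \<in> J_map D ` carrier (H1_dD D)"
    proof
      assume "dlt X \<in> ?C"
      then obtain n where n: "n \<in> ?H" "dlt X = dlt n" unfolding CP_InnG_eq by blast
      \<comment> \<open>Subtracting a Hamiltonian derivation with the same \<delta> leaves a Poisson
        derivation with \<delta> = 0, hence X_Q for a central cocycle Q.\<close>
      have Y: "X - n \<in> ?P" using subspace_diff[OF P X] n(1) HP by blast
      have "dlt (X - n) = 0" using dlt_linear(1)[of X "- n"] dlt_linear(2)[of "-1" n] n(2) by simp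
      moreover obtain Q where "Q \<in> MV 1" "X - n = pairX Q (dlt (X - n))"
        by (rule poiss_decomposition[OF Y]) (rule that)
      ultimately have Q: "Q \<in> MV 1" "X - n = X_Q D Q" unfolding X_Q_pairX by simp_all
      then have QZ: "Q \<in> Z" unfolding ZX using Y by simp
      have "b = ?H +>\<^bsub>vspace ?P\<^esub> X_Q D Q"
        unfolding b by (rule coset_vspace_eq[OF H]) (use n(1) Q(2)[symmetric] in simp)
      then have "b = J_map D (B +>\<^bsub>vspace Z\<^esub> Q)" using J[OF QZ] by simp
      moreover have "B +>\<^bsub>vspace Z\<^esub> Q \<in> carrier (H1_dD D)" unfolding cA using QZ by blast
      ultimately show "b \<in> J_map D ` carrier (H1_dD D)" by blast
    next
      assume "b \<in> J_map D ` carrier (H1_dD D)"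
      then obtain a where a: "a \<in> carrier (H1_dD D)" "b = J_map D a" by (rule imageE)
      obtain Q where Q: "Q \<in> Z" "a = B +>\<^bsub>vspace Z\<^esub> Q" using a(1) unfolding cA by (rule bexE)
      have "X \<in> b" unfolding b by (rule coset_self[OF mP sH]) (simp add: X)
      then have "X \<in> ?H +>\<^bsub>vspace ?P\<^esub> X_Q D Q" unfolding a(2) Q(2) J[OF Q(1)] .
      then obtain n where n: "n \<in> ?H" "X = n + X_Q D Q" unfolding coset_vspace by blast
      have "dlt (X_Q D Q) = 0"
        unfolding X_Q_pairX by (rule dlt_pairX[OF zero_derivative_endo]) (use Q(1) in \<open>simp add: ZX\<close>)
      then have "dlt X = dlt n" using n(2) dlt_linear(1) by simp
      then show "dlt X \<in> ?C" unfolding CP_InnG_eq using n(1) by blast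
    qed
    finally show "arrow_delta D b = \<zero>\<^bsub>quot_module ?M ?C\<^esub> \<longleftrightarrow> b \<in> J_map D ` carrier (H1_dD D)" .
  qed
qed

end

theorem theorem3p1:
  fixes D :: "('a, 'e::euclidean_space) setting"
  assumes "smooth_manifold (amb D)"
    and "poisson_structure (amb D) (amb_poisson D)"
    and "embedded_poisson_submanifold D"
    and "dim (sub_model D) < dim (model (amb D))"
    and "exponential_map D"
  shows "short_exact
      (quot_module (H1_dD D) (a_kernel (H1_dD D) (H1_P D) (J_map D)))
      (H1_P D)
      (quot_module (vspace (MP D)) (CP D + InnG D))
      (arrow_J D) (arrow_delta D)
    \<and> short_exact
      (quot_module (vspace (MP0 D)) (CP0 D + InnG D))
      (quot_module (vspace (MP D)) (CP D + InnG D))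
      (quot_module (vspace (symbol D ` MP D)) (ham_S D))
      (arrow_incl D) (arrow_symbol D)"
proof -
  interpret exponential_setting D
    by unfold_locales (use assms in simp_all)
  show ?thesis using horizontal_sequence vertical_sequence by blast
qed

end
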